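(* Let $J\colon\mathcal{C}\to\mathcal{D}$ be a pseudofunctor between 2-categories, let $T$ be a relative pseudomonad over $J$, and let $S\colon\mathcal{D}\to\mathcal{D}$ be a 2-monad that restricts along $J$. Assume that $T$ has a lifting to either strict algebras or pseudoalgebras for $S$. Then $S$ has an extension to a pseudomonad $\tilde{S}\colon\mathrm{Kl}(T)\to\mathrm{Kl}(T)$ on the Kleisli bicategory of $T$.
   Context: "$\cdot$" is vertical composition of 2-cells, juxtaposition is composition of morphisms and whiskering; associativity and unit isomorphisms of bicategories are suppressed. Relative pseudomonad. A relative pseudomonad $T$ over $J\colon\mathcal{C}\to\mathcal{D}$ consists of: an object $TX\in\mathcal{D}$ for each $X\in\mathcal{C}$; functors $(-)^*\colon\mathcal{D}[JX,TY]\to\mathcal{D}[TX,TY]$; morphisms $i_X\colon JX\to TX$; invertible 2-cells $\mu_{g,f}\colon(g^*f)^*\to g^*f^*$, natural in $f\colon JX\to TY$, $g\colon JY\to TZ$; invertible 2-cells $\eta_f\colon f\to f^*i_X$, natural in $f$; invertible 2-cells $\theta_X\colon (i_X)^*\to 1_{TX}$; such that, for $f\colon JX\to TY$, $g\colon JY\to TZ$, $h\colon JZ\to TV$, one has $(h^*\mu_{g,f})\cdot\mu_{h,g^*f}\cdot(\mu_{h,g}f)^*=(\mu_{h,g}f^* )\cdot\mu_{h^*g,f}$ and $(f^*\theta_X)\cdot\mu_{f,i_X}\cdot(\eta_f)^*=1_{f^*}$. Kleisli bicategory. $\mathrm{Kl}(T)$ has the objects of $\mathcal{C}$ as objects and $\mathrm{Kl}(T)[X,Y]=\mathcal{D}[JX,TY]$.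 The composite of $f\colon JX\to TY$ and $g\colon JY\to TZ$ is $g^*f$; the identity on $X$ is $i_X$; associativity, right unit and left unit isomorphisms are given by $\mu_{h,g}f$, $\eta_f$ and $\theta_Yf$. There is a pseudofunctor $F^T\colon\mathcal{C}\to\mathrm{Kl}(T)$ that is the identity on objects and sends $g\colon X\to Y$ to $i_Y\,J(g)\colon JX\to TY$. 2-monads and algebras. A 2-monad $S$ has multiplication $m\colon S^2\to S$ and unit $e\colon1\to S$ satisfying the monad axioms strictly. For a 2-monad $S$ on a 2-category, a pseudoalgebra is an object $A$ with $a\colon SA\to A$ and invertible 2-cells $a\,S(a)\to a\,m_A$ and $1_A\to a\,e_A$ satisfying the usual two coherence axioms; it is a strict algebra when these 2-cells are identities. A pseudomorphism $(A,a)\to(B,b)$ is a morphism $f\colon A\to B$ with an invertible 2-cell $\bar f\colon b\,S(f)\to f\,a$ satisfying the usual two coherence axioms; an algebra 2-cell $f\to g$ is a 2-cell compatible with $\bar f,\bar g$. $\mathrm{Ps}\text{-}S\text{-}\mathrm{Alg}$ is the 2-category of pseudoalgebras, pseudomorphisms and algebra 2-cells, and $S\text{-}\mathrm{Alg}$ its locally full (indeed full on pseudomorphisms) sub-2-category of strict algebras; a subscript $\mathcal{C}$ or $\mathcal{D}$ indicates the base. $S$ restricts along $J$: $S$ restricts to a 2-monad, also written $S$, on $\mathcal{C}$ with $JS=SJ$ and with multiplication and unit components $m_X\colon S^2X\to SX$, $e_X\colon X\to SX$ in $\mathcal{C}$ corresponding under $J$ to those of $S$ on $\mathcal{D}$.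 Consequently $J$ lifts to pseudofunctors, also written $J$, $\mathrm{Ps}\text{-}S\text{-}\mathrm{Alg}_{\mathcal{C}}\to\mathrm{Ps}\text{-}S\text{-}\mathrm{Alg}_{\mathcal{D}}$ and $S\text{-}\mathrm{Alg}_{\mathcal{C}}\to S\text{-}\mathrm{Alg}_{\mathcal{D}}$, commuting with the inclusions and forgetful 2-functors. Liftings. A lifting of $T$ to pseudoalgebras (respectively, to strict algebras) for $S$ consists of: a pseudoalgebra (respectively, strict algebra) structure on $TA$ for every $A\in S\text{-}\mathrm{Alg}_{\mathcal{C}}$; a pseudomorphism structure on $f^*\colon TA\to TB$ for every pseudomorphism $f\colon JA\to TB$; a pseudomorphism structure on $i_A\colon JA\to TA$ for every $A\in S\text{-}\mathrm{Alg}_{\mathcal{C}}$; such that $\mu_{g,f}$ (for pseudomorphisms $f\colon JA\to TB$, $g\colon JB\to TC$), $\eta_f$ (for pseudomorphisms $f\colon JA\to TB$) and $\theta_A$ (for $A\in S\text{-}\mathrm{Alg}_{\mathcal{C}}$) are algebra 2-cells. Extension. A pseudomonad $\tilde S$ on $\mathrm{Kl}(T)$ is an extension of $S$ if $\tilde S$ agrees with $S$ on objects ($\tilde SX=SX$), there is an invertible pseudonatural transformation $\tilde SF^T\cong F^TS$ with identity 1-cell components, and, up to invertible 2-cells, the components of the unit and multiplication of $\tilde S$ at $X$ are $F^T(e_X)$ (that is, $i_{SX}\,e_X\colon JX\to SJX=JSX\to TSX$) and $F^T(m_X)$.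
   Formalization: A lifting is also required to make α* an algebra 2-cell whenever α is (the statement fails without this), and that J sends strict algebras to strict algebras is taken as part of "S restricts along J". *)

theory Defs
  imports Main
begin

section \<open>Bicategories\<close>

text \<open>
  Objects, morphisms (1-cells) and 2-cells are elements of three types, selected by the carriers
  \<open>Obj\<close>, \<open>Mor\<close> and \<open>Cel\<close>; \<open>src2\<close> and \<open>trg2\<close> are the source and target morphisms of a 2-cell.
  All operations are total functions, constrained only on well-typed arguments. The composite of
  \<open>f : X \<rightarrow> Y\<close> and \<open>g : Y \<rightarrow> Z\<close> is \<open>g \<odot> f\<close>, vertical composition is \<open>\<beta> \<cdot> \<alpha>\<close> (first \<open>\<alpha>\<close>),
  and \<open>\<beta> \<star> \<alpha>\<close> is horizontal composition.

  The constraints point in the directions \<open>assoc h g f : (h \<odot> g) \<odot> f \<rightarrow> h \<odot> (g \<odot> f)\<close>,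
  \<open>lunit f : 1 \<odot> f \<rightarrow> f\<close> and \<open>runit f : f \<rightarrow> f \<odot> 1\<close>. The last one follows the direction of the
  2-cells \<open>\<eta>\<close> of a relative pseudomonad.
\<close>

record ('o, 'm, 'c) bicat =
  Obj :: "'o set"
  Mor :: "'m set"
  src :: "'m \<Rightarrow> 'o"
  trg :: "'m \<Rightarrow> 'o"
  Cel :: "'c set"
  src2 :: "'c \<Rightarrow> 'm"
  trg2 :: "'c \<Rightarrow> 'm"
  one :: "'o \<Rightarrow> 'm"
  cmp :: "'m \<Rightarrow> 'm \<Rightarrow> 'm" (infixr "\<odot>\<index>" 80)
  idc :: "'m \<Rightarrow> 'c"
  vcmp :: "'c \<Rightarrow> 'c \<Rightarrow> 'c" (infixr "\<cdot>\<index>" 70)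
  hcmp :: "'c \<Rightarrow> 'c \<Rightarrow> 'c" (infixr "\<star>\<index>" 75)
  assoc :: "'m \<Rightarrow> 'm \<Rightarrow> 'm \<Rightarrow> 'c"
  lunit :: "'m \<Rightarrow> 'c"
  runit :: "'m \<Rightarrow> 'c"

definition hom :: "('o, 'm, 'c) bicat \<Rightarrow> 'o \<Rightarrow> 'o \<Rightarrow> 'm set" where
  "hom B X Y = {f \<in> Mor B. src B f = X \<and> trg B f = Y}"

definition cells :: "('o, 'm, 'c) bicat \<Rightarrow> 'm \<Rightarrow> 'm \<Rightarrow> 'c set" where
  "cells B f g = {\<alpha> \<in> Cel B. src2 B \<alpha> = f \<and> trg2 B \<alpha> = g}"

abbreviation wleft :: "('o, 'm, 'c) bicat \<Rightarrow> 'm \<Rightarrow> 'c \<Rightarrow> 'c" where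
  "wleft B g \<alpha> \<equiv> hcmp B (idc B g) \<alpha>"

abbreviation wright :: "('o, 'm, 'c) bicat \<Rightarrow> 'c \<Rightarrow> 'm \<Rightarrow> 'c" where
  "wright B \<beta> f \<equiv> hcmp B \<beta> (idc B f)"

open_bundle whiskering_syntax
begin
notation wleft ("(_ \<rhd>\<index> _)" [76, 75] 75)
notation wright ("(_ \<lhd>\<index> _)" [76, 75] 75)
end

definition inverse_cells :: "('o, 'm, 'c) bicat \<Rightarrow> 'c \<Rightarrow> 'c \<Rightarrow> bool" where
  "inverse_cells B \<alpha> \<beta> \<longleftrightarrow> \<alpha> \<in> Cel B \<and> \<beta> \<in> cells B (trg2 B \<alpha>) (src2 B \<alpha>) \<and>
     \<beta> \<cdot>\<^bsub>B\<^esub> \<alpha> = idc B (src2 B \<alpha>) \<and> \<alpha> \<cdot>\<^bsub>B\<^esub> \<beta> = idc B (trg2 B \<alpha>)"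

definition invertible :: "('o, 'm, 'c) bicat \<Rightarrow> 'c \<Rightarrow> bool" where
  "invertible B \<alpha> \<longleftrightarrow> (\<exists>\<beta>. inverse_cells B \<alpha> \<beta>)"

definition inv2 :: "('o, 'm, 'c) bicat \<Rightarrow> 'c \<Rightarrow> 'c" where
  "inv2 B \<alpha> = (THE \<beta>. inverse_cells B \<alpha> \<beta>)"

definition icells :: "('o, 'm, 'c) bicat \<Rightarrow> 'm \<Rightarrow> 'm \<Rightarrow> 'c set" where
  "icells B f g = {\<alpha> \<in> cells B f g. invertible B \<alpha>}"

locale bicategory =
  fixes B :: "('o, 'm, 'c) bicat" (structure)
  assumes src_Obj: "f \<in> Mor B \<Longrightarrow> src B f \<in> Obj B"
    and trg_Obj: "f \<in> Mor B \<Longrightarrow> trg B f \<in> Obj B"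
    and src2_Mor: "\<alpha> \<in> Cel B \<Longrightarrow> src2 B \<alpha> \<in> Mor B"
    and trg2_Mor: "\<alpha> \<in> Cel B \<Longrightarrow> trg2 B \<alpha> \<in> Mor B"
    and src_trg2: "\<alpha> \<in> Cel B \<Longrightarrow> src B (trg2 B \<alpha>) = src B (src2 B \<alpha>)"
    and trg_trg2: "\<alpha> \<in> Cel B \<Longrightarrow> trg B (trg2 B \<alpha>) = trg B (src2 B \<alpha>)"
    and one_hom: "X \<in> Obj B \<Longrightarrow> one B X \<in> hom B X X"
    and cmp_hom: "\<lbrakk>f \<in> hom B X Y; g \<in> hom B Y Z\<rbrakk> \<Longrightarrow> g \<odot> f \<in> hom B X Z"
    and idc_cells: "f \<in> Mor B \<Longrightarrow> idc B f \<in> cells B f f"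
    and vcmp_cells: "\<lbrakk>\<alpha> \<in> cells B f g; \<beta> \<in> cells B g h\<rbrakk> \<Longrightarrow> \<beta> \<cdot> \<alpha> \<in> cells B f h"
    and vcmp_assoc: "\<lbrakk>\<alpha> \<in> cells B f g; \<beta> \<in> cells B g h; \<gamma> \<in> cells B h k\<rbrakk>
          \<Longrightarrow> (\<gamma> \<cdot> \<beta>) \<cdot> \<alpha> = \<gamma> \<cdot> \<beta> \<cdot> \<alpha>"
    and vcmp_idc_left: "\<alpha> \<in> cells B f g \<Longrightarrow> idc B g \<cdot> \<alpha> = \<alpha>"
    and vcmp_idc_right: "\<alpha> \<in> cells B f g \<Longrightarrow> \<alpha> \<cdot> idc B f = \<alpha>"
    and hcmp_cells: "\<lbrakk>f \<in> hom B X Y; g \<in> hom B Y Z; \<alpha> \<in> cells B f f'; \<beta> \<in> cells B g g'\<rbrakk>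
          \<Longrightarrow> \<beta> \<star> \<alpha> \<in> cells B (g \<odot> f) (g' \<odot> f')"
    and hcmp_idc: "\<lbrakk>f \<in> hom B X Y; g \<in> hom B Y Z\<rbrakk> \<Longrightarrow> idc B g \<star> idc B f = idc B (g \<odot> f)"
    and interchange: "\<lbrakk>f \<in> hom B X Y; g \<in> hom B Y Z; \<alpha> \<in> cells B f f'; \<alpha>' \<in> cells B f' f'';
            \<beta> \<in> cells B g g'; \<beta>' \<in> cells B g' g''\<rbrakk>
          \<Longrightarrow> (\<beta>' \<cdot> \<beta>) \<star> (\<alpha>' \<cdot> \<alpha>) = (\<beta>' \<star> \<alpha>') \<cdot> (\<beta> \<star> \<alpha>)"
    and assoc_icells: "\<lbrakk>f \<in> hom B X Y; g \<in> hom B Y Z; h \<in> hom B Z W\<rbrakk>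
          \<Longrightarrow> assoc B h g f \<in> icells B ((h \<odot> g) \<odot> f) (h \<odot> (g \<odot> f))"
    and lunit_icells: "f \<in> hom B X Y \<Longrightarrow> lunit B f \<in> icells B (one B Y \<odot> f) f"
    and runit_icells: "f \<in> hom B X Y \<Longrightarrow> runit B f \<in> icells B f (f \<odot> one B X)"
    and assoc_natural: "\<lbrakk>f \<in> hom B X Y; g \<in> hom B Y Z; h \<in> hom B Z W;
            \<alpha> \<in> cells B f f'; \<beta> \<in> cells B g g'; \<gamma> \<in> cells B h h'\<rbrakk>
          \<Longrightarrow> assoc B h' g' f' \<cdot> ((\<gamma> \<star> \<beta>) \<star> \<alpha>) = (\<gamma> \<star> (\<beta> \<star> \<alpha>)) \<cdot> assoc B h g f"
    and lunit_natural: "\<lbrakk>f \<in> hom B X Y; \<alpha> \<in> cells B f f'\<rbrakk>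
          \<Longrightarrow> lunit B f' \<cdot> (one B Y \<rhd> \<alpha>) = \<alpha> \<cdot> lunit B f"
    and runit_natural: "\<lbrakk>f \<in> hom B X Y; \<alpha> \<in> cells B f f'\<rbrakk>
          \<Longrightarrow> runit B f' \<cdot> \<alpha> = (\<alpha> \<lhd> one B X) \<cdot> runit B f"
    and pentagon: "\<lbrakk>f \<in> hom B X Y; g \<in> hom B Y Z; h \<in> hom B Z W; k \<in> hom B W V\<rbrakk>
          \<Longrightarrow> (k \<rhd> assoc B h g f) \<cdot> assoc B k (h \<odot> g) f \<cdot> (assoc B k h g \<lhd> f)
            = assoc B k h (g \<odot> f) \<cdot> assoc B (k \<odot> h) g f"
    and triangle: "\<lbrakk>f \<in> hom B X Y; g \<in> hom B Y Z\<rbrakk>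
          \<Longrightarrow> (g \<rhd> lunit B f) \<cdot> assoc B g (one B Y) f \<cdot> (runit B g \<lhd> f) = idc B (g \<odot> f)"

text \<open>
  Sources and targets of 2-cells are determined, so identity constraints also force
  composition of morphisms to be strictly associative and unital.
\<close>

locale two_category = bicategory +
  assumes assoc_idc: "\<lbrakk>f \<in> hom B X Y; g \<in> hom B Y Z; h \<in> hom B Z W\<rbrakk>
          \<Longrightarrow> assoc B h g f = idc B (h \<odot> (g \<odot> f))"
    and lunit_idc: "f \<in> Mor B \<Longrightarrow> lunit B f = idc B f"
    and runit_idc: "f \<in> Mor B \<Longrightarrow> runit B f = idc B f"


section \<open>Pseudofunctors, pseudonatural transformations, modifications\<close>

text \<open>
  The comparison 2-cells of a pseudofunctor \<open>F\<close> are
  \<open>pcmp F g f : F g \<odot> F f \<rightarrow> F (g \<odot> f)\<close> and \<open>pone F X : 1 \<rightarrow> F 1\<close>.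
\<close>

record ('o1, 'm1, 'c1, 'o2, 'm2, 'c2) pfun =
  pob :: "'o1 \<Rightarrow> 'o2"
  pmor :: "'m1 \<Rightarrow> 'm2"
  pcel :: "'c1 \<Rightarrow> 'c2"
  pcmp :: "'m1 \<Rightarrow> 'm1 \<Rightarrow> 'c2"
  pone :: "'o1 \<Rightarrow> 'c2"

locale pseudofunctor =
  A: bicategory A + B: bicategory B
  for A :: "('o1, 'm1, 'c1) bicat" and B :: "('o2, 'm2, 'c2) bicat" +
  fixes F :: "('o1, 'm1, 'c1, 'o2, 'm2, 'c2) pfun"
  assumes pob_Obj: "X \<in> Obj A \<Longrightarrow> pob F X \<in> Obj B"
    and pmor_hom: "f \<in> hom A X Y \<Longrightarrow> pmor F f \<in> hom B (pob F X) (pob F Y)"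
    and pcel_cells: "\<alpha> \<in> cells A f g \<Longrightarrow> pcel F \<alpha> \<in> cells B (pmor F f) (pmor F g)"
    and pcel_idc: "f \<in> Mor A \<Longrightarrow> pcel F (idc A f) = idc B (pmor F f)"
    and pcel_vcmp: "\<lbrakk>\<alpha> \<in> cells A f g; \<beta> \<in> cells A g h\<rbrakk>
          \<Longrightarrow> pcel F (\<beta> \<cdot>\<^bsub>A\<^esub> \<alpha>) = pcel F \<beta> \<cdot>\<^bsub>B\<^esub> pcel F \<alpha>"
    and pcmp_icells: "\<lbrakk>f \<in> hom A X Y; g \<in> hom A Y Z\<rbrakk>
          \<Longrightarrow> pcmp F g f \<in> icells B (pmor F g \<odot>\<^bsub>B\<^esub> pmor F f) (pmor F (g \<odot>\<^bsub>A\<^esub> f))"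
    and pone_icells: "X \<in> Obj A \<Longrightarrow> pone F X \<in> icells B (one B (pob F X)) (pmor F (one A X))"
    and pcmp_natural: "\<lbrakk>f \<in> hom A X Y; g \<in> hom A Y Z; \<alpha> \<in> cells A f f'; \<beta> \<in> cells A g g'\<rbrakk>
          \<Longrightarrow> pcmp F g' f' \<cdot>\<^bsub>B\<^esub> (pcel F \<beta> \<star>\<^bsub>B\<^esub> pcel F \<alpha>) = pcel F (\<beta> \<star>\<^bsub>A\<^esub> \<alpha>) \<cdot>\<^bsub>B\<^esub> pcmp F g f"
    and pcmp_assoc: "\<lbrakk>f \<in> hom A X Y; g \<in> hom A Y Z; h \<in> hom A Z W\<rbrakk>
          \<Longrightarrow> pcel F (assoc A h g f) \<cdot>\<^bsub>B\<^esub> pcmp F (h \<odot>\<^bsub>A\<^esub> g) f \<cdot>\<^bsub>B\<^esub> (pcmp F h g \<lhd>\<^bsub>B\<^esub> pmor F f)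
            = pcmp F h (g \<odot>\<^bsub>A\<^esub> f) \<cdot>\<^bsub>B\<^esub> (pmor F h \<rhd>\<^bsub>B\<^esub> pcmp F g f)
                \<cdot>\<^bsub>B\<^esub> assoc B (pmor F h) (pmor F g) (pmor F f)"
    and pone_left: "f \<in> hom A X Y
          \<Longrightarrow> pcel F (lunit A f) \<cdot>\<^bsub>B\<^esub> pcmp F (one A Y) f \<cdot>\<^bsub>B\<^esub> (pone F Y \<lhd>\<^bsub>B\<^esub> pmor F f)
            = lunit B (pmor F f)"
    and pone_right: "f \<in> hom A X Y
          \<Longrightarrow> pcmp F f (one A X) \<cdot>\<^bsub>B\<^esub> (pmor F f \<rhd>\<^bsub>B\<^esub> pone F X) \<cdot>\<^bsub>B\<^esub> runit B (pmor F f)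
            = pcel F (runit A f)"

text \<open>As for 2-categories, identity comparison 2-cells force strict preservation.\<close>

locale two_functor = pseudofunctor +
  assumes pcmp_idc: "\<lbrakk>f \<in> hom A X Y; g \<in> hom A Y Z\<rbrakk>
          \<Longrightarrow> pcmp F g f = idc B (pmor F g \<odot>\<^bsub>B\<^esub> pmor F f)"
    and pone_idc: "X \<in> Obj A \<Longrightarrow> pone F X = idc B (one B (pob F X))"

definition pf_id :: "('o, 'm, 'c) bicat \<Rightarrow> ('o, 'm, 'c, 'o, 'm, 'c) pfun" where
  "pf_id B = \<lparr>pob = (\<lambda>X. X), pmor = (\<lambda>f. f), pcel = (\<lambda>\<alpha>. \<alpha>),
     pcmp = (\<lambda>g f. idc B (g \<odot>\<^bsub>B\<^esub> f)), pone = (\<lambda>X. idc B (one B X))\<rparr>"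

text \<open>In \<open>pf_comp C G F\<close>, the bicategory \<open>C\<close> is the codomain of \<open>G\<close>.\<close>

definition pf_comp :: "('o3, 'm3, 'c3) bicat \<Rightarrow> ('o2, 'm2, 'c2, 'o3, 'm3, 'c3) pfun \<Rightarrow>
    ('o1, 'm1, 'c1, 'o2, 'm2, 'c2) pfun \<Rightarrow> ('o1, 'm1, 'c1, 'o3, 'm3, 'c3) pfun" where
  "pf_comp C G F = \<lparr>pob = (\<lambda>X. pob G (pob F X)), pmor = (\<lambda>f. pmor G (pmor F f)),
     pcel = (\<lambda>\<alpha>. pcel G (pcel F \<alpha>)),
     pcmp = (\<lambda>g f. pcel G (pcmp F g f) \<cdot>\<^bsub>C\<^esub> pcmp G (pmor F g) (pmor F f)),
     pone = (\<lambda>X. pcel G (pone F X) \<cdot>\<^bsub>C\<^esub> pone G (pob F X))\<rparr>"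

text \<open>Equality of pseudofunctors out of \<open>A\<close>, including the comparison 2-cells.\<close>

definition pf_eq :: "('o1, 'm1, 'c1) bicat \<Rightarrow> ('o1, 'm1, 'c1, 'o2, 'm2, 'c2) pfun \<Rightarrow>
    ('o1, 'm1, 'c1, 'o2, 'm2, 'c2) pfun \<Rightarrow> bool" where
  "pf_eq A F G \<longleftrightarrow> (\<forall>X\<in>Obj A. pob F X = pob G X) \<and> (\<forall>f\<in>Mor A. pmor F f = pmor G f) \<and>
     (\<forall>\<alpha>\<in>Cel A. pcel F \<alpha> = pcel G \<alpha>) \<and>
     (\<forall>f\<in>Mor A. \<forall>g\<in>Mor A. trg A f = src A g \<longrightarrow> pcmp F g f = pcmp G g f) \<and>
     (\<forall>X\<in>Obj A. pone F X = pone G X)"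

text \<open>
  A pseudonatural transformation \<open>t : F \<rightarrow> G\<close> has components \<open>tob t X : F X \<rightarrow> G X\<close> and invertible
  2-cells \<open>tmor t f : tob t Y \<odot> F f \<rightarrow> G f \<odot> tob t X\<close> for \<open>f : X \<rightarrow> Y\<close>.
\<close>

record ('o1, 'm1, 'm2, 'c2) pnat =
  tob :: "'o1 \<Rightarrow> 'm2"
  tmor :: "'m1 \<Rightarrow> 'c2"

locale pseudonatural =
  F: pseudofunctor A B F + G: pseudofunctor A B G
  for A :: "('o1, 'm1, 'c1) bicat" and B :: "('o2, 'm2, 'c2) bicat"
    and F G :: "('o1, 'm1, 'c1, 'o2, 'm2, 'c2) pfun" +
  fixes t :: "('o1, 'm1, 'm2, 'c2) pnat"
  assumes tob_hom: "X \<in> Obj A \<Longrightarrow> tob t X \<in> hom B (pob F X) (pob G X)"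
    and tmor_icells: "f \<in> hom A X Y
          \<Longrightarrow> tmor t f \<in> icells B (tob t Y \<odot>\<^bsub>B\<^esub> pmor F f) (pmor G f \<odot>\<^bsub>B\<^esub> tob t X)"
    and tmor_natural: "\<lbrakk>f \<in> hom A X Y; \<alpha> \<in> cells A f f'\<rbrakk>
          \<Longrightarrow> tmor t f' \<cdot>\<^bsub>B\<^esub> (tob t Y \<rhd>\<^bsub>B\<^esub> pcel F \<alpha>) = (pcel G \<alpha> \<lhd>\<^bsub>B\<^esub> tob t X) \<cdot>\<^bsub>B\<^esub> tmor t f"
    and tmor_cmp: "\<lbrakk>f \<in> hom A X Y; g \<in> hom A Y Z\<rbrakk>
          \<Longrightarrow> tmor t (g \<odot>\<^bsub>A\<^esub> f) \<cdot>\<^bsub>B\<^esub> (tob t Z \<rhd>\<^bsub>B\<^esub> pcmp F g f)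
                \<cdot>\<^bsub>B\<^esub> assoc B (tob t Z) (pmor F g) (pmor F f)
            = (pcmp G g f \<lhd>\<^bsub>B\<^esub> tob t X) \<cdot>\<^bsub>B\<^esub> inv2 B (assoc B (pmor G g) (pmor G f) (tob t X))
                \<cdot>\<^bsub>B\<^esub> (pmor G g \<rhd>\<^bsub>B\<^esub> tmor t f) \<cdot>\<^bsub>B\<^esub> assoc B (pmor G g) (tob t Y) (pmor F f)
                \<cdot>\<^bsub>B\<^esub> (tmor t g \<lhd>\<^bsub>B\<^esub> pmor F f)"
    and tmor_one: "X \<in> Obj A
          \<Longrightarrow> tmor t (one A X) \<cdot>\<^bsub>B\<^esub> (tob t X \<rhd>\<^bsub>B\<^esub> pone F X) \<cdot>\<^bsub>B\<^esub> runit B (tob t X)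
                \<cdot>\<^bsub>B\<^esub> lunit B (tob t X)
            = pone G X \<lhd>\<^bsub>B\<^esub> tob t X"

definition pn_id :: "('o2, 'm2, 'c2) bicat \<Rightarrow> ('o1, 'm1, 'c1, 'o2, 'm2, 'c2) pfun \<Rightarrow>
    ('o1, 'm1, 'm2, 'c2) pnat" where
  "pn_id B F = \<lparr>tob = (\<lambda>X. one B (pob F X)),
     tmor = (\<lambda>f. runit B (pmor F f) \<cdot>\<^bsub>B\<^esub> lunit B (pmor F f))\<rparr>"

text \<open>The composite of \<open>t : F \<rightarrow> G\<close> and \<open>s : G \<rightarrow> H\<close>, for pseudofunctors from \<open>A\<close> to \<open>B\<close>.\<close>

definition pn_comp :: "('o1, 'm1, 'c1) bicat \<Rightarrow> ('o2, 'm2, 'c2) bicat \<Rightarrow>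
    ('o1, 'm1, 'c1, 'o2, 'm2, 'c2) pfun \<Rightarrow> ('o1, 'm1, 'c1, 'o2, 'm2, 'c2) pfun \<Rightarrow>
    ('o1, 'm1, 'c1, 'o2, 'm2, 'c2) pfun \<Rightarrow>
    ('o1, 'm1, 'm2, 'c2) pnat \<Rightarrow> ('o1, 'm1, 'm2, 'c2) pnat \<Rightarrow> ('o1, 'm1, 'm2, 'c2) pnat" where
  "pn_comp A B F G H s t = \<lparr>tob = (\<lambda>X. tob s X \<odot>\<^bsub>B\<^esub> tob t X),
     tmor = (\<lambda>f. assoc B (pmor H f) (tob s (src A f)) (tob t (src A f))
       \<cdot>\<^bsub>B\<^esub> (tmor s f \<lhd>\<^bsub>B\<^esub> tob t (src A f))
       \<cdot>\<^bsub>B\<^esub> inv2 B (assoc B (tob s (trg A f)) (pmor G f) (tob t (src A f)))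
       \<cdot>\<^bsub>B\<^esub> (tob s (trg A f) \<rhd>\<^bsub>B\<^esub> tmor t f)
       \<cdot>\<^bsub>B\<^esub> assoc B (tob s (trg A f)) (tob t (trg A f)) (pmor F f))\<rparr>"

text \<open>
  Whiskering of \<open>t : F \<rightarrow> G\<close> (pseudofunctors from \<open>A\<close> to \<open>B\<close>) by \<open>H : B \<rightarrow> C\<close> after, and by
  \<open>K : A' \<rightarrow> A\<close> before.
\<close>

definition pn_wleft :: "('o1, 'm1, 'c1) bicat \<Rightarrow> ('o3, 'm3, 'c3) bicat \<Rightarrow>
    ('o2, 'm2, 'c2, 'o3, 'm3, 'c3) pfun \<Rightarrow> ('o1, 'm1, 'c1, 'o2, 'm2, 'c2) pfun \<Rightarrow>
    ('o1, 'm1, 'c1, 'o2, 'm2, 'c2) pfun \<Rightarrow> ('o1, 'm1, 'm2, 'c2) pnat \<Rightarrow>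
    ('o1, 'm1, 'm3, 'c3) pnat" where
  "pn_wleft A C H F G t = \<lparr>tob = (\<lambda>X. pmor H (tob t X)),
     tmor = (\<lambda>f. inv2 C (pcmp H (pmor G f) (tob t (src A f)))
       \<cdot>\<^bsub>C\<^esub> pcel H (tmor t f) \<cdot>\<^bsub>C\<^esub> pcmp H (tob t (trg A f)) (pmor F f))\<rparr>"

definition pn_wright :: "('o1, 'm1, 'm2, 'c2) pnat \<Rightarrow> ('o0, 'm0, 'c0, 'o1, 'm1, 'c1) pfun \<Rightarrow>
    ('o0, 'm0, 'm2, 'c2) pnat" where
  "pn_wright t K = \<lparr>tob = (\<lambda>X. tob t (pob K X)), tmor = (\<lambda>f. tmor t (pmor K f))\<rparr>"

text \<open>Invertible modifications between \<open>t, s : F \<rightarrow> G\<close>, for pseudofunctors from \<open>A\<close> to \<open>B\<close>.\<close>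

definition invertible_modification :: "('o1, 'm1, 'c1) bicat \<Rightarrow> ('o2, 'm2, 'c2) bicat \<Rightarrow>
    ('o1, 'm1, 'c1, 'o2, 'm2, 'c2) pfun \<Rightarrow> ('o1, 'm1, 'c1, 'o2, 'm2, 'c2) pfun \<Rightarrow>
    ('o1, 'm1, 'm2, 'c2) pnat \<Rightarrow> ('o1, 'm1, 'm2, 'c2) pnat \<Rightarrow> ('o1 \<Rightarrow> 'c2) \<Rightarrow> bool" where
  "invertible_modification A B F G t s \<Gamma> \<longleftrightarrow>
     (\<forall>X\<in>Obj A. \<Gamma> X \<in> icells B (tob t X) (tob s X)) \<and>
     (\<forall>X Y. \<forall>f\<in>hom A X Y. (pmor G f \<rhd>\<^bsub>B\<^esub> \<Gamma> X) \<cdot>\<^bsub>B\<^esub> tmor t f = tmor s f \<cdot>\<^bsub>B\<^esub> (\<Gamma> Y \<lhd>\<^bsub>B\<^esub> pmor F f))"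


section \<open>Pseudomonads on a bicategory\<close>

text \<open>
  The modifications have components \<open>masc X : m\<^sub>X \<odot> S m\<^sub>X \<rightarrow> m\<^sub>X \<odot> m\<^sub>S\<^sub>X\<close>,
  \<open>mlu X : m\<^sub>X \<odot> e\<^sub>S\<^sub>X \<rightarrow> 1\<close> and \<open>mru X : m\<^sub>X \<odot> S e\<^sub>X \<rightarrow> 1\<close>.
\<close>

record ('o, 'm, 'c) pmonad =
  mfun :: "('o, 'm, 'c, 'o, 'm, 'c) pfun"
  mmult :: "('o, 'm, 'm, 'c) pnat"
  munit :: "('o, 'm, 'm, 'c) pnat"
  masc :: "'o \<Rightarrow> 'c"
  mlu :: "'o \<Rightarrow> 'c"
  mru :: "'o \<Rightarrow> 'c"

locale pseudomonad_data =
  fixes B :: "('o, 'm, 'c) bicat" (structure) and M :: "('o, 'm, 'c) pmonad"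
begin

abbreviation "S \<equiv> mfun M"
abbreviation "SS \<equiv> pf_comp B S S"
abbreviation "SSS \<equiv> pf_comp B S SS"
abbreviation "I \<equiv> pf_id B"
abbreviation "e \<equiv> munit M"
abbreviation "m \<equiv> mmult M"

end

locale pseudomonad = pseudomonad_data + bicategory +
  assumes mfun_pseudofunctor: "pseudofunctor B B S"
    and munit_pseudonatural: "pseudonatural B B I S e"
    and mmult_pseudonatural: "pseudonatural B B SS S m"
    and masc_modification:
      "invertible_modification B B SSS S
         (pn_comp B B SSS SS S m (pn_wleft B B S SS S m))
         (pn_comp B B SSS SS S m (pn_wright m S)) (masc M)"
    and mlu_modification:
      "invertible_modification B B S S
         (pn_comp B B S SS S m (pn_wright e S)) (pn_id B S) (mlu M)"
    and mru_modification:
      "invertible_modification B B S S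
         (pn_comp B B S SS S m (pn_wleft B B S I S e)) (pn_id B S) (mru M)"
    \<comment> \<open>both sides go from \<open>(m\<^sub>X \<odot> S m\<^sub>X) \<odot> S S m\<^sub>X\<close> to \<open>(m\<^sub>X \<odot> m\<^sub>S\<^sub>X) \<odot> m\<^sub>S\<^sub>S\<^sub>X\<close>\<close>
    and masc_coherence: "\<lbrakk>X \<in> Obj B;
        u = tob m X; v = tob m (pob S X); w = tob m (pob S (pob S X)); a = masc M\<rbrakk>
      \<Longrightarrow> (a X \<lhd> w) \<cdot> inv2 B (assoc B u (pmor S u) w) \<cdot> (u \<rhd> tmor m u)
            \<cdot> assoc B u v (pmor S (pmor S u)) \<cdot> (a X \<lhd> pmor S (pmor S u))
        = inv2 B (assoc B u v w) \<cdot> (u \<rhd> a (pob S X)) \<cdot> assoc B u v (pmor S v)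
            \<cdot> (a X \<lhd> pmor S v) \<cdot> inv2 B (assoc B u (pmor S u) (pmor S v))
            \<cdot> (u \<rhd> (inv2 B (pcmp S u v) \<cdot> pcel S (a X) \<cdot> pcmp S u (pmor S u)))
            \<cdot> assoc B u (pmor S u) (pmor S (pmor S u))"
    \<comment> \<open>both sides go from \<open>(m\<^sub>X \<odot> S m\<^sub>X) \<odot> S e\<^sub>S\<^sub>X\<close> to \<open>m\<^sub>X \<odot> S 1\<close>\<close>
    and munit_coherence: "\<lbrakk>X \<in> Obj B;
        u = tob m X; v = tob m (pob S X); j = tob e (pob S X)\<rbrakk>
      \<Longrightarrow> (u \<rhd> (pcel S (mlu M X) \<cdot> pcmp S u j)) \<cdot> assoc B u (pmor S u) (pmor S j)
        = (u \<rhd> (pone S (pob S X) \<cdot> mru M (pob S X))) \<cdot> assoc B u v (pmor S j)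
            \<cdot> (masc M X \<lhd> pmor S j)"


section \<open>2-monads and their pseudoalgebras\<close>

record ('o, 'm, 'c) monad2 =
  sfun :: "('o, 'm, 'c, 'o, 'm, 'c) pfun"
  smult :: "'o \<Rightarrow> 'm"
  sunit :: "'o \<Rightarrow> 'm"

locale two_monad_data =
  fixes B :: "('o, 'm, 'c) bicat" (structure) and M :: "('o, 'm, 'c) monad2"
begin

abbreviation "S \<equiv> sfun M"
abbreviation "m \<equiv> smult M"
abbreviation "e \<equiv> sunit M"

end

locale two_monad = two_monad_data + two_category +
  assumes sfun_two_functor: "two_functor B B S"
    and smult_hom: "X \<in> Obj B \<Longrightarrow> m X \<in> hom B (pob S (pob S X)) (pob S X)"
    and sunit_hom: "X \<in> Obj B \<Longrightarrow> e X \<in> hom B X (pob S X)"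
    and smult_natural: "f \<in> hom B X Y \<Longrightarrow> m Y \<odot> pmor S (pmor S f) = pmor S f \<odot> m X"
    and sunit_natural: "f \<in> hom B X Y \<Longrightarrow> e Y \<odot> f = pmor S f \<odot> e X"
    and smult_natural2: "\<lbrakk>f \<in> hom B X Y; \<alpha> \<in> cells B f f'\<rbrakk>
          \<Longrightarrow> m Y \<rhd> pcel S (pcel S \<alpha>) = pcel S \<alpha> \<lhd> m X"
    and sunit_natural2: "\<lbrakk>f \<in> hom B X Y; \<alpha> \<in> cells B f f'\<rbrakk>
          \<Longrightarrow> e Y \<rhd> \<alpha> = pcel S \<alpha> \<lhd> e X"
    and smult_assoc: "X \<in> Obj B \<Longrightarrow> m X \<odot> pmor S (m X) = m X \<odot> m (pob S X)"
    and smult_unit_left: "X \<in> Obj B \<Longrightarrow> m X \<odot> e (pob S X) = one B (pob S X)"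
    and smult_unit_right: "X \<in> Obj B \<Longrightarrow> m X \<odot> pmor S (e X) = one B (pob S X)"

text \<open>
  A pseudoalgebra has an object \<open>car\<close>, a morphism \<open>act : S car \<rightarrow> car\<close>, written \<open>a\<close>, and 2-cells
  \<open>amul : a \<odot> S a \<rightarrow> a \<odot> m\<close> and \<open>aone : 1 \<rightarrow> a \<odot> e\<close>.
\<close>

record ('o, 'm, 'c) palg =
  car :: 'o
  act :: 'm
  amul :: 'c
  aone :: 'c

context
  fixes B :: "('o, 'm, 'c) bicat" (structure) and M :: "('o, 'm, 'c) monad2"
begin

text \<open>
  In the following equations, 2-cells are composed across strict equalities of morphisms such as
  \<open>m \<odot> S S f = S f \<odot> m\<close>.
\<close>

definition pseudoalgebra :: "('o, 'm, 'c) palg \<Rightarrow> bool" where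
  "pseudoalgebra P \<longleftrightarrow>
    (let S = sfun M; A = car P; a = act P; m = smult M A; e = sunit M A in
      A \<in> Obj B \<and> a \<in> hom B (pob S A) A \<and>
      amul P \<in> icells B (a \<odot> pmor S a) (a \<odot> m) \<and>
      aone P \<in> icells B (one B A) (a \<odot> e) \<and>
      (amul P \<lhd> smult M (pob S A)) \<cdot> (amul P \<lhd> pmor S (pmor S a))
        = (amul P \<lhd> pmor S m) \<cdot> (a \<rhd> pcel S (amul P)) \<and>
      (amul P \<lhd> pmor S e) \<cdot> (a \<rhd> pcel S (aone P)) = idc B a)"

definition strict_algebra :: "('o, 'm, 'c) palg \<Rightarrow> bool" where
  "strict_algebra P \<longleftrightarrow> pseudoalgebra P \<and>
     amul P = idc B (act P \<odot> pmor (sfun M) (act P)) \<and> aone P = idc B (one B (car P))"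

definition pseudomorphism :: "('o, 'm, 'c) palg \<Rightarrow> ('o, 'm, 'c) palg \<Rightarrow> 'm \<Rightarrow> 'c \<Rightarrow> bool" where
  "pseudomorphism P Q f \<phi> \<longleftrightarrow>
    (let S = sfun M; A = car P; a = act P; b = act Q in
      f \<in> hom B A (car Q) \<and>
      \<phi> \<in> icells B (b \<odot> pmor S f) (f \<odot> a) \<and>
      (\<phi> \<lhd> smult M A) \<cdot> (amul Q \<lhd> pmor S (pmor S f))
        = (f \<rhd> amul P) \<cdot> (\<phi> \<lhd> pmor S a) \<cdot> (b \<rhd> pcel S \<phi>) \<and>
      (\<phi> \<lhd> sunit M A) \<cdot> (aone Q \<lhd> f) = f \<rhd> aone P)"

definition algebra_cell :: "('o, 'm, 'c) palg \<Rightarrow> ('o, 'm, 'c) palg \<Rightarrow> 'm \<Rightarrow> 'c \<Rightarrow> 'm \<Rightarrow> 'c \<Rightarrow> 'c \<Rightarrow> bool"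
  where
  "algebra_cell P Q f \<phi> g \<psi> \<alpha> \<longleftrightarrow> \<alpha> \<in> cells B f g \<and>
     (\<alpha> \<lhd> act P) \<cdot> \<phi> = \<psi> \<cdot> (act Q \<rhd> pcel (sfun M) \<alpha>)"

text \<open>Structure 2-cells of the identity and of the composite of \<open>(f, \<phi>)\<close> and \<open>(g, \<psi>)\<close>.\<close>

definition psm_id :: "('o, 'm, 'c) palg \<Rightarrow> 'c" where
  "psm_id P = idc B (act P)"

definition psm_comp :: "'m \<Rightarrow> 'c \<Rightarrow> 'm \<Rightarrow> 'c \<Rightarrow> 'c" where
  "psm_comp g \<psi> f \<phi> = (g \<rhd> \<phi>) \<cdot> (\<psi> \<lhd> pmor (sfun M) f)"

end


section \<open>Restriction of a 2-monad along a pseudofunctor\<close>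

text \<open>
  The strict algebra \<open>J A\<close> induced by a strict algebra \<open>A\<close> of the restricted 2-monad. That it is
  one is automatic when \<open>J\<close> is a 2-functor. A general pseudofunctor need not preserve the strict
  equation \<open>a \<odot> S a = a \<odot> m\<close>, so the restriction includes the existence of the lift of \<open>J\<close> to
  strict algebras.
\<close>

definition lift_alg :: "('od, 'md, 'cd) bicat \<Rightarrow> ('od, 'md, 'cd) monad2 \<Rightarrow>
    ('oc, 'mc, 'cc, 'od, 'md, 'cd) pfun \<Rightarrow> ('oc, 'mc, 'cc) palg \<Rightarrow> ('od, 'md, 'cd) palg" where
  "lift_alg D SD J A = \<lparr>car = pob J (car A), act = pmor J (act A),
     amul = idc D (pmor J (act A) \<odot>\<^bsub>D\<^esub> pmor (sfun SD) (pmor J (act A))),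
     aone = idc D (one D (pob J (car A)))\<rparr>"

locale restricts_along =
  SC: two_monad C SC + SD: two_monad D SD + J: pseudofunctor C D J
  for C :: "('oc, 'mc, 'cc) bicat" and D :: "('od, 'md, 'cd) bicat"
    and J :: "('oc, 'mc, 'cc, 'od, 'md, 'cd) pfun"
    and SC :: "('oc, 'mc, 'cc) monad2" and SD :: "('od, 'md, 'cd) monad2" +
  assumes restrict_fun: "pf_eq C (pf_comp D J (sfun SC)) (pf_comp D (sfun SD) J)"
    and restrict_mult: "X \<in> Obj C \<Longrightarrow> pmor J (smult SC X) = smult SD (pob J X)"
    and restrict_unit: "X \<in> Obj C \<Longrightarrow> pmor J (sunit SC X) = sunit SD (pob J X)"
    and restrict_alg: "strict_algebra C SC A \<Longrightarrow> strict_algebra D SD (lift_alg D SD J A)"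


section \<open>Relative pseudomonads and their Kleisli bicategories\<close>

text \<open>
  For \<open>f : J X \<rightarrow> T Y\<close>, the functor \<open>(-)\<^sup>*\<close> is \<open>star T X Y\<close> on morphisms and \<open>star2 T X Y\<close> on
  2-cells. The indices \<open>X\<close>, \<open>Y\<close> are needed since \<open>J\<close> and \<open>T\<close> need not be injective on objects.
\<close>

record ('oc, 'od, 'md, 'cd) rpmonad =
  Tob :: "'oc \<Rightarrow> 'od"
  star :: "'oc \<Rightarrow> 'oc \<Rightarrow> 'md \<Rightarrow> 'md"
  star2 :: "'oc \<Rightarrow> 'oc \<Rightarrow> 'cd \<Rightarrow> 'cd"
  Ti :: "'oc \<Rightarrow> 'md"
  Tmu :: "'oc \<Rightarrow> 'oc \<Rightarrow> 'oc \<Rightarrow> 'md \<Rightarrow> 'md \<Rightarrow> 'cd"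
  Teta :: "'oc \<Rightarrow> 'oc \<Rightarrow> 'md \<Rightarrow> 'cd"
  Ttheta :: "'oc \<Rightarrow> 'cd"

definition khom :: "('od, 'md, 'cd) bicat \<Rightarrow> ('oc, 'mc, 'cc, 'od, 'md, 'cd) pfun \<Rightarrow>
    ('oc, 'od, 'md, 'cd) rpmonad \<Rightarrow> 'oc \<Rightarrow> 'oc \<Rightarrow> 'md set" where
  "khom D J T X Y = hom D (pob J X) (Tob T Y)"

locale relative_pseudomonad =
  C: two_category C + D: two_category D + J: pseudofunctor C D J
  for C :: "('oc, 'mc, 'cc) bicat" and D :: "('od, 'md, 'cd) bicat" (structure)
    and J :: "('oc, 'mc, 'cc, 'od, 'md, 'cd) pfun" +
  fixes T :: "('oc, 'od, 'md, 'cd) rpmonad"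
  assumes Tob_Obj: "X \<in> Obj C \<Longrightarrow> Tob T X \<in> Obj D"
    and star_hom: "\<lbrakk>X \<in> Obj C; Y \<in> Obj C; f \<in> khom D J T X Y\<rbrakk>
          \<Longrightarrow> star T X Y f \<in> hom D (Tob T X) (Tob T Y)"
    and star2_cells: "\<lbrakk>X \<in> Obj C; Y \<in> Obj C; f \<in> khom D J T X Y; \<alpha> \<in> cells D f f'\<rbrakk>
          \<Longrightarrow> star2 T X Y \<alpha> \<in> cells D (star T X Y f) (star T X Y f')"
    and star2_idc: "\<lbrakk>X \<in> Obj C; Y \<in> Obj C; f \<in> khom D J T X Y\<rbrakk>
          \<Longrightarrow> star2 T X Y (idc D f) = idc D (star T X Y f)"
    and star2_vcmp: "\<lbrakk>X \<in> Obj C; Y \<in> Obj C; f \<in> khom D J T X Y;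
            \<alpha> \<in> cells D f f'; \<beta> \<in> cells D f' f''\<rbrakk>
          \<Longrightarrow> star2 T X Y (\<beta> \<cdot>\<^bsub>D\<^esub> \<alpha>) = star2 T X Y \<beta> \<cdot>\<^bsub>D\<^esub> star2 T X Y \<alpha>"
    and Ti_khom: "X \<in> Obj C \<Longrightarrow> Ti T X \<in> khom D J T X X"
    and Tmu_icells: "\<lbrakk>X \<in> Obj C; Y \<in> Obj C; Z \<in> Obj C; f \<in> khom D J T X Y; g \<in> khom D J T Y Z\<rbrakk>
          \<Longrightarrow> Tmu T X Y Z g f
            \<in> icells D (star T X Z (star T Y Z g \<odot>\<^bsub>D\<^esub> f)) (star T Y Z g \<odot>\<^bsub>D\<^esub> star T X Y f)"
    and Teta_icells: "\<lbrakk>X \<in> Obj C; Y \<in> Obj C; f \<in> khom D J T X Y\<rbrakk>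
          \<Longrightarrow> Teta T X Y f \<in> icells D f (star T X Y f \<odot>\<^bsub>D\<^esub> Ti T X)"
    and Ttheta_icells: "X \<in> Obj C
          \<Longrightarrow> Ttheta T X \<in> icells D (star T X X (Ti T X)) (one D (Tob T X))"
    and Tmu_natural: "\<lbrakk>X \<in> Obj C; Y \<in> Obj C; Z \<in> Obj C; f \<in> khom D J T X Y; g \<in> khom D J T Y Z;
            \<alpha> \<in> cells D f f'; \<beta> \<in> cells D g g'\<rbrakk>
          \<Longrightarrow> Tmu T X Y Z g' f' \<cdot>\<^bsub>D\<^esub> star2 T X Z (star2 T Y Z \<beta> \<star>\<^bsub>D\<^esub> \<alpha>)
            = (star2 T Y Z \<beta> \<star>\<^bsub>D\<^esub> star2 T X Y \<alpha>) \<cdot>\<^bsub>D\<^esub> Tmu T X Y Z g f"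
    and Teta_natural: "\<lbrakk>X \<in> Obj C; Y \<in> Obj C; f \<in> khom D J T X Y; \<alpha> \<in> cells D f f'\<rbrakk>
          \<Longrightarrow> Teta T X Y f' \<cdot>\<^bsub>D\<^esub> \<alpha> = (star2 T X Y \<alpha> \<lhd>\<^bsub>D\<^esub> Ti T X) \<cdot>\<^bsub>D\<^esub> Teta T X Y f"
    and Tmu_coherence: "\<lbrakk>X \<in> Obj C; Y \<in> Obj C; Z \<in> Obj C; V \<in> Obj C;
            f \<in> khom D J T X Y; g \<in> khom D J T Y Z; h \<in> khom D J T Z V\<rbrakk>
          \<Longrightarrow> (star T Z V h \<rhd>\<^bsub>D\<^esub> Tmu T X Y Z g f) \<cdot>\<^bsub>D\<^esub> Tmu T X Z V h (star T Y Z g \<odot>\<^bsub>D\<^esub> f)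
                \<cdot>\<^bsub>D\<^esub> star2 T X V (Tmu T Y Z V h g \<lhd>\<^bsub>D\<^esub> f)
            = (Tmu T Y Z V h g \<lhd>\<^bsub>D\<^esub> star T X Y f) \<cdot>\<^bsub>D\<^esub> Tmu T X Y V (star T Z V h \<odot>\<^bsub>D\<^esub> g) f"
    and Teta_coherence: "\<lbrakk>X \<in> Obj C; Y \<in> Obj C; f \<in> khom D J T X Y\<rbrakk>
          \<Longrightarrow> (star T X Y f \<rhd>\<^bsub>D\<^esub> Ttheta T X) \<cdot>\<^bsub>D\<^esub> Tmu T X X Y f (Ti T X)
                \<cdot>\<^bsub>D\<^esub> star2 T X Y (Teta T X Y f)
            = idc D (star T X Y f)"

text \<open>
  A morphism \<open>X \<rightarrow> Y\<close> of \<open>Kl T\<close> is a morphism \<open>f : J X \<rightarrow> T Y\<close>, encoded as \<open>(X, f, Y)\<close> so that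
  source and target in \<open>C\<close> can be recovered; likewise for 2-cells.
\<close>

definition Kl :: "('oc, 'mc, 'cc) bicat \<Rightarrow> ('od, 'md, 'cd) bicat \<Rightarrow>
    ('oc, 'mc, 'cc, 'od, 'md, 'cd) pfun \<Rightarrow> ('oc, 'od, 'md, 'cd) rpmonad \<Rightarrow>
    ('oc, 'oc \<times> 'md \<times> 'oc, 'oc \<times> 'cd \<times> 'oc) bicat" where
  "Kl C D J T = \<lparr>
     Obj = Obj C,
     Mor = {(X, f, Y). X \<in> Obj C \<and> Y \<in> Obj C \<and> f \<in> khom D J T X Y},
     src = (\<lambda>(X, f, Y). X),
     trg = (\<lambda>(X, f, Y). Y),
     Cel = {(X, \<alpha>, Y). X \<in> Obj C \<and> Y \<in> Obj C \<and> \<alpha> \<in> Cel D \<and> src2 D \<alpha> \<in> khom D J T X Y},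
     src2 = (\<lambda>(X, \<alpha>, Y). (X, src2 D \<alpha>, Y)),
     trg2 = (\<lambda>(X, \<alpha>, Y). (X, trg2 D \<alpha>, Y)),
     one = (\<lambda>X. (X, Ti T X, X)),
     cmp = (\<lambda>(Y, g, Z) (X, f, _). (X, star T Y Z g \<odot>\<^bsub>D\<^esub> f, Z)),
     idc = (\<lambda>(X, f, Y). (X, idc D f, Y)),
     vcmp = (\<lambda>(X, \<beta>, Y) (_, \<alpha>, _). (X, \<beta> \<cdot>\<^bsub>D\<^esub> \<alpha>, Y)),
     hcmp = (\<lambda>(Y, \<beta>, Z) (X, \<alpha>, _). (X, star2 T Y Z \<beta> \<star>\<^bsub>D\<^esub> \<alpha>, Z)),
     assoc = (\<lambda>(Z, h, W) (Y, g, _) (X, f, _). (X, Tmu T Y Z W h g \<lhd>\<^bsub>D\<^esub> f, W)),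
     lunit = (\<lambda>(X, f, Y). (X, Ttheta T Y \<lhd>\<^bsub>D\<^esub> f, Y)),
     runit = (\<lambda>(X, f, Y). (X, Teta T X Y f, Y))\<rparr>"

text \<open>
  The comparison 2-cell of \<open>F\<^sup>T\<close> at \<open>g : X \<rightarrow> Y\<close> and \<open>h : Y \<rightarrow> Z\<close> is the composite
  \<open>(i\<^sub>Z J(h))\<^sup>* i\<^sub>Y J(g) \<rightarrow> i\<^sub>Z J(h) J(g) \<rightarrow> i\<^sub>Z J(h g)\<close> of the inverse of \<open>\<eta>\<close> and the comparison of \<open>J\<close>.
\<close>

definition FT :: "('oc, 'mc, 'cc) bicat \<Rightarrow> ('od, 'md, 'cd) bicat \<Rightarrow>
    ('oc, 'mc, 'cc, 'od, 'md, 'cd) pfun \<Rightarrow> ('oc, 'od, 'md, 'cd) rpmonad \<Rightarrow>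
    ('oc, 'mc, 'cc, 'oc, 'oc \<times> 'md \<times> 'oc, 'oc \<times> 'cd \<times> 'oc) pfun" where
  "FT C D J T = \<lparr>
     pob = (\<lambda>X. X),
     pmor = (\<lambda>g. (src C g, Ti T (trg C g) \<odot>\<^bsub>D\<^esub> pmor J g, trg C g)),
     pcel = (\<lambda>\<alpha>. (src C (src2 C \<alpha>), Ti T (trg C (src2 C \<alpha>)) \<rhd>\<^bsub>D\<^esub> pcel J \<alpha>, trg C (src2 C \<alpha>))),
     pcmp = (\<lambda>h g. (src C g,
        (Ti T (trg C h) \<rhd>\<^bsub>D\<^esub> pcmp J h g)
          \<cdot>\<^bsub>D\<^esub> (inv2 D (Teta T (src C h) (trg C h) (Ti T (trg C h) \<odot>\<^bsub>D\<^esub> pmor J h)) \<lhd>\<^bsub>D\<^esub> pmor J g),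
        trg C h)),
     pone = (\<lambda>X. (X, Ti T X \<rhd>\<^bsub>D\<^esub> pone J X, X))\<rparr>"


section \<open>Liftings and extensions\<close>

text \<open>
  A lifting assigns the algebra \<open>lalg L A\<close> on \<open>T A\<close> to a strict algebra \<open>A\<close>, the structure 2-cell
  \<open>lstar L A B f \<phi>\<close> of \<open>f\<^sup>*\<close> to a pseudomorphism \<open>(f, \<phi>) : J A \<rightarrow> T B\<close>, and the structure 2-cell
  \<open>li L A\<close> to \<open>i\<^sub>A\<close>.
\<close>

record ('oc, 'mc, 'cc, 'od, 'md, 'cd) lifting_data =
  lalg :: "('oc, 'mc, 'cc) palg \<Rightarrow> ('od, 'md, 'cd) palg"
  lstar :: "('oc, 'mc, 'cc) palg \<Rightarrow> ('oc, 'mc, 'cc) palg \<Rightarrow> 'md \<Rightarrow> 'cd \<Rightarrow> 'cd"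
  li :: "('oc, 'mc, 'cc) palg \<Rightarrow> 'cd"

locale lifting =
  fixes C :: "('oc, 'mc, 'cc) bicat" and D :: "('od, 'md, 'cd) bicat"
    and J :: "('oc, 'mc, 'cc, 'od, 'md, 'cd) pfun" and T :: "('oc, 'od, 'md, 'cd) rpmonad"
    and SC :: "('oc, 'mc, 'cc) monad2" and SD :: "('od, 'md, 'cd) monad2"
    and L :: "('oc, 'mc, 'cc, 'od, 'md, 'cd) lifting_data"
begin

abbreviation "salg \<equiv> strict_algebra C SC"
abbreviation "psm \<equiv> pseudomorphism D SD"
abbreviation "acell \<equiv> algebra_cell D SD"
abbreviation "jalg \<equiv> lift_alg D SD J"
abbreviation "talg \<equiv> lalg L"
abbreviation "tstar A B \<equiv> star T (car A) (car B)"

text \<open>The structure of \<open>g\<^sup>* h\<close>, for \<open>(g, \<psi>) : J B \<rightarrow> T E\<close> and \<open>(h, \<phi>)\<close> with codomain \<open>T B\<close>.\<close>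

abbreviation "psm_st B E g \<psi> h \<phi> \<equiv> psm_comp D SD (tstar B E g) (lstar L B E g \<psi>) h \<phi>"

end

text \<open>
  \<open>lstar_cell\<close> expresses that \<open>(-)\<^sup>*\<close> acts as a functor on pseudomorphisms and algebra 2-cells,
  as it must for the lifted data to be a relative pseudomonad. It does not follow from the other
  conditions.
\<close>

locale lifting_to_pseudoalgebras = lifting +
  assumes lalg_car: "salg A \<Longrightarrow> car (talg A) = Tob T (car A)"
    and lalg_pseudoalgebra: "salg A \<Longrightarrow> pseudoalgebra D SD (talg A)"
    and lstar_psm: "\<lbrakk>salg A; salg B; psm (jalg A) (talg B) f \<phi>\<rbrakk>
          \<Longrightarrow> psm (talg A) (talg B) (tstar A B f) (lstar L A B f \<phi>)"
    and lstar_cell: "\<lbrakk>salg A; salg B; psm (jalg A) (talg B) f \<phi>; psm (jalg A) (talg B) f' \<phi>';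
            acell (jalg A) (talg B) f \<phi> f' \<phi>' \<alpha>\<rbrakk>
          \<Longrightarrow> acell (talg A) (talg B) (tstar A B f) (lstar L A B f \<phi>)
                (tstar A B f') (lstar L A B f' \<phi>') (star2 T (car A) (car B) \<alpha>)"
    and li_psm: "salg A \<Longrightarrow> psm (jalg A) (talg A) (Ti T (car A)) (li L A)"
    and Tmu_acell: "\<lbrakk>salg A; salg B; salg E; psm (jalg A) (talg B) f \<phi>; psm (jalg B) (talg E) g \<psi>\<rbrakk>
          \<Longrightarrow> acell (talg A) (talg E)
                (tstar A E (tstar B E g \<odot>\<^bsub>D\<^esub> f))
                (lstar L A E (tstar B E g \<odot>\<^bsub>D\<^esub> f) (psm_st B E g \<psi> f \<phi>))
                (tstar B E g \<odot>\<^bsub>D\<^esub> tstar A B f)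
                (psm_st B E g \<psi> (tstar A B f) (lstar L A B f \<phi>))
                (Tmu T (car A) (car B) (car E) g f)"
    and Teta_acell: "\<lbrakk>salg A; salg B; psm (jalg A) (talg B) f \<phi>\<rbrakk>
          \<Longrightarrow> acell (jalg A) (talg B) f \<phi>
                (tstar A B f \<odot>\<^bsub>D\<^esub> Ti T (car A)) (psm_st A B f \<phi> (Ti T (car A)) (li L A))
                (Teta T (car A) (car B) f)"
    and Ttheta_acell: "salg A
          \<Longrightarrow> acell (talg A) (talg A)
                (tstar A A (Ti T (car A))) (lstar L A A (Ti T (car A)) (li L A))
                (one D (Tob T (car A))) (psm_id D (talg A))
                (Ttheta T (car A))"

locale lifting_to_strict_algebras = lifting_to_pseudoalgebras +
  assumes lalg_strict: "salg A \<Longrightarrow> strict_algebra D SD (talg A)"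

text \<open>
  \<open>M\<close> is an extension to \<open>Kl T\<close> of the 2-monad \<open>S\<close> on \<open>C\<close>. The transformation
  \<open>mfun M \<circ> F\<^sup>T \<rightarrow> F\<^sup>T \<circ> S\<close> has identity components, so its invertibility amounts to that of
  its 2-cells.
\<close>

definition extension_of :: "('oc, 'mc, 'cc) bicat \<Rightarrow> ('od, 'md, 'cd) bicat \<Rightarrow>
    ('oc, 'mc, 'cc, 'od, 'md, 'cd) pfun \<Rightarrow> ('oc, 'od, 'md, 'cd) rpmonad \<Rightarrow>
    ('oc, 'mc, 'cc) monad2 \<Rightarrow> ('oc, 'oc \<times> 'md \<times> 'oc, 'oc \<times> 'cd \<times> 'oc) pmonad \<Rightarrow> bool" where
  "extension_of C D J T S M \<longleftrightarrow>
    (let K = Kl C D J T; F = FT C D J T in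
      (\<forall>X\<in>Obj C. pob (mfun M) X = pob (sfun S) X) \<and>
      (\<exists>\<kappa>. pseudonatural C K (pf_comp K (mfun M) F) (pf_comp K F (sfun S)) \<kappa> \<and>
           (\<forall>X\<in>Obj C. tob \<kappa> X = one K (pob (sfun S) X))) \<and>
      (\<forall>X\<in>Obj C. icells K (tob (munit M) X) (pmor F (sunit S X)) \<noteq> {}) \<and>
      (\<forall>X\<in>Obj C. icells K (tob (mmult M) X) (pmor F (smult S X)) \<noteq> {}))"

end

theory Submission
  imports Defs
begin

text \<open>
  By 2-naturality of \<open>S\<close> a morphism \<open>x : J X \<rightarrow> T S Y\<close> extends to \<open>t\<^sub>Y S x : J S X \<rightarrow> T S Y\<close>, where \<open>t\<^sub>Y\<close> is the
  lifted action on \<open>T\<close> of the free algebra \<open>S Y\<close>, and this is a pseudomorphism out of the free algebra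
  \<open>J S X\<close>. Hence \<open>x \<mapsto> (t\<^sub>Y S x)\<^sup>*\<close> makes \<open>R = T S\<close> a relative pseudomonad over \<open>J\<close>, with unit
  \<open>i\<^sub>S\<^sub>X e\<^sub>X\<close>; its structure 2-cells come from the pseudomorphism structures on \<open>f\<^sup>*\<close> and \<open>i\<close>, and its
  axioms from the 2-cells of \<open>T\<close> being algebra 2-cells.

  Since the extension operator of \<open>R\<close> factors as \<open>x \<mapsto> (x\<^sup>\<dagger>)\<^sup>*\<close> through a map \<open>J S X \<rightarrow> T S Y\<close>, the assignment
  \<open>f \<mapsto> S\<^sub>1 f = (e\<^sub>Y\<^sup>* f)\<^sup>\<dagger>\<close> is the action on morphisms of a pseudomonad on \<open>Kl T\<close>, with multiplication \<open>i\<^sub>S\<^sub>X\<^sup>\<dagger>\<close>. Each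
  axiom is an equation of 2-cells of \<open>D\<close>. The functor \<open>(-)\<^sup>*\<close> is faithful on 2-cells, and it turns such an
  equation into one between composites of 2-cells that are compatible with the free \<open>R\<close>-algebra
  structures. Those are determined by their restriction along \<open>e\<^sub>X\<^sup>* : T X \<rightarrow> T S X\<close>, where all structure
  2-cells become composites of structure 2-cells of \<open>T\<close> and of the comparison \<open>e\<^sub>Y\<^sup>* f\<^sup>* \<rightarrow> (S\<^sub>1 f)\<^sup>* e\<^sub>X\<^sup>*\<close>, and cancel.
\<close>

section \<open>Bicategories\<close>

text \<open>A Kleisli morphism f from X to Y ends in T Y, and Y is a mere object of C, so T Y
  carries no action of S. Hence f is first composed with e_Y^* into T S Y, which has one, and the
  lifting is evaluated at free algebras throughout. The price is that S_1 respects composition only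
  up to a 2-cell that involves the unit, and that coherence laws nest stars and daggers several
  levels deep. Such laws are not pasted by hand: every structure 2-cell exists in two forms, in
  Kl(T) and between composites of stars, and on the second form a uniqueness principle reduces
  coherence to interchange. One family \<open>omega X Y x\<close> plays two roles. At x = e_Y^* f it
  is naturality of the multiplication; at x = i it is associativity, because the multiplication is
  itself a dagger. Once S has produced R, the pseudomonad is built from T, R and the dagger alone,
  in the locale \<open>kleisli_extension\<close>. The comparison 2-cells of J enter only through F^T
  and its comparison with S_1.\<close>

lemma inverse_cells_sym: "inverse_cells B a b \<Longrightarrow> inverse_cells B b a"
  by (auto simp: inverse_cells_def cells_def)

context bicategory
begin

lemma inverse_cells_unique:
  assumes "inverse_cells B a b" "inverse_cells B a c" shows "b = c"
proof -
  have ab: "a \<in> Cel B" "b \<in> cells B (trg2 B a) (src2 B a)" "b \<cdot> a = idc B (src2 B a)"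
    and ac: "c \<in> cells B (trg2 B a) (src2 B a)" "a \<cdot> c = idc B (trg2 B a)"
    using assms by (auto simp: inverse_cells_def)
  have a: "a \<in> cells B (src2 B a) (trg2 B a)" using ab(1) by (simp add: cells_def)
  have "b = b \<cdot> (a \<cdot> c)" using vcmp_idc_right[OF ab(2)] ac(2) by simp
  also have "\<dots> = (b \<cdot> a) \<cdot> c" using vcmp_assoc[OF ac(1) a ab(2)] by simp
  also have "\<dots> = c" using vcmp_idc_left[OF ac(1)] ab(3) by simp
  finally show ?thesis .
qed

lemma inv2_eqI: "inverse_cells B a b \<Longrightarrow> inv2 B a = b"
  unfolding inv2_def using inverse_cells_unique by blast

lemma inverse_cells_inv2: "invertible B a \<Longrightarrow> inverse_cells B a (inv2 B a)"
  unfolding invertible_def using inv2_eqI by metis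

end

text \<open>
  The rules \<open>strict\<close> normalise pasting composites: whiskerings are distributed over \<open>\<cdot>\<close>, composites
  are associated to the right, and inverses cancel. Typing side conditions are solved by rewriting sources
  and targets; \<open>into1\<close> and \<open>into2\<close> keep the condition on the inner factor in a form that has one
  rewrite rule for each way of building that factor.
\<close>

named_theorems strict
named_theorems tydef

definition into1 :: "('o, 'm, 'c) bicat \<Rightarrow> 'm \<Rightarrow> 'o \<Rightarrow> bool" where
  [tydef]: "into1 B f X \<longleftrightarrow> f \<in> Mor B \<and> trg B f = X"

definition into2 :: "('o, 'm, 'c) bicat \<Rightarrow> 'c \<Rightarrow> 'm \<Rightarrow> bool" where
  [tydef]: "into2 B \<alpha> f \<longleftrightarrow> \<alpha> \<in> Cel B \<and> trg2 B \<alpha> = f"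

context bicategory
begin

lemma cmp_typ:
  assumes "g \<in> Mor B" "into1 B f (src B g)"
  shows cmp_Mor[strict]: "g \<odot> f \<in> Mor B" and src_cmp[strict]: "src B (g \<odot> f) = src B f"
    and trg_cmp[strict]: "trg B (g \<odot> f) = trg B g"
  using cmp_hom[of f "src B f" "trg B f" g "trg B g"] assms by (auto simp: hom_def tydef)

lemma into1_cmp[strict]: "\<lbrakk>g \<in> Mor B; into1 B f (src B g); trg B g = X\<rbrakk> \<Longrightarrow> into1 B (g \<odot> f) X"
  using cmp_typ[of g f] by (simp add: into1_def)

lemma one_typ:
  assumes "X \<in> Obj B"
  shows one_Mor[strict]: "one B X \<in> Mor B" and src_one[strict]: "src B (one B X) = X"
    and trg_one[strict]: "trg B (one B X) = X"
  using one_hom[OF assms] by (auto simp: hom_def)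

lemma into1I: "f \<in> Mor B \<Longrightarrow> trg B f = X \<Longrightarrow> into1 B f Y \<longleftrightarrow> X = Y"
  by (simp add: into1_def)

lemma into2I: "\<alpha> \<in> Cel B \<Longrightarrow> trg2 B \<alpha> = f \<Longrightarrow> into2 B \<alpha> g \<longleftrightarrow> f = g"
  by (simp add: into2_def)

lemmas [strict] = into1I[OF one_Mor trg_one]

lemma idc_typ:
  assumes "f \<in> Mor B"
  shows idc_Cel[strict]: "idc B f \<in> Cel B" and src2_idc[strict]: "src2 B (idc B f) = f"
    and trg2_idc[strict]: "trg2 B (idc B f) = f"
  using idc_cells[OF assms] by (auto simp: cells_def)

lemmas [strict] = into2I[OF idc_Cel trg2_idc]

lemma vcmp_typ:
  assumes "\<beta> \<in> Cel B" "into2 B \<alpha> (src2 B \<beta>)"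
  shows vcmp_Cel[strict]: "\<beta> \<cdot> \<alpha> \<in> Cel B" and src2_vcmp[strict]: "src2 B (\<beta> \<cdot> \<alpha>) = src2 B \<alpha>"
    and trg2_vcmp[strict]: "trg2 B (\<beta> \<cdot> \<alpha>) = trg2 B \<beta>"
  using vcmp_cells[of \<alpha> "src2 B \<alpha>" "trg2 B \<alpha>" \<beta> "trg2 B \<beta>"] assms by (auto simp: cells_def tydef)

lemma into2_vcmp[strict]: "\<lbrakk>\<beta> \<in> Cel B; into2 B \<alpha> (src2 B \<beta>); trg2 B \<beta> = f\<rbrakk> \<Longrightarrow> into2 B (\<beta> \<cdot> \<alpha>) f"
  using vcmp_typ[of \<beta> \<alpha>] by (simp add: into2_def)

lemma hcmp_typ:
  assumes "\<alpha> \<in> Cel B" "\<beta> \<in> Cel B" "src B (src2 B \<beta>) = trg B (src2 B \<alpha>)"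
  shows hcmp_Cel[strict]: "\<beta> \<star> \<alpha> \<in> Cel B" and src2_hcmp[strict]: "src2 B (\<beta> \<star> \<alpha>) = src2 B \<beta> \<odot> src2 B \<alpha>"
    and trg2_hcmp[strict]: "trg2 B (\<beta> \<star> \<alpha>) = trg2 B \<beta> \<odot> trg2 B \<alpha>"
  using hcmp_cells[of "src2 B \<alpha>" "src B (src2 B \<alpha>)" "trg B (src2 B \<alpha>)" "src2 B \<beta>" "trg B (src2 B \<beta>)"
      \<alpha> "trg2 B \<alpha>" \<beta> "trg2 B \<beta>"] assms src2_Mor by (auto simp: cells_def hom_def)

lemmas [strict] = into2I[OF hcmp_Cel trg2_hcmp]
lemmas [strict] = src_Obj trg_Obj src2_Mor trg2_Mor src_trg2 trg_trg2

lemma vassoc[strict]: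
  "\<lbrakk>\<gamma> \<in> Cel B; into2 B \<beta> (src2 B \<gamma>); into2 B \<alpha> (src2 B \<beta>)\<rbrakk>
   \<Longrightarrow> (\<gamma> \<cdot> \<beta>) \<cdot> \<alpha> = \<gamma> \<cdot> (\<beta> \<cdot> \<alpha>)"
  using vcmp_assoc[of \<alpha> "src2 B \<alpha>" "trg2 B \<alpha>" \<beta> "trg2 B \<beta>" \<gamma> "trg2 B \<gamma>"] by (simp add: cells_def into2_def)

lemma idc_vcmp[strict]: "into2 B \<alpha> f \<Longrightarrow> idc B f \<cdot> \<alpha> = \<alpha>"
  using vcmp_idc_left[of \<alpha> "src2 B \<alpha>" "trg2 B \<alpha>"] by (auto simp: cells_def into2_def)

lemma vcmp_idc[strict]: "\<alpha> \<in> Cel B \<Longrightarrow> src2 B \<alpha> = f \<Longrightarrow> \<alpha> \<cdot> idc B f = \<alpha>"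
  using vcmp_idc_right[of \<alpha> "src2 B \<alpha>" "trg2 B \<alpha>"] by (auto simp: cells_def)

lemma idc_hcmp_idc[strict]:
  "\<lbrakk>g \<in> Mor B; into1 B f (src B g)\<rbrakk> \<Longrightarrow> g \<rhd> idc B f = idc B (g \<odot> f)"
  using hcmp_idc[of f "src B f" "trg B f" g "trg B g"] by (simp add: hom_def into1_def)

lemma interch:
  assumes "\<alpha> \<in> Cel B" "\<alpha>' \<in> Cel B" "src2 B \<alpha>' = trg2 B \<alpha>" "\<beta> \<in> Cel B" "\<beta>' \<in> Cel B"
    "src2 B \<beta>' = trg2 B \<beta>" "src B (src2 B \<beta>) = trg B (src2 B \<alpha>)"
  shows "(\<beta>' \<cdot> \<beta>) \<star> (\<alpha>' \<cdot> \<alpha>) = (\<beta>' \<star> \<alpha>') \<cdot> (\<beta> \<star> \<alpha>)"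
  by (rule interchange[of "src2 B \<alpha>" "src B (src2 B \<alpha>)" "trg B (src2 B \<alpha>)" "src2 B \<beta>" "trg B (src2 B \<beta>)"])
    (use assms in \<open>auto simp: hom_def cells_def strict tydef\<close>)

lemma wl_vcmp[strict]:
  "\<lbrakk>\<beta> \<in> Cel B; into2 B \<alpha> (src2 B \<beta>); g \<in> Mor B; src B g = trg B (src2 B \<beta>)\<rbrakk>
   \<Longrightarrow> g \<rhd> (\<beta> \<cdot> \<alpha>) = (g \<rhd> \<beta>) \<cdot> (g \<rhd> \<alpha>)"
  using interch[of \<alpha> \<beta> "idc B g" "idc B g"] trg_trg2[of \<alpha>] by (simp add: strict tydef)

lemma wr_vcmp[strict]:
  "\<lbrakk>\<beta> \<in> Cel B; into2 B \<alpha> (src2 B \<beta>); g \<in> Mor B; src B (src2 B \<beta>) = trg B g\<rbrakk>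
   \<Longrightarrow> (\<beta> \<cdot> \<alpha>) \<lhd> g = (\<beta> \<lhd> g) \<cdot> (\<alpha> \<lhd> g)"
  using interch[of "idc B g" "idc B g" \<alpha> \<beta>] src_trg2[of \<alpha>] by (simp add: strict tydef)

lemma hcmp_left_first:
  "\<lbrakk>\<alpha> \<in> Cel B; \<beta> \<in> Cel B; src B (src2 B \<beta>) = trg B (src2 B \<alpha>)\<rbrakk>
   \<Longrightarrow> \<beta> \<star> \<alpha> = (\<beta> \<lhd> trg2 B \<alpha>) \<cdot> (src2 B \<beta> \<rhd> \<alpha>)"
  using interch[of \<alpha> "idc B (trg2 B \<alpha>)" "idc B (src2 B \<beta>)" \<beta>] by (simp add: strict tydef)

lemma hcmp_right_first:
  "\<lbrakk>\<alpha> \<in> Cel B; \<beta> \<in> Cel B; src B (src2 B \<beta>) = trg B (src2 B \<alpha>)\<rbrakk>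
   \<Longrightarrow> \<beta> \<star> \<alpha> = (trg2 B \<beta> \<rhd> \<alpha>) \<cdot> (\<beta> \<lhd> src2 B \<alpha>)"
  using interch[of "idc B (src2 B \<alpha>)" \<alpha> \<beta> "idc B (trg2 B \<beta>)"] by (simp add: strict tydef)

lemma slide:
  "\<lbrakk>\<alpha> \<in> Cel B; \<beta> \<in> Cel B; src B (src2 B \<beta>) = trg B (src2 B \<alpha>)\<rbrakk>
   \<Longrightarrow> (\<beta> \<lhd> trg2 B \<alpha>) \<cdot> (src2 B \<beta> \<rhd> \<alpha>) = (trg2 B \<beta> \<rhd> \<alpha>) \<cdot> (\<beta> \<lhd> src2 B \<alpha>)"
  using hcmp_left_first hcmp_right_first by metis

lemma inv2_typ:
  assumes "invertible B \<alpha>"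
  shows invertible_Cel: "\<alpha> \<in> Cel B" and inv2_Cel[strict]: "inv2 B \<alpha> \<in> Cel B"
    and src2_inv2[strict]: "src2 B (inv2 B \<alpha>) = trg2 B \<alpha>" and trg2_inv2[strict]: "trg2 B (inv2 B \<alpha>) = src2 B \<alpha>"
    and inv2_vcmp_self[strict]: "inv2 B \<alpha> \<cdot> \<alpha> = idc B (src2 B \<alpha>)" 
    and vcmp_inv2_self[strict]: "\<alpha> \<cdot> inv2 B \<alpha> = idc B (trg2 B \<alpha>)"
    and inv2_inv2[strict]: "inv2 B (inv2 B \<alpha>) = \<alpha>"
    and invertible_inv2[strict]: "invertible B (inv2 B \<alpha>)"
  using inverse_cells_inv2[OF assms] inv2_eqI[OF inverse_cells_sym]
  by (auto simp: inverse_cells_def cells_def invertible_def)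

lemmas [strict] = into2I[OF inv2_Cel trg2_inv2]

lemma inverse_cells_iff:
  "inverse_cells B \<alpha> \<beta> \<longleftrightarrow> \<alpha> \<in> Cel B \<and> \<beta> \<in> Cel B \<and> src2 B \<beta> = trg2 B \<alpha> \<and> trg2 B \<beta> = src2 B \<alpha> \<and>
     \<beta> \<cdot> \<alpha> = idc B (src2 B \<alpha>) \<and> \<alpha> \<cdot> \<beta> = idc B (trg2 B \<alpha>)"
  by (auto simp: inverse_cells_def cells_def)

lemma vcmp_inv2_self2[strict]:
  "\<lbrakk>invertible B \<alpha>; into2 B \<xi> (trg2 B \<alpha>)\<rbrakk> \<Longrightarrow> \<alpha> \<cdot> (inv2 B \<alpha> \<cdot> \<xi>) = \<xi>"
  using vassoc[of \<alpha> "inv2 B \<alpha>" \<xi>] by (simp add: strict tydef invertible_Cel del: vassoc)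

lemma inv2_vcmp_self2[strict]:
  "\<lbrakk>invertible B \<alpha>; into2 B \<xi> (src2 B \<alpha>)\<rbrakk> \<Longrightarrow> inv2 B \<alpha> \<cdot> (\<alpha> \<cdot> \<xi>) = \<xi>"
  using vassoc[of "inv2 B \<alpha>" \<alpha> \<xi>] by (simp add: strict tydef invertible_Cel del: vassoc)

lemma inverse_cells_intro: "inverse_cells B \<alpha> \<beta> \<Longrightarrow> invertible B \<alpha> \<and> inv2 B \<alpha> = \<beta>"
  using inv2_eqI by (auto simp: invertible_def)

lemma idc_inverse:
  assumes "f \<in> Mor B"
  shows invertible_idc[strict]: "invertible B (idc B f)" and inv2_idc[strict]: "inv2 B (idc B f) = idc B f"
  using inverse_cells_intro[of "idc B f" "idc B f"] assms by (simp_all add: inverse_cells_iff strict tydef)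

lemma vcmp_inverse:
  assumes "invertible B \<beta>" "invertible B \<alpha>" "src2 B \<beta> = trg2 B \<alpha>"
  shows invertible_vcmp[strict]: "invertible B (\<beta> \<cdot> \<alpha>)" and inv2_vcmp[strict]: "inv2 B (\<beta> \<cdot> \<alpha>) = inv2 B \<alpha> \<cdot> inv2 B \<beta>"
  using inverse_cells_intro[of "\<beta> \<cdot> \<alpha>" "inv2 B \<alpha> \<cdot> inv2 B \<beta>"] assms invertible_Cel by (simp_all add: inverse_cells_iff strict tydef)

lemma hcmp_inverse:
  assumes "invertible B \<alpha>" "invertible B \<beta>" "src B (src2 B \<beta>) = trg B (src2 B \<alpha>)"
  shows invertible_hcmp[strict]: "invertible B (\<beta> \<star> \<alpha>)" and inv2_hcmp[strict]: "inv2 B (\<beta> \<star> \<alpha>) = inv2 B \<beta> \<star> inv2 B \<alpha>"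
proof -
  have "inverse_cells B (\<beta> \<star> \<alpha>) (inv2 B \<beta> \<star> inv2 B \<alpha>)"
    using assms invertible_Cel interch[of \<alpha> "inv2 B \<alpha>" \<beta> "inv2 B \<beta>"] interch[of "inv2 B \<alpha>" \<alpha> "inv2 B \<beta>" \<beta>]
    by (simp add: inverse_cells_iff strict tydef)
  then show "invertible B (\<beta> \<star> \<alpha>)" "inv2 B (\<beta> \<star> \<alpha>) = inv2 B \<beta> \<star> inv2 B \<alpha>" using inverse_cells_intro by blast+
qed

context
  fixes \<alpha> f assumes A: "invertible B \<alpha>" "f \<in> Mor B"
begin

lemma wl_cancel:
  assumes "src B f = trg B (src2 B \<alpha>)"
  shows [strict]: "(f \<rhd> \<alpha>) \<cdot> (f \<rhd> inv2 B \<alpha>) = idc B (f \<odot> trg2 B \<alpha>)"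
    and [strict]: "(f \<rhd> inv2 B \<alpha>) \<cdot> (f \<rhd> \<alpha>) = idc B (f \<odot> src2 B \<alpha>)"
  using assms A invertible_Cel by (simp_all flip: wl_vcmp add: strict tydef)

lemma wr_cancel:
  assumes "src B (src2 B \<alpha>) = trg B f"
  shows [strict]: "(\<alpha> \<lhd> f) \<cdot> (inv2 B \<alpha> \<lhd> f) = idc B (trg2 B \<alpha> \<odot> f)"
    and [strict]: "(inv2 B \<alpha> \<lhd> f) \<cdot> (\<alpha> \<lhd> f) = idc B (src2 B \<alpha> \<odot> f)"
  using assms A invertible_Cel by (simp_all flip: wr_vcmp add: strict tydef)

lemma wl_cancel2:
  assumes "src B f = trg B (src2 B \<alpha>)"
  shows [strict]: "into2 B \<xi> (f \<odot> trg2 B \<alpha>) \<Longrightarrow> (f \<rhd> \<alpha>) \<cdot> ((f \<rhd> inv2 B \<alpha>) \<cdot> \<xi>) = \<xi>"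
    and [strict]: "into2 B \<xi> (f \<odot> src2 B \<alpha>) \<Longrightarrow> (f \<rhd> inv2 B \<alpha>) \<cdot> ((f \<rhd> \<alpha>) \<cdot> \<xi>) = \<xi>"
  using assms A invertible_Cel by (simp_all flip: vassoc add: strict tydef)

lemma wr_cancel2:
  assumes "src B (src2 B \<alpha>) = trg B f"
  shows [strict]: "into2 B \<xi> (trg2 B \<alpha> \<odot> f) \<Longrightarrow> (\<alpha> \<lhd> f) \<cdot> ((inv2 B \<alpha> \<lhd> f) \<cdot> \<xi>) = \<xi>"
    and [strict]: "into2 B \<xi> (src2 B \<alpha> \<odot> f) \<Longrightarrow> (inv2 B \<alpha> \<lhd> f) \<cdot> ((\<alpha> \<lhd> f) \<cdot> \<xi>) = \<xi>"
  using assms A invertible_Cel by (simp_all flip: vassoc add: strict tydef)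

lemma wlr_cancel:
  assumes "src B f = trg B (src2 B \<alpha>)" "src B (src2 B \<alpha>) = trg B g" "g \<in> Mor B"
  shows [strict]: "(f \<rhd> \<alpha> \<lhd> g) \<cdot> (f \<rhd> inv2 B \<alpha> \<lhd> g) = idc B (f \<odot> trg2 B \<alpha> \<odot> g)"
    and [strict]: "(f \<rhd> inv2 B \<alpha> \<lhd> g) \<cdot> (f \<rhd> \<alpha> \<lhd> g) = idc B (f \<odot> src2 B \<alpha> \<odot> g)"
  using assms A invertible_Cel by (simp_all flip: wl_vcmp wr_vcmp add: strict tydef)

lemma wlr_cancel2:
  assumes "src B f = trg B (src2 B \<alpha>)" "src B (src2 B \<alpha>) = trg B g" "g \<in> Mor B"
  shows [strict]: "into2 B \<xi> (f \<odot> trg2 B \<alpha> \<odot> g) \<Longrightarrow>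
      (f \<rhd> \<alpha> \<lhd> g) \<cdot> ((f \<rhd> inv2 B \<alpha> \<lhd> g) \<cdot> \<xi>) = \<xi>"
    and [strict]: "into2 B \<xi> (f \<odot> src2 B \<alpha> \<odot> g) \<Longrightarrow>
      (f \<rhd> inv2 B \<alpha> \<lhd> g) \<cdot> ((f \<rhd> \<alpha> \<lhd> g) \<cdot> \<xi>) = \<xi>"
  using assms A invertible_Cel by (simp_all flip: vassoc add: strict tydef)

end

lemma cancel_right:
  assumes "invertible B \<gamma>" "\<alpha> \<cdot> \<gamma> = \<beta> \<cdot> \<gamma>" "\<alpha> \<in> Cel B" "\<beta> \<in> Cel B"
    "src2 B \<alpha> = trg2 B \<gamma>" "src2 B \<beta> = trg2 B \<gamma>"
  shows "\<alpha> = \<beta>"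
proof -
  have "(\<alpha> \<cdot> \<gamma>) \<cdot> inv2 B \<gamma> = (\<beta> \<cdot> \<gamma>) \<cdot> inv2 B \<gamma>" using assms by simp
  then show ?thesis using assms(1,3-) invertible_Cel by (simp add: strict tydef)
qed

lemma cancel_left:
  assumes "invertible B \<gamma>" "\<gamma> \<cdot> \<alpha> = \<gamma> \<cdot> \<beta>" "\<alpha> \<in> Cel B" "\<beta> \<in> Cel B"
    "trg2 B \<alpha> = src2 B \<gamma>" "trg2 B \<beta> = src2 B \<gamma>"
  shows "\<alpha> = \<beta>"
proof -
  have "inv2 B \<gamma> \<cdot> (\<gamma> \<cdot> \<alpha>) = inv2 B \<gamma> \<cdot> (\<gamma> \<cdot> \<beta>)" using assms by simp
  then show ?thesis using assms(1,3-) by (simp add: strict tydef)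
qed

text \<open>Used in the form \<open>eq[THEN vcmp_extend]\<close>, it lets an equation between
  composites of two 2-cells rewrite the middle of a chain associated to the right.\<close>

lemma vcmp_extend:
  assumes "\<beta> \<cdot> \<alpha> = \<delta> \<cdot> \<gamma>" "\<alpha> \<in> Cel B" "\<beta> \<in> Cel B" "\<gamma> \<in> Cel B" "\<delta> \<in> Cel B" "\<xi> \<in> Cel B"
    "src2 B \<beta> = trg2 B \<alpha>" "src2 B \<delta> = trg2 B \<gamma>" "src2 B \<alpha> = trg2 B \<xi>" "src2 B \<gamma> = trg2 B \<xi>"
  shows "\<beta> \<cdot> (\<alpha> \<cdot> \<xi>) = \<delta> \<cdot> (\<gamma> \<cdot> \<xi>)"
  using assms by (simp add: tydef flip: vassoc)

end

section \<open>Strict composition in a 2-category\<close>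

context two_category
begin

text \<open>The associator is an identity 2-cell, so its source and target coincide. The unit laws
  below follow in the same way.\<close>

lemma cmp_assoc[strict]:
  assumes "h \<in> Mor B" "into1 B g (src B h)" "into1 B f (src B g)"
  shows "(h \<odot> g) \<odot> f = h \<odot> (g \<odot> f)"
proof -
  note assms = assms[unfolded into1_def]
  have *: "f \<in> hom B (src B f) (trg B f)" "g \<in> hom B (trg B f) (trg B g)" "h \<in> hom B (trg B g) (trg B h)"
    using assms by (auto simp: hom_def)
  have "assoc B h g f \<in> cells B ((h \<odot> g) \<odot> f) (h \<odot> g \<odot> f)"
    using assoc_icells[OF *] by (simp add: icells_def)
  then have "src2 B (idc B (h \<odot> g \<odot> f)) = (h \<odot> g) \<odot> f" using assoc_idc[OF *] by (simp add: cells_def)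
  then show ?thesis using assms by (simp add: strict tydef)
qed

lemma one_cmp[strict]: "into1 B f X \<Longrightarrow> one B X \<odot> f = f"
  using lunit_icells[of f "src B f" "trg B f"] lunit_idc[of f] idc_typ[of f]
  by (auto simp: into1_def hom_def icells_def cells_def)

lemma cmp_one[strict]: "f \<in> Mor B \<Longrightarrow> src B f = X \<Longrightarrow> f \<odot> one B X = f"
  using runit_icells[of f "src B f" "trg B f"] runit_idc[of f] idc_typ[of f]
  by (simp add: hom_def icells_def cells_def)

text \<open>Naturality of the associator, whose components are identities.\<close>

lemma hassoc[strict]:
  assumes "\<alpha> \<in> Cel B" "\<beta> \<in> Cel B" "\<gamma> \<in> Cel B" "src B (src2 B \<beta>) = trg B (src2 B \<alpha>)"
    "src B (src2 B \<gamma>) = trg B (src2 B \<beta>)"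
  shows "(\<gamma> \<star> \<beta>) \<star> \<alpha> = \<gamma> \<star> (\<beta> \<star> \<alpha>)"
proof -
  have h1: "src2 B \<alpha> \<in> hom B (src B (src2 B \<alpha>)) (trg B (src2 B \<alpha>))"
       "src2 B \<beta> \<in> hom B (trg B (src2 B \<alpha>)) (trg B (src2 B \<beta>))"
       "src2 B \<gamma> \<in> hom B (trg B (src2 B \<beta>)) (trg B (src2 B \<gamma>))"
    and h2: "trg2 B \<alpha> \<in> hom B (src B (src2 B \<alpha>)) (trg B (src2 B \<alpha>))"
       "trg2 B \<beta> \<in> hom B (trg B (src2 B \<alpha>)) (trg B (src2 B \<beta>))"
       "trg2 B \<gamma> \<in> hom B (trg B (src2 B \<beta>)) (trg B (src2 B \<gamma>))"
    using assms by (auto simp: hom_def strict tydef)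
  have "assoc B (trg2 B \<gamma>) (trg2 B \<beta>) (trg2 B \<alpha>) \<cdot> ((\<gamma> \<star> \<beta>) \<star> \<alpha>)
      = (\<gamma> \<star> (\<beta> \<star> \<alpha>)) \<cdot> assoc B (src2 B \<gamma>) (src2 B \<beta>) (src2 B \<alpha>)"
    using assoc_natural[OF h1, of \<alpha> _ \<beta> _ \<gamma>] assms by (simp add: cells_def)
  then show ?thesis using assms by (simp add: assoc_idc[OF h1] assoc_idc[OF h2] strict tydef)
qed

lemma one_hcmp[strict]: "\<alpha> \<in> Cel B \<Longrightarrow> trg B (src2 B \<alpha>) = X \<Longrightarrow> one B X \<rhd> \<alpha> = \<alpha>"
  using lunit_natural[of "src2 B \<alpha>" "src B (src2 B \<alpha>)" "trg B (src2 B \<alpha>)" \<alpha> "trg2 B \<alpha>"]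
  by (auto simp: hom_def cells_def lunit_idc strict tydef)

lemma hcmp_one[strict]: "\<alpha> \<in> Cel B \<Longrightarrow> src B (src2 B \<alpha>) = X \<Longrightarrow> \<alpha> \<lhd> one B X = \<alpha>"
  using runit_natural[of "src2 B \<alpha>" "src B (src2 B \<alpha>)" "trg B (src2 B \<alpha>)" \<alpha> "trg2 B \<alpha>"]
  by (auto simp: hom_def cells_def runit_idc strict tydef)

lemma idc_hcmp_hcmp[strict]:
  "\<lbrakk>\<alpha> \<in> Cel B; h \<in> Mor B; g \<in> Mor B; src B h = trg B (src2 B \<alpha>); src B g = trg B h\<rbrakk>
   \<Longrightarrow> g \<rhd> (h \<rhd> \<alpha>) = g \<odot> h \<rhd> \<alpha>"
  using hassoc[of \<alpha> "idc B h" "idc B g"] by (simp add: strict tydef)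

end

section \<open>Relative pseudomonads and the Kleisli bicategory\<close>

context relative_pseudomonad
begin

abbreviation "st \<equiv> star T"
abbreviation "st2 \<equiv> star2 T"
abbreviation "ti \<equiv> Ti T"
abbreviation "mu \<equiv> Tmu T"
abbreviation "eta \<equiv> Teta T"
abbreviation "th \<equiv> Ttheta T"

text \<open>
  The bicategories \<open>Kl T\<close> and \<open>D\<close> share their 2-cells, so calculations in \<open>Kl T\<close> take place in \<open>D\<close>,
  where composition of morphisms is strict.
\<close>

definition kl :: "'oc \<Rightarrow> 'oc \<Rightarrow> 'md \<Rightarrow> bool" where
  [tydef]: "kl X Y f \<longleftrightarrow> X \<in> Obj C \<and> Y \<in> Obj C \<and> f \<in> Mor D \<and> src D f = pob J X \<and> trg D f = Tob T Y"

text \<open>Typing the source suffices: the target is parallel to it, as \<open>kl2D\<close>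
  records.\<close>

abbreviation "kl2 X Y \<alpha> \<equiv> kl X Y (src2 D \<alpha>) \<and> \<alpha> \<in> Cel D"

lemma klD: "kl X Y f \<Longrightarrow> X \<in> Obj C \<and> Y \<in> Obj C \<and> f \<in> Mor D \<and> src D f = pob J X \<and> trg D f = Tob T Y \<and> into1 D f (Tob T Y)"
  by (simp add: tydef)

lemma kl2D: "kl2 X Y \<alpha> \<Longrightarrow> kl X Y (trg2 D \<alpha>) \<and> src2 D \<alpha> \<in> Mor D \<and> trg2 D \<alpha> \<in> Mor D \<and>
    X \<in> Obj C \<and> Y \<in> Obj C \<and> src D (src2 D \<alpha>) = pob J X \<and> trg D (src2 D \<alpha>) = Tob T Y \<and>
    src D (trg2 D \<alpha>) = pob J X \<and> trg D (trg2 D \<alpha>) = Tob T Y \<and>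
    into1 D (src2 D \<alpha>) (Tob T Y) \<and> into1 D (trg2 D \<alpha>) (Tob T Y) \<and> into2 D \<alpha> (trg2 D \<alpha>)"
  by (simp add: tydef strict)

lemma khom_iff: "f \<in> khom D J T X Y \<longleftrightarrow> f \<in> Mor D \<and> src D f = pob J X \<and> trg D f = Tob T Y"
  by (auto simp: khom_def hom_def)

lemma cells_iff: "\<alpha> \<in> cells D f g \<longleftrightarrow> \<alpha> \<in> Cel D \<and> src2 D \<alpha> = f \<and> trg2 D \<alpha> = g"
  by (auto simp: cells_def)

lemmas [strict] = J.pob_Obj Tob_Obj

lemma st_typ:
  assumes "kl X Y f"
  shows st_Mor[strict]: "st X Y f \<in> Mor D" and src_st[strict]: "src D (st X Y f) = Tob T X"
    and trg_st[strict]: "trg D (st X Y f) = Tob T Y"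
  using star_hom[of X Y f] assms by (auto simp: khom_iff hom_def tydef)

lemmas [strict] = D.into1I[OF st_Mor trg_st]

lemma ti_typ:
  assumes "X \<in> Obj C"
  shows ti_Mor[strict]: "ti X \<in> Mor D" and src_ti[strict]: "src D (ti X) = pob J X" and trg_ti[strict]: "trg D (ti X) = Tob T X"
  using Ti_khom[OF assms] by (auto simp: khom_iff tydef)

lemmas [strict] = D.into1I[OF ti_Mor trg_ti]

lemma kl_ti[strict]: "X \<in> Obj C \<Longrightarrow> kl X X (ti X)"
  by (simp add: strict tydef)

lemma kl_cmp[strict]: "kl Y Z g \<Longrightarrow> kl X Y f \<Longrightarrow> kl X Z (st Y Z g \<odot> f)"
  by (simp add: strict tydef)

lemma st2_typ:
  assumes "kl2 X Y \<alpha>"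
  shows st2_Cel[strict]: "st2 X Y \<alpha> \<in> Cel D" and src2_st2[strict]: "src2 D (st2 X Y \<alpha>) = st X Y (src2 D \<alpha>)"
    and trg2_st2[strict]: "trg2 D (st2 X Y \<alpha>) = st X Y (trg2 D \<alpha>)"
  using star2_cells[of X Y "src2 D \<alpha>" \<alpha> "trg2 D \<alpha>"] assms by (auto simp: khom_iff cells_iff strict tydef)

lemmas [strict] = D.into2I[OF st2_Cel trg2_st2]

lemma mu_typ:
  assumes "kl X Y f" "kl Y Z g"
  shows mu_Cel[strict]: "mu X Y Z g f \<in> Cel D" and src2_mu[strict]: "src2 D (mu X Y Z g f) = st X Z (st Y Z g \<odot> f)"
    and trg2_mu[strict]: "trg2 D (mu X Y Z g f) = st Y Z g \<odot> st X Y f" and invertible_mu[strict]: "invertible D (mu X Y Z g f)"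
  using Tmu_icells[of X Y Z f g] assms by (auto simp: khom_iff cells_iff icells_def tydef)

lemmas [strict] = D.into2I[OF mu_Cel trg2_mu]

lemma eta_typ:
  assumes "kl X Y f"
  shows eta_Cel[strict]: "eta X Y f \<in> Cel D" and src2_eta[strict]: "src2 D (eta X Y f) = f"
    and trg2_eta[strict]: "trg2 D (eta X Y f) = st X Y f \<odot> ti X" and invertible_eta[strict]: "invertible D (eta X Y f)"
  using Teta_icells[of X Y f] assms by (auto simp: khom_iff cells_iff icells_def tydef)

lemmas [strict] = D.into2I[OF eta_Cel trg2_eta]

lemma th_typ:
  assumes "X \<in> Obj C"
  shows th_Cel[strict]: "th X \<in> Cel D" and src2_th[strict]: "src2 D (th X) = st X X (ti X)"
    and trg2_th[strict]: "trg2 D (th X) = one D (Tob T X)" and invertible_th[strict]: "invertible D (th X)"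
  using Ttheta_icells[of X] assms by (auto simp: cells_iff icells_def)

lemmas [strict] = D.into2I[OF th_Cel trg2_th]

lemma st2_idc[strict]: "kl X Y f \<Longrightarrow> st2 X Y (idc D f) = idc D (st X Y f)"
  using star2_idc by (simp add: khom_iff tydef)

lemma st2_vcmp[strict]:
  "\<lbrakk>\<beta> \<in> Cel D; into2 D \<alpha> (src2 D \<beta>); kl X Y (src2 D \<beta>)\<rbrakk> \<Longrightarrow> st2 X Y (\<beta> \<cdot> \<alpha>) = st2 X Y \<beta> \<cdot> st2 X Y \<alpha>"
  using star2_vcmp[of X Y "src2 D \<alpha>" \<alpha> "trg2 D \<alpha>" \<beta> "trg2 D \<beta>"] D.src_trg2[of \<alpha>] D.trg_trg2[of \<alpha>] D.src2_Mor[of \<alpha>] by (simp add: khom_iff cells_iff tydef)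

lemma st2_inverse:
  assumes "invertible D \<alpha>" "kl X Y (src2 D \<alpha>)"
  shows invertible_st2[strict]: "invertible D (st2 X Y \<alpha>)" and st2_inv2[strict]: "st2 X Y (inv2 D \<alpha>) = inv2 D (st2 X Y \<alpha>)"
proof -
  have a: "\<alpha> \<in> Cel D" using assms(1) by (rule D.invertible_Cel)
  have "inverse_cells D (st2 X Y \<alpha>) (st2 X Y (inv2 D \<alpha>))"
    using assms a by (simp add: D.inverse_cells_iff strict tydef flip: st2_vcmp)
  then show "invertible D (st2 X Y \<alpha>)" "st2 X Y (inv2 D \<alpha>) = inv2 D (st2 X Y \<alpha>)"
    using D.inverse_cells_intro by metis+
qed

lemma mu_natural:
  assumes "kl2 X Y \<alpha>" "kl2 Y Z \<beta>"
  shows "mu X Y Z (trg2 D \<beta>) (trg2 D \<alpha>) \<cdot> st2 X Z (st2 Y Z \<beta> \<star> \<alpha>) =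
    (st2 Y Z \<beta> \<star> st2 X Y \<alpha>) \<cdot> mu X Y Z (src2 D \<beta>) (src2 D \<alpha>)"
  using Tmu_natural[of X Y Z "src2 D \<alpha>" "src2 D \<beta>" \<alpha> "trg2 D \<alpha>" \<beta> "trg2 D \<beta>"] assms
  by (simp add: khom_iff cells_iff strict tydef)

lemma mu_natural_left:
  assumes "kl2 Y Z \<beta>" "kl X Y f"
  shows "mu X Y Z (trg2 D \<beta>) f \<cdot> st2 X Z (st2 Y Z \<beta> \<lhd> f) =
    (st2 Y Z \<beta> \<lhd> st X Y f) \<cdot> mu X Y Z (src2 D \<beta>) f"
  using mu_natural[of X Y "idc D f" Z \<beta>] assms by (simp add: strict tydef)

lemma mu_natural_right:
  assumes "kl Y Z g" "kl2 X Y \<alpha>"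
  shows "mu X Y Z g (trg2 D \<alpha>) \<cdot> st2 X Z (st Y Z g \<rhd> \<alpha>) =
    (st Y Z g \<rhd> st2 X Y \<alpha>) \<cdot> mu X Y Z g (src2 D \<alpha>)"
  using mu_natural[of X Y \<alpha> Z "idc D g"] assms by (simp add: strict tydef)

lemma eta_natural:
  assumes "kl2 X Y \<alpha>"
  shows "eta X Y (trg2 D \<alpha>) \<cdot> \<alpha> = (st2 X Y \<alpha> \<lhd> ti X) \<cdot> eta X Y (src2 D \<alpha>)"
  using Teta_natural[of X Y "src2 D \<alpha>" \<alpha> "trg2 D \<alpha>"] assms by (simp add: khom_iff cells_iff strict tydef)

lemma mu_coherence:
  assumes "kl X Y f" "kl Y Z g" "kl Z V h"
  shows "(st Z V h \<rhd> mu X Y Z g f) \<cdot> mu X Z V h (st Y Z g \<odot> f) \<cdot> st2 X V (mu Y Z V h g \<lhd> f)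
     = (mu Y Z V h g \<lhd> st X Y f) \<cdot> mu X Y V (st Z V h \<odot> g) f"
  using Tmu_coherence[of X Y Z V f g h] assms by (simp add: khom_iff tydef)

lemma eta_coherence:
  assumes "kl X Y f"
  shows "(st X Y f \<rhd> th X) \<cdot> mu X X Y f (ti X) \<cdot> st2 X Y (eta X Y f) = idc D (st X Y f)"
  using Teta_coherence[of X Y f] assms by (simp add: khom_iff tydef)

text \<open>Naturality of \<open>eta\<close> recovers \<alpha> from \<open>st2 X Y \<alpha>\<close>
  whiskered by \<open>ti X\<close>, since \<open>eta\<close> is invertible.\<close>

lemma st2_faithful:
  assumes "kl2 X Y \<alpha>" "\<beta> \<in> Cel D" "src2 D \<beta> = src2 D \<alpha>" "trg2 D \<beta> = trg2 D \<alpha>" "st2 X Y \<alpha> = st2 X Y \<beta>"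
  shows "\<alpha> = \<beta>"
proof (rule D.cancel_left)
  show "eta X Y (trg2 D \<alpha>) \<cdot> \<alpha> = eta X Y (trg2 D \<alpha>) \<cdot> \<beta>"
    using eta_natural[of X Y \<alpha>] eta_natural[of X Y \<beta>] assms by simp
qed (use assms in \<open>simp_all add: strict tydef\<close>)

text \<open>By way of \<open>th X\<close>, whiskering with \<open>st X X (ti X)\<close> is
  isomorphic to doing nothing.\<close>

lemma st_ti_faithful:
  assumes "X \<in> Obj C" "\<alpha> \<in> Cel D" "\<beta> \<in> Cel D" "src2 D \<beta> = src2 D \<alpha>" "trg2 D \<beta> = trg2 D \<alpha>"
    "trg D (src2 D \<alpha>) = Tob T X"
    "st X X (ti X) \<rhd> \<alpha> = st X X (ti X) \<rhd> \<beta>"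
  shows "\<alpha> = \<beta>"
proof (rule D.cancel_right)
  show "invertible D (th X \<lhd> src2 D \<alpha>)" using assms by (simp add: strict tydef)
  show "\<alpha> \<cdot> (th X \<lhd> src2 D \<alpha>) = \<beta> \<cdot> (th X \<lhd> src2 D \<alpha>)"
    using D.slide[of \<alpha> "th X"] D.slide[of \<beta> "th X"] assms by (simp add: strict tydef)
qed (use assms in \<open>simp_all add: strict tydef\<close>)

text \<open>
  This law and the unit laws \<open>mu_eta\<close>, \<open>th_eta\<close> are not among the axioms; they follow like Kelly's redundant
  axioms of a monoidal category.
\<close>

lemma st_th:
  assumes "kl X Y f"
  shows "st2 X Y (th Y \<lhd> f) = (th Y \<lhd> st X Y f) \<cdot> mu X Y Y (ti Y) f"
proof -
  let ?i = "ti Y" and ?e = "st2 X Y (st2 Y Y (eta Y Y (ti Y)) \<lhd> f)"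
  let ?m = "st2 X Y (mu Y Y Y ?i ?i \<lhd> f)" and ?I = "st Y Y (ti Y)"
  have K: "(?I \<rhd> th Y) \<cdot> mu Y Y Y ?i ?i \<cdot> st2 Y Y (eta Y Y ?i) = idc D ?I"
    using assms by (intro eta_coherence) (simp add: strict tydef)
  have K1: "st2 X Y (?I \<rhd> th Y \<lhd> f) \<cdot> ?m \<cdot> ?e = idc D (st X Y (?I \<odot> f))"
    using arg_cong[OF K, of "\<lambda>z. st2 X Y (z \<lhd> f)"] assms by (simp add: strict tydef)
  have K2: "(?I \<rhd> th Y \<lhd> st X Y f) \<cdot> (mu Y Y Y ?i ?i \<lhd> st X Y f) \<cdot> (st2 Y Y (eta Y Y ?i) \<lhd> st X Y f)
      = idc D (?I \<odot> st X Y f)"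
    using arg_cong[OF K, of "\<lambda>z. z \<lhd> st X Y f"] assms by (simp add: strict tydef)
  \<comment> \<open>The equation is first whiskered with \<open>?I\<close> and precomposed with an
    invertible 2-cell. In this form associativity of \<open>mu\<close> with \<open>ti Y\<close> in
    both outer places and the unit axiom at \<open>ti Y\<close> apply; both additions are cancelled
    at the end.\<close>
  have "(?I \<rhd> st2 X Y (th Y \<lhd> f)) \<cdot> (mu X Y Y ?i (?I \<odot> f) \<cdot> ?m \<cdot> ?e)
     = ((?I \<rhd> st2 X Y (th Y \<lhd> f)) \<cdot> mu X Y Y ?i (?I \<odot> f)) \<cdot> ?m \<cdot> ?e"
    using assms by (simp add: strict tydef)
  also have "\<dots> = (mu X Y Y ?i f \<cdot> st2 X Y (?I \<rhd> th Y \<lhd> f)) \<cdot> ?m \<cdot> ?e"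
    using mu_natural_right[of Y Y ?i X "th Y \<lhd> f"] assms by (simp add: strict tydef)
  also have "\<dots> = mu X Y Y ?i f \<cdot> (st2 X Y (?I \<rhd> th Y \<lhd> f) \<cdot> ?m \<cdot> ?e)"
    using assms by (simp add: strict tydef)
  also have "\<dots> = mu X Y Y ?i f" using K1 assms by (simp add: strict tydef)
  also have "\<dots> = ((?I \<rhd> th Y \<lhd> st X Y f) \<cdot> (mu Y Y Y ?i ?i \<lhd> st X Y f) \<cdot> (st2 Y Y (eta Y Y ?i) \<lhd> st X Y f)) \<cdot> mu X Y Y ?i f"
    using K2 assms by (simp add: strict tydef)
  also have "\<dots> = (?I \<rhd> th Y \<lhd> st X Y f) \<cdot> (mu Y Y Y ?i ?i \<lhd> st X Y f) \<cdot> (mu X Y Y (?I \<odot> ?i) f \<cdot> ?e)"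
    using mu_natural_left[of Y Y "eta Y Y ?i" X f] assms by (simp add: strict tydef)
  also have "\<dots> = (?I \<rhd> th Y \<lhd> st X Y f) \<cdot> ((mu Y Y Y ?i ?i \<lhd> st X Y f) \<cdot> mu X Y Y (?I \<odot> ?i) f) \<cdot> ?e"
    using assms by (simp add: strict tydef)
  also have "\<dots> = (?I \<rhd> ((th Y \<lhd> st X Y f) \<cdot> mu X Y Y ?i f)) \<cdot> (mu X Y Y ?i (?I \<odot> f) \<cdot> ?m \<cdot> ?e)"
    using mu_coherence[of X Y f Y ?i Y ?i, symmetric] assms by (simp add: strict tydef)
  finally have *: "(?I \<rhd> st2 X Y (th Y \<lhd> f)) \<cdot> (mu X Y Y ?i (?I \<odot> f) \<cdot> ?m \<cdot> ?e) = \<dots>" .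
  have "?I \<rhd> st2 X Y (th Y \<lhd> f) = ?I \<rhd> ((th Y \<lhd> st X Y f) \<cdot> mu X Y Y ?i f)"
    by (rule D.cancel_right[OF _ *]) (use assms in \<open>simp_all add: strict tydef\<close>)
  then show ?thesis by (rule st_ti_faithful[of Y, rotated 6]) (use assms in \<open>simp_all add: strict tydef\<close>)
qed

text \<open>
  The rules \<open>flat\<close> move \<open>(-)\<^sup>*\<close> inwards, up to conjugation with \<open>\<mu>\<close>, until it only meets generating
  2-cells.
\<close>

named_theorems flat

lemma st2_wr[flat]:
  assumes "kl2 Y Z \<beta>" "kl X Y f"
  shows "st2 X Z (st2 Y Z \<beta> \<lhd> f) =
    inv2 D (mu X Y Z (trg2 D \<beta>) f) \<cdot> (st2 Y Z \<beta> \<lhd> st X Y f) \<cdot> mu X Y Z (src2 D \<beta>) f"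
  by (subst mu_natural_left[OF assms, symmetric]) (use assms in \<open>simp add: strict tydef\<close>)

lemma st2_wl[flat]:
  assumes "kl Y Z g" "kl2 X Y \<alpha>"
  shows "st2 X Z (st Y Z g \<rhd> \<alpha>) =
    inv2 D (mu X Y Z g (trg2 D \<alpha>)) \<cdot> (st Y Z g \<rhd> st2 X Y \<alpha>) \<cdot> mu X Y Z g (src2 D \<alpha>)"
  by (subst mu_natural_right[OF assms, symmetric]) (use assms in \<open>simp add: strict tydef\<close>)

lemma st2_mu[flat]:
  assumes "kl X Y f" "kl Y Z g" "kl Z V h"
  shows "st2 X V (mu Y Z V h g \<lhd> f) =
    inv2 D (mu X Z V h (st Y Z g \<odot> f)) \<cdot> (st Z V h \<rhd> inv2 D (mu X Y Z g f)) \<cdot>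
    (mu Y Z V h g \<lhd> st X Y f) \<cdot> mu X Y V (st Z V h \<odot> g) f"
  by (subst mu_coherence[OF assms, symmetric]) (use assms in \<open>simp add: strict tydef\<close>)

lemma st2_inv_mu[flat]:
  assumes "kl X Y f" "kl Y Z g" "kl Z V h"
  shows "st2 X V (inv2 D (mu Y Z V h g) \<lhd> f) =
    inv2 D (mu X Y V (st Z V h \<odot> g) f) \<cdot> (inv2 D (mu Y Z V h g) \<lhd> st X Y f) \<cdot>
    (st Z V h \<rhd> mu X Y Z g f) \<cdot> mu X Z V h (st Y Z g \<odot> f)"
proof -
  have "st2 X V (inv2 D (mu Y Z V h g \<lhd> f)) = inv2 D (st2 X V (mu Y Z V h g \<lhd> f))"
    using assms by (intro st2_inv2) (simp_all add: strict tydef)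
  then show ?thesis using assms by (simp add: strict tydef st2_mu)
qed

lemmas [flat] = st_th

lemma st2_inv_th[flat]:
  assumes "kl X Y f"
  shows "st2 X Y (inv2 D (th Y) \<lhd> f) = inv2 D (mu X Y Y (ti Y) f) \<cdot> (inv2 D (th Y) \<lhd> st X Y f)"
proof -
  have "st2 X Y (inv2 D (th Y \<lhd> f)) = inv2 D (st2 X Y (th Y \<lhd> f))"
    using assms by (intro st2_inv2) (simp_all add: strict tydef)
  then show ?thesis using assms by (simp add: strict tydef st_th)
qed

lemma st2_eta[flat]:
  assumes "kl X Y f"
  shows "st2 X Y (eta X Y f) = inv2 D (mu X X Y f (ti X)) \<cdot> (st X Y f \<rhd> inv2 D (th X))"
proof -
  have "(inv2 D (mu X X Y f (ti X)) \<cdot> (st X Y f \<rhd> inv2 D (th X))) \<cdot>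
     (st X Y f \<rhd> th X) \<cdot> mu X X Y f (ti X) \<cdot> st2 X Y (eta X Y f) = st2 X Y (eta X Y f)"
    using assms by (simp add: strict tydef)
  then show ?thesis using assms by (simp add: eta_coherence strict tydef)
qed

lemma mu_eta:
  assumes "kl X Y f" "kl Y Z g"
  shows "(mu X Y Z g f \<lhd> ti X) \<cdot> eta X Z (st Y Z g \<odot> f) = st Y Z g \<rhd> eta X Y f"
proof (rule st2_faithful[of X Z])
  show "st2 X Z ((mu X Y Z g f \<lhd> ti X) \<cdot> eta X Z (st Y Z g \<odot> f)) = st2 X Z (st Y Z g \<rhd> eta X Y f)"
    \<comment> \<open>After (-)^* both sides are built from \<open>mu\<close> and the inverse of
      \<open>th\<close>, in orders that interchange relates.\<close>
    using D.slide[of "inv2 D (th X)" "mu X Y Z g f"] assms by (simp add: strict tydef flat)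
qed (use assms in \<open>simp_all add: strict tydef\<close>)

lemma th_eta:
  assumes "X \<in> Obj C"
  shows "(th X \<lhd> ti X) \<cdot> eta X X (ti X) = idc D (ti X)"
proof (rule st2_faithful[of X X])
  show "st2 X X ((th X \<lhd> ti X) \<cdot> eta X X (ti X)) = st2 X X (idc D (ti X))"
    using D.slide[of "inv2 D (th X)" "th X"] assms by (simp add: strict tydef flat)
qed (use assms in \<open>simp_all add: strict tydef\<close>)

section \<open>Morphisms and 2-cells of free algebras\<close>

text \<open>
  A list \<open>[f\<^sub>1, \<dots>, f\<^sub>n]\<close> of Kleisli morphisms stands for the morphism \<open>f\<^sub>1\<^sup>* \<cdots> f\<^sub>n\<^sup>*\<close> of free algebras. Its
  pseudomorphism structure consists of the 2-cells \<open>(f\<^sub>1\<^sup>* \<cdots> f\<^sub>n\<^sup>* w)\<^sup>* \<rightarrow> f\<^sub>1\<^sup>* \<cdots> f\<^sub>n\<^sup>* w\<^sup>*\<close>, given by \<open>pil\<close>, and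
  \<open>rcel\<close> singles out the 2-cells compatible with it.
\<close>

fun hatl :: "'oc \<Rightarrow> ('oc \<times> 'md \<times> 'oc) list \<Rightarrow> 'md" where
  "hatl Z [] = one D (Tob T Z)"
| "hatl Z ((X, f, Y) # l) = st X Y f \<odot> hatl Z l"

fun path :: "'oc \<Rightarrow> ('oc \<times> 'md \<times> 'oc) list \<Rightarrow> 'oc \<Rightarrow> bool" where
  "path Z [] Y \<longleftrightarrow> Z = Y \<and> Y \<in> Obj C"
| "path Z ((A, f, B) # l) Y \<longleftrightarrow> B = Y \<and> kl A B f \<and> path Z l A"

fun pil :: "'oc \<Rightarrow> ('oc \<times> 'md \<times> 'oc) list \<Rightarrow> 'oc \<Rightarrow> 'md \<Rightarrow> 'cd" where
  "pil Z [] W w = idc D (st W Z w)"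
| "pil Z ((X, f, Y) # l) W w = (st X Y f \<rhd> pil Z l W w) \<cdot> mu W X Y f (hatl Z l \<odot> w)"

lemma path_Obj: "path Z l Y \<Longrightarrow> Z \<in> Obj C" "path Z l Y \<Longrightarrow> Y \<in> Obj C"
  by (induction Z l Y rule: path.induct) (auto simp: tydef)

lemma path_append: "path Z (l @ k) Y \<longleftrightarrow> (\<exists>X. path X l Y \<and> path Z k X)"
  by (induction l arbitrary: Y) (auto simp: path_Obj)

lemma hatl_typ:
  assumes "path Z l Y"
  shows hatl_Mor: "hatl Z l \<in> Mor D" and src_hatl: "src D (hatl Z l) = Tob T Z"
    and trg_hatl: "trg D (hatl Z l) = Tob T Y"
  using assms by (induction Z l Y rule: path.induct) (auto simp: strict tydef)

lemma hatl_append: "path X l Y \<Longrightarrow> path Z k X \<Longrightarrow> hatl Z (l @ k) = hatl X l \<odot> hatl Z k"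
proof (induction X l Y rule: path.induct)
  case (1 X Y)
  then show ?case using hatl_typ[of Z k X] by (simp add: strict tydef)
next
  case (2 X A f B l Y)
  then have t: "A \<in> Obj C" "Y \<in> Obj C" "f \<in> Mor D" "src D f = pob J A" "trg D f = Tob T Y" "B = Y"
      "path X l A" "path Z k X" by (auto simp: tydef)
  have "hatl Z (l @ k) = hatl X l \<odot> hatl Z k" using 2(1) t by simp
  then show ?case using t by (simp add: strict tydef hatl_typ[OF t(7)] hatl_typ[OF t(8)])
qed

lemma pil_typ:
  assumes "path Z l Y" "kl W Z w"
  shows "pil Z l W w \<in> Cel D \<and> src2 D (pil Z l W w) = st W Y (hatl Z l \<odot> w) \<and>
     trg2 D (pil Z l W w) = hatl Z l \<odot> st W Z w \<and> invertible D (pil Z l W w)"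
  using assms by (induction Z l Y rule: path.induct) (auto simp: strict tydef hatl_typ)

lemma pil_append:
  assumes "path X l Y" "path Z k X" "kl W Z w"
  shows "pil Z (l @ k) W w = (hatl X l \<rhd> pil Z k W w) \<cdot> pil X l W (hatl Z k \<odot> w)"
  using assms
proof (induction X l Y rule: path.induct)
  case (1 X Y)
  then show ?case using hatl_typ[of Z k X] pil_typ[of Z k X W w] by (simp add: strict tydef)
next
  case (2 X A f B l Y)
  then have t: "A \<in> Obj C" "Y \<in> Obj C" "f \<in> Mor D" "src D f = pob J A" "trg D f = Tob T Y" "B = Y"
      "path X l A" "path Z k X" "kl W Z w" by (auto simp: tydef)
  note T = hatl_typ[OF t(7)] hatl_typ[OF t(8)]
  have kw: "kl W X (hatl Z k \<odot> w)" using t path_Obj[OF t(7)] by (simp add: T strict tydef)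
  have IH: "pil Z (l @ k) W w = (hatl X l \<rhd> pil Z k W w) \<cdot> pil X l W (hatl Z k \<odot> w)"
    using 2(1) t by simp
  show ?case unfolding append.simps pil.simps IH hatl_append[OF t(7,8)] \<open>B = Y\<close>
    using t(1-5,9) path_Obj[OF t(7)] pil_typ[OF t(8,9)] pil_typ[OF t(7) kw] by (simp add: T strict tydef)
qed

lemma pil_natural:
  assumes "path Z l Y" "kl2 W Z \<alpha>"
  shows "pil Z l W (trg2 D \<alpha>) \<cdot> st2 W Y (hatl Z l \<rhd> \<alpha>) = (hatl Z l \<rhd> st2 W Z \<alpha>) \<cdot> pil Z l W (src2 D \<alpha>)"
  using assms
proof (induction Z l Y rule: path.induct)
  case (1 Z Y)
  then show ?case by (simp add: strict tydef)
next
  case (2 Z A f B l Y)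
  let ?l = "hatl Z l" and ?f = "idc D (st A Y f)"
  have t: "A \<in> Obj C" "Y \<in> Obj C" "f \<in> Mor D" "src D f = pob J A" "trg D f = Tob T Y" "B = Y"
      "path Z l A" "kl2 W Z \<alpha>" using 2 by (auto simp: tydef)
  note T = hatl_typ[OF t(7)]
  have IH: "pil Z l W (trg2 D \<alpha>) \<cdot> st2 W A (?l \<rhd> \<alpha>) = (?l \<rhd> st2 W Z \<alpha>) \<cdot> pil Z l W (src2 D \<alpha>)"
    using 2(1) t by simp
  have p: "kl W Z (src2 D \<alpha>)" "kl W Z (trg2 D \<alpha>)" using t(8) by (simp_all add: strict tydef)
  note P = pil_typ[OF t(7) p(1)] pil_typ[OF t(7) p(2)]
  have mn: "mu W A Y f (?l \<odot> trg2 D \<alpha>) \<cdot> st2 W Y (st A Y f \<odot> ?l \<rhd> \<alpha>) =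
    (?f \<star> st2 W A (?l \<rhd> \<alpha>)) \<cdot> mu W A Y f (?l \<odot> src2 D \<alpha>)"
    using mu_natural_right[of A Y f W "?l \<rhd> \<alpha>"] t(1-5,8) by (simp add: T strict tydef)
  have "(?f \<star> pil Z l W (trg2 D \<alpha>)) \<cdot> (?f \<star> st2 W A (?l \<rhd> \<alpha>)) = (st A Y f \<odot> ?l \<rhd> st2 W Z \<alpha>) \<cdot> (?f \<star> pil Z l W (src2 D \<alpha>))"
    using arg_cong[OF IH, of "\<lambda>z. ?f \<star> z"] t(1-5,8) P by (simp add: T strict tydef)
  then have "(?f \<star> pil Z l W (trg2 D \<alpha>)) \<cdot> (?f \<star> st2 W A (?l \<rhd> \<alpha>)) \<cdot> mu W A Y f (?l \<odot> src2 D \<alpha>)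
    = (st A Y f \<odot> ?l \<rhd> st2 W Z \<alpha>) \<cdot> (?f \<star> pil Z l W (src2 D \<alpha>)) \<cdot> mu W A Y f (?l \<odot> src2 D \<alpha>)"
    by (rule D.vcmp_extend) (use t(1-5,8) P in \<open>simp_all add: T strict tydef\<close>)
  then show ?case unfolding pil.simps hatl.simps mn[symmetric] \<open>B = Y\<close>
    using t(1-5,8) P by (simp add: T strict tydef)
qed

definition rcel :: "'oc \<Rightarrow> ('oc \<times> 'md \<times> 'oc) list \<Rightarrow> ('oc \<times> 'md \<times> 'oc) list \<Rightarrow> 'oc \<Rightarrow> 'cd \<Rightarrow> bool" where
  "rcel Z l l' Y \<xi> \<longleftrightarrow> path Z l Y \<and> path Z l' Y \<and> \<xi> \<in> Cel D \<and> src2 D \<xi> = hatl Z l \<and> trg2 D \<xi> = hatl Z l' \<and>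
    (\<forall>W w. kl W Z w \<longrightarrow> (\<xi> \<lhd> st W Z w) \<cdot> pil Z l W w = pil Z l' W w \<cdot> st2 W Y (\<xi> \<lhd> w))"

lemma rcel_eq:
  "\<lbrakk>rcel Z l l' Y \<xi>; kl W Z w\<rbrakk> \<Longrightarrow> (\<xi> \<lhd> st W Z w) \<cdot> pil Z l W w = pil Z l' W w \<cdot> st2 W Y (\<xi> \<lhd> w)"
  by (simp add: rcel_def)

lemma rcel_typ:
  assumes "rcel Z l l' Y \<xi>"
  shows "path Z l Y" "path Z l' Y" "\<xi> \<in> Cel D" "src2 D \<xi> = hatl Z l" "trg2 D \<xi> = hatl Z l'"
  using assms by (simp_all add: rcel_def)

lemma rcel_idc: "path Z l Y \<Longrightarrow> rcel Z l l Y (idc D (hatl Z l))"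
  using path_Obj by (auto simp: rcel_def strict tydef pil_typ hatl_typ)

lemma rcel_vcmp:
  assumes "rcel Z l l' Y \<alpha>" "rcel Z l' l'' Y \<beta>"
  shows "rcel Z l l'' Y (\<beta> \<cdot> \<alpha>)"
proof -
  note t = rcel_typ[OF assms(1)] rcel_typ(2-)[OF assms(2)]
  have "((\<beta> \<cdot> \<alpha>) \<lhd> st W Z w) \<cdot> pil Z l W w = pil Z l'' W w \<cdot> st2 W Y ((\<beta> \<cdot> \<alpha>) \<lhd> w)" if w: "kl W Z w" for W w
  proof -
    have "((\<beta> \<cdot> \<alpha>) \<lhd> st W Z w) \<cdot> pil Z l W w = (\<beta> \<lhd> st W Z w) \<cdot> ((\<alpha> \<lhd> st W Z w) \<cdot> pil Z l W w)"
      using w t by (simp add: strict tydef hatl_typ[OF t(1)] hatl_typ[OF t(2)] pil_typ)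
    also have "\<dots> = ((\<beta> \<lhd> st W Z w) \<cdot> pil Z l' W w) \<cdot> st2 W Y (\<alpha> \<lhd> w)"
      using w t path_Obj[OF t(1)] rcel_eq[OF assms(1) w] by (simp add: strict tydef hatl_typ[OF t(1)] hatl_typ[OF t(2)] pil_typ)
    also have "\<dots> = pil Z l'' W w \<cdot> st2 W Y ((\<beta> \<cdot> \<alpha>) \<lhd> w)"
      using w t path_Obj[OF t(1)] rcel_eq[OF assms(2) w] 
      by (simp add: strict tydef hatl_typ[OF t(1)] hatl_typ[OF t(2)] hatl_typ[OF t(6)] pil_typ)
    finally show ?thesis .
  qed
  with t show ?thesis by (simp add: rcel_def strict tydef)
qed

lemma rcel_inv:
  assumes "rcel Z l l' Y \<alpha>" "invertible D \<alpha>"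
  shows "rcel Z l' l Y (inv2 D \<alpha>)"
proof -
  note t = rcel_typ[OF assms(1)] assms(2)
  have "(inv2 D \<alpha> \<lhd> st W Z w) \<cdot> pil Z l' W w = pil Z l W w \<cdot> st2 W Y (inv2 D \<alpha> \<lhd> w)" if w: "kl W Z w" for W w
  proof -
    have "((inv2 D \<alpha> \<lhd> st W Z w) \<cdot> pil Z l' W w) = 
      (inv2 D \<alpha> \<lhd> st W Z w) \<cdot> (pil Z l' W w \<cdot> st2 W Y (\<alpha> \<lhd> w)) \<cdot> st2 W Y (inv2 D \<alpha> \<lhd> w)"
      using w t path_Obj[OF t(1)] by (simp add: strict tydef hatl_typ[OF t(1)] hatl_typ[OF t(2)] pil_typ flip: st2_vcmp)
    also have "\<dots> = pil Z l W w \<cdot> st2 W Y (inv2 D \<alpha> \<lhd> w)"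
      unfolding rcel_eq[OF assms(1) w, symmetric]
      using w t path_Obj[OF t(1)] by (simp add: strict tydef hatl_typ[OF t(1)] hatl_typ[OF t(2)] pil_typ)
    finally show ?thesis .
  qed
  with t show ?thesis by (simp add: rcel_def strict tydef)
qed

text \<open>Whiskering on the right only slides \<xi> past the structure 2-cell of k. Whiskering on
  the left, treated next, needs \<open>pil_natural\<close> for p.\<close>

lemma rcel_wr:
  assumes "rcel X l l' Y \<xi>" "path Z k X"
  shows "rcel Z (l @ k) (l' @ k) Y (\<xi> \<lhd> hatl Z k)"
proof -
  note t = rcel_typ[OF assms(1)] assms(2)
  have "((\<xi> \<lhd> hatl Z k) \<lhd> st W Z w) \<cdot> pil Z (l @ k) W w
      = pil Z (l' @ k) W w \<cdot> st2 W Y ((\<xi> \<lhd> hatl Z k) \<lhd> w)" if w: "kl W Z w" for W w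
  proof -
    note T = strict tydef hatl_typ[OF t(1)] hatl_typ[OF t(2)] hatl_typ[OF t(6)] pil_typ path_Obj[OF t(1)]
    have kw: "kl W X (hatl Z k \<odot> w)" using t w by (simp add: T)
    have "((\<xi> \<lhd> hatl Z k) \<lhd> st W Z w) \<cdot> pil Z (l @ k) W w
      = ((\<xi> \<lhd> hatl Z k \<odot> st W Z w) \<cdot> (hatl X l \<rhd> pil Z k W w)) \<cdot> pil X l W (hatl Z k \<odot> w)"
      using w t by (simp add: T pil_append)
    also have "\<dots> = (hatl X l' \<rhd> pil Z k W w) \<cdot> ((\<xi> \<lhd> st W X (hatl Z k \<odot> w)) \<cdot> pil X l W (hatl Z k \<odot> w))"
      using D.slide[of "pil Z k W w" \<xi>] w t by (simp add: T)
    also have "\<dots> = pil Z (l' @ k) W w \<cdot> st2 W Y ((\<xi> \<lhd> hatl Z k) \<lhd> w)"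
      unfolding rcel_eq[OF assms(1) kw] using w t by (simp add: T pil_append)
    finally show ?thesis .
  qed
  with t show ?thesis by (auto simp add: rcel_def strict tydef path_append hatl_append hatl_typ)
qed

lemma rcel_wl:
  assumes "rcel Z l l' Y \<xi>" "path Y p V"
  shows "rcel Z (p @ l) (p @ l') V (hatl Y p \<rhd> \<xi>)"
proof -
  note t = rcel_typ[OF assms(1)] assms(2)
  have "((hatl Y p \<rhd> \<xi>) \<lhd> st W Z w) \<cdot> pil Z (p @ l) W w
      = pil Z (p @ l') W w \<cdot> st2 W V ((hatl Y p \<rhd> \<xi>) \<lhd> w)" if w: "kl W Z w" for W w
  proof -
    note T = strict tydef hatl_typ[OF t(1)] hatl_typ[OF t(2)] hatl_typ[OF t(6)] pil_typ path_Obj[OF t(1)]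
    have "((hatl Y p \<rhd> \<xi>) \<lhd> st W Z w) \<cdot> pil Z (p @ l) W w
      = (hatl Y p \<rhd> ((\<xi> \<lhd> st W Z w) \<cdot> pil Z l W w)) \<cdot> pil Y p W (hatl Z l \<odot> w)"
      using w t by (simp add: T pil_append)
    also have "\<dots> = (hatl Y p \<rhd> pil Z l' W w) \<cdot> ((hatl Y p \<rhd> st2 W Y (\<xi> \<lhd> w)) \<cdot> pil Y p W (hatl Z l \<odot> w))"
      unfolding rcel_eq[OF assms(1) w] using w t by (simp add: T)
    also have "\<dots> = (hatl Y p \<rhd> pil Z l' W w) \<cdot> (pil Y p W (hatl Z l' \<odot> w) \<cdot> st2 W V (hatl Y p \<rhd> \<xi> \<lhd> w))"
      using pil_natural[OF t(6), of W "\<xi> \<lhd> w"] w t by (simp add: T)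
    also have "\<dots> = pil Z (p @ l') W w \<cdot> st2 W V ((hatl Y p \<rhd> \<xi>) \<lhd> w)"
      using w t path_Obj[OF t(6)] by (simp add: T pil_append)
    finally show ?thesis .
  qed
  with t show ?thesis by (auto simp add: rcel_def strict tydef path_append hatl_append hatl_typ)
qed

text \<open>Compatibility is here the associativity axiom of T itself. For \<open>th\<close> it is
  the derived law \<open>st_th\<close>, and for a 2-cell \<open>st2 X Y \<alpha>\<close> it is
  naturality of \<open>mu\<close>.\<close>

lemma rcel_mu:
  assumes "kl X Y f" "kl Y Z g"
  shows "rcel X [(X, st Y Z g \<odot> f, Z)] [(Y, g, Z), (X, f, Y)] Z (mu X Y Z g f)"
  using assms mu_coherence by (auto simp: rcel_def strict tydef)

lemma rcel_th: "X \<in> Obj C \<Longrightarrow> rcel X [(X, ti X, X)] [] X (th X)"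
  using st_th by (auto simp: rcel_def strict tydef)

lemma rcel_st2: "kl2 X Y \<alpha> \<Longrightarrow> rcel X [(X, src2 D \<alpha>, Y)] [(X, trg2 D \<alpha>, Y)] Y (st2 X Y \<alpha>)"
  using mu_natural_left by (auto simp: rcel_def strict tydef)

text \<open>Compatibility at w = \<open>ti Z\<close> passes from the whiskering with
  \<open>ti Z\<close> to the one with \<open>st Z Z (ti Z)\<close>, and \<open>th Z\<close> replaces
  that morphism by an identity. This is the 2-dimensional part of freeness.\<close>

lemma rcel_unique:
  assumes "rcel Z l l' Y \<alpha>" "rcel Z l l' Y \<beta>" "\<alpha> \<lhd> ti Z = \<beta> \<lhd> ti Z"
  shows "\<alpha> = \<beta>"
proof -
  note t = rcel_typ[OF assms(1)] rcel_typ[OF assms(2)]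
  have Z: "Z \<in> Obj C" using path_Obj t by simp
  note T = strict tydef hatl_typ[OF t(1)] hatl_typ[OF t(2)] pil_typ Z
  have i: "kl Z Z (ti Z)" using Z by (simp add: strict tydef)
  have "(\<alpha> \<lhd> st Z Z (ti Z)) \<cdot> pil Z l Z (ti Z) = (\<beta> \<lhd> st Z Z (ti Z)) \<cdot> pil Z l Z (ti Z)"
    using rcel_eq[OF assms(1) i] rcel_eq[OF assms(2) i] assms(3) by simp
  then have "\<alpha> \<lhd> st Z Z (ti Z) = \<beta> \<lhd> st Z Z (ti Z)"
    by (rule D.cancel_right[rotated]) (use t in \<open>simp_all add: T\<close>)
  then have "\<alpha> \<cdot> (hatl Z l \<rhd> th Z) = \<beta> \<cdot> (hatl Z l \<rhd> th Z)"
    using D.slide[of "th Z" \<alpha>] D.slide[of "th Z" \<beta>] t by (simp add: T)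
  then show ?thesis by (rule D.cancel_right[rotated]) (use t in \<open>simp_all add: T\<close>)
qed

section \<open>The Kleisli bicategory\<close>

abbreviation "K \<equiv> Kl C D J T"

lemma Kl_sel[simp]:
  "Obj K = Obj C" "(X, f, Y) \<in> Mor K \<longleftrightarrow> kl X Y f" "src K (X, f, Y) = X" "trg K (X, f, Y) = Y"
  "(X, \<alpha>, Y) \<in> Cel K \<longleftrightarrow> kl2 X Y \<alpha>"
  "src2 K (X, \<alpha>, Y) = (X, src2 D \<alpha>, Y)" "trg2 K (X, \<alpha>, Y) = (X, trg2 D \<alpha>, Y)"
  "one K X = (X, ti X, X)" "cmp K (Y, g, Z) (X, f, Y') = (X, st Y Z g \<odot> f, Z)"
  "idc K (X, f, Y) = (X, idc D f, Y)" "vcmp K (X, \<beta>, Y) (X', \<alpha>, Y') = (X, \<beta> \<cdot> \<alpha>, Y)"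
  "hcmp K (Y, \<beta>, Z) (X, \<alpha>, Y') = (X, st2 Y Z \<beta> \<star> \<alpha>, Z)"
  "assoc K (Z, h, W) (Y, g, Z') (X, f, Y') = (X, mu Y Z W h g \<lhd> f, W)"
  "lunit K (X, f, Y) = (X, th Y \<lhd> f, Y)" "runit K (X, f, Y) = (X, eta X Y f, Y)"
  by (auto simp: Kl_def khom_iff strict tydef)

lemma hom_Kl: "f \<in> hom K X Y \<longleftrightarrow> (\<exists>g. f = (X, g, Y) \<and> kl X Y g)"
  by (cases f) (auto simp: hom_def tydef)

lemma Mor_Kl: "f \<in> Mor K \<longleftrightarrow> (\<exists>X g Y. f = (X, g, Y) \<and> kl X Y g)"
  by (cases f) auto

lemma Cel_Kl: "\<alpha> \<in> Cel K \<longleftrightarrow> (\<exists>X \<beta> Y. \<alpha> = (X, \<beta>, Y) \<and> kl2 X Y \<beta>)"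
  by (cases \<alpha>) auto

lemma cells_Kl: "\<alpha> \<in> cells K f g \<longleftrightarrow>
    (\<exists>X \<beta> Y. \<alpha> = (X, \<beta>, Y) \<and> kl2 X Y \<beta> \<and> f = (X, src2 D \<beta>, Y) \<and> g = (X, trg2 D \<beta>, Y))"
  by (cases \<alpha>) (auto simp: cells_def)

lemma inverse_cells_Kl:
  "inverse_cells K (X, \<alpha>, Y) \<beta>' \<longleftrightarrow> (\<exists>\<beta>. \<beta>' = (X, \<beta>, Y) \<and> kl2 X Y \<alpha> \<and> inverse_cells D \<alpha> \<beta>)"
  by (cases \<beta>') (auto simp: inverse_cells_def cells_Kl cells_iff strict tydef)

lemma invertible_Kl: "invertible K (X, \<alpha>, Y) \<longleftrightarrow> kl2 X Y \<alpha> \<and> invertible D \<alpha>"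
  by (auto simp: invertible_def inverse_cells_Kl)

lemma inv2_Kl:
  assumes "invertible D \<alpha>" "kl2 X Y \<alpha>"
  shows "inv2 K (X, \<alpha>, Y) = (X, inv2 D \<alpha>, Y)"
  unfolding inv2_def[of K] using D.inverse_cells_inv2[OF assms(1)] assms(2)
  by (intro the_equality) (auto simp: inverse_cells_Kl dest: D.inv2_eqI)

lemma icells_Kl: "\<alpha> \<in> icells K f g \<longleftrightarrow>
    (\<exists>X \<beta> Y. \<alpha> = (X, \<beta>, Y) \<and> kl2 X Y \<beta> \<and> f = (X, src2 D \<beta>, Y) \<and> g = (X, trg2 D \<beta>, Y) \<and> invertible D \<beta>)"
  by (cases \<alpha>) (auto simp: icells_def cells_Kl invertible_Kl)

text \<open>Pentagon and triangle are the two axioms of T whiskered by the innermost morphism.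
  Naturality of the associator joins naturality of \<open>mu\<close> with interchange, because
  \<open>mu\<close> is itself whiskered by the third morphism.\<close>

lemma bicategory_Kl: "bicategory K"
proof (unfold_locales, goal_cases)
  case (16 f X Y g Z \<alpha> f' \<alpha>' f'' \<beta> g' \<beta>' g'')
  then show ?case by (auto simp: hom_Kl cells_Kl strict tydef D.interch)
next
  case (20 f X Y g Z h W \<alpha> f' \<beta> g' \<gamma> h')
  then obtain a b c where *: "f = (X, src2 D a, Y)" "g = (Y, src2 D b, Z)" "h = (Z, src2 D c, W)"
    "f' = (X, trg2 D a, Y)" "g' = (Y, trg2 D b, Z)" "h' = (Z, trg2 D c, W)"
    "\<alpha> = (X, a, Y)" "\<beta> = (Y, b, Z)" "\<gamma> = (Z, c, W)" "kl2 X Y a" "kl2 Y Z b" "kl2 Z W c"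
    by (auto simp: hom_Kl cells_Kl)
  have "(mu Y Z W (trg2 D c) (trg2 D b) \<lhd> trg2 D a) \<cdot> (st2 Y W (st2 Z W c \<star> b) \<star> a)
    = (mu Y Z W (trg2 D c) (trg2 D b) \<cdot> st2 Y W (st2 Z W c \<star> b)) \<star> a"
    using * D.interch[of a "idc D (trg2 D a)" "st2 Y W (st2 Z W c \<star> b)" "mu Y Z W (trg2 D c) (trg2 D b)"]
    by (simp add: strict tydef)
  also have "\<dots> = (st2 Z W c \<star> st2 Y Z b \<star> a) \<cdot> (mu Y Z W (src2 D c) (src2 D b) \<lhd> src2 D a)"
    using * mu_natural[of Y Z b W c]
      D.interch[of "idc D (src2 D a)" a "mu Y Z W (src2 D c) (src2 D b)" "st2 Z W c \<star> st2 Y Z b"]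
    by (simp add: strict tydef)
  finally show ?case using * by (simp add: strict tydef)
next
  case (21 f X Y \<alpha> f')
  then obtain a where *: "f = (X, src2 D a, Y)" "f' = (X, trg2 D a, Y)" "\<alpha> = (X, a, Y)" "kl2 X Y a"
    by (auto simp: hom_Kl cells_Kl)
  then show ?case using D.slide[of a "th Y"] by (simp add: strict tydef)
next
  case (22 f X Y \<alpha> f')
  then obtain a where *: "f = (X, src2 D a, Y)" "f' = (X, trg2 D a, Y)" "\<alpha> = (X, a, Y)" "kl2 X Y a"
    by (auto simp: hom_Kl cells_Kl)
  then show ?case using eta_natural[of X Y a] by (simp add: strict tydef)
next
  case (23 f X Y g Z h W k V)
  then obtain f0 g0 h0 k0 where *: "f = (X, f0, Y)" "g = (Y, g0, Z)" "h = (Z, h0, W)" "k = (W, k0, V)"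
    "kl X Y f0" "kl Y Z g0" "kl Z W h0" "kl W V k0" by (auto simp: hom_Kl)
  then show ?case
    using arg_cong[OF mu_coherence[of Y Z g0 W h0 V k0], of "\<lambda>z. z \<lhd> f0"] by (simp add: strict tydef)
next
  case (24 f X Y g Z)
  then obtain f0 g0 where *: "f = (X, f0, Y)" "g = (Y, g0, Z)" "kl X Y f0" "kl Y Z g0" by (auto simp: hom_Kl)
  then show ?case
    using arg_cong[OF eta_coherence[of Y Z g0], of "\<lambda>z. z \<lhd> f0"] by (simp add: strict tydef)
qed (auto simp: hom_Kl cells_Kl Mor_Kl Cel_Kl icells_Kl strict tydef)

end

context two_category
begin

lemma cancel_both:
  assumes "\<gamma> \<cdot> (\<alpha> \<cdot> \<delta>) = \<gamma> \<cdot> (\<beta> \<cdot> \<delta>)" "invertible B \<gamma>" "invertible B \<delta>" "\<alpha> \<in> Cel B" "\<beta> \<in> Cel B"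
    "src2 B \<alpha> = trg2 B \<delta>" "src2 B \<beta> = trg2 B \<delta>" "trg2 B \<alpha> = src2 B \<gamma>" "trg2 B \<beta> = src2 B \<gamma>"
  shows "\<alpha> = \<beta>"
  using cancel_right[OF assms(3) cancel_left[OF assms(2,1)]] assms(2-) invertible_Cel by (simp add: strict tydef)

end

section \<open>The pseudomonad of a factored extension operator\<close>

text \<open>
  \<open>R\<close> is a relative pseudomonad on \<open>X \<mapsto> T S X\<close> whose operator factors as \<open>x \<mapsto> (x\<^sup>\<dagger>)\<^sup>*\<close>, where
  \<open>x\<^sup>\<dagger> = dg X Y x\<close>, together with the 2-cells \<open>dmu\<close>, \<open>dth\<close> through which \<open>\<mu>\<close>, \<open>\<theta>\<close> of \<open>R\<close> factor.
\<close>

locale kleisli_extension = relative_pseudomonad C D J T + R: relative_pseudomonad C D J R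
  for C :: "('oc, 'mc, 'cc) bicat" and D :: "('od, 'md, 'cd) bicat" (structure)
    and J :: "('oc, 'mc, 'cc, 'od, 'md, 'cd) pfun"
    and T R :: "('oc, 'od, 'md, 'cd) rpmonad" +
  fixes so :: "'oc \<Rightarrow> 'oc" and dg :: "'oc \<Rightarrow> 'oc \<Rightarrow> 'md \<Rightarrow> 'md" and dg2 :: "'oc \<Rightarrow> 'oc \<Rightarrow> 'cd \<Rightarrow> 'cd"
    and dmu :: "'oc \<Rightarrow> 'oc \<Rightarrow> 'oc \<Rightarrow> 'md \<Rightarrow> 'md \<Rightarrow> 'cd" and dth :: "'oc \<Rightarrow> 'cd"
  assumes so_Obj[strict]: "X \<in> Obj C \<Longrightarrow> so X \<in> Obj C"
    and Tob_R[strict]: "X \<in> Obj C \<Longrightarrow> Tob R X = Tob T (so X)"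
    and dg_typ[strict]: "kl X (so Y) x \<Longrightarrow> Y \<in> Obj C \<Longrightarrow> kl (so X) (so Y) (dg X Y x)"
    and star_R[strict]: "kl X (so Y) x \<Longrightarrow> Y \<in> Obj C \<Longrightarrow> star R X Y x = st (so X) (so Y) (dg X Y x)"
    and dg2_typ: "kl2 X (so Y) \<alpha> \<Longrightarrow> Y \<in> Obj C \<Longrightarrow>
          dg2 X Y \<alpha> \<in> Cel D \<and> src2 D (dg2 X Y \<alpha>) = dg X Y (src2 D \<alpha>) \<and> trg2 D (dg2 X Y \<alpha>) = dg X Y (trg2 D \<alpha>)"
    and star2_R[strict]: "kl2 X (so Y) \<alpha> \<Longrightarrow> Y \<in> Obj C \<Longrightarrow> star2 R X Y \<alpha> = st2 (so X) (so Y) (dg2 X Y \<alpha>)"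
    and dmu_typ: "kl X (so Y) f \<Longrightarrow> kl Y (so Z) g \<Longrightarrow> Z \<in> Obj C \<Longrightarrow>
          invertible D (dmu X Y Z g f) \<and> src2 D (dmu X Y Z g f) = dg X Z (star R Y Z g \<odot> f) \<and>
          trg2 D (dmu X Y Z g f) = star R Y Z g \<odot> dg X Y f"
    and Tmu_R: "kl X (so Y) f \<Longrightarrow> kl Y (so Z) g \<Longrightarrow> Z \<in> Obj C \<Longrightarrow>
          Tmu R X Y Z g f = mu (so X) (so Y) (so Z) (dg Y Z g) (dg X Y f) \<cdot> st2 (so X) (so Z) (dmu X Y Z g f)"
    and dth_typ: "X \<in> Obj C \<Longrightarrow>
          invertible D (dth X) \<and> src2 D (dth X) = dg X X (Ti R X) \<and> trg2 D (dth X) = ti (so X)"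
    and Ttheta_R: "X \<in> Obj C \<Longrightarrow> Ttheta R X = th (so X) \<cdot> st2 (so X) (so X) (dth X)"
begin

abbreviation "e \<equiv> Ti R"
abbreviation "eh X \<equiv> st X (so X) (Ti R X)"

definition "S1 X Y f = dg X Y (eh Y \<odot> f)"
definition "S2 X Y \<alpha> = dg2 X Y (eh Y \<rhd> \<alpha>)"
definition "mm X = dg (so X) X (ti (so X))"

abbreviation "sh X Y f \<equiv> st (so X) (so Y) (S1 X Y f)"
abbreviation "mh X \<equiv> st (so (so X)) (so X) (mm X)"
abbreviation "ph X Y x \<equiv> st (so X) (so Y) (dg X Y x)"

text \<open>Typing for R becomes typing for T, so that one set of rules serves both.\<close>

lemma R_kl[strict]: "Y \<in> Obj C \<Longrightarrow> R.kl X Y x \<longleftrightarrow> kl X (so Y) x"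
  by (simp add: kl_def R.kl_def Tob_R so_Obj)

text \<open>Folding keeps \<open>dg\<close> at these two kinds of argument recognisable to the rules
  stated for \<open>S1\<close> and \<open>mm\<close>.\<close>

lemmas S1_fold[strict] = S1_def[symmetric]
lemmas mm_fold[strict] = mm_def[symmetric]

lemma e_typ:
  assumes "X \<in> Obj C"
  shows e_Mor[strict]: "e X \<in> Mor D" and src_e[strict]: "src D (e X) = pob J X" and trg_e[strict]: "trg D (e X) = Tob T (so X)"
  using R.ti_typ[OF assms] assms by (simp_all add: strict)

lemmas [strict] = D.into1I[OF e_Mor trg_e]

lemma kl_e[strict]: "X \<in> Obj C \<Longrightarrow> kl X (so X) (e X)"
  by (simp add: strict tydef)

lemma dg_rules:
  assumes "kl X (so Y) x" "Y \<in> Obj C"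
  shows dg_Mor[strict]: "dg X Y x \<in> Mor D" and src_dg[strict]: "src D (dg X Y x) = pob J (so X)"
    and trg_dg[strict]: "trg D (dg X Y x) = Tob T (so Y)"
  using klD[OF dg_typ[OF assms]] by auto

lemmas [strict] = D.into1I[OF dg_Mor trg_dg]

lemma kl_S1[strict]: "kl X Y f \<Longrightarrow> kl (so X) (so Y) (S1 X Y f)"
  using klD[of X Y f] unfolding S1_def by (simp add: strict del: S1_fold)

lemma kl_mm[strict]: "X \<in> Obj C \<Longrightarrow> kl (so (so X)) (so X) (mm X)"
  unfolding mm_def by (simp add: strict del: mm_fold)

lemma S1_typ:
  assumes "kl X Y f"
  shows S1_Mor[strict]: "S1 X Y f \<in> Mor D" and src_S1[strict]: "src D (S1 X Y f) = pob J (so X)"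
    and trg_S1[strict]: "trg D (S1 X Y f) = Tob T (so Y)"
  using klD[OF kl_S1[OF assms]] by simp_all

lemmas [strict] = D.into1I[OF S1_Mor trg_S1]

lemma mm_typ:
  assumes "X \<in> Obj C"
  shows mm_Mor[strict]: "mm X \<in> Mor D" and src_mm[strict]: "src D (mm X) = pob J (so (so X))"
    and trg_mm[strict]: "trg D (mm X) = Tob T (so X)"
  using klD[OF kl_mm[OF assms]] by simp_all

lemmas [strict] = D.into1I[OF mm_Mor trg_mm]

lemma dg2_rules:
  assumes "kl2 X (so Y) \<alpha>" "Y \<in> Obj C"
  shows dg2_Cel[strict]: "dg2 X Y \<alpha> \<in> Cel D" and src2_dg2[strict]: "src2 D (dg2 X Y \<alpha>) = dg X Y (src2 D \<alpha>)"
    and trg2_dg2[strict]: "trg2 D (dg2 X Y \<alpha>) = dg X Y (trg2 D \<alpha>)"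
  using dg2_typ[OF assms] by auto

lemmas [strict] = D.into2I[OF dg2_Cel trg2_dg2]

text \<open>Functoriality of the dagger on 2-cells is inherited from R: \<open>star2 R\<close> is
  \<open>st2\<close> after \<open>dg2\<close>, and \<open>st2\<close> is faithful.\<close>

lemma dg2_idc[strict]:
  assumes "kl X (so Y) x" "Y \<in> Obj C" shows "dg2 X Y (idc D x) = idc D (dg X Y x)"
proof (rule st2_faithful[of "so X" "so Y"])
  have "star2 R X Y (idc D x) = idc D (star R X Y x)" by (rule R.st2_idc) (use assms klD[OF assms(1)] in \<open>simp add: R_kl\<close>)
  then show "st2 (so X) (so Y) (dg2 X Y (idc D x)) = st2 (so X) (so Y) (idc D (dg X Y x))"
    using assms klD[OF assms(1)] by (simp add: strict)
qed (use assms klD[OF assms(1)] in \<open>simp_all add: strict\<close>)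

lemma dg2_vcmp[strict]:
  assumes "kl2 X (so Y) \<beta>" "Y \<in> Obj C" "into2 D \<alpha> (src2 D \<beta>)"
  shows "dg2 X Y (\<beta> \<cdot> \<alpha>) = dg2 X Y \<beta> \<cdot> dg2 X Y \<alpha>"
proof -
  have \<alpha>: "\<alpha> \<in> Cel D" "trg2 D \<alpha> = src2 D \<beta>" "kl X (so Y) (src2 D \<alpha>)"
    using assms kl2D[OF assms(1)] D.src_trg2[of \<alpha>] D.trg_trg2[of \<alpha>] D.src2_Mor[of \<alpha>] by (simp_all add: tydef)
  note assms = assms \<alpha>
  show ?thesis
proof (rule st2_faithful[of "so X" "so Y"])
  have "star2 R X Y (\<beta> \<cdot> \<alpha>) = star2 R X Y \<beta> \<cdot> star2 R X Y \<alpha>"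
    by (rule R.st2_vcmp) (use assms kl2D[OF assms(1)] in \<open>simp_all add: R_kl\<close>)
  then show "st2 (so X) (so Y) (dg2 X Y (\<beta> \<cdot> \<alpha>)) = st2 (so X) (so Y) (dg2 X Y \<beta> \<cdot> dg2 X Y \<alpha>)"
    using assms kl2D[OF assms(1)] by (simp add: strict)
qed (use assms kl2D[OF assms(1)] in \<open>simp_all add: strict\<close>)
qed

lemma dg2_inverse:
  assumes "invertible D \<alpha>" "kl X (so Y) (src2 D \<alpha>)" "Y \<in> Obj C"
  shows invertible_dg2[strict]: "invertible D (dg2 X Y \<alpha>)" and dg2_inv2[strict]: "dg2 X Y (inv2 D \<alpha>) = inv2 D (dg2 X Y \<alpha>)"
proof -
  have a: "\<alpha> \<in> Cel D" using assms(1) by (rule D.invertible_Cel)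
  have "inverse_cells D (dg2 X Y \<alpha>) (dg2 X Y (inv2 D \<alpha>))"
    using assms a kl2D[OF conjI[OF assms(2) a]] by (simp add: D.inverse_cells_iff strict flip: dg2_vcmp)
  then show "invertible D (dg2 X Y \<alpha>)" "dg2 X Y (inv2 D \<alpha>) = inv2 D (dg2 X Y \<alpha>)"
    using D.inverse_cells_intro by metis+
qed

lemma S2_typ:
  assumes "kl2 X Y \<alpha>"
  shows S2_Cel[strict]: "S2 X Y \<alpha> \<in> Cel D" and src2_S2[strict]: "src2 D (S2 X Y \<alpha>) = S1 X Y (src2 D \<alpha>)"
    and trg2_S2[strict]: "trg2 D (S2 X Y \<alpha>) = S1 X Y (trg2 D \<alpha>)"
  using assms kl2D[OF assms(1)] by (simp_all add: strict S2_def)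

lemmas [strict] = D.into2I[OF S2_typ(1,3)]

lemma dmu_rules:
  assumes "kl X (so Y) f" "kl Y (so Z) g" "Z \<in> Obj C" "Y \<in> Obj C"
  shows dmu_Cel[strict]: "dmu X Y Z g f \<in> Cel D" and invertible_dmu[strict]: "invertible D (dmu X Y Z g f)"
    and src2_dmu[strict]: "src2 D (dmu X Y Z g f) = dg X Z (ph Y Z g \<odot> f)"
    and trg2_dmu[strict]: "trg2 D (dmu X Y Z g f) = ph Y Z g \<odot> dg X Y f"
  using dmu_typ[OF assms(1,2,3)] D.invertible_Cel assms klD[OF assms(1)] klD[OF assms(2)] by (simp_all add: strict)

lemma dth_rules:
  assumes "X \<in> Obj C"
  shows dth_Cel[strict]: "dth X \<in> Cel D" and invertible_dth[strict]: "invertible D (dth X)"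
    and src2_dth[strict]: "src2 D (dth X) = dg X X (e X)" and trg2_dth[strict]: "trg2 D (dth X) = ti (so X)"
  using dth_typ[OF assms] D.invertible_Cel by simp_all

lemmas [strict] = D.into2I[OF dmu_Cel trg2_dmu] D.into2I[OF dth_Cel trg2_dth]

lemma Teta_R_typ:
  assumes "kl X (so Y) x" "Y \<in> Obj C"
  shows [strict]: "Teta R X Y x \<in> Cel D" "src2 D (Teta R X Y x) = x" "trg2 D (Teta R X Y x) = ph X Y x \<odot> e X"
     "invertible D (Teta R X Y x)"
  using R.eta_typ[of X Y x] assms klD[OF assms(1)] by (simp_all add: strict)

lemmas [strict] = D.into2I[OF Teta_R_typ(1,3)]

text \<open>
  From here on, the name of a 2-cell with a final \<open>h\<close> denotes the 2-cell of free \<open>R\<close>-algebras that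
  \<open>(-)\<^sup>*\<close> makes of it, up to conjugation with \<open>\<mu>\<close> and \<open>\<theta>\<close> of \<open>T\<close>.
\<close>

definition "ss X Y f = mu X (so X) (so Y) (S1 X Y f) (e X) \<cdot> st2 X (so Y) (Teta R X Y (eh Y \<odot> f)) \<cdot> inv2 D (mu X Y (so Y) (e Y) f)"

lemma ss_typ:
  assumes "kl X Y f"
  shows [strict]: "ss X Y f \<in> Cel D" "src2 D (ss X Y f) = eh Y \<odot> st X Y f" "trg2 D (ss X Y f) = sh X Y f \<odot> eh X"
    "invertible D (ss X Y f)"
  using assms klD[OF assms(1)] by (simp_all add: strict ss_def)

lemmas [strict] = D.into2I[OF ss_typ(1,3)]

lemma st2_unit_cell[flat]:
  assumes "kl X Y f"
  shows "st2 X (so Y) (Teta R X Y (eh Y \<odot> f)) = inv2 D (mu X (so X) (so Y) (S1 X Y f) (e X)) \<cdot> ss X Y f \<cdot> mu X Y (so Y) (e Y) f"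
  using assms klD[OF assms(1)] by (simp add: strict ss_def)

lemma ss_natural:
  assumes "kl2 X Y \<alpha>"
  shows "ss X Y (trg2 D \<alpha>) \<cdot> (eh Y \<rhd> st2 X Y \<alpha>) = (st2 (so X) (so Y) (S2 X Y \<alpha>) \<lhd> eh X) \<cdot> ss X Y (src2 D \<alpha>)"
proof -
  have "Teta R X Y (eh Y \<odot> trg2 D \<alpha>) \<cdot> (eh Y \<rhd> \<alpha>) =
    (st2 (so X) (so Y) (S2 X Y \<alpha>) \<lhd> e X) \<cdot> Teta R X Y (eh Y \<odot> src2 D \<alpha>)"
    using R.eta_natural[of X Y "eh Y \<rhd> \<alpha>"] assms kl2D[OF assms(1)] by (simp add: strict S2_def)
  from arg_cong[OF this, of "st2 X (so Y)"]
  have *: "inv2 D (mu X (so X) (so Y) (S1 X Y (trg2 D \<alpha>)) (e X)) \<cdot> (ss X Y (trg2 D \<alpha>) \<cdot> (eh Y \<rhd> st2 X Y \<alpha>)) \<cdot> mu X Y (so Y) (e Y) (src2 D \<alpha>)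
    = inv2 D (mu X (so X) (so Y) (S1 X Y (trg2 D \<alpha>)) (e X)) \<cdot> ((st2 (so X) (so Y) (S2 X Y \<alpha>) \<lhd> eh X) \<cdot> ss X Y (src2 D \<alpha>)) \<cdot> mu X Y (so Y) (e Y) (src2 D \<alpha>)"
    using assms kl2D[OF assms(1)] by (simp add: strict flat)
  show ?thesis
    by (rule D.cancel_both[OF *]) (use assms kl2D[OF assms(1)] in \<open>simp_all add: strict\<close>)
qed

text \<open>Compatibility solved for the starred 2-cell. In this form a compatible 2-cell acquires a
  rule \<open>flat\<close> of its own.\<close>

lemma st2_rcel:
  assumes "rcel Z l l' Y \<xi>" "kl W Z w"
  shows "st2 W Y (\<xi> \<lhd> w) = inv2 D (pil Z l' W w) \<cdot> (\<xi> \<lhd> st W Z w) \<cdot> pil Z l W w"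
  unfolding rcel_eq[OF assms]
  using assms(2) rcel_typ[OF assms(1)] path_Obj[OF rcel_typ(1)[OF assms(1)]]
    pil_typ[OF rcel_typ(2)[OF assms(1)] assms(2)]
    hatl_typ[OF rcel_typ(1)[OF assms(1)]] hatl_typ[OF rcel_typ(2)[OF assms(1)]]
  by (simp add: strict tydef)

lemma rcel_ss:
  assumes "kl X Y f"
  shows "rcel X [(Y, e Y, so Y), (X, f, Y)] [(so X, S1 X Y f, so Y), (X, e X, so X)] (so Y) (ss X Y f)"
proof -
  have 1: "rcel X [(X, eh Y \<odot> f, so Y)] [(X, sh X Y f \<odot> e X, so Y)] (so Y) (st2 X (so Y) (Teta R X Y (eh Y \<odot> f)))"
    using rcel_st2[of X "so Y" "Teta R X Y (eh Y \<odot> f)"] assms klD[OF assms(1)] by (simp add: strict)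
  have 2: "rcel X [(Y, e Y, so Y), (X, f, Y)] [(X, eh Y \<odot> f, so Y)] (so Y) (inv2 D (mu X Y (so Y) (e Y) f))"
    using assms klD[OF assms(1)] by (intro rcel_inv rcel_mu) (simp_all add: strict)
  have 3: "rcel X [(X, sh X Y f \<odot> e X, so Y)] [(so X, S1 X Y f, so Y), (X, e X, so X)] (so Y) (mu X (so X) (so Y) (S1 X Y f) (e X))"
    using assms klD[OF assms(1)] by (intro rcel_mu) (simp_all add: strict)
  show ?thesis unfolding ss_def by (rule rcel_vcmp[OF rcel_vcmp[OF 2 1] 3])
qed

lemma st2_ss[flat]:
  assumes "kl Y Z g" "kl X Y f"
  shows "st2 X (so Z) (ss Y Z g \<lhd> f) =
    inv2 D (mu X (so Y) (so Z) (S1 Y Z g) (eh Y \<odot> f)) \<cdot> (sh Y Z g \<rhd> inv2 D (mu X Y (so Y) (e Y) f)) \<cdot> 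
    (ss Y Z g \<lhd> st X Y f) \<cdot> (eh Z \<rhd> mu X Y Z g f) \<cdot> mu X Z (so Z) (e Z) (st Y Z g \<odot> f)"
  using st2_rcel[OF rcel_ss, of Y Z g X f] assms klD[OF assms(1)] klD[OF assms(2)] by (simp add: strict)

text \<open>The comparison of S_1 with composition. The inverse of \<open>dmu\<close> draws (S_1
  g)^* into the dagger, which leaves \<open>sh Y Z g \<odot> eh Y \<odot> f\<close> under it, and
  the inverse of \<open>ss\<close> turns this into
  \<open>eh Z \<odot> st Y Z g \<odot> f\<close>.\<close>

definition "chi X Y Z g f = dg2 X Z (inv2 D (ss Y Z g) \<lhd> f) \<cdot> inv2 D (dmu X Y Z (eh Z \<odot> g) (eh Y \<odot> f))"
definition "chih X Y Z g f = star2 R X Z (inv2 D (ss Y Z g) \<lhd> f) \<cdot> inv2 D (Tmu R X Y Z (eh Z \<odot> g) (eh Y \<odot> f))"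

lemma chi_typ:
  assumes "kl X Y f" "kl Y Z g"
  shows [strict]: "chi X Y Z g f \<in> Cel D" "src2 D (chi X Y Z g f) = sh Y Z g \<odot> S1 X Y f"
    "trg2 D (chi X Y Z g f) = S1 X Z (st Y Z g \<odot> f)" "invertible D (chi X Y Z g f)"
  using assms klD[OF assms(1)] klD[OF assms(2)] by (simp_all add: strict chi_def)

lemmas [strict] = D.into2I[OF chi_typ(1,3)]

lemma chih_typ:
  assumes "kl X Y f" "kl Y Z g"
  shows [strict]: "chih X Y Z g f \<in> Cel D" "src2 D (chih X Y Z g f) = sh Y Z g \<odot> sh X Y f"
    "trg2 D (chih X Y Z g f) = sh X Z (st Y Z g \<odot> f)" "invertible D (chih X Y Z g f)"
  using assms klD[OF assms(1)] klD[OF assms(2)] by (simp_all add: strict chih_def)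

lemmas [strict] = D.into2I[OF chih_typ(1,3)]

lemma st2_chi[flat]:
  assumes "kl X Y f" "kl Y Z g"
  shows "st2 (so X) (so Z) (chi X Y Z g f) = chih X Y Z g f \<cdot> mu (so X) (so Y) (so Z) (S1 Y Z g) (S1 X Y f)"
  using assms klD[OF assms(1)] klD[OF assms(2)] by (simp add: chi_def chih_def strict Tmu_R)

lemma rcel_chih:
  assumes "kl X Y f" "kl Y Z g"
  shows "R.rcel X [(Y, eh Z \<odot> g, Z), (X, eh Y \<odot> f, Y)] [(X, eh Z \<odot> st Y Z g \<odot> f, Z)] Z (chih X Y Z g f)"
proof -
  have 1: "R.rcel X [(X, ph Y Z (eh Z \<odot> g) \<odot> eh Y \<odot> f, Z)] [(X, eh Z \<odot> st Y Z g \<odot> f, Z)] Z (star2 R X Z (inv2 D (ss Y Z g) \<lhd> f))"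
    using R.rcel_st2[of X Z "inv2 D (ss Y Z g) \<lhd> f"] assms klD[OF assms(1)] klD[OF assms(2)] by (simp add: strict)
  have 2: "R.rcel X [(Y, eh Z \<odot> g, Z), (X, eh Y \<odot> f, Y)] [(X, ph Y Z (eh Z \<odot> g) \<odot> eh Y \<odot> f, Z)] Z (inv2 D (Tmu R X Y Z (eh Z \<odot> g) (eh Y \<odot> f)))"
    using R.rcel_inv[OF R.rcel_mu[of X Y "eh Y \<odot> f" Z "eh Z \<odot> g"]] assms klD[OF assms(1)] klD[OF assms(2)] by (simp add: strict)
  show ?thesis unfolding chih_def by (rule R.rcel_vcmp[OF 2 1])
qed

text \<open>Both halves of \<open>chih\<close> disappear at the unit of R: the inverse of
  \<open>Tmu R\<close> cancels by \<open>R.mu_eta\<close>, and the starred inverse of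
  \<open>ss\<close> moves through \<open>Teta R\<close> by naturality and meets
  \<open>ss\<close>.\<close>

lemma chih_e:
  assumes "kl X Y f" "kl Y Z g"
  shows "(chih X Y Z g f \<lhd> e X) \<cdot> (sh Y Z g \<rhd> Teta R X Y (eh Y \<odot> f)) \<cdot> (ss Y Z g \<lhd> f) =
    Teta R X Z (eh Z \<odot> st Y Z g \<odot> f)"
proof -
  have 1: "sh Y Z g \<rhd> Teta R X Y (eh Y \<odot> f) =
     (Tmu R X Y Z (eh Z \<odot> g) (eh Y \<odot> f) \<lhd> e X) \<cdot> Teta R X Z (sh Y Z g \<odot> eh Y \<odot> f)"
    using R.mu_eta[of X Y "eh Y \<odot> f" Z "eh Z \<odot> g"] assms klD[OF assms(1)] klD[OF assms(2)] by (simp add: strict)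
  have 2: "(star2 R X Z (inv2 D (ss Y Z g) \<lhd> f) \<lhd> e X) \<cdot> Teta R X Z (sh Y Z g \<odot> eh Y \<odot> f)
     = Teta R X Z (eh Z \<odot> st Y Z g \<odot> f) \<cdot> (inv2 D (ss Y Z g) \<lhd> f)"
    using R.eta_natural[of X Z "inv2 D (ss Y Z g) \<lhd> f"] assms klD[OF assms(1)] klD[OF assms(2)] by (simp add: strict)
  have "(chih X Y Z g f \<lhd> e X) \<cdot> (sh Y Z g \<rhd> Teta R X Y (eh Y \<odot> f)) \<cdot> (ss Y Z g \<lhd> f)
    = ((star2 R X Z (inv2 D (ss Y Z g) \<lhd> f) \<lhd> e X) \<cdot> Teta R X Z (sh Y Z g \<odot> eh Y \<odot> f)) \<cdot> (ss Y Z g \<lhd> f)"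
    unfolding 1 chih_def using assms klD[OF assms(1)] klD[OF assms(2)] by (simp add: strict)
  then show ?thesis unfolding 2 using assms klD[OF assms(1)] klD[OF assms(2)] by (simp add: strict)
qed

text \<open>The image of \<open>chih_e\<close> under (-)^*, with the conjugating 2-cells
  \<open>mu\<close> cancelled on both sides.\<close>

lemma chih_eh:
  assumes "kl X Y f" "kl Y Z g"
  shows "(chih X Y Z g f \<lhd> eh X) \<cdot> (sh Y Z g \<rhd> ss X Y f) \<cdot> (ss Y Z g \<lhd> st X Y f) =
    ss X Z (st Y Z g \<odot> f) \<cdot> (eh Z \<rhd> inv2 D (mu X Y Z g f))"
proof -
  \<comment> \<open>Written through \<open>st2\<close> of \<open>chi\<close>, the 2-cell
    \<open>chih\<close> can be starred again by the rules \<open>flat\<close>;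
    \<open>st2_chi\<close> would undo this form and is switched off for that computation.\<close>
  have c: "chih X Y Z g f = st2 (so X) (so Z) (chi X Y Z g f) \<cdot> inv2 D (mu (so X) (so Y) (so Z) (S1 Y Z g) (S1 X Y f))"
    using assms klD[OF assms(1)] klD[OF assms(2)] by (simp add: strict flat)
  let ?m = "mu X (so X) (so Z) (S1 X Z (st Y Z g \<odot> f)) (e X)"
  let ?n = "(eh Z \<rhd> mu X Y Z g f) \<cdot> mu X Z (so Z) (e Z) (st Y Z g \<odot> f)"
  have "st2 X (so Z) (chih X Y Z g f \<lhd> e X) =
      inv2 D ?m \<cdot> (chih X Y Z g f \<lhd> eh X) \<cdot> (sh Y Z g \<rhd> mu X (so X) (so Y) (S1 X Y f) (e X)) \<cdot> mu X (so Y) (so Z) (S1 Y Z g) (sh X Y f \<odot> e X)"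
    unfolding c using assms klD[OF assms(1)] klD[OF assms(2)] by (simp add: strict flat del: st2_chi)
  then have "inv2 D ?m \<cdot> ((chih X Y Z g f \<lhd> eh X) \<cdot> (sh Y Z g \<rhd> ss X Y f) \<cdot> (ss Y Z g \<lhd> st X Y f)) \<cdot> ?n
    = inv2 D ?m \<cdot> (ss X Z (st Y Z g \<odot> f) \<cdot> (eh Z \<rhd> inv2 D (mu X Y Z g f))) \<cdot> ?n"
    using arg_cong[OF chih_e[OF assms], of "st2 X (so Z)"] assms klD[OF assms(1)] klD[OF assms(2)] by (simp add: strict flat)
  then show ?thesis
    by (rule D.cancel_both) (use assms klD[OF assms(1)] klD[OF assms(2)] in \<open>simp_all add: strict\<close>)
qed

text \<open>Since \<open>mm X\<close> is the dagger of \<open>ti (so X)\<close>, the 2-cell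
  \<open>Teta R\<close> at \<open>ti (so X)\<close> ends in \<open>mh X \<odot> e (so X)\<close>.
  Its inverse is the left unit modification.\<close>

definition "rho X = inv2 D (Teta R (so X) X (ti (so X)))"
definition "rhoh X = th (so X) \<cdot> st2 (so X) (so X) (rho X) \<cdot> inv2 D (mu (so X) (so (so X)) (so X) (mm X) (e (so X)))"

lemma rho_typ:
  assumes "X \<in> Obj C"
  shows [strict]: "rho X \<in> Cel D" "src2 D (rho X) = mh X \<odot> e (so X)" "trg2 D (rho X) = ti (so X)"
    "invertible D (rho X)"
  using assms by (simp_all add: strict rho_def)

lemmas [strict] = D.into2I[OF rho_typ(1,3)]

lemma rhoh_typ:
  assumes "X \<in> Obj C"
  shows [strict]: "rhoh X \<in> Cel D" "src2 D (rhoh X) = mh X \<odot> eh (so X)" "trg2 D (rhoh X) = one D (Tob T (so X))"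
    "invertible D (rhoh X)"
  using assms by (simp_all add: strict rhoh_def)

lemmas [strict] = D.into2I[OF rhoh_typ(1,3)]

lemma st2_rho[flat]:
  assumes "X \<in> Obj C"
  shows "st2 (so X) (so X) (rho X) = inv2 D (th (so X)) \<cdot> rhoh X \<cdot> mu (so X) (so (so X)) (so X) (mm X) (e (so X))"
  using assms by (simp add: strict rhoh_def)

lemma rcel_rhoh:
  assumes "X \<in> Obj C"
  shows "rcel (so X) [(so (so X), mm X, so X), (so X, e (so X), so (so X))] [] (so X) (rhoh X)"
proof -
  have 1: "rcel (so X) [(so X, mh X \<odot> e (so X), so X)] [(so X, ti (so X), so X)] (so X) (st2 (so X) (so X) (rho X))"
    using rcel_st2[of "so X" "so X" "rho X"] assms by (simp add: strict)
  have 2: "rcel (so X) [(so (so X), mm X, so X), (so X, e (so X), so (so X))] [(so X, mh X \<odot> e (so X), so X)] (so X)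
      (inv2 D (mu (so X) (so (so X)) (so X) (mm X) (e (so X))))"
    using assms by (intro rcel_inv rcel_mu) (simp_all add: strict)
  show ?thesis unfolding rhoh_def by (rule rcel_vcmp[OF rcel_vcmp[OF 2 1] rcel_th]) (use assms in \<open>simp add: strict\<close>)
qed

lemma st2_rhoh[flat]:
  assumes "X \<in> Obj C" "kl W (so X) w"
  shows "st2 W (so X) (rhoh X \<lhd> w) = (rhoh X \<lhd> st W (so X) w) \<cdot> 
    (mh X \<rhd> mu W (so X) (so (so X)) (e (so X)) w) \<cdot> mu W (so (so X)) (so X) (mm X) (eh (so X) \<odot> w)"
  using st2_rcel[OF rcel_rhoh, of X W w] assms klD[OF assms(2)] by (simp add: strict)

text \<open>The unit comparison of S_1: \<open>dth\<close> identifies \<open>ti (so X)\<close> with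
  the dagger of \<open>e X\<close>, and \<open>eta\<close> rewrites \<open>e X\<close> under the
  dagger as \<open>eh X \<odot> ti X\<close>.\<close>

definition "iota X = dg2 X X (eta X (so X) (e X)) \<cdot> inv2 D (dth X)"
definition "ioth X = star2 R X X (eta X (so X) (e X)) \<cdot> inv2 D (Ttheta R X)"

lemma iota_typ:
  assumes "X \<in> Obj C"
  shows [strict]: "iota X \<in> Cel D" "src2 D (iota X) = ti (so X)" "trg2 D (iota X) = S1 X X (ti X)" "invertible D (iota X)"
  using assms by (simp_all add: strict iota_def)

lemmas [strict] = D.into2I[OF iota_typ(1,3)]

lemma ioth_typ:
  assumes "X \<in> Obj C"
  shows [strict]: "ioth X \<in> Cel D" "src2 D (ioth X) = one D (Tob T (so X))" "trg2 D (ioth X) = sh X X (ti X)" "invertible D (ioth X)"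
  using assms by (simp_all add: strict ioth_def)

lemmas [strict] = D.into2I[OF ioth_typ(1,3)]

lemma st2_iota[flat]:
  assumes "X \<in> Obj C"
  shows "st2 (so X) (so X) (iota X) = ioth X \<cdot> th (so X)"
  using assms by (simp add: strict ioth_def iota_def Ttheta_R)

lemma rcel_ioth:
  assumes "X \<in> Obj C"
  shows "R.rcel X [] [(X, eh X \<odot> ti X, X)] X (ioth X)"
proof -
  have 1: "R.rcel X [(X, e X, X)] [(X, eh X \<odot> ti X, X)] X (star2 R X X (eta X (so X) (e X)))"
    using R.rcel_st2[of X X "eta X (so X) (e X)"] assms by (simp add: strict)
  have 2: "R.rcel X [] [(X, e X, X)] X (inv2 D (Ttheta R X))"
    using R.rcel_inv[OF R.rcel_th[of X]] assms by (simp add: strict)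
  show ?thesis unfolding ioth_def by (rule R.rcel_vcmp[OF 2 1])
qed

lemma inv_Ttheta_e:
  assumes "X \<in> Obj C"
  shows "inv2 D (Ttheta R X) \<lhd> e X = Teta R X X (e X)"
proof (rule D.cancel_left)
  show "(Ttheta R X \<lhd> e X) \<cdot> (inv2 D (Ttheta R X) \<lhd> e X) = (Ttheta R X \<lhd> e X) \<cdot> Teta R X X (e X)"
    using R.th_eta[of X] assms by (simp add: strict)
qed (use assms in \<open>simp_all add: strict\<close>)

lemma ioth_e:
  assumes "X \<in> Obj C"
  shows "ioth X \<lhd> e X = Teta R X X (eh X \<odot> ti X) \<cdot> eta X (so X) (e X)"
  using R.eta_natural[of X X "eta X (so X) (e X)"] assms by (simp add: strict ioth_def inv_Ttheta_e)

lemma ioth_eh: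
  assumes "X \<in> Obj C"
  shows "ioth X \<lhd> eh X = ss X X (ti X) \<cdot> (eh X \<rhd> inv2 D (th X))"
proof -
  have c: "ioth X = st2 (so X) (so X) (iota X) \<cdot> inv2 D (th (so X))" using assms by (simp add: strict flat)
  let ?m = "mu X (so X) (so X) (S1 X X (ti X)) (e X)"
  have "st2 X (so X) (ioth X \<lhd> e X) = inv2 D ?m \<cdot> (ioth X \<lhd> eh X)"
    unfolding c using assms by (simp add: strict flat del: st2_iota)
  then have "inv2 D ?m \<cdot> (ioth X \<lhd> eh X) = inv2 D ?m \<cdot> (ss X X (ti X) \<cdot> (eh X \<rhd> inv2 D (th X)))"
    using arg_cong[OF ioth_e[OF assms], of "st2 X (so X)"] assms by (simp add: strict flat)
  then show ?thesis by (rule D.cancel_left[rotated]) (use assms in \<open>simp_all add: strict\<close>)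
qed

text \<open>Put p = \<open>dg X Y x\<close>. The first factor to act, an inverse \<open>dmu\<close>,
  draws \<open>mh Y\<close> into the dagger; \<open>rhoh\<close> cancels
  \<open>mh Y \<odot> eh (so Y)\<close> there; \<open>eta\<close> opens p as its star after
  \<open>ti (so X)\<close>; the last \<open>dmu\<close> brings that star out again. Keeping x
  general pays twice: x = \<open>eh Y \<odot> f\<close> yields naturality of the multiplication, and
  \<open>omega (so X) X (ti (so X))\<close> is the associator.\<close>

definition "omega X Y x = dmu (so X) X Y x (ti (so X)) \<cdot> dg2 (so X) Y (eta (so X) (so Y) (dg X Y x)) \<cdot>
  dg2 (so X) Y (rhoh Y \<lhd> dg X Y x) \<cdot> inv2 D (dmu (so X) (so Y) Y (ti (so Y)) (eh (so Y) \<odot> dg X Y x))"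
definition "omh X Y x = Tmu R (so X) X Y x (ti (so X)) \<cdot> star2 R (so X) Y (eta (so X) (so Y) (dg X Y x)) \<cdot>
  star2 R (so X) Y (rhoh Y \<lhd> dg X Y x) \<cdot> inv2 D (Tmu R (so X) (so Y) Y (ti (so Y)) (eh (so Y) \<odot> dg X Y x))"

lemma omega_typ:
  assumes "kl X (so Y) x" "Y \<in> Obj C"
  shows [strict]: "omega X Y x \<in> Cel D" "src2 D (omega X Y x) = mh Y \<odot> S1 (so X) (so Y) (dg X Y x)"
    "trg2 D (omega X Y x) = ph X Y x \<odot> mm X" "invertible D (omega X Y x)"
  using assms klD[OF assms(1)] by (simp_all add: strict omega_def)

lemmas [strict] = D.into2I[OF omega_typ(1,3)]

lemma omh_typ:
  assumes "kl X (so Y) x" "Y \<in> Obj C"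
  shows [strict]: "omh X Y x \<in> Cel D" "src2 D (omh X Y x) = mh Y \<odot> sh (so X) (so Y) (dg X Y x)"
    "trg2 D (omh X Y x) = ph X Y x \<odot> mh X" "invertible D (omh X Y x)"
  using assms klD[OF assms(1)] by (simp_all add: strict omh_def)

lemmas [strict] = D.into2I[OF omh_typ(1,3)]

lemma st2_omega[flat]:
  assumes "kl X (so Y) x" "Y \<in> Obj C"
  shows "st2 (so (so X)) (so Y) (omega X Y x) = inv2 D (mu (so (so X)) (so X) (so Y) (dg X Y x) (mm X)) \<cdot> omh X Y x \<cdot>
     mu (so (so X)) (so (so Y)) (so Y) (mm Y) (S1 (so X) (so Y) (dg X Y x))"
  using assms klD[OF assms(1)] by (simp add: strict omega_def omh_def Tmu_R)

lemma rcel_omh: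
  assumes "kl X (so Y) x" "Y \<in> Obj C"
  shows "R.rcel (so X) [(so Y, ti (so Y), Y), (so X, eh (so Y) \<odot> dg X Y x, so Y)] [(X, x, Y), (so X, ti (so X), X)] Y (omh X Y x)"
proof -
  let ?p = "dg X Y x"
  have 1: "R.rcel (so X) [(so X, ?p, Y)] [(so X, ph X Y x \<odot> ti (so X), Y)] Y (star2 R (so X) Y (eta (so X) (so Y) ?p))"
    using R.rcel_st2[of "so X" Y "eta (so X) (so Y) ?p"] assms klD[OF assms(1)] by (simp add: strict)
  have 2: "R.rcel (so X) [(so X, mh Y \<odot> eh (so Y) \<odot> ?p, Y)] [(so X, ?p, Y)] Y (star2 R (so X) Y (rhoh Y \<lhd> ?p))"
    using R.rcel_st2[of "so X" Y "rhoh Y \<lhd> ?p"] assms klD[OF assms(1)] by (simp add: strict)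
  have 3: "R.rcel (so X) [(so X, ph X Y x \<odot> ti (so X), Y)] [(X, x, Y), (so X, ti (so X), X)] Y (Tmu R (so X) X Y x (ti (so X)))"
    using R.rcel_mu[of "so X" X "ti (so X)" Y x] assms klD[OF assms(1)] by (simp add: strict)
  have 4: "R.rcel (so X) [(so Y, ti (so Y), Y), (so X, eh (so Y) \<odot> dg X Y x, so Y)] [(so X, mh Y \<odot> eh (so Y) \<odot> ?p, Y)] Y
     (inv2 D (Tmu R (so X) (so Y) Y (ti (so Y)) (eh (so Y) \<odot> ?p)))"
    using R.rcel_inv[OF R.rcel_mu[of "so X" "so Y" "eh (so Y) \<odot> ?p" Y "ti (so Y)"]] assms klD[OF assms(1)] by (simp add: strict)
  show ?thesis unfolding omh_def by (rule R.rcel_vcmp[OF R.rcel_vcmp[OF R.rcel_vcmp[OF 4 2] 1] 3])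
qed

text \<open>The unit of R passes the factors of \<open>omh\<close> one after another:
  \<open>R.mu_eta\<close>, then \<open>R.eta_natural\<close> for the two starred 2-cells together,
  then \<open>R.mu_eta\<close> again.\<close>

lemma omh_e:
  assumes "kl X (so Y) x" "Y \<in> Obj C"
  shows "(omh X Y x \<lhd> e (so X)) \<cdot> (mh Y \<rhd> Teta R (so X) (so Y) (eh (so Y) \<odot> dg X Y x)) =
    (ph X Y x \<rhd> Teta R (so X) X (ti (so X))) \<cdot> eta (so X) (so Y) (dg X Y x) \<cdot> (rhoh Y \<lhd> dg X Y x)"
proof -
  let ?p = "dg X Y x" and ?e = "idc D (e (so X))"
  let ?a = "eta (so X) (so Y) ?p \<cdot> (rhoh Y \<lhd> ?p)" and ?q = "mh Y \<odot> eh (so Y) \<odot> ?p"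
  have 1: "mh Y \<rhd> Teta R (so X) (so Y) (eh (so Y) \<odot> ?p) =
      (Tmu R (so X) (so Y) Y (ti (so Y)) (eh (so Y) \<odot> ?p) \<star> ?e) \<cdot> Teta R (so X) Y ?q"
    using R.mu_eta[of "so X" "so Y" "eh (so Y) \<odot> ?p" Y "ti (so Y)"] assms klD[OF assms(1)] by (simp add: strict)
  have 2: "(star2 R (so X) Y ?a \<star> ?e) \<cdot> Teta R (so X) Y ?q = Teta R (so X) Y (ph X Y x \<odot> ti (so X)) \<cdot> ?a"
    using R.eta_natural[of "so X" Y ?a] assms klD[OF assms(1)] by (simp add: strict)
  have 3: "(Tmu R (so X) X Y x (ti (so X)) \<star> ?e) \<cdot> Teta R (so X) Y (ph X Y x \<odot> ti (so X)) = ph X Y x \<rhd> Teta R (so X) X (ti (so X))"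
    using R.mu_eta[of "so X" X "ti (so X)" Y x] assms klD[OF assms(1)] by (simp add: strict)
  have "(omh X Y x \<star> ?e) \<cdot> (mh Y \<rhd> Teta R (so X) (so Y) (eh (so Y) \<odot> ?p)) =
     (Tmu R (so X) X Y x (ti (so X)) \<star> ?e) \<cdot> ((star2 R (so X) Y ?a \<star> ?e) \<cdot> Teta R (so X) Y ?q)"
    unfolding 1 omh_def using assms klD[OF assms(1)] by (simp add: strict)
  also have "\<dots> = ((Tmu R (so X) X Y x (ti (so X)) \<star> ?e) \<cdot> Teta R (so X) Y (ph X Y x \<odot> ti (so X))) \<cdot> ?a"
    unfolding 2 using assms klD[OF assms(1)] by (simp add: strict)
  finally show ?thesis unfolding 3 using assms klD[OF assms(1)] by (simp add: strict)
qed

text \<open>The image of \<open>omh_e\<close> under (-)^*. Read this way, \<open>omh\<close>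
  mediates between the left unit 2-cells at X and at Y.\<close>

lemma omh_eh:
  assumes "kl X (so Y) x" "Y \<in> Obj C"
  shows "(ph X Y x \<rhd> rhoh X) \<cdot> (omh X Y x \<lhd> eh (so X)) \<cdot> (mh Y \<rhd> ss (so X) (so Y) (dg X Y x)) =
    rhoh Y \<lhd> ph X Y x"
proof -
  let ?p = "dg X Y x"
  have c: "omh X Y x = mu (so (so X)) (so X) (so Y) (dg X Y x) (mm X) \<cdot> st2 (so (so X)) (so Y) (omega X Y x) \<cdot>
     inv2 D (mu (so (so X)) (so (so Y)) (so Y) (mm Y) (S1 (so X) (so Y) (dg X Y x)))"
    using assms klD[OF assms(1)] by (simp add: strict flat)
  have 1: "st2 (so X) (so Y) (omh X Y x \<lhd> e (so X)) =
     inv2 D (mu (so X) (so X) (so Y) ?p (mh X \<odot> e (so X))) \<cdot> (ph X Y x \<rhd> inv2 D (mu (so X) (so (so X)) (so X) (mm X) (e (so X)))) \<cdot>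
     (omh X Y x \<lhd> eh (so X)) \<cdot> (mh Y \<rhd> mu (so X) (so (so X)) (so (so Y)) (S1 (so X) (so Y) ?p) (e (so X))) \<cdot>
     mu (so X) (so (so Y)) (so Y) (mm Y) (sh (so X) (so Y) ?p \<odot> e (so X))"
    unfolding c using assms klD[OF assms(1)] by (simp add: strict flat del: st2_omega)
  have 2: "st2 (so X) (so X) (Teta R (so X) X (ti (so X))) =
     inv2 D (mu (so X) (so (so X)) (so X) (mm X) (e (so X))) \<cdot> inv2 D (rhoh X) \<cdot> th (so X)"
    using assms klD[OF assms(1)] by (simp add: strict rhoh_def rho_def)
  let ?l = "inv2 D (mu (so X) (so X) (so Y) ?p (mh X \<odot> e (so X))) \<cdot> (ph X Y x \<rhd> inv2 D (mu (so X) (so (so X)) (so X) (mm X) (e (so X)))) \<cdot>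
    (ph X Y x \<rhd> inv2 D (rhoh X))"
  let ?r = "(mh Y \<rhd> mu (so X) (so Y) (so (so Y)) (e (so Y)) ?p) \<cdot> mu (so X) (so (so Y)) (so Y) (mm Y) (eh (so Y) \<odot> ?p)"
  have "?l \<cdot> ((ph X Y x \<rhd> rhoh X) \<cdot> (omh X Y x \<lhd> eh (so X)) \<cdot> (mh Y \<rhd> ss (so X) (so Y) (dg X Y x))) \<cdot> ?r
    = ?l \<cdot> (rhoh Y \<lhd> ph X Y x) \<cdot> ?r"
    using arg_cong[OF omh_e[OF assms], of "st2 (so X) (so Y)"] assms klD[OF assms(1)] by (simp add: strict flat 1 2)
  then show ?thesis by (rule D.cancel_both) (use assms klD[OF assms(1)] in \<open>simp_all add: strict\<close>)
qed

text \<open>The right unit modification: \<open>dmu\<close> and \<open>rhoh\<close> reduce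
  \<open>mh X\<close> after \<open>S1 X (so X) (e X)\<close> to the dagger of \<open>e X\<close>,
  which \<open>dth\<close> identifies with \<open>ti (so X)\<close>.\<close>

definition "rr X = dth X \<cdot> dg2 X X (rhoh X \<lhd> e X) \<cdot> inv2 D (dmu X (so X) X (ti (so X)) (eh (so X) \<odot> e X))"
definition "rrh X = Ttheta R X \<cdot> star2 R X X (rhoh X \<lhd> e X) \<cdot> inv2 D (Tmu R X (so X) X (ti (so X)) (eh (so X) \<odot> e X))"

lemma rr_typ:
  assumes "X \<in> Obj C"
  shows [strict]: "rr X \<in> Cel D" "src2 D (rr X) = mh X \<odot> S1 X (so X) (e X)" "trg2 D (rr X) = ti (so X)" "invertible D (rr X)"
  using assms by (simp_all add: strict rr_def)

lemmas [strict] = D.into2I[OF rr_typ(1,3)]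

lemma rrh_typ:
  assumes "X \<in> Obj C"
  shows [strict]: "rrh X \<in> Cel D" "src2 D (rrh X) = mh X \<odot> sh X (so X) (e X)" "trg2 D (rrh X) = one D (Tob T (so X))" "invertible D (rrh X)"
  using assms by (simp_all add: strict rrh_def)

lemmas [strict] = D.into2I[OF rrh_typ(1,3)]

lemma st2_rr[flat]:
  assumes "X \<in> Obj C"
  shows "st2 (so X) (so X) (rr X) = inv2 D (th (so X)) \<cdot> rrh X \<cdot> mu (so X) (so (so X)) (so X) (mm X) (S1 X (so X) (e X))"
  using assms by (simp add: strict rr_def rrh_def Tmu_R Ttheta_R)

lemma rcel_rrh:
  assumes "X \<in> Obj C"
  shows "R.rcel X [(so X, ti (so X), X), (X, eh (so X) \<odot> e X, so X)] [] X (rrh X)"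
proof -
  have 1: "R.rcel X [(X, mh X \<odot> eh (so X) \<odot> e X, X)] [(X, e X, X)] X (star2 R X X (rhoh X \<lhd> e X))"
    using R.rcel_st2[of X X "rhoh X \<lhd> e X"] assms by (simp add: strict)
  have 2: "R.rcel X [(so X, ti (so X), X), (X, eh (so X) \<odot> e X, so X)] [(X, mh X \<odot> eh (so X) \<odot> e X, X)] X
     (inv2 D (Tmu R X (so X) X (ti (so X)) (eh (so X) \<odot> e X)))"
    using R.rcel_inv[OF R.rcel_mu[of X "so X" "eh (so X) \<odot> e X" X "ti (so X)"]] assms by (simp add: strict)
  show ?thesis unfolding rrh_def by (rule R.rcel_vcmp[OF R.rcel_vcmp[OF 2 1] R.rcel_th[OF assms]])
qed

lemma rrh_e:
  assumes "X \<in> Obj C"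
  shows "(rrh X \<lhd> e X) \<cdot> (mh X \<rhd> Teta R X (so X) (eh (so X) \<odot> e X)) = rhoh X \<lhd> e X"
proof -
  let ?q = "mh X \<odot> eh (so X) \<odot> e X"
  have 1: "mh X \<rhd> Teta R X (so X) (eh (so X) \<odot> e X) =
      (Tmu R X (so X) X (ti (so X)) (eh (so X) \<odot> e X) \<lhd> e X) \<cdot> Teta R X X ?q"
    using R.mu_eta[of X "so X" "eh (so X) \<odot> e X" X "ti (so X)"] assms by (simp add: strict)
  have 2: "(star2 R X X (rhoh X \<lhd> e X) \<lhd> e X) \<cdot> Teta R X X ?q = Teta R X X (e X) \<cdot> (rhoh X \<lhd> e X)"
    using R.eta_natural[of X X "rhoh X \<lhd> e X"] assms by (simp add: strict)
  have "(rrh X \<lhd> e X) \<cdot> (mh X \<rhd> Teta R X (so X) (eh (so X) \<odot> e X)) =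
    (Ttheta R X \<lhd> e X) \<cdot> ((star2 R X X (rhoh X \<lhd> e X) \<lhd> e X) \<cdot> Teta R X X ?q)"
    unfolding 1 rrh_def using assms by (simp add: strict)
  then show ?thesis unfolding 2 using assms by (simp add: strict flip: inv_Ttheta_e)
qed

lemma rrh_eh:
  assumes "X \<in> Obj C"
  shows "(rrh X \<lhd> eh X) \<cdot> (mh X \<rhd> ss X (so X) (e X)) = rhoh X \<lhd> eh X"
proof -
  have c: "rrh X = th (so X) \<cdot> st2 (so X) (so X) (rr X) \<cdot> inv2 D (mu (so X) (so (so X)) (so X) (mm X) (S1 X (so X) (e X)))"
    using assms by (simp add: strict flat)
  have 1: "st2 X (so X) (rrh X \<lhd> e X) = (rrh X \<lhd> eh X) \<cdot>
      (mh X \<rhd> mu X (so X) (so (so X)) (S1 X (so X) (e X)) (e X)) \<cdot> mu X (so (so X)) (so X) (mm X) (sh X (so X) (e X) \<odot> e X)"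
    unfolding c using assms by (simp add: strict flat del: st2_rr)
  let ?r = "(mh X \<rhd> mu X (so X) (so (so X)) (e (so X)) (e X)) \<cdot> mu X (so (so X)) (so X) (mm X) (eh (so X) \<odot> e X)"
  have "((rrh X \<lhd> eh X) \<cdot> (mh X \<rhd> ss X (so X) (e X))) \<cdot> ?r = (rhoh X \<lhd> eh X) \<cdot> ?r"
    using arg_cong[OF rrh_e[OF assms], of "st2 X (so X)"] assms by (simp add: strict flat 1)
  then show ?thesis by (rule D.cancel_right[rotated]) (use assms in \<open>simp_all add: strict\<close>)
qed

end

text \<open>The rules \<open>push\<close> restrict 2-cells of free \<open>R\<close>-algebras along \<open>e\<^sub>X\<^sup>*\<close>.\<close>

named_theorems push

section \<open>Coherence between free R-algebras\<close>

context kleisli_extension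
begin

lemma wr_assoc: "\<lbrakk>\<xi> \<in> Cel D; P \<in> Mor D; Q \<in> Mor D; src D P = trg D Q; src D (src2 D \<xi>) = trg D P\<rbrakk> \<Longrightarrow>
    \<xi> \<lhd> P \<odot> Q = (\<xi> \<lhd> P) \<lhd> Q"
  by (simp add: strict tydef)

text \<open>\<open>R.rcel_unique\<close> asks for agreement at \<open>e X\<close>. There
  \<open>eta\<close> identifies \<open>e X\<close> with \<open>eh X \<odot> ti X\<close>, so
  agreement at \<open>eh X\<close> is enough. The morphism \<open>eh X\<close> is a star, and
  \<open>ss\<close> and \<open>rhoh\<close> are 2-cells between composites of such stars; hence they
  can be slid past the 2-cells under test.\<close>

lemma rcel_test:
  assumes "R.rcel X l l' Y \<alpha>" "R.rcel X l l' Y \<beta>" "\<alpha> \<lhd> eh X = \<beta> \<lhd> eh X"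
  shows "\<alpha> = \<beta>"
proof (rule R.rcel_unique[OF assms(1,2)], rule D.cancel_left)
  note t = R.rcel_typ[OF assms(1)] R.rcel_typ[OF assms(2)]
  note T = R.path_Obj[OF t(1)] R.hatl_typ[OF t(1)] R.hatl_typ[OF t(2)] t
  have *: "\<alpha> \<lhd> eh X \<odot> ti X = \<beta> \<lhd> eh X \<odot> ti X"
  proof -
    have "\<alpha> \<lhd> eh X \<odot> ti X = (\<alpha> \<lhd> eh X) \<lhd> ti X"
      by (rule wr_assoc) (use T in \<open>simp_all add: strict\<close>)
    also have "\<dots> = \<beta> \<lhd> eh X \<odot> ti X"
      unfolding assms(3) by (rule wr_assoc[symmetric]) (use T in \<open>simp_all add: strict\<close>)
    finally show ?thesis .
  qed
  show "(R.hatl X l' \<rhd> eta X (so X) (e X)) \<cdot> (\<alpha> \<lhd> e X) = (R.hatl X l' \<rhd> eta X (so X) (e X)) \<cdot> (\<beta> \<lhd> e X)"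
    using D.slide[of "eta X (so X) (e X)" \<alpha>] D.slide[of "eta X (so X) (e X)" \<beta>] T
    by (simp add: strict tydef *)
qed (use R.rcel_typ[OF assms(1)] R.rcel_typ[OF assms(2)] R.path_Obj[OF R.rcel_typ(1)[OF assms(1)]]
    R.hatl_typ[OF R.rcel_typ(1)[OF assms(1)]] R.hatl_typ[OF R.rcel_typ(2)[OF assms(1)]] in \<open>simp_all add: strict tydef\<close>)

lemma chih_push:
  assumes "kl X Y f" "kl Y Z g"
  shows [push]: "chih X Y Z g f \<lhd> eh X =
    ss X Z (st Y Z g \<odot> f) \<cdot> (eh Z \<rhd> inv2 D (mu X Y Z g f)) \<cdot> (inv2 D (ss Y Z g) \<lhd> st X Y f) \<cdot> (sh Y Z g \<rhd> inv2 D (ss X Y f))"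
    (is "?a = ?b")
    and [push]: "inv2 D (chih X Y Z g f) \<lhd> eh X =
     (sh Y Z g \<rhd> ss X Y f) \<cdot> (ss Y Z g \<lhd> st X Y f) \<cdot> (eh Z \<rhd> mu X Y Z g f) \<cdot> inv2 D (ss X Z (st Y Z g \<odot> f))"
proof -
  let ?r = "(sh Y Z g \<rhd> ss X Y f) \<cdot> (ss Y Z g \<lhd> st X Y f)"
  show *: "?a = ?b"
    by (rule D.cancel_right[of ?r]) (use chih_eh[OF assms] klD[OF assms(1)] klD[OF assms(2)] assms in \<open>simp_all add: strict\<close>)
  show "inv2 D (chih X Y Z g f) \<lhd> eh X =
     (sh Y Z g \<rhd> ss X Y f) \<cdot> (ss Y Z g \<lhd> st X Y f) \<cdot> (eh Z \<rhd> mu X Y Z g f) \<cdot> inv2 D (ss X Z (st Y Z g \<odot> f))"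
    using arg_cong[OF *, of "inv2 D"] klD[OF assms(1)] klD[OF assms(2)] assms by (simp add: strict)
qed

lemmas ioth_push[push] = ioth_eh

lemma omh_push[push]:
  assumes "kl X (so Y) x" "Y \<in> Obj C"
  shows "omh X Y x \<lhd> eh (so X) =
    (ph X Y x \<rhd> inv2 D (rhoh X)) \<cdot> (rhoh Y \<lhd> ph X Y x) \<cdot> (mh Y \<rhd> inv2 D (ss (so X) (so Y) (dg X Y x)))"
proof -
  have "(ph X Y x \<rhd> inv2 D (rhoh X)) \<cdot> (rhoh Y \<lhd> ph X Y x) \<cdot> (mh Y \<rhd> inv2 D (ss (so X) (so Y) (dg X Y x)))
    = omh X Y x \<lhd> eh (so X)"
    unfolding omh_eh[OF assms, symmetric] using klD[OF assms(1)] assms by (simp add: strict)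
  then show ?thesis by simp
qed

lemma rrh_push[push]:
  assumes "X \<in> Obj C"
  shows "rrh X \<lhd> eh X = (rhoh X \<lhd> eh X) \<cdot> (mh X \<rhd> inv2 D (ss X (so X) (e X)))"
  unfolding rrh_eh[OF assms, symmetric] using assms by (simp add: strict)

lemma S2_push[push]:
  assumes "kl2 X Y \<alpha>"
  shows "st2 (so X) (so Y) (S2 X Y \<alpha>) \<lhd> eh X = ss X Y (trg2 D \<alpha>) \<cdot> (eh Y \<rhd> st2 X Y \<alpha>) \<cdot> inv2 D (ss X Y (src2 D \<alpha>))"
proof -
  have "(ss X Y (trg2 D \<alpha>) \<cdot> (eh Y \<rhd> st2 X Y \<alpha>)) \<cdot> inv2 D (ss X Y (src2 D \<alpha>)) = st2 (so X) (so Y) (S2 X Y \<alpha>) \<lhd> eh X"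
    unfolding ss_natural[OF assms] using assms kl2D[OF assms] by (simp add: strict)
  then show ?thesis using assms kl2D[OF assms] by (simp add: strict)
qed

text \<open>The right-hand sides are bracketed to the left in order to expose a whiskering with
  \<open>eh X\<close>, to which the rules above apply.\<close>

lemma push_past:
  assumes "into1 D Q (Tob T X)"
  shows [push]: "\<lbrakk>kl X Y f; kl Y Z g\<rbrakk> \<Longrightarrow> chih X Y Z g f \<lhd> eh X \<odot> Q = (chih X Y Z g f \<lhd> eh X) \<lhd> Q"
    and [push]: "\<lbrakk>kl X Y f; kl Y Z g\<rbrakk> \<Longrightarrow> inv2 D (chih X Y Z g f) \<lhd> eh X \<odot> Q = (inv2 D (chih X Y Z g f) \<lhd> eh X) \<lhd> Q"
    and [push]: "X \<in> Obj C \<Longrightarrow> ioth X \<lhd> eh X \<odot> Q = (ioth X \<lhd> eh X) \<lhd> Q"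
    and [push]: "\<lbrakk>kl Z (so Y) x; Y \<in> Obj C; X = so Z\<rbrakk> \<Longrightarrow> omh Z Y x \<lhd> eh X \<odot> Q = (omh Z Y x \<lhd> eh X) \<lhd> Q"
    and [push]: "X \<in> Obj C \<Longrightarrow> rrh X \<lhd> eh X \<odot> Q = (rrh X \<lhd> eh X) \<lhd> Q"
    and [push]: "kl2 X Y \<alpha> \<Longrightarrow> st2 (so X) (so Y) (S2 X Y \<alpha>) \<lhd> eh X \<odot> Q = (st2 (so X) (so Y) (S2 X Y \<alpha>) \<lhd> eh X) \<lhd> Q"
  using assms by (intro wr_assoc; simp add: strict tydef)+

text \<open>Sliding \<xi> along \<open>ss\<close> brings \<open>eh\<close> next to \<xi>, where the
  rules \<open>push\<close> can act on it. Next, \<open>rhoh\<close> does the same for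
  \<open>mh X \<odot> eh (so X)\<close> and even removes the whiskering.\<close>

lemma push_ss[push]:
  assumes "\<xi> \<in> Cel D" "src D (src2 D \<xi>) = Tob T (so Y)" "kl X Y f"
  shows "\<xi> \<lhd> sh X Y f \<odot> eh X =
    (trg2 D \<xi> \<rhd> ss X Y f) \<cdot> (\<xi> \<lhd> eh Y \<odot> st X Y f) \<cdot> (src2 D \<xi> \<rhd> inv2 D (ss X Y f))"
  using D.slide[of "inv2 D (ss X Y f)" \<xi>] assms klD[OF assms(3)] by (simp add: strict)

lemma push_rhoh[push]:
  assumes "\<xi> \<in> Cel D" "src D (src2 D \<xi>) = Tob T (so X)" "X \<in> Obj C"
  shows "\<xi> \<lhd> mh X \<odot> eh (so X) = (trg2 D \<xi> \<rhd> inv2 D (rhoh X)) \<cdot> \<xi> \<cdot> (src2 D \<xi> \<rhd> rhoh X)"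
  using D.slide[of "rhoh X" \<xi>] assms by (simp add: strict tydef)

text \<open>The pattern of all coherence lemmas below: every factor is compatible with the
  structures of a list of free maps, so \<open>rcel_test\<close> allows restriction along
  \<open>eh X\<close>. There both sides are composites of \<open>ss\<close> and \<open>mu\<close>,
  and interchange closes the gap. This one becomes the associativity axiom of the pseudofunctor
  S_1.\<close>

lemma chih_assoc:
  assumes "kl X Y f" "kl Y Z g" "kl Z V h"
  shows "st2 (so X) (so V) (S2 X V (mu Y Z V h g \<lhd> f)) \<cdot> chih X Y V (st Z V h \<odot> g) f \<cdot> (chih Y Z V h g \<lhd> sh X Y f) =
    chih X Z V h (st Y Z g \<odot> f) \<cdot> (sh Z V h \<rhd> chih X Y Z g f)"
proof -
  note K = assms klD[OF assms(1)] klD[OF assms(2)] klD[OF assms(3)]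
  let ?f = "(X, eh Y \<odot> f, Y)" and ?g = "(Y, eh Z \<odot> g, Z)" and ?h = "(Z, eh V \<odot> h, V)"
  have 1: "R.rcel X [?h, ?g, ?f] [(Y, eh V \<odot> st Z V h \<odot> g, V), ?f] V (chih Y Z V h g \<lhd> sh X Y f)"
    using R.rcel_wr[OF rcel_chih[of Y Z g V h], of X "[?f]"] K by (simp add: strict)
  have 2: "R.rcel X [(Y, eh V \<odot> st Z V h \<odot> g, V), ?f] [(X, eh V \<odot> st Y V (st Z V h \<odot> g) \<odot> f, V)] V (chih X Y V (st Z V h \<odot> g) f)"
    using rcel_chih[of X Y f V "st Z V h \<odot> g"] K by (simp add: strict)
  have 3: "R.rcel X [(X, eh V \<odot> st Y V (st Z V h \<odot> g) \<odot> f, V)] [(X, eh V \<odot> st Z V h \<odot> st Y Z g \<odot> f, V)] V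
     (st2 (so X) (so V) (S2 X V (mu Y Z V h g \<lhd> f)))"
    using R.rcel_st2[of X V "eh V \<rhd> mu Y Z V h g \<lhd> f"] K by (simp add: strict S2_def)
  have 4: "R.rcel X [?h, ?g, ?f] [?h, (X, eh Z \<odot> st Y Z g \<odot> f, Z)] V (sh Z V h \<rhd> chih X Y Z g f)"
    using R.rcel_wl[OF rcel_chih[of X Y f Z g], of "[?h]" V] K by (simp add: strict)
  have 5: "R.rcel X [?h, (X, eh Z \<odot> st Y Z g \<odot> f, Z)] [(X, eh V \<odot> st Z V h \<odot> st Y Z g \<odot> f, V)] V (chih X Z V h (st Y Z g \<odot> f))"
    using rcel_chih[of X Z "st Y Z g \<odot> f" V h] K by (simp add: strict)
  \<comment> \<open>Rewriting leaves \<open>mu\<close> and \<open>ss\<close> in opposite orders on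
    the two sides.\<close>
  have sl: "(inv2 D (ss Z V h) \<lhd> st X Z (st Y Z g \<odot> f)) \<cdot> (sh Z V h \<odot> eh Z \<rhd> inv2 D (mu X Y Z g f)) =
     (eh V \<odot> st Z V h \<rhd> inv2 D (mu X Y Z g f)) \<cdot> (inv2 D (ss Z V h) \<lhd> st Y Z g \<odot> st X Y f)"
    using D.slide[of "inv2 D (mu X Y Z g f)" "inv2 D (ss Z V h)"] K by (simp add: strict)
  show ?thesis
    by (rule rcel_test[OF R.rcel_vcmp[OF R.rcel_vcmp[OF 1 2] 3, simplified] R.rcel_vcmp[OF 4 5]])
      (use K in \<open>simp add: strict push flat sl sl[THEN D.vcmp_extend]\<close>)
qed

text \<open>List entries for R: the star of R sends the first to \<open>sh X Y f\<close> and the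
  second to \<open>mh X\<close>.\<close>

abbreviation "eF X Y f \<equiv> (X, eh Y \<odot> f, Y)"
abbreviation "eM X \<equiv> (so X, ti (so X), X)"

lemma rcel_S2:
  assumes "kl2 X Y \<alpha>"
  shows "R.rcel X [eF X Y (src2 D \<alpha>)] [eF X Y (trg2 D \<alpha>)] Y (st2 (so X) (so Y) (S2 X Y \<alpha>))"
  using R.rcel_st2[of X Y "eh Y \<rhd> \<alpha>"] assms kl2D[OF assms] by (simp add: strict S2_def)

lemma chih_natural_left:
  assumes "kl X Y f" "kl2 Y Z \<beta>"
  shows "chih X Y Z (trg2 D \<beta>) f \<cdot> (st2 (so Y) (so Z) (S2 Y Z \<beta>) \<lhd> sh X Y f) =
    st2 (so X) (so Z) (S2 X Z (st2 Y Z \<beta> \<lhd> f)) \<cdot> chih X Y Z (src2 D \<beta>) f"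
proof -
  note K = assms klD[OF assms(1)] kl2D[OF assms(2)]
  have 1: "R.rcel X [eF Y Z (src2 D \<beta>), eF X Y f] [eF Y Z (trg2 D \<beta>), eF X Y f] Z (st2 (so Y) (so Z) (S2 Y Z \<beta>) \<lhd> sh X Y f)"
    using R.rcel_wr[OF rcel_S2[OF assms(2)], of X "[eF X Y f]"] K by (simp add: strict)
  have 2: "R.rcel X [eF Y Z (trg2 D \<beta>), eF X Y f] [eF X Z (st Y Z (trg2 D \<beta>) \<odot> f)] Z (chih X Y Z (trg2 D \<beta>) f)"
    using rcel_chih[of X Y f Z "trg2 D \<beta>"] K by (simp add: strict)
  have 3: "R.rcel X [eF Y Z (src2 D \<beta>), eF X Y f] [eF X Z (st Y Z (src2 D \<beta>) \<odot> f)] Z (chih X Y Z (src2 D \<beta>) f)"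
    using rcel_chih[of X Y f Z "src2 D \<beta>"] K by (simp add: strict)
  have 4: "R.rcel X [eF X Z (st Y Z (src2 D \<beta>) \<odot> f)] [eF X Z (st Y Z (trg2 D \<beta>) \<odot> f)] Z (st2 (so X) (so Z) (S2 X Z (st2 Y Z \<beta> \<lhd> f)))"
    using rcel_S2[of X Z "st2 Y Z \<beta> \<lhd> f"] K by (simp add: strict)
  show ?thesis
    by (rule rcel_test[OF R.rcel_vcmp[OF 1 2] R.rcel_vcmp[OF 3 4]]) (use K in \<open>simp add: strict push flat\<close>)
qed

lemma chih_natural_right:
  assumes "kl Y Z g" "kl2 X Y \<alpha>"
  shows "chih X Y Z g (trg2 D \<alpha>) \<cdot> (sh Y Z g \<rhd> st2 (so X) (so Y) (S2 X Y \<alpha>)) =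
    st2 (so X) (so Z) (S2 X Z (st Y Z g \<rhd> \<alpha>)) \<cdot> chih X Y Z g (src2 D \<alpha>)"
proof -
  note K = assms klD[OF assms(1)] kl2D[OF assms(2)]
  have 1: "R.rcel X [eF Y Z g, eF X Y (src2 D \<alpha>)] [eF Y Z g, eF X Y (trg2 D \<alpha>)] Z (sh Y Z g \<rhd> st2 (so X) (so Y) (S2 X Y \<alpha>))"
    using R.rcel_wl[OF rcel_S2[OF assms(2)], of "[eF Y Z g]" Z] K by (simp add: strict)
  have 2: "R.rcel X [eF Y Z g, eF X Y (trg2 D \<alpha>)] [eF X Z (st Y Z g \<odot> trg2 D \<alpha>)] Z (chih X Y Z g (trg2 D \<alpha>))"
    using rcel_chih[of X Y "trg2 D \<alpha>" Z g] K by (simp add: strict)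
  have 3: "R.rcel X [eF Y Z g, eF X Y (src2 D \<alpha>)] [eF X Z (st Y Z g \<odot> src2 D \<alpha>)] Z (chih X Y Z g (src2 D \<alpha>))"
    using rcel_chih[of X Y "src2 D \<alpha>" Z g] K by (simp add: strict)
  have 4: "R.rcel X [eF X Z (st Y Z g \<odot> src2 D \<alpha>)] [eF X Z (st Y Z g \<odot> trg2 D \<alpha>)] Z (st2 (so X) (so Z) (S2 X Z (st Y Z g \<rhd> \<alpha>)))"
    using rcel_S2[of X Z "st Y Z g \<rhd> \<alpha>"] K by (simp add: strict)
  have sl: "(inv2 D (ss Y Z g) \<lhd> st X Y (trg2 D \<alpha>)) \<cdot> (sh Y Z g \<odot> eh Y \<rhd> st2 X Y \<alpha>) =
     (eh Z \<odot> st Y Z g \<rhd> st2 X Y \<alpha>) \<cdot> (inv2 D (ss Y Z g) \<lhd> st X Y (src2 D \<alpha>))"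
    using D.slide[of "st2 X Y \<alpha>" "inv2 D (ss Y Z g)"] K by (simp add: strict)
  show ?thesis
    by (rule rcel_test[OF R.rcel_vcmp[OF 1 2] R.rcel_vcmp[OF 3 4]])
      (use K in \<open>simp add: strict push flat sl sl[THEN D.vcmp_extend]\<close>)
qed

lemma chih_ioth:
  assumes "kl X Y f"
  shows "st2 (so X) (so Y) (S2 X Y (th Y \<lhd> f)) \<cdot> chih X Y Y (ti Y) f \<cdot> (ioth Y \<lhd> sh X Y f) = idc D (sh X Y f)"
proof -
  note K = assms klD[OF assms(1)]
  have 1: "R.rcel X [eF X Y f] [eF Y Y (ti Y), eF X Y f] Y (ioth Y \<lhd> sh X Y f)"
    using R.rcel_wr[OF rcel_ioth[of Y], of X "[eF X Y f]"] K by (simp add: strict)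
  have 2: "R.rcel X [eF Y Y (ti Y), eF X Y f] [eF X Y (st Y Y (ti Y) \<odot> f)] Y (chih X Y Y (ti Y) f)"
    using rcel_chih[of X Y f Y "ti Y"] K by (simp add: strict)
  have 3: "R.rcel X [eF X Y (st Y Y (ti Y) \<odot> f)] [eF X Y f] Y (st2 (so X) (so Y) (S2 X Y (th Y \<lhd> f)))"
    using rcel_S2[of X Y "th Y \<lhd> f"] K by (simp add: strict)
  have 4: "R.rcel X [eF X Y f] [eF X Y f] Y (idc D (sh X Y f))"
    using R.rcel_idc[of X "[eF X Y f]" Y] K by (simp add: strict)
  show ?thesis
    by (rule rcel_test[OF R.rcel_vcmp[OF R.rcel_vcmp[OF 1 2] 3, simplified] 4]) 
      (use K in \<open>simp add: strict push flat\<close>)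
qed

lemma ioth_chih:
  assumes "kl X Y f"
  shows "chih X X Y f (ti X) \<cdot> (sh X Y f \<rhd> ioth X) = st2 (so X) (so Y) (S2 X Y (eta X Y f))"
proof -
  note K = assms klD[OF assms(1)]
  have 1: "R.rcel X [eF X Y f] [eF X Y f, eF X X (ti X)] Y (sh X Y f \<rhd> ioth X)"
    using R.rcel_wl[OF rcel_ioth[of X], of "[eF X Y f]" Y] K by (simp add: strict)
  have 2: "R.rcel X [eF X Y f, eF X X (ti X)] [eF X Y (st X Y f \<odot> ti X)] Y (chih X X Y f (ti X))"
    using rcel_chih[of X X "ti X" Y f] K by (simp add: strict)
  have 3: "R.rcel X [eF X Y f] [eF X Y (st X Y f \<odot> ti X)] Y (st2 (so X) (so Y) (S2 X Y (eta X Y f)))"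
    using rcel_S2[of X Y "eta X Y f"] K by (simp add: strict)
  have sl: "(inv2 D (ss X Y f) \<lhd> st X X (ti X)) \<cdot> (sh X Y f \<odot> eh X \<rhd> inv2 D (th X)) =
    (eh Y \<odot> st X Y f \<rhd> inv2 D (th X)) \<cdot> inv2 D (ss X Y f)"
    using D.slide[of "inv2 D (th X)" "inv2 D (ss X Y f)"] K by (simp add: strict)
  show ?thesis
    by (rule rcel_test[OF R.rcel_vcmp[OF 1 2] 3]) (use K in \<open>simp add: strict push flat sl sl[THEN D.vcmp_extend]\<close>)
qed

lemma rcel_omh_F:
  assumes "kl X Y f"
  shows "R.rcel (so X) [eM Y, eF (so X) (so Y) (S1 X Y f)] [eF X Y f, eM X] Y (omh X Y (eh Y \<odot> f))"
  using rcel_omh[of X Y "eh Y \<odot> f"] assms klD[OF assms] by (simp add: strict)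

lemma rcel_omh_M:
  assumes "X \<in> Obj C"
  shows "R.rcel (so (so X)) [eM X, eF (so (so X)) (so X) (mm X)] [eM X, eM (so X)] X (omh (so X) X (ti (so X)))"
  using rcel_omh[of "so X" X "ti (so X)"] assms by (simp add: strict)

lemma omh_natural:
  assumes "kl2 X Y \<alpha>"
  shows "omh X Y (eh Y \<odot> trg2 D \<alpha>) \<cdot> (mh Y \<rhd> st2 (so (so X)) (so (so Y)) (S2 (so X) (so Y) (S2 X Y \<alpha>))) =
    (st2 (so X) (so Y) (S2 X Y \<alpha>) \<lhd> mh X) \<cdot> omh X Y (eh Y \<odot> src2 D \<alpha>)"
proof -
  note K = assms kl2D[OF assms(1)]
  have 1: "R.rcel (so X) [eM Y, eF (so X) (so Y) (S1 X Y (src2 D \<alpha>))] [eM Y, eF (so X) (so Y) (S1 X Y (trg2 D \<alpha>))] Y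
     (mh Y \<rhd> st2 (so (so X)) (so (so Y)) (S2 (so X) (so Y) (S2 X Y \<alpha>)))"
    using R.rcel_wl[OF rcel_S2[of "so X" "so Y" "S2 X Y \<alpha>"], of "[eM Y]" Y] K by (simp add: strict)
  have 2: "R.rcel (so X) [eM Y, eF (so X) (so Y) (S1 X Y (trg2 D \<alpha>))] [eF X Y (trg2 D \<alpha>), eM X] Y (omh X Y (eh Y \<odot> trg2 D \<alpha>))"
    using rcel_omh_F[of X Y "trg2 D \<alpha>"] K by simp
  have 3: "R.rcel (so X) [eM Y, eF (so X) (so Y) (S1 X Y (src2 D \<alpha>))] [eF X Y (src2 D \<alpha>), eM X] Y (omh X Y (eh Y \<odot> src2 D \<alpha>))"
    using rcel_omh_F[of X Y "src2 D \<alpha>"] K by simp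
  have 4: "R.rcel (so X) [eF X Y (src2 D \<alpha>), eM X] [eF X Y (trg2 D \<alpha>), eM X] Y (st2 (so X) (so Y) (S2 X Y \<alpha>) \<lhd> mh X)"
    using R.rcel_wr[OF rcel_S2[OF assms], of "so X" "[eM X]"] K by (simp add: strict)
  \<comment> \<open>\<open>rhoh Y\<close> ends in an identity morphism, so a 2-cell that passes it
    loses its whiskering. The same interchange recurs in the lemmas on \<open>omh\<close>
    below.\<close>
  have sl: "(rhoh Y \<lhd> sh X Y (trg2 D \<alpha>)) \<cdot> (mh Y \<odot> eh (so Y) \<rhd> st2 (so X) (so Y) (S2 X Y \<alpha>)) =
     st2 (so X) (so Y) (S2 X Y \<alpha>) \<cdot> (rhoh Y \<lhd> sh X Y (src2 D \<alpha>))"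
    using D.slide[of "st2 (so X) (so Y) (S2 X Y \<alpha>)" "rhoh Y"] K by (simp add: strict)
  show ?thesis
    by (rule rcel_test[OF R.rcel_vcmp[OF 1 2] R.rcel_vcmp[OF 3 4]])
      (use K in \<open>simp add: strict push flat sl sl[THEN D.vcmp_extend]\<close>)
qed

text \<open>The source of the composition axiom for the multiplication. \<open>S2_push\<close> frees
  \<open>chi\<close> from \<open>S2\<close>, and the resulting \<open>chih\<close> passes
  \<open>rhoh Z\<close> by interchange.\<close>

lemma omh_chih:
  assumes "kl X Y f" "kl Y Z g"
  shows "omh X Z (eh Z \<odot> st Y Z g \<odot> f) \<cdot> (mh Z \<rhd> st2 (so (so X)) (so (so Z)) (S2 (so X) (so Z) (chi X Y Z g f))) \<cdot>
      (mh Z \<rhd> chih (so X) (so Y) (so Z) (S1 Y Z g) (S1 X Y f)) =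
    (chih X Y Z g f \<lhd> mh X) \<cdot> (sh Y Z g \<rhd> omh X Y (eh Y \<odot> f)) \<cdot> (omh Y Z (eh Z \<odot> g) \<lhd> sh (so X) (so Y) (S1 X Y f))"
proof -
  note K = assms klD[OF assms(1)] klD[OF assms(2)]
  let ?gf = "st Y Z g \<odot> f" and ?f = "eF (so X) (so Y) (S1 X Y f)" and ?g = "eF (so Y) (so Z) (S1 Y Z g)"
  have 1: "R.rcel (so X) [eM Z, ?g, ?f] [eM Z, eF (so X) (so Z) (sh Y Z g \<odot> S1 X Y f)] Z (mh Z \<rhd> chih (so X) (so Y) (so Z) (S1 Y Z g) (S1 X Y f))"
    using R.rcel_wl[OF rcel_chih[of "so X" "so Y" "S1 X Y f" "so Z" "S1 Y Z g"], of "[eM Z]" Z] K by (simp add: strict)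
  have 2: "R.rcel (so X) [eM Z, eF (so X) (so Z) (sh Y Z g \<odot> S1 X Y f)] [eM Z, eF (so X) (so Z) (S1 X Z ?gf)] Z
     (mh Z \<rhd> st2 (so (so X)) (so (so Z)) (S2 (so X) (so Z) (chi X Y Z g f)))"
    using R.rcel_wl[OF rcel_S2[of "so X" "so Z" "chi X Y Z g f"], of "[eM Z]" Z] K by (simp add: strict)
  have 3: "R.rcel (so X) [eM Z, eF (so X) (so Z) (S1 X Z ?gf)] [eF X Z ?gf, eM X] Z (omh X Z (eh Z \<odot> ?gf))"
    using rcel_omh_F[of X Z ?gf] K by (simp add: strict)
  have 4: "R.rcel (so X) [eM Z, ?g, ?f] [eF Y Z g, eM Y, ?f] Z (omh Y Z (eh Z \<odot> g) \<lhd> sh (so X) (so Y) (S1 X Y f))"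
    using R.rcel_wr[OF rcel_omh_F[of Y Z g], of "so X" "[?f]"] K by (simp add: strict)
  have 5: "R.rcel (so X) [eF Y Z g, eM Y, ?f] [eF Y Z g, eF X Y f, eM X] Z (sh Y Z g \<rhd> omh X Y (eh Y \<odot> f))"
    using R.rcel_wl[OF rcel_omh_F[of X Y f], of "[eF Y Z g]" Z] K by (simp add: strict)
  have 6: "R.rcel (so X) [eF Y Z g, eF X Y f, eM X] [eF X Z ?gf, eM X] Z (chih X Y Z g f \<lhd> mh X)"
    using R.rcel_wr[OF rcel_chih[of X Y f Z g], of "so X" "[eM X]"] K by (simp add: strict)
  have sl: "(rhoh Z \<lhd> sh X Z ?gf) \<cdot> (mh Z \<odot> eh (so Z) \<rhd> chih X Y Z g f) =
     chih X Y Z g f \<cdot> (rhoh Z \<lhd> sh Y Z g \<odot> sh X Y f)"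
    using D.slide[of "chih X Y Z g f" "rhoh Z"] K by (simp add: strict)
  have A: "R.rcel (so X) [eM Z, ?g, ?f] [eF X Z ?gf, eM X] Z (omh X Z (eh Z \<odot> st Y Z g \<odot> f) \<cdot> (mh Z \<rhd> st2 (so (so X)) (so (so Z)) (S2 (so X) (so Z) (chi X Y Z g f))) \<cdot>
      (mh Z \<rhd> chih (so X) (so Y) (so Z) (S1 Y Z g) (S1 X Y f)))"
    by (rule R.rcel_vcmp[OF R.rcel_vcmp[OF 1 2] 3])
  have B: "R.rcel (so X) [eM Z, ?g, ?f] [eF X Z ?gf, eM X] Z
    ((chih X Y Z g f \<lhd> mh X) \<cdot> (sh Y Z g \<rhd> omh X Y (eh Y \<odot> f)) \<cdot> (omh Y Z (eh Z \<odot> g) \<lhd> sh (so X) (so Y) (S1 X Y f)))"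
    by (rule R.rcel_vcmp[OF R.rcel_vcmp[OF 4 5] 6])
  show ?thesis
    by (rule rcel_test[OF A B]) (use K in \<open>simp add: strict push flat sl sl[THEN D.vcmp_extend]\<close>)
qed

lemma omh_ioth:
  assumes "X \<in> Obj C"
  shows "omh X X (eh X \<odot> ti X) \<cdot> (mh X \<rhd> st2 (so (so X)) (so (so X)) (S2 (so X) (so X) (iota X))) \<cdot> (mh X \<rhd> ioth (so X)) =
    ioth X \<lhd> mh X"
proof -
  note K = assms
  have 1: "R.rcel (so X) [eM X] [eM X, eF (so X) (so X) (ti (so X))] X (mh X \<rhd> ioth (so X))"
    using R.rcel_wl[OF rcel_ioth[of "so X"], of "[eM X]" X] K by (simp add: strict)
  have 2: "R.rcel (so X) [eM X, eF (so X) (so X) (ti (so X))] [eM X, eF (so X) (so X) (S1 X X (ti X))] X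
     (mh X \<rhd> st2 (so (so X)) (so (so X)) (S2 (so X) (so X) (iota X)))"
    using R.rcel_wl[OF rcel_S2[of "so X" "so X" "iota X"], of "[eM X]" X] K by (simp add: strict)
  have 3: "R.rcel (so X) [eM X, eF (so X) (so X) (S1 X X (ti X))] [eF X X (ti X), eM X] X (omh X X (eh X \<odot> ti X))"
    using rcel_omh_F[of X X "ti X"] K by (simp add: strict)
  have 4: "R.rcel (so X) [eM X] [eF X X (ti X), eM X] X (ioth X \<lhd> mh X)"
    using R.rcel_wr[OF rcel_ioth[of X], of "so X" "[eM X]"] K by (simp add: strict)
  have sl: "(rhoh X \<lhd> sh X X (ti X)) \<cdot> (mh X \<odot> eh (so X) \<rhd> ioth X) = ioth X \<cdot> rhoh X"
    using D.slide[of "ioth X" "rhoh X"] K by (simp add: strict)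
  show ?thesis
    by (rule rcel_test[OF R.rcel_vcmp[OF R.rcel_vcmp[OF 1 2] 3] 4])
      (use K in \<open>simp add: strict push flat sl sl[THEN D.vcmp_extend]\<close>)
qed

abbreviation "hat2 X Y \<alpha> \<equiv> st2 (so X) (so Y) (S2 X Y \<alpha>)"

text \<open>Becomes the modification axiom of the associator. Because \<open>omh\<close> covers both
  the associator and naturality of the multiplication, one rule, \<open>omh_push\<close>, treats all
  of its occurrences.\<close>

lemma omh_modification:
  assumes "kl X Y f"
  shows "(sh X Y f \<rhd> omh (so X) X (ti (so X))) \<cdot> (omh X Y (eh Y \<odot> f) \<lhd> sh (so (so X)) (so X) (mm X)) \<cdot>
     (mh Y \<rhd> inv2 D (chih (so (so X)) (so X) (so Y) (S1 X Y f) (mm X))) \<cdot>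
     (mh Y \<rhd> hat2 (so (so X)) (so Y) (omega X Y (eh Y \<odot> f))) \<cdot>
     (mh Y \<rhd> chih (so (so X)) (so (so Y)) (so Y) (mm Y) (S1 (so X) (so Y) (S1 X Y f)))
   = (omh X Y (eh Y \<odot> f) \<lhd> mh (so X)) \<cdot> (mh Y \<rhd> omh (so X) (so Y) (eh (so Y) \<odot> S1 X Y f)) \<cdot>
     (omh (so Y) Y (ti (so Y)) \<lhd> sh (so (so X)) (so (so Y)) (S1 (so X) (so Y) (S1 X Y f)))"
    (is "?A = ?B")
proof -
  note K = assms klD[OF assms]
  let ?X = "so X" and ?XX = "so (so X)" and ?Y = "so Y" and ?YY = "so (so Y)"
  let ?f = "S1 X Y f" let ?ff = "S1 ?X ?Y ?f"
  let ?Fff = "eF ?XX ?YY ?ff" and ?Ff = "eF ?X ?Y ?f"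
  have 1: "R.rcel ?XX [eM Y, eF ?YY ?Y (mm Y), ?Fff] [eM Y, eF ?XX ?Y (mh Y \<odot> ?ff)] Y (mh Y \<rhd> chih ?XX ?YY ?Y (mm Y) ?ff)"
    using R.rcel_wl[OF rcel_chih[of ?XX ?YY ?ff ?Y "mm Y"], of "[eM Y]" Y] K by (simp add: strict)
  have 2: "R.rcel ?XX [eM Y, eF ?XX ?Y (mh Y \<odot> ?ff)] [eM Y, eF ?XX ?Y (sh X Y f \<odot> mm X)] Y (mh Y \<rhd> hat2 ?XX ?Y (omega X Y (eh Y \<odot> f)))"
    using R.rcel_wl[OF rcel_S2[of ?XX ?Y "omega X Y (eh Y \<odot> f)"], of "[eM Y]" Y] K by (simp add: strict)
  have 3: "R.rcel ?XX [eM Y, eF ?XX ?Y (sh X Y f \<odot> mm X)] [eM Y, ?Ff, eF ?XX ?X (mm X)] Y (mh Y \<rhd> inv2 D (chih ?XX ?X ?Y ?f (mm X)))"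
    using R.rcel_wl[OF R.rcel_inv[OF rcel_chih[of ?XX ?X "mm X" ?Y ?f]], of "[eM Y]" Y] K by (simp add: strict)
  have 4: "R.rcel ?XX [eM Y, ?Ff, eF ?XX ?X (mm X)] [eF X Y f, eM X, eF ?XX ?X (mm X)] Y (omh X Y (eh Y \<odot> f) \<lhd> sh ?XX ?X (mm X))"
    using R.rcel_wr[OF rcel_omh_F[of X Y f], of ?XX "[eF ?XX ?X (mm X)]"] K by (simp add: strict)
  have 5: "R.rcel ?XX [eF X Y f, eM X, eF ?XX ?X (mm X)] [eF X Y f, eM X, eM ?X] Y (sh X Y f \<rhd> omh ?X X (ti ?X))"
    using R.rcel_wl[OF rcel_omh_M[of X], of "[eF X Y f]" Y] K by (simp add: strict)
  have 6: "R.rcel ?XX [eM Y, eF ?YY ?Y (mm Y), ?Fff] [eM Y, eM ?Y, ?Fff] Y (omh ?Y Y (ti ?Y) \<lhd> sh ?XX ?YY ?ff)"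
    using R.rcel_wr[OF rcel_omh_M[of Y], of ?XX "[?Fff]"] K by (simp add: strict)
  have 7: "R.rcel ?XX [eM Y, eM ?Y, ?Fff] [eM Y, ?Ff, eM ?X] Y (mh Y \<rhd> omh ?X ?Y (eh ?Y \<odot> ?f))"
    using R.rcel_wl[OF rcel_omh_F[of ?X ?Y ?f], of "[eM Y]" Y] K by (simp add: strict)
  have 8: "R.rcel ?XX [eM Y, ?Ff, eM ?X] [eF X Y f, eM X, eM ?X] Y (omh X Y (eh Y \<odot> f) \<lhd> mh ?X)"
    using R.rcel_wr[OF rcel_omh_F[of X Y f], of ?XX "[eM ?X]"] K by (simp add: strict)
  have sl: "(rhoh Y \<lhd> sh X Y f \<odot> mh X) \<cdot> (mh Y \<odot> eh ?Y \<rhd> omh X Y (eh Y \<odot> f)) =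
     omh X Y (eh Y \<odot> f) \<cdot> (rhoh Y \<lhd> mh Y \<odot> sh ?X ?Y ?f)"
    using D.slide[of "omh X Y (eh Y \<odot> f)" "rhoh Y"] K by (simp add: strict)
  have A: "R.rcel ?XX [eM Y, eF ?YY ?Y (mm Y), ?Fff] [eF X Y f, eM X, eM ?X] Y ?A"
    by (rule R.rcel_vcmp[OF R.rcel_vcmp[OF R.rcel_vcmp[OF R.rcel_vcmp[OF 1 2] 3] 4] 5])
  have B: "R.rcel ?XX [eM Y, eF ?YY ?Y (mm Y), ?Fff] [eF X Y f, eM X, eM ?X] Y ?B"
    by (rule R.rcel_vcmp[OF R.rcel_vcmp[OF 6 7] 8])
  show ?thesis
    by (rule rcel_test[OF A B]) (use K in \<open>simp add: strict push flat sl sl[THEN D.vcmp_extend]\<close>)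
qed

lemma rrh_modification:
  assumes "kl X Y f"
  shows "(sh X Y f \<rhd> rrh X) \<cdot> (omh X Y (eh Y \<odot> f) \<lhd> sh X (so X) (e X)) \<cdot>
     (mh Y \<rhd> inv2 D (chih X (so X) (so Y) (S1 X Y f) (e X))) \<cdot>
     (mh Y \<rhd> hat2 X (so Y) (Teta R X Y (eh Y \<odot> f))) \<cdot> (mh Y \<rhd> chih X Y (so Y) (e Y) f)
   = rrh Y \<lhd> sh X Y f"
    (is "?A = ?B")
proof -
  note K = assms klD[OF assms]
  let ?X = "so X" and ?Y = "so Y" let ?f = "S1 X Y f"
  have 1: "R.rcel X [eM Y, eF Y ?Y (e Y), eF X Y f] [eM Y, eF X ?Y (eh Y \<odot> f)] Y (mh Y \<rhd> chih X Y ?Y (e Y) f)"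
    using R.rcel_wl[OF rcel_chih[of X Y f ?Y "e Y"], of "[eM Y]" Y] K by (simp add: strict)
  have 2: "R.rcel X [eM Y, eF X ?Y (eh Y \<odot> f)] [eM Y, eF X ?Y (sh X Y f \<odot> e X)] Y (mh Y \<rhd> hat2 X ?Y (Teta R X Y (eh Y \<odot> f)))"
    using R.rcel_wl[OF rcel_S2[of X ?Y "Teta R X Y (eh Y \<odot> f)"], of "[eM Y]" Y] K by (simp add: strict)
  have 3: "R.rcel X [eM Y, eF X ?Y (sh X Y f \<odot> e X)] [eM Y, eF ?X ?Y ?f, eF X ?X (e X)] Y (mh Y \<rhd> inv2 D (chih X ?X ?Y ?f (e X)))"
    using R.rcel_wl[OF R.rcel_inv[OF rcel_chih[of X ?X "e X" ?Y ?f]], of "[eM Y]" Y] K by (simp add: strict)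
  have 4: "R.rcel X [eM Y, eF ?X ?Y ?f, eF X ?X (e X)] [eF X Y f, eM X, eF X ?X (e X)] Y (omh X Y (eh Y \<odot> f) \<lhd> sh X ?X (e X))"
    using R.rcel_wr[OF rcel_omh_F[of X Y f], of X "[eF X ?X (e X)]"] K by (simp add: strict)
  have 5: "R.rcel X [eF X Y f, eM X, eF X ?X (e X)] [eF X Y f] Y (sh X Y f \<rhd> rrh X)"
    using R.rcel_wl[OF rcel_rrh[of X], of "[eF X Y f]" Y] K by (simp add: strict)
  have B: "R.rcel X [eM Y, eF Y ?Y (e Y), eF X Y f] [eF X Y f] Y ?B"
    using R.rcel_wr[OF rcel_rrh[of Y], of X "[eF X Y f]"] K by (simp add: strict)
  have sl: "(rhoh Y \<lhd> sh X Y f \<odot> eh X) \<cdot> (mh Y \<odot> eh ?Y \<rhd> ss X Y f) = ss X Y f \<cdot> (rhoh Y \<lhd> eh Y \<odot> st X Y f)"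
    using D.slide[of "ss X Y f" "rhoh Y"] K by (simp add: strict)
  have A: "R.rcel X [eM Y, eF Y ?Y (e Y), eF X Y f] [eF X Y f] Y ?A"
    by (rule R.rcel_vcmp[OF R.rcel_vcmp[OF R.rcel_vcmp[OF R.rcel_vcmp[OF 1 2] 3] 4] 5])
  show ?thesis
    by (rule rcel_test[OF A B]) (use K in \<open>simp add: strict push flat sl sl[THEN D.vcmp_extend]\<close>)
qed

text \<open>The associativity coherence of the pseudomonad. Here \<open>S2_push\<close> and
  \<open>flat\<close> turn the associator under \<open>S2\<close> into a further \<open>omh\<close>,
  which \<open>sl\<close> carries past \<open>rhoh X\<close>.\<close>

lemma omh_coherence:
  assumes "X \<in> Obj C"
  shows "(omh (so X) X (ti (so X)) \<lhd> mh (so (so X))) \<cdot> (mh X \<rhd> omh (so (so X)) (so X) (eh (so X) \<odot> mm X)) \<cdot>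
      (omh (so X) X (ti (so X)) \<lhd> sh (so (so (so X))) (so (so X)) (S1 (so (so X)) (so X) (mm X)))
    = (mh X \<rhd> omh (so (so X)) (so X) (ti (so (so X)))) \<cdot>
      (omh (so X) X (ti (so X)) \<lhd> sh (so (so (so X))) (so (so X)) (mm (so X))) \<cdot>
      (mh X \<rhd> inv2 D (chih (so (so (so X))) (so (so X)) (so X) (mm X) (mm (so X)))) \<cdot>
      (mh X \<rhd> hat2 (so (so (so X))) (so X) (omega (so X) X (ti (so X)))) \<cdot>
      (mh X \<rhd> chih (so (so (so X))) (so (so X)) (so X) (mm X) (S1 (so (so X)) (so X) (mm X)))"
    (is "?A = ?B")
proof -
  note K = assms
  let ?X = "so X" and ?XX = "so (so X)" and ?XXX = "so (so (so X))" let ?u = "mm X" and ?v = "mm (so X)"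
  let ?Su = "S1 ?XX ?X ?u" let ?a = "omh ?X X (ti ?X)"
  let ?Fu = "eF ?XX ?X ?u" and ?FSu = "eF ?XXX ?XX ?Su" and ?Fv = "eF ?XXX ?XX ?v"
  have 1: "R.rcel ?XXX [eM X, ?Fu, ?FSu] [eM X, eM ?X, ?FSu] X (?a \<lhd> sh ?XXX ?XX ?Su)"
    using R.rcel_wr[OF rcel_omh_M[of X], of ?XXX "[?FSu]"] K by (simp add: strict)
  have 2: "R.rcel ?XXX [eM X, eM ?X, ?FSu] [eM X, ?Fu, eM ?XX] X (mh X \<rhd> omh ?XX ?X (eh ?X \<odot> ?u))"
    using R.rcel_wl[OF rcel_omh_F[of ?XX ?X ?u], of "[eM X]" X] K by (simp add: strict)
  have 3: "R.rcel ?XXX [eM X, ?Fu, eM ?XX] [eM X, eM ?X, eM ?XX] X (?a \<lhd> mh ?XX)"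
    using R.rcel_wr[OF rcel_omh_M[of X], of ?XXX "[eM ?XX]"] K by (simp add: strict)
  have 4: "R.rcel ?XXX [eM X, ?Fu, ?FSu] [eM X, eF ?XXX ?X (mh X \<odot> ?Su)] X (mh X \<rhd> chih ?XXX ?XX ?X ?u ?Su)"
    using R.rcel_wl[OF rcel_chih[of ?XXX ?XX ?Su ?X ?u], of "[eM X]" X] K by (simp add: strict)
  have 5: "R.rcel ?XXX [eM X, eF ?XXX ?X (mh X \<odot> ?Su)] [eM X, eF ?XXX ?X (mh X \<odot> ?v)] X (mh X \<rhd> hat2 ?XXX ?X (omega ?X X (ti ?X)))"
    using R.rcel_wl[OF rcel_S2[of ?XXX ?X "omega ?X X (ti ?X)"], of "[eM X]" X] K by (simp add: strict)
  have 6: "R.rcel ?XXX [eM X, eF ?XXX ?X (mh X \<odot> ?v)] [eM X, ?Fu, ?Fv] X (mh X \<rhd> inv2 D (chih ?XXX ?XX ?X ?u ?v))"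
    using R.rcel_wl[OF R.rcel_inv[OF rcel_chih[of ?XXX ?XX ?v ?X ?u]], of "[eM X]" X] K by (simp add: strict)
  have 7: "R.rcel ?XXX [eM X, ?Fu, ?Fv] [eM X, eM ?X, ?Fv] X (?a \<lhd> sh ?XXX ?XX ?v)"
    using R.rcel_wr[OF rcel_omh_M[of X], of ?XXX "[?Fv]"] K by (simp add: strict)
  have 8: "R.rcel ?XXX [eM X, eM ?X, ?Fv] [eM X, eM ?X, eM ?XX] X (mh X \<rhd> omh ?XX ?X (ti ?XX))"
    using R.rcel_wl[OF rcel_omh_M[of ?X], of "[eM X]" X] K by (simp add: strict)
  have sl: "(rhoh X \<lhd> mh X \<odot> mh ?X) \<cdot> (mh X \<odot> eh ?X \<rhd> ?a) = ?a \<cdot> (rhoh X \<lhd> mh X \<odot> sh ?XX ?X ?u)"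
    using D.slide[of ?a "rhoh X"] K by (simp add: strict)
  have A: "R.rcel ?XXX [eM X, ?Fu, ?FSu] [eM X, eM ?X, eM ?XX] X ?A"
    by (rule R.rcel_vcmp[OF R.rcel_vcmp[OF 1 2] 3])
  have B: "R.rcel ?XXX [eM X, ?Fu, ?FSu] [eM X, eM ?X, eM ?XX] X ?B"
    by (rule R.rcel_vcmp[OF R.rcel_vcmp[OF R.rcel_vcmp[OF R.rcel_vcmp[OF 4 5] 6] 7] 8])
  show ?thesis
    by (rule rcel_test[OF A B]) (use K in \<open>simp add: strict push flat sl sl[THEN D.vcmp_extend]\<close>)
qed

lemma unit_coherence:
  assumes "X \<in> Obj C"
  shows "(mh X \<rhd> hat2 (so X) (so X) (rho X)) \<cdot> (mh X \<rhd> chih (so X) (so (so X)) (so X) (mm X) (e (so X))) =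
    (mh X \<rhd> ioth (so X)) \<cdot> (mh X \<rhd> rrh (so X)) \<cdot> (omh (so X) X (ti (so X)) \<lhd> sh (so X) (so (so X)) (e (so X)))"
    (is "?A = ?B")
proof -
  note K = assms
  let ?X = "so X" and ?XX = "so (so X)" let ?a = "omh ?X X (ti ?X)" and ?j = "eF (so X) (so (so X)) (e (so X))"
  have 1: "R.rcel ?X [eM X, eF ?XX ?X (mm X), ?j] [eM X, eF ?X ?X (mh X \<odot> e ?X)] X (mh X \<rhd> chih ?X ?XX ?X (mm X) (e ?X))"
    using R.rcel_wl[OF rcel_chih[of ?X ?XX "e ?X" ?X "mm X"], of "[eM X]" X] K by (simp add: strict)
  have 2: "R.rcel ?X [eM X, eF ?X ?X (mh X \<odot> e ?X)] [eM X, eF ?X ?X (ti ?X)] X (mh X \<rhd> hat2 ?X ?X (rho X))"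
    using R.rcel_wl[OF rcel_S2[of ?X ?X "rho X"], of "[eM X]" X] K by (simp add: strict)
  have 3: "R.rcel ?X [eM X, eF ?XX ?X (mm X), ?j] [eM X, eM ?X, ?j] X (?a \<lhd> sh ?X ?XX (e ?X))"
    using R.rcel_wr[OF rcel_omh_M[of X], of ?X "[?j]"] K by (simp add: strict)
  have 4: "R.rcel ?X [eM X, eM ?X, ?j] [eM X] X (mh X \<rhd> rrh ?X)"
    using R.rcel_wl[OF rcel_rrh[of ?X], of "[eM X]" X] K by (simp add: strict)
  have 5: "R.rcel ?X [eM X] [eM X, eF ?X ?X (ti ?X)] X (mh X \<rhd> ioth ?X)"
    using R.rcel_wl[OF rcel_ioth[of ?X], of "[eM X]" X] K by (simp add: strict)
  have B: "R.rcel ?X [eM X, eF ?XX ?X (mm X), ?j] [eM X, eF ?X ?X (ti ?X)] X ?B"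
    by (rule R.rcel_vcmp[OF R.rcel_vcmp[OF 3 4] 5])
  show ?thesis
    by (rule rcel_test[OF R.rcel_vcmp[OF 1 2] B]) (use K in \<open>simp add: strict push flat\<close>)
qed

end

section \<open>Pseudofunctors\<close>

context bicategory
begin

lemma assoc_typ:
  assumes "h \<in> Mor B" "into1 B g (src B h)" "into1 B f (src B g)"
  shows [strict]: "assoc B h g f \<in> Cel B" "src2 B (assoc B h g f) = (h \<odot> g) \<odot> f"
    "trg2 B (assoc B h g f) = h \<odot> (g \<odot> f)" "invertible B (assoc B h g f)"
  using assoc_icells[of f "src B f" "src B g" g "src B h" h "trg B h"] assms
  by (auto simp: tydef hom_def icells_def cells_def)

lemma lunit_typ:
  assumes "f \<in> Mor B"
  shows [strict]: "lunit B f \<in> Cel B" "src2 B (lunit B f) = one B (trg B f) \<odot> f"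
    "trg2 B (lunit B f) = f" "invertible B (lunit B f)"
  using lunit_icells[of f "src B f" "trg B f"] assms by (auto simp: tydef hom_def icells_def cells_def)

lemma runit_typ:
  assumes "f \<in> Mor B"
  shows [strict]: "runit B f \<in> Cel B" "src2 B (runit B f) = f"
    "trg2 B (runit B f) = f \<odot> one B (src B f)" "invertible B (runit B f)"
  using runit_icells[of f "src B f" "trg B f"] assms by (auto simp: tydef hom_def icells_def cells_def)

lemmas [strict] = into2I[OF assoc_typ(1,3)] into2I[OF lunit_typ(1,3)] into2I[OF runit_typ(1,3)]

lemma hom_iff: "f \<in> hom B X Y \<longleftrightarrow> f \<in> Mor B \<and> src B f = X \<and> trg B f = Y"
  by (auto simp: hom_def)

lemma cells_iff': "\<alpha> \<in> cells B f g \<longleftrightarrow> \<alpha> \<in> Cel B \<and> src2 B \<alpha> = f \<and> trg2 B \<alpha> = g"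
  by (auto simp: cells_def)

lemma icells_iff: "\<alpha> \<in> icells B f g \<longleftrightarrow> \<alpha> \<in> Cel B \<and> src2 B \<alpha> = f \<and> trg2 B \<alpha> = g \<and> invertible B \<alpha>"
  by (auto simp: cells_def icells_def)

end

context pseudofunctor
begin

lemmas [strict] = pob_Obj

lemma pmor_typ:
  assumes "f \<in> Mor A"
  shows pmor_Mor[strict]: "pmor F f \<in> Mor B" and src_pmor[strict]: "src B (pmor F f) = pob F (src A f)"
    and trg_pmor[strict]: "trg B (pmor F f) = pob F (trg A f)"
  using pmor_hom[of f "src A f" "trg A f"] assms by (auto simp: hom_def)

lemma pcel_typ:
  assumes "\<alpha> \<in> Cel A"
  shows pcel_Cel[strict]: "pcel F \<alpha> \<in> Cel B" and src2_pcel[strict]: "src2 B (pcel F \<alpha>) = pmor F (src2 A \<alpha>)"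
    and trg2_pcel[strict]: "trg2 B (pcel F \<alpha>) = pmor F (trg2 A \<alpha>)"
  using pcel_cells[of \<alpha> "src2 A \<alpha>" "trg2 A \<alpha>"] assms by (auto simp: cells_def)

lemma pcmp_typ:
  assumes "g \<in> Mor A" "into1 A f (src A g)"
  shows pcmp_Cel[strict]: "pcmp F g f \<in> Cel B" and src2_pcmp[strict]: "src2 B (pcmp F g f) = pmor F g \<odot>\<^bsub>B\<^esub> pmor F f"
    and trg2_pcmp[strict]: "trg2 B (pcmp F g f) = pmor F (g \<odot>\<^bsub>A\<^esub> f)" and invertible_pcmp[strict]: "invertible B (pcmp F g f)"
  using pcmp_icells[of f "src A f" "src A g" g "trg A g"] assms by (auto simp: tydef hom_def icells_def cells_def)

lemma pone_typ:
  assumes "X \<in> Obj A"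
  shows pone_Cel[strict]: "pone F X \<in> Cel B" and src2_pone[strict]: "src2 B (pone F X) = one B (pob F X)"
    and trg2_pone[strict]: "trg2 B (pone F X) = pmor F (one A X)" and invertible_pone[strict]: "invertible B (pone F X)"
  using pone_icells[OF assms] by (auto simp: icells_def cells_def)

lemmas [strict] = B.into1I[OF pmor_Mor trg_pmor] B.into2I[OF pcel_Cel trg2_pcel] B.into2I[OF pcmp_Cel trg2_pcmp]
  B.into2I[OF pone_Cel trg2_pone]

lemma pcel_idc'[strict]: "f \<in> Mor A \<Longrightarrow> pcel F (idc A f) = idc B (pmor F f)"
  by (rule pcel_idc)

lemma pcel_vcmp'[strict]: "\<beta> \<in> Cel A \<Longrightarrow> into2 A \<alpha> (src2 A \<beta>) \<Longrightarrow> pcel F (\<beta> \<cdot>\<^bsub>A\<^esub> \<alpha>) = pcel F \<beta> \<cdot>\<^bsub>B\<^esub> pcel F \<alpha>"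
  using pcel_vcmp[of \<alpha> "src2 A \<alpha>" "trg2 A \<alpha>" \<beta> "trg2 A \<beta>"] by (simp add: tydef cells_def)

lemma pcel_inverse:
  assumes "invertible A \<alpha>"
  shows invertible_pcel[strict]: "invertible B (pcel F \<alpha>)" and pcel_inv2[strict]: "pcel F (inv2 A \<alpha>) = inv2 B (pcel F \<alpha>)"
proof -
  have "inverse_cells B (pcel F \<alpha>) (pcel F (inv2 A \<alpha>))"
    using assms A.invertible_Cel by (simp add: B.inverse_cells_iff strict tydef flip: pcel_vcmp')
  then show "invertible B (pcel F \<alpha>)" "pcel F (inv2 A \<alpha>) = inv2 B (pcel F \<alpha>)"
    using B.inverse_cells_intro by metis+
qed

lemma pcmp_nat:
  "\<lbrakk>\<beta> \<in> Cel A; \<alpha> \<in> Cel A; trg A (src2 A \<alpha>) = src A (src2 A \<beta>)\<rbrakk> \<Longrightarrow>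
    pcmp F (trg2 A \<beta>) (trg2 A \<alpha>) \<cdot>\<^bsub>B\<^esub> (pcel F \<beta> \<star>\<^bsub>B\<^esub> pcel F \<alpha>) = pcel F (\<beta> \<star>\<^bsub>A\<^esub> \<alpha>) \<cdot>\<^bsub>B\<^esub> pcmp F (src2 A \<beta>) (src2 A \<alpha>)"
  using pcmp_natural[of "src2 A \<alpha>" "src A (src2 A \<alpha>)" "trg A (src2 A \<alpha>)" "src2 A \<beta>" "trg A (src2 A \<beta>)" \<alpha> "trg2 A \<alpha>" \<beta> "trg2 A \<beta>"]
  by (simp add: A.hom_iff A.cells_iff' strict)

lemma pcmp_nat_left:
  "\<lbrakk>\<beta> \<in> Cel A; f \<in> Mor A; trg A f = src A (src2 A \<beta>)\<rbrakk> \<Longrightarrow>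
    pcmp F (trg2 A \<beta>) f \<cdot>\<^bsub>B\<^esub> (pcel F \<beta> \<star>\<^bsub>B\<^esub> idc B (pmor F f)) = pcel F (\<beta> \<star>\<^bsub>A\<^esub> idc A f) \<cdot>\<^bsub>B\<^esub> pcmp F (src2 A \<beta>) f"
  using pcmp_nat[of \<beta> "idc A f"] by (simp add: strict)

lemma pcmp_nat_right:
  "\<lbrakk>g \<in> Mor A; \<alpha> \<in> Cel A; trg A (src2 A \<alpha>) = src A g\<rbrakk> \<Longrightarrow>
    pcmp F g (trg2 A \<alpha>) \<cdot>\<^bsub>B\<^esub> (idc B (pmor F g) \<star>\<^bsub>B\<^esub> pcel F \<alpha>) = pcel F (idc A g \<star>\<^bsub>A\<^esub> \<alpha>) \<cdot>\<^bsub>B\<^esub> pcmp F g (src2 A \<alpha>)"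
  using pcmp_nat[of "idc A g" \<alpha>] by (simp add: strict)

end

lemma pf_sel[simp]:
  "pob (pf_id B) X = X" "pmor (pf_id B) f = f" "pcel (pf_id B) \<alpha> = \<alpha>"
  "pcmp (pf_id B) g f = idc B (g \<odot>\<^bsub>B\<^esub> f)" "pone (pf_id B) X = idc B (one B X)"
  "pob (pf_comp C G F) X = pob G (pob F X)" "pmor (pf_comp C G F) f = pmor G (pmor F f)"
  "pcel (pf_comp C G F) \<alpha> = pcel G (pcel F \<alpha>)"
  "pcmp (pf_comp C G F) g f = pcel G (pcmp F g f) \<cdot>\<^bsub>C\<^esub> pcmp G (pmor F g) (pmor F f)"
  "pone (pf_comp C G F) X = pcel G (pone F X) \<cdot>\<^bsub>C\<^esub> pone G (pob F X)"
  by (simp_all add: pf_id_def pf_comp_def)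

lemma pseudofunctor_id:
  assumes "bicategory B" shows "pseudofunctor B B (pf_id B)"
proof -
  interpret B: bicategory B by (rule assms)
  show ?thesis
  proof (intro pseudofunctor.intro pseudofunctor_axioms.intro, goal_cases)
  qed (use assms in \<open>auto simp: B.hom_iff B.cells_iff' B.icells_iff strict tydef\<close>)
qed

text \<open>Each axiom is the image under G of the axiom for F, followed by the axiom for G;
  naturality of \<open>pcmp G\<close> glues the two.\<close>

lemma pseudofunctor_comp:
  assumes "pseudofunctor A B F" "pseudofunctor B C G"
  shows "pseudofunctor A C (pf_comp C G F)"
proof -
  interpret F: pseudofunctor A B F by (rule assms)
  interpret G: pseudofunctor B C G by (rule assms)
  note hc = F.A.hom_iff F.A.cells_iff' F.B.hom_iff F.B.cells_iff' G.B.hom_iff G.B.cells_iff' G.B.icells_iff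
  show ?thesis
  proof (intro pseudofunctor.intro pseudofunctor_axioms.intro, goal_cases)
    case (10 f X Y g Z \<alpha> f' \<beta> g')
    then have t: "f \<in> Mor A" "src A f = X" "trg A f = Y" "g \<in> Mor A" "src A g = Y" "trg A g = Z"
      "\<alpha> \<in> Cel A" "src2 A \<alpha> = f" "trg2 A \<alpha> = f'" "\<beta> \<in> Cel A" "src2 A \<beta> = g" "trg2 A \<beta> = g'" by (auto simp: hc)
    have t': "f' \<in> Mor A" "src A f' = X" "trg A f' = Y" "g' \<in> Mor A" "src A g' = Y" "trg A g' = Z"
      using t F.A.src_trg2 F.A.trg_trg2 F.A.trg2_Mor by metis+
    note T = t t'
    have 1: "pcmp G (pmor F g') (pmor F f') \<cdot>\<^bsub>C\<^esub> (pcel G (pcel F \<beta>) \<star>\<^bsub>C\<^esub> pcel G (pcel F \<alpha>)) =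
      pcel G (pcel F \<beta> \<star>\<^bsub>B\<^esub> pcel F \<alpha>) \<cdot>\<^bsub>C\<^esub> pcmp G (pmor F g) (pmor F f)"
      using G.pcmp_nat[of "pcel F \<beta>" "pcel F \<alpha>"] T by (simp add: strict)
    have 2: "pcel G (pcmp F g' f') \<cdot>\<^bsub>C\<^esub> pcel G (pcel F \<beta> \<star>\<^bsub>B\<^esub> pcel F \<alpha>) = pcel G (pcel F (\<beta> \<star>\<^bsub>A\<^esub> \<alpha>)) \<cdot>\<^bsub>C\<^esub> pcel G (pcmp F g f)"
      using arg_cong[OF F.pcmp_nat[of \<beta> \<alpha>], of "pcel G"] T by (simp add: strict tydef)
    show ?case using T by (simp add: strict tydef 1 2[THEN G.B.vcmp_extend])
  next
    case (11 f X Y g Z h W)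
    then have T: "f \<in> Mor A" "src A f = X" "trg A f = Y" "g \<in> Mor A" "src A g = Y" "trg A g = Z"
      "h \<in> Mor A" "src A h = Z" "trg A h = W" by (auto simp: hc)
    let ?f = "pmor F f" and ?g = "pmor F g" and ?h = "pmor F h"
    have 1: "pcmp G (pmor F (h \<odot>\<^bsub>A\<^esub> g)) ?f \<cdot>\<^bsub>C\<^esub> (pcel G (pcmp F h g) \<star>\<^bsub>C\<^esub> idc C (pmor G ?f)) =
       pcel G (pcmp F h g \<star>\<^bsub>B\<^esub> idc B ?f) \<cdot>\<^bsub>C\<^esub> pcmp G (?h \<odot>\<^bsub>B\<^esub> ?g) ?f"
      using G.pcmp_nat_left[of "pcmp F h g" ?f] T by (simp add: strict tydef)
    have 2: "pcmp G ?h (pmor F (g \<odot>\<^bsub>A\<^esub> f)) \<cdot>\<^bsub>C\<^esub> (idc C (pmor G ?h) \<star>\<^bsub>C\<^esub> pcel G (pcmp F g f)) =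
       pcel G (idc B ?h \<star>\<^bsub>B\<^esub> pcmp F g f) \<cdot>\<^bsub>C\<^esub> pcmp G ?h (?g \<odot>\<^bsub>B\<^esub> ?f)"
      using G.pcmp_nat_right[of ?h "pcmp F g f"] T by (simp add: strict tydef)
    have 3: "pcel G (pcel F (assoc A h g f)) \<cdot>\<^bsub>C\<^esub> pcel G (pcmp F (h \<odot>\<^bsub>A\<^esub> g) f) \<cdot>\<^bsub>C\<^esub> pcel G (pcmp F h g \<star>\<^bsub>B\<^esub> idc B ?f)
      = pcel G (pcmp F h (g \<odot>\<^bsub>A\<^esub> f)) \<cdot>\<^bsub>C\<^esub> pcel G (idc B ?h \<star>\<^bsub>B\<^esub> pcmp F g f) \<cdot>\<^bsub>C\<^esub> pcel G (assoc B ?h ?g ?f)"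
      using arg_cong[OF F.pcmp_assoc[OF 11], of "pcel G"] T by (simp add: strict tydef)
    have 4: "pcel G (assoc B ?h ?g ?f) \<cdot>\<^bsub>C\<^esub> pcmp G (?h \<odot>\<^bsub>B\<^esub> ?g) ?f \<cdot>\<^bsub>C\<^esub> (pcmp G ?h ?g \<star>\<^bsub>C\<^esub> idc C (pmor G ?f)) =
       pcmp G ?h (?g \<odot>\<^bsub>B\<^esub> ?f) \<cdot>\<^bsub>C\<^esub> (idc C (pmor G ?h) \<star>\<^bsub>C\<^esub> pcmp G ?g ?f) \<cdot>\<^bsub>C\<^esub> assoc C (pmor G ?h) (pmor G ?g) (pmor G ?f)"
      using G.pcmp_assoc[of ?f "pob F X" "pob F Y" ?g "pob F Z" ?h "pob F W"] T by (simp add: strict hc)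
    let ?r = "pcmp G (?h \<odot>\<^bsub>B\<^esub> ?g) ?f \<cdot>\<^bsub>C\<^esub> (pcmp G ?h ?g \<star>\<^bsub>C\<^esub> idc C (pmor G ?f))"
    have "pcel G (pcel F (assoc A h g f)) \<cdot>\<^bsub>C\<^esub> pcel G (pcmp F (h \<odot>\<^bsub>A\<^esub> g) f) \<cdot>\<^bsub>C\<^esub> pcel G (pcmp F h g \<star>\<^bsub>B\<^esub> idc B ?f) \<cdot>\<^bsub>C\<^esub> ?r =
      (pcel G (pcel F (assoc A h g f)) \<cdot>\<^bsub>C\<^esub> pcel G (pcmp F (h \<odot>\<^bsub>A\<^esub> g) f) \<cdot>\<^bsub>C\<^esub> pcel G (pcmp F h g \<star>\<^bsub>B\<^esub> idc B ?f)) \<cdot>\<^bsub>C\<^esub> ?r"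
      using T by (simp add: strict tydef)
    also have "\<dots> = pcel G (pcmp F h (g \<odot>\<^bsub>A\<^esub> f)) \<cdot>\<^bsub>C\<^esub> pcel G (idc B ?h \<star>\<^bsub>B\<^esub> pcmp F g f) \<cdot>\<^bsub>C\<^esub>
       (pcel G (assoc B ?h ?g ?f) \<cdot>\<^bsub>C\<^esub> ?r)"
      unfolding 3 using T by (simp add: strict tydef)
    finally show ?case unfolding 4 using T
      by (simp add: strict tydef 1[THEN G.B.vcmp_extend] 2[THEN G.B.vcmp_extend])
  next
    case (12 f X Y)
    then have T: "f \<in> Mor A" "src A f = X" "trg A f = Y" "Y \<in> Obj A" using F.A.trg_Obj by (auto simp: hc)
    let ?f = "pmor F f"
    have 1: "pcmp G (pmor F (one A Y)) ?f \<cdot>\<^bsub>C\<^esub> (pcel G (pone F Y) \<star>\<^bsub>C\<^esub> idc C (pmor G ?f)) =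
       pcel G (pone F Y \<star>\<^bsub>B\<^esub> idc B ?f) \<cdot>\<^bsub>C\<^esub> pcmp G (one B (pob F Y)) ?f"
      using G.pcmp_nat_left[of "pone F Y" ?f] T by (simp add: strict tydef)
    have 2: "pcel G (pcel F (lunit A f)) \<cdot>\<^bsub>C\<^esub> pcel G (pcmp F (one A Y) f) \<cdot>\<^bsub>C\<^esub> pcel G (pone F Y \<star>\<^bsub>B\<^esub> idc B ?f) = pcel G (lunit B ?f)"
      using arg_cong[OF F.pone_left[OF 12], of "pcel G"] T by (simp add: strict tydef)
    have 3: "pcel G (lunit B ?f) \<cdot>\<^bsub>C\<^esub> pcmp G (one B (pob F Y)) ?f \<cdot>\<^bsub>C\<^esub> (pone G (pob F Y) \<star>\<^bsub>C\<^esub> idc C (pmor G ?f)) = lunit C (pmor G ?f)"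
      using G.pone_left[of ?f "pob F X" "pob F Y"] T by (simp add: strict hc)
    show ?case unfolding pf_sel 3[symmetric] 2[symmetric] using T
      by (simp add: strict tydef 1[THEN G.B.vcmp_extend])
  next
    case (13 f X Y)
    then have T: "f \<in> Mor A" "src A f = X" "trg A f = Y" "X \<in> Obj A" using F.A.src_Obj by (auto simp: hc)
    let ?f = "pmor F f"
    have 1: "pcmp G ?f (pmor F (one A X)) \<cdot>\<^bsub>C\<^esub> (idc C (pmor G ?f) \<star>\<^bsub>C\<^esub> pcel G (pone F X)) =
       pcel G (idc B ?f \<star>\<^bsub>B\<^esub> pone F X) \<cdot>\<^bsub>C\<^esub> pcmp G ?f (one B (pob F X))"
      using G.pcmp_nat_right[of ?f "pone F X"] T by (simp add: strict tydef)
    have 2: "pcel G (pcmp F f (one A X)) \<cdot>\<^bsub>C\<^esub> pcel G (idc B ?f \<star>\<^bsub>B\<^esub> pone F X) \<cdot>\<^bsub>C\<^esub> pcel G (runit B ?f) = pcel G (pcel F (runit A f))"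
      using arg_cong[OF F.pone_right[OF 13], of "pcel G"] T by (simp add: strict tydef)
    have 3: "pcmp G ?f (one B (pob F X)) \<cdot>\<^bsub>C\<^esub> (idc C (pmor G ?f) \<star>\<^bsub>C\<^esub> pone G (pob F X)) \<cdot>\<^bsub>C\<^esub> runit C (pmor G ?f) = pcel G (runit B ?f)"
      using G.pone_right[of ?f "pob F X" "pob F Y"] T by (simp add: strict hc)
    show ?case unfolding pf_sel 3[symmetric] 2[symmetric] using T
      by (simp add: strict tydef 1[THEN G.B.vcmp_extend])
  qed (use F.A.bicategory_axioms G.B.bicategory_axioms in \<open>auto simp: hc strict tydef\<close>)
qed

section \<open>The pseudomonad on Kl(T)\<close>

context kleisli_extension
begin

text \<open>In a nested star the inner \<open>st2\<close> of \<open>chi\<close> is rewritten to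
  \<open>chih\<close> first, so a whiskered \<open>chih\<close> needs its own rule. The rules for
  \<open>ioth\<close>, \<open>omh\<close> and \<open>rrh\<close> answer the same need.\<close>

lemma st2_chih[flat]:
  assumes "kl X Y f" "kl Y Z g" "kl W (so X) w"
  shows "st2 W (so Z) (chih X Y Z g f \<lhd> w) = inv2 D (mu W (so X) (so Z) (S1 X Z (st Y Z g \<odot> f)) w) \<cdot>
     (chih X Y Z g f \<lhd> st W (so X) w) \<cdot> (sh Y Z g \<rhd> mu W (so X) (so Y) (S1 X Y f) w) \<cdot>
     mu W (so Y) (so Z) (S1 Y Z g) (sh X Y f \<odot> w)"
proof -
  note K = assms klD[OF assms(1)] klD[OF assms(2)] klD[OF assms(3)]
  have c: "chih X Y Z g f = st2 (so X) (so Z) (chi X Y Z g f) \<cdot> inv2 D (mu (so X) (so Y) (so Z) (S1 Y Z g) (S1 X Y f))"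
    using K by (simp add: strict flat)
  show ?thesis unfolding c using K by (simp add: strict flat del: st2_chi)
qed

lemma st2_ioth[flat]:
  assumes "X \<in> Obj C" "kl W (so X) w"
  shows "st2 W (so X) (ioth X \<lhd> w) = inv2 D (mu W (so X) (so X) (S1 X X (ti X)) w) \<cdot> (ioth X \<lhd> st W (so X) w)"
proof -
  note K = assms klD[OF assms(2)]
  have c: "ioth X = st2 (so X) (so X) (iota X) \<cdot> inv2 D (th (so X))" using K by (simp add: strict flat)
  show ?thesis unfolding c using K by (simp add: strict flat del: st2_iota)
qed

lemma st2_omh[flat]:
  assumes "kl X (so Y) x" "Y \<in> Obj C" "kl W (so (so X)) w"
  shows "st2 W (so Y) (omh X Y x \<lhd> w) =
     inv2 D (mu W (so X) (so Y) (dg X Y x) (mh X \<odot> w)) \<cdot> (ph X Y x \<rhd> inv2 D (mu W (so (so X)) (so X) (mm X) w)) \<cdot>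
     (omh X Y x \<lhd> st W (so (so X)) w) \<cdot> (mh Y \<rhd> mu W (so (so X)) (so (so Y)) (S1 (so X) (so Y) (dg X Y x)) w) \<cdot>
     mu W (so (so Y)) (so Y) (mm Y) (sh (so X) (so Y) (dg X Y x) \<odot> w)"
proof -
  note K = assms klD[OF assms(1)] klD[OF assms(3)]
  have c: "omh X Y x = mu (so (so X)) (so X) (so Y) (dg X Y x) (mm X) \<cdot> st2 (so (so X)) (so Y) (omega X Y x) \<cdot>
     inv2 D (mu (so (so X)) (so (so Y)) (so Y) (mm Y) (S1 (so X) (so Y) (dg X Y x)))"
    using K by (simp add: strict flat)
  show ?thesis unfolding c using K by (simp add: strict flat del: st2_omega)
qed

lemma st2_rrh[flat]:
  assumes "X \<in> Obj C" "kl W (so X) w"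
  shows "st2 W (so X) (rrh X \<lhd> w) = (rrh X \<lhd> st W (so X) w) \<cdot>
      (mh X \<rhd> mu W (so X) (so (so X)) (S1 X (so X) (e X)) w) \<cdot> mu W (so (so X)) (so X) (mm X) (sh X (so X) (e X) \<odot> w)"
proof -
  note K = assms klD[OF assms(2)]
  have c: "rrh X = th (so X) \<cdot> st2 (so X) (so X) (rr X) \<cdot> inv2 D (mu (so X) (so (so X)) (so X) (mm X) (S1 X (so X) (e X)))"
    using K by (simp add: strict flat)
  show ?thesis unfolding c using K by (simp add: strict flat del: st2_rr)
qed

lemma S2_idc[strict]: "kl X Y f \<Longrightarrow> S2 X Y (idc D f) = idc D (S1 X Y f)"
  using klD[of X Y f] by (simp add: S2_def strict)

lemma S2_vcmp[strict]:
  assumes "\<beta> \<in> Cel D" "into2 D \<alpha> (src2 D \<beta>)" "kl X Y (src2 D \<beta>)"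
  shows "S2 X Y (\<beta> \<cdot> \<alpha>) = S2 X Y \<beta> \<cdot> S2 X Y \<alpha>"
proof -
  have t: "\<alpha> \<in> Cel D" "trg2 D \<alpha> = src2 D \<beta>" using assms by (simp_all add: tydef)
  then have "src D (src2 D \<beta>) = src D (src2 D \<alpha>)" "trg D (src2 D \<beta>) = trg D (src2 D \<alpha>)"
    using D.src_trg2[of \<alpha>] D.trg_trg2[of \<alpha>] by simp_all
  then show ?thesis using assms t klD[OF assms(3)] by (simp add: S2_def strict)
qed

text \<open>Naturality in each variable separately comes from the starred versions by faithfulness;
  interchange joins the two.\<close>

lemma chi_natural:
  assumes "kl2 X Y \<alpha>" "kl2 Y Z \<beta>"
  shows "chi X Y Z (trg2 D \<beta>) (trg2 D \<alpha>) \<cdot> (hat2 Y Z \<beta> \<star> S2 X Y \<alpha>) =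
    S2 X Z (st2 Y Z \<beta> \<star> \<alpha>) \<cdot> chi X Y Z (src2 D \<beta>) (src2 D \<alpha>)"
proof -
  note K = assms kl2D[OF assms(1)] kl2D[OF assms(2)]
  have L: "chi X Y Z (trg2 D \<beta>) f \<cdot> (hat2 Y Z \<beta> \<lhd> S1 X Y f) = S2 X Z (st2 Y Z \<beta> \<lhd> f) \<cdot> chi X Y Z (src2 D \<beta>) f"
    if f: "kl X Y f" for f
  proof (rule st2_faithful[of "so X" "so Z"])
    note K = K f klD[OF f]
    show "st2 (so X) (so Z) (chi X Y Z (trg2 D \<beta>) f \<cdot> (hat2 Y Z \<beta> \<lhd> S1 X Y f)) =
       st2 (so X) (so Z) (S2 X Z (st2 Y Z \<beta> \<lhd> f) \<cdot> chi X Y Z (src2 D \<beta>) f)"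
      using K chih_natural_left[OF f assms(2), THEN D.vcmp_extend, of "mu (so X) (so Y) (so Z) (S1 Y Z (src2 D \<beta>)) (S1 X Y f)"]
      by (simp add: strict flat)
  qed (use K f klD[OF f] in \<open>simp_all add: strict\<close>)
  have R: "chi X Y Z g (trg2 D \<alpha>) \<cdot> (sh Y Z g \<rhd> S2 X Y \<alpha>) = S2 X Z (st Y Z g \<rhd> \<alpha>) \<cdot> chi X Y Z g (src2 D \<alpha>)"
    if g: "kl Y Z g" for g
  proof (rule st2_faithful[of "so X" "so Z"])
    note K = K g klD[OF g]
    show "st2 (so X) (so Z) (chi X Y Z g (trg2 D \<alpha>) \<cdot> (sh Y Z g \<rhd> S2 X Y \<alpha>)) =
       st2 (so X) (so Z) (S2 X Z (st Y Z g \<rhd> \<alpha>) \<cdot> chi X Y Z g (src2 D \<alpha>))"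
      using K chih_natural_right[OF g assms(1), THEN D.vcmp_extend, of "mu (so X) (so Y) (so Z) (S1 Y Z g) (S1 X Y (src2 D \<alpha>))"]
      by (simp add: strict flat)
  qed (use K g klD[OF g] in \<open>simp_all add: strict\<close>)
  have 1: "hat2 Y Z \<beta> \<star> S2 X Y \<alpha> = (hat2 Y Z \<beta> \<lhd> S1 X Y (trg2 D \<alpha>)) \<cdot> (sh Y Z (src2 D \<beta>) \<rhd> S2 X Y \<alpha>)"
    using D.hcmp_left_first[of "S2 X Y \<alpha>" "hat2 Y Z \<beta>"] K by (simp add: strict)
  have 2: "st2 Y Z \<beta> \<star> \<alpha> = (st2 Y Z \<beta> \<lhd> trg2 D \<alpha>) \<cdot> (st Y Z (src2 D \<beta>) \<rhd> \<alpha>)"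
    using D.hcmp_left_first[of \<alpha> "st2 Y Z \<beta>"] K by (simp add: strict)
  have "chi X Y Z (trg2 D \<beta>) (trg2 D \<alpha>) \<cdot> (hat2 Y Z \<beta> \<star> S2 X Y \<alpha>) =
     (chi X Y Z (trg2 D \<beta>) (trg2 D \<alpha>) \<cdot> (hat2 Y Z \<beta> \<lhd> S1 X Y (trg2 D \<alpha>))) \<cdot> (sh Y Z (src2 D \<beta>) \<rhd> S2 X Y \<alpha>)"
    unfolding 1 using K by (simp add: strict)
  also have "\<dots> = S2 X Z (st2 Y Z \<beta> \<lhd> trg2 D \<alpha>) \<cdot> (chi X Y Z (src2 D \<beta>) (trg2 D \<alpha>) \<cdot> (sh Y Z (src2 D \<beta>) \<rhd> S2 X Y \<alpha>))"
    using K L[of "trg2 D \<alpha>"] by (simp add: strict)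
  also have "\<dots> = S2 X Z (st2 Y Z \<beta> \<star> \<alpha>) \<cdot> chi X Y Z (src2 D \<beta>) (src2 D \<alpha>)"
    unfolding 2 using K R[of "src2 D \<beta>"] by (simp add: strict)
  finally show ?thesis .
qed

text \<open>(-)^* sends either side to a side of \<open>chih_assoc\<close> followed on the right by
  the same \<open>?Q\<close>, and it is faithful on 2-cells. The laws for \<open>omega\<close> and
  \<open>rr\<close> are obtained likewise, with a common left factor \<open>?P\<close> as
  well.\<close>

lemma chi_assoc:
  assumes "kl X Y f" "kl Y Z g" "kl Z V h"
  shows "S2 X V (mu Y Z V h g \<lhd> f) \<cdot> chi X Y V (st Z V h \<odot> g) f \<cdot> (st2 (so Y) (so V) (chi Y Z V h g) \<lhd> S1 X Y f) =
    chi X Z V h (st Y Z g \<odot> f) \<cdot> (sh Z V h \<rhd> chi X Y Z g f) \<cdot> (mu (so Y) (so Z) (so V) (S1 Z V h) (S1 Y Z g) \<lhd> S1 X Y f)"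
    (is "?L = ?R")
proof (rule st2_faithful[of "so X" "so V"])
  note K = assms klD[OF assms(1)] klD[OF assms(2)] klD[OF assms(3)]
  let ?Q = "(mu (so Y) (so Z) (so V) (S1 Z V h) (S1 Y Z g) \<lhd> sh X Y f) \<cdot> mu (so X) (so Y) (so V) (sh Z V h \<odot> S1 Y Z g) (S1 X Y f)"
  have "st2 (so X) (so V) ?L = (hat2 X V (mu Y Z V h g \<lhd> f) \<cdot> chih X Y V (st Z V h \<odot> g) f \<cdot> (chih Y Z V h g \<lhd> sh X Y f)) \<cdot> ?Q"
    using K by (simp add: strict flat)
  also have "\<dots> = st2 (so X) (so V) ?R"
    unfolding chih_assoc[OF assms] using K by (simp add: strict flat)
  finally show "st2 (so X) (so V) ?L = st2 (so X) (so V) ?R" .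
  show "kl2 (so X) (so V) ?L" "?R \<in> Cel D" "src2 D ?R = src2 D ?L" "trg2 D ?R = trg2 D ?L"
    using K by (simp_all add: strict)
qed

lemma chi_iota:
  assumes "kl X Y f"
  shows "S2 X Y (th Y \<lhd> f) \<cdot> chi X Y Y (ti Y) f \<cdot> (st2 (so Y) (so Y) (iota Y) \<lhd> S1 X Y f) = th (so Y) \<lhd> S1 X Y f"
    (is "?L = ?R")
proof (rule st2_faithful[of "so X" "so Y"])
  note K = assms klD[OF assms]
  let ?Q = "(th (so Y) \<lhd> sh X Y f) \<cdot> mu (so X) (so Y) (so Y) (ti (so Y)) (S1 X Y f)"
  have "st2 (so X) (so Y) ?L = (hat2 X Y (th Y \<lhd> f) \<cdot> chih X Y Y (ti Y) f \<cdot> (ioth Y \<lhd> sh X Y f)) \<cdot> ?Q"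
    using K by (simp add: strict flat)
  also have "\<dots> = st2 (so X) (so Y) ?R"
    unfolding chih_ioth[OF assms] using K by (simp add: strict flat)
  finally show "st2 (so X) (so Y) ?L = st2 (so X) (so Y) ?R" .
  show "kl2 (so X) (so Y) ?L" "?R \<in> Cel D" "src2 D ?R = src2 D ?L" "trg2 D ?R = trg2 D ?L"
    using K by (simp_all add: strict)
qed

lemma iota_chi:
  assumes "kl X Y f"
  shows "chi X X Y f (ti X) \<cdot> (sh X Y f \<rhd> iota X) \<cdot> eta (so X) (so Y) (S1 X Y f) = S2 X Y (eta X Y f)"
    (is "?L = ?R")
proof (rule st2_faithful[of "so X" "so Y"])
  note K = assms klD[OF assms]
  show "st2 (so X) (so Y) ?L = st2 (so X) (so Y) ?R"
    using K by (simp add: strict flat flip: ioth_chih)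
  show "kl2 (so X) (so Y) ?L" "?R \<in> Cel D" "src2 D ?R = src2 D ?L" "trg2 D ?R = trg2 D ?L"
    using K by (simp_all add: strict)
qed

definition "KS = \<lparr>pob = so, pmor = (\<lambda>(X, f, Y). (so X, S1 X Y f, so Y)), pcel = (\<lambda>(X, \<alpha>, Y). (so X, S2 X Y \<alpha>, so Y)),
  pcmp = (\<lambda>(Y, g, Z) (X, f, _). (so X, chi X Y Z g f, so Z)), pone = (\<lambda>X. (so X, iota X, so X))\<rparr>"

lemma KS_sel[simp]:
  "pob KS = so" "pmor KS (X, f, Y) = (so X, S1 X Y f, so Y)" "pcel KS (X, \<alpha>, Y) = (so X, S2 X Y \<alpha>, so Y)"
  "pcmp KS (Y, g, Z) (X, f, Y') = (so X, chi X Y Z g f, so Z)" "pone KS X = (so X, iota X, so X)"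
  by (simp_all add: KS_def)

lemma pseudofunctor_KS: "pseudofunctor K K KS"
proof (intro pseudofunctor.intro pseudofunctor_axioms.intro, goal_cases)
  case (5 \<alpha> f g)
  then show ?case by (auto simp: cells_Kl kl2D strict)
next
  case (7 \<alpha> f g \<beta> h)
  obtain X a Y X' b Y' where ab: "\<alpha> = (X, a, Y)" "\<beta> = (X', b, Y')" by (cases \<alpha>, cases \<beta>)
  have *: "X' = X" "Y' = Y" "kl2 X Y a" "kl2 X Y b" "src2 D b = trg2 D a" using 7 by (auto simp: ab cells_Kl)
  show ?case using ab *(1,2) kl2D[OF *(3)] kl2D[OF *(4)] *(3-5) by (simp add: strict)
next
  case (8 f X Y g Z)
  then obtain f0 g0 where *: "f = (X, f0, Y)" "g = (Y, g0, Z)" "kl X Y f0" "kl Y Z g0" by (auto simp: hom_Kl)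
  then show ?case using klD[OF *(3)] klD[OF *(4)] by (simp add: icells_Kl strict)
next
  case (10 f X Y g Z \<alpha> f' \<beta> g')
  then obtain a b where *: "\<alpha> = (X, a, Y)" "\<beta> = (Y, b, Z)" "kl2 X Y a" "kl2 Y Z b"
    "f = (X, src2 D a, Y)" "f' = (X, trg2 D a, Y)" "g = (Y, src2 D b, Z)" "g' = (Y, trg2 D b, Z)" by (auto simp: cells_Kl hom_Kl)
  then show ?case using chi_natural[OF *(3,4)] by simp
next
  case (11 f X Y g Z h W)
  then obtain f0 g0 h0 where *: "f = (X, f0, Y)" "g = (Y, g0, Z)" "h = (Z, h0, W)" "kl X Y f0" "kl Y Z g0" "kl Z W h0" by (auto simp: hom_Kl)
  then show ?case using chi_assoc[OF *(4-6)] klD[OF *(6)] by (simp add: strict)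
next
  case (12 f X Y)
  then obtain f0 where *: "f = (X, f0, Y)" "kl X Y f0" by (auto simp: hom_Kl)
  then show ?case using chi_iota[OF *(2)] by simp
next
  case (13 f X Y)
  then obtain f0 where *: "f = (X, f0, Y)" "kl X Y f0" by (auto simp: hom_Kl)
  then show ?case using iota_chi[OF *(2)] by (simp add: strict)
qed (use bicategory_Kl in \<open>auto simp: hom_Kl cells_Kl icells_Kl Mor_Kl strict dest: klD\<close>)

lemma unit_natural:
  assumes "kl2 X Y \<alpha>"
  shows "Teta R X Y (eh Y \<odot> trg2 D \<alpha>) \<cdot> (eh Y \<rhd> \<alpha>) = (hat2 X Y \<alpha> \<lhd> e X) \<cdot> Teta R X Y (eh Y \<odot> src2 D \<alpha>)"
  using R.eta_natural[of X Y "eh Y \<rhd> \<alpha>"] assms kl2D[OF assms] by (simp add: strict S2_def)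

text \<open>This is \<open>chih_e\<close>, once \<open>st2\<close> of \<open>chi\<close> has been
  rewritten through \<open>chih\<close> and the adjacent \<open>mu\<close> cancelled.\<close>

lemma unit_cmp:
  assumes "kl X Y f" "kl Y Z g"
  shows "Teta R X Z (eh Z \<odot> st Y Z g \<odot> f) \<cdot> (mu Y Z (so Z) (e Z) g \<lhd> f) =
     (st2 (so X) (so Z) (chi X Y Z g f) \<lhd> e X) \<cdot> (inv2 D (mu (so X) (so Y) (so Z) (S1 Y Z g) (S1 X Y f)) \<lhd> e X) \<cdot>
     (sh Y Z g \<rhd> Teta R X Y (eh Y \<odot> f)) \<cdot> (mu Y (so Y) (so Z) (S1 Y Z g) (e Y) \<lhd> f) \<cdot>
     (st2 Y (so Z) (Teta R Y Z (eh Z \<odot> g)) \<lhd> f)"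
  using klD[OF assms(1)] klD[OF assms(2)] assms by (simp add: strict flat flip: chih_e)

lemma unit_one:
  assumes "X \<in> Obj C"
  shows "Teta R X X (eh X \<odot> ti X) \<cdot> eta X (so X) (e X) \<cdot> (th (so X) \<lhd> e X) = st2 (so X) (so X) (iota X) \<lhd> e X"
proof -
  have "Teta R X X (eh X \<odot> ti X) \<cdot> eta X (so X) (e X) \<cdot> (th (so X) \<lhd> e X) = (ioth X \<lhd> e X) \<cdot> (th (so X) \<lhd> e X)"
    unfolding ioth_e[OF assms] using assms by (simp add: strict)
  then show ?thesis using assms by (simp add: strict flat)
qed

lemma omega_natural:
  assumes "kl2 X Y \<alpha>"
  shows "omega X Y (eh Y \<odot> trg2 D \<alpha>) \<cdot> (mh Y \<rhd> S2 (so X) (so Y) (S2 X Y \<alpha>)) =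
    (hat2 X Y \<alpha> \<lhd> mm X) \<cdot> omega X Y (eh Y \<odot> src2 D \<alpha>)" (is "?L = ?R")
proof (rule st2_faithful[of "so (so X)" "so Y"])
  note K = assms kl2D[OF assms]
  let ?P = "inv2 D (mu (so (so X)) (so X) (so Y) (S1 X Y (trg2 D \<alpha>)) (mm X))"
  let ?Q = "mu (so (so X)) (so (so Y)) (so Y) (mm Y) (S1 (so X) (so Y) (S1 X Y (src2 D \<alpha>)))"
  have "st2 (so (so X)) (so Y) ?L = ?P \<cdot> (omh X Y (eh Y \<odot> trg2 D \<alpha>) \<cdot> (mh Y \<rhd> st2 (so (so X)) (so (so Y)) (S2 (so X) (so Y) (S2 X Y \<alpha>)))) \<cdot> ?Q"
    using K by (simp add: strict flat)
  also have "\<dots> = st2 (so (so X)) (so Y) ?R" unfolding omh_natural[OF assms] using K by (simp add: strict flat)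
  finally show "st2 (so (so X)) (so Y) ?L = st2 (so (so X)) (so Y) ?R" .
  show "kl2 (so (so X)) (so Y) ?L" "?R \<in> Cel D" "src2 D ?R = src2 D ?L" "trg2 D ?R = trg2 D ?L"
    using K by (simp_all add: strict)
qed

lemma omega_chi:
  assumes "kl X Y f" "kl Y Z g"
  shows "omega X Z (eh Z \<odot> st Y Z g \<odot> f) \<cdot>
     (mh Z \<rhd> (S2 (so X) (so Z) (chi X Y Z g f) \<cdot> chi (so X) (so Y) (so Z) (S1 Y Z g) (S1 X Y f))) \<cdot>
     (mu (so (so Y)) (so (so Z)) (so Z) (mm Z) (S1 (so Y) (so Z) (S1 Y Z g)) \<lhd> S1 (so X) (so Y) (S1 X Y f))
   = (st2 (so X) (so Z) (chi X Y Z g f) \<lhd> mm X) \<cdot> (inv2 D (mu (so X) (so Y) (so Z) (S1 Y Z g) (S1 X Y f)) \<lhd> mm X) \<cdot>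
     (sh Y Z g \<rhd> omega X Y (eh Y \<odot> f)) \<cdot>
     (mu (so (so Y)) (so Y) (so Z) (S1 Y Z g) (mm Y) \<lhd> S1 (so X) (so Y) (S1 X Y f)) \<cdot>
     (st2 (so (so Y)) (so Z) (omega Y Z (eh Z \<odot> g)) \<lhd> S1 (so X) (so Y) (S1 X Y f))" (is "?L = ?R")
proof (rule st2_faithful[of "so (so X)" "so Z"])
  note K = assms klD[OF assms(1)] klD[OF assms(2)]
  let ?SSg = "S1 (so Y) (so Z) (S1 Y Z g)" and ?SSf = "S1 (so X) (so Y) (S1 X Y f)"
  let ?P = "inv2 D (mu (so (so X)) (so X) (so Z) (S1 X Z (st Y Z g \<odot> f)) (mm X))"
  let ?Q = "(mu (so (so Y)) (so (so Z)) (so Z) (mm Z) ?SSg \<lhd> sh (so X) (so Y) (S1 X Y f)) \<cdot>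
    mu (so (so X)) (so (so Y)) (so Z) (mh Z \<odot> ?SSg) ?SSf"
  have "st2 (so (so X)) (so Z) ?L = ?P \<cdot> (omh X Z (eh Z \<odot> st Y Z g \<odot> f) \<cdot> (mh Z \<rhd> st2 (so (so X)) (so (so Z)) (S2 (so X) (so Z) (chi X Y Z g f))) \<cdot>
      (mh Z \<rhd> chih (so X) (so Y) (so Z) (S1 Y Z g) (S1 X Y f))) \<cdot> ?Q"
    using K by (simp add: strict flat)
  also have "\<dots> = st2 (so (so X)) (so Z) ?R" unfolding omh_chih[OF assms] using K by (simp add: strict flat)
  finally show "st2 (so (so X)) (so Z) ?L = st2 (so (so X)) (so Z) ?R" .
  show "kl2 (so (so X)) (so Z) ?L" "?R \<in> Cel D" "src2 D ?R = src2 D ?L" "trg2 D ?R = trg2 D ?L"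
    using K by (simp_all add: strict)
qed

lemma omega_iota:
  assumes "X \<in> Obj C"
  shows "omega X X (eh X \<odot> ti X) \<cdot> (mh X \<rhd> (S2 (so X) (so X) (iota X) \<cdot> iota (so X))) \<cdot>
     eta (so (so X)) (so X) (mm X) \<cdot> (th (so X) \<lhd> mm X) = st2 (so X) (so X) (iota X) \<lhd> mm X" (is "?L = ?R")
proof (rule st2_faithful[of "so (so X)" "so X"])
  note K = assms
  let ?P = "inv2 D (mu (so (so X)) (so X) (so X) (S1 X X (ti X)) (mm X))"
  let ?Q = "(th (so X) \<lhd> mh X) \<cdot> mu (so (so X)) (so X) (so X) (ti (so X)) (mm X)"
  have "st2 (so (so X)) (so X) ?L = ?P \<cdot> (omh X X (eh X \<odot> ti X) \<cdot> (mh X \<rhd> st2 (so (so X)) (so (so X)) (S2 (so X) (so X) (iota X))) \<cdot> (mh X \<rhd> ioth (so X))) \<cdot> ?Q"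
    using K by (simp add: strict flat)
  also have "\<dots> = st2 (so (so X)) (so X) ?R" unfolding omh_ioth[OF assms] using K by (simp add: strict flat)
  finally show "st2 (so (so X)) (so X) ?L = st2 (so (so X)) (so X) ?R" .
  show "kl2 (so (so X)) (so X) ?L" "?R \<in> Cel D" "src2 D ?R = src2 D ?L" "trg2 D ?R = trg2 D ?L"
    using K by (simp_all add: strict)
qed

text \<open>Here \<open>omh_e\<close> at x = \<open>eh Y \<odot> f\<close> already is the statement
  up to cancellation, since \<open>rho\<close> is the inverse of a unit 2-cell of R.\<close>

lemma rho_modification:
  assumes "kl X Y f"
  shows "(sh X Y f \<rhd> rho X) \<cdot>
     (mu (so (so X)) (so X) (so Y) (S1 X Y f) (mm X) \<lhd> e (so X)) \<cdot>
     (st2 (so (so X)) (so Y) (omega X Y (eh Y \<odot> f)) \<lhd> e (so X)) \<cdot>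
     (inv2 D (mu (so (so X)) (so (so Y)) (so Y) (mm Y) (S1 (so X) (so Y) (S1 X Y f))) \<lhd> e (so X)) \<cdot>
     (mh Y \<rhd> Teta R (so X) (so Y) (eh (so Y) \<odot> S1 X Y f)) \<cdot>
     (mu (so Y) (so (so Y)) (so Y) (mm Y) (e (so Y)) \<lhd> S1 X Y f)
   = (eta (so X) (so Y) (S1 X Y f) \<cdot> (th (so Y) \<lhd> S1 X Y f)) \<cdot> (st2 (so Y) (so Y) (rho Y) \<lhd> S1 X Y f)"
proof -
  note K = assms klD[OF assms]
  have E: "(omh X Y (eh Y \<odot> f) \<lhd> e (so X)) \<cdot> (mh Y \<rhd> Teta R (so X) (so Y) (eh (so Y) \<odot> S1 X Y f)) =
    (sh X Y f \<rhd> inv2 D (rho X)) \<cdot> (eta (so X) (so Y) (S1 X Y f) \<cdot> (rhoh Y \<lhd> S1 X Y f))"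
    using omh_e[of X Y "eh Y \<odot> f"] K by (simp add: strict rho_def)
  show ?thesis using K by (simp add: strict flat E[THEN D.vcmp_extend])
qed

lemma omega_modification:
  assumes "kl X Y f"
  defines "f1 \<equiv> S1 X Y f" and "f2 \<equiv> S1 (so X) (so Y) (S1 X Y f)" and "f3 \<equiv> S1 (so (so X)) (so (so Y)) (S1 (so X) (so Y) (S1 X Y f))"
    and "u \<equiv> S1 (so (so X)) (so X) (mm X)" and "v \<equiv> S1 (so (so Y)) (so Y) (mm Y)"
  shows "(sh X Y f \<rhd> omega (so X) X (ti (so X))) \<cdot> 
     (mu (so (so X)) (so X) (so Y) f1 (mm X) \<lhd> u) \<cdot> (st2 (so (so X)) (so Y) (omega X Y (eh Y \<odot> f)) \<lhd> u) \<cdot>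
     (inv2 D (mu (so (so X)) (so (so Y)) (so Y) (mm Y) f2) \<lhd> u) \<cdot>
     (mh Y \<rhd> (inv2 D (chi (so (so X)) (so X) (so Y) f1 (mm X)) \<cdot> S2 (so (so X)) (so Y) (omega X Y (eh Y \<odot> f)) \<cdot>
        chi (so (so X)) (so (so Y)) (so Y) (mm Y) f2)) \<cdot>
     (mu (so (so (so Y))) (so (so Y)) (so Y) (mm Y) v \<lhd> f3)
   = ((mu (so (so X)) (so X) (so Y) f1 (mm X) \<lhd> mm (so X)) \<cdot> (st2 (so (so X)) (so Y) (omega X Y (eh Y \<odot> f)) \<lhd> mm (so X)) \<cdot>
      (inv2 D (mu (so (so X)) (so (so Y)) (so Y) (mm Y) f2) \<lhd> mm (so X)) \<cdot>
      (mh Y \<rhd> omega (so X) (so Y) (eh (so Y) \<odot> f1)) \<cdot>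
      (mu (so (so (so Y))) (so (so Y)) (so Y) (mm Y) (mm (so Y)) \<lhd> f3)) \<cdot>
     (st2 (so (so (so Y))) (so Y) (omega (so Y) Y (ti (so Y))) \<lhd> f3)" (is "?L = ?R")
proof (rule st2_faithful[of "so (so (so X))" "so Y"])
  note K = assms klD[OF assms(1)]
  let ?Z = "so (so (so X))"
  let ?P = "inv2 D (mu ?Z (so X) (so Y) f1 (mh X \<odot> mm (so X))) \<cdot> (sh X Y f \<rhd> inv2 D (mu ?Z (so (so X)) (so X) (mm X) (mm (so X))))"
  let ?Q = "(mu (so (so (so Y))) (so (so Y)) (so Y) (mm Y) v \<lhd> st ?Z (so (so (so Y))) f3) \<cdot>
    mu ?Z (so (so (so Y))) (so Y) (mh Y \<odot> v) f3"
  have "st2 ?Z (so Y) ?L = ?P \<cdot> ((sh X Y f \<rhd> omh (so X) X (ti (so X))) \<cdot> (omh X Y (eh Y \<odot> f) \<lhd> sh (so (so X)) (so X) (mm X)) \<cdot>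
     (mh Y \<rhd> inv2 D (chih (so (so X)) (so X) (so Y) (S1 X Y f) (mm X))) \<cdot>
     (mh Y \<rhd> hat2 (so (so X)) (so Y) (omega X Y (eh Y \<odot> f))) \<cdot>
     (mh Y \<rhd> chih (so (so X)) (so (so Y)) (so Y) (mm Y) (S1 (so X) (so Y) (S1 X Y f)))) \<cdot> ?Q"
    unfolding assms(2-) using K(1,7) by (simp add: strict flat)
  also have "\<dots> = st2 ?Z (so Y) ?R" unfolding omh_modification[OF assms(1)] unfolding assms(2-) using K(1,7) by (simp add: strict flat)
  finally show "st2 ?Z (so Y) ?L = st2 ?Z (so Y) ?R" .
  show "kl2 ?Z (so Y) ?L" "?R \<in> Cel D" "src2 D ?R = src2 D ?L" "trg2 D ?R = trg2 D ?L"
    unfolding assms(2-) using K(1,7) by (simp_all add: strict)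
qed

lemma rr_modification:
  assumes "kl X Y f"
  shows "(sh X Y f \<rhd> rr X) \<cdot> 
     (mu (so (so X)) (so X) (so Y) (S1 X Y f) (mm X) \<lhd> S1 X (so X) (e X)) \<cdot>
     (st2 (so (so X)) (so Y) (omega X Y (eh Y \<odot> f)) \<lhd> S1 X (so X) (e X)) \<cdot>
     (inv2 D (mu (so (so X)) (so (so Y)) (so Y) (mm Y) (S1 (so X) (so Y) (S1 X Y f))) \<lhd> S1 X (so X) (e X)) \<cdot>
     (mh Y \<rhd> (inv2 D (chi X (so X) (so Y) (S1 X Y f) (e X)) \<cdot> S2 X (so Y) (Teta R X Y (eh Y \<odot> f)) \<cdot> chi X Y (so Y) (e Y) f)) \<cdot>
     (mu (so Y) (so (so Y)) (so Y) (mm Y) (S1 Y (so Y) (e Y)) \<lhd> S1 X Y f)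
   = (eta (so X) (so Y) (S1 X Y f) \<cdot> (th (so Y) \<lhd> S1 X Y f)) \<cdot> (st2 (so Y) (so Y) (rr Y) \<lhd> S1 X Y f)" (is "?L = ?R")
proof (rule st2_faithful[of "so X" "so Y"])
  note K = assms klD[OF assms(1)]
  let ?P = "inv2 D (mu (so X) (so X) (so Y) (S1 X Y f) (ti (so X))) \<cdot> (sh X Y f \<rhd> inv2 D (th (so X)))"
  let ?Q = "(mu (so Y) (so (so Y)) (so Y) (mm Y) (S1 Y (so Y) (e Y)) \<lhd> sh X Y f) \<cdot>
    mu (so X) (so Y) (so Y) (mh Y \<odot> S1 Y (so Y) (e Y)) (S1 X Y f)"
  have "st2 (so X) (so Y) ?L = ?P \<cdot> ((sh X Y f \<rhd> rrh X) \<cdot> (omh X Y (eh Y \<odot> f) \<lhd> sh X (so X) (e X)) \<cdot>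
     (mh Y \<rhd> inv2 D (chih X (so X) (so Y) (S1 X Y f) (e X))) \<cdot>
     (mh Y \<rhd> hat2 X (so Y) (Teta R X Y (eh Y \<odot> f))) \<cdot> (mh Y \<rhd> chih X Y (so Y) (e Y) f)) \<cdot> ?Q"
    using K by (simp add: strict flat)
  also have "\<dots> = st2 (so X) (so Y) ?R" unfolding rrh_modification[OF assms(1)] using K by (simp add: strict flat)
  finally show "st2 (so X) (so Y) ?L = st2 (so X) (so Y) ?R" .
  show "kl2 (so X) (so Y) ?L" "?R \<in> Cel D" "src2 D ?R = src2 D ?L" "trg2 D ?R = trg2 D ?L"
    using K by (simp_all add: strict)
qed

lemma omega_coherence:
  assumes "X \<in> Obj C"
  defines "X2 \<equiv> so (so X)" and "X3 \<equiv> so (so (so X))" and "u \<equiv> mm X" and "v \<equiv> mm (so X)" and "w \<equiv> mm (so (so X))"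
    and "a \<equiv> omega (so X) X (ti (so X))" and "a' \<equiv> omega (so (so X)) (so X) (ti (so (so X)))" and
      "Su \<equiv> S1 (so (so X)) (so X) (mm X)" and "Sv \<equiv> S1 (so (so (so X))) (so (so X)) (mm (so X))" and
      "SSu \<equiv> S1 (so (so (so X))) (so (so X)) (S1 (so (so X)) (so X) (mm X))"
  shows "(st2 X3 (so X) a \<lhd> w) \<cdot> (inv2 D (mu X3 X2 (so X) u Su) \<lhd> w) \<cdot>
      (mh X \<rhd> omega X2 (so X) (eh (so X) \<odot> u)) \<cdot> (mu X3 X2 (so X) u v \<lhd> SSu) \<cdot> (st2 X3 (so X) a \<lhd> SSu)
    = (inv2 D (mu X3 X2 (so X) u v) \<lhd> w) \<cdot> (mh X \<rhd> a') \<cdot> (mu X3 X2 (so X) u v \<lhd> Sv) \<cdot>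
      (st2 X3 (so X) a \<lhd> Sv) \<cdot> (inv2 D (mu X3 X2 (so X) u Su) \<lhd> Sv) \<cdot>
      (mh X \<rhd> (inv2 D (chi X3 X2 (so X) u v) \<cdot> S2 X3 (so X) a \<cdot> chi X3 X2 (so X) u Su)) \<cdot> (mu X3 X2 (so X) u Su \<lhd> SSu)"
    (is "?L = ?R")
proof (rule st2_faithful[of "so X3" "so X"])
  let ?P = "inv2 D (mu (so X3) X3 (so X) (mh X \<odot> v) w) \<cdot> (inv2 D (mu X3 X2 (so X) u v) \<lhd> mh X2)"
  let ?Q = "(mu X3 X2 (so X) u Su \<lhd> st (so X3) X3 SSu) \<cdot> mu (so X3) X3 (so X) (mh X \<odot> Su) SSu"
  have "st2 (so X3) (so X) ?L = ?P \<cdot> ((omh (so X) X (ti (so X)) \<lhd> mh (so (so X))) \<cdot> (mh X \<rhd> omh (so (so X)) (so X) (eh (so X) \<odot> mm X)) \<cdot>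
      (omh (so X) X (ti (so X)) \<lhd> sh (so (so (so X))) (so (so X)) (S1 (so (so X)) (so X) (mm X)))) \<cdot> ?Q"
    unfolding assms(2-) using assms(1) by (simp add: strict flat)
  also have "\<dots> = st2 (so X3) (so X) ?R" unfolding omh_coherence[OF assms(1)] unfolding assms(2-) using assms(1) by (simp add: strict flat)
  finally show "st2 (so X3) (so X) ?L = st2 (so X3) (so X) ?R" .
  show "kl2 (so X3) (so X) ?L" "?R \<in> Cel D" "src2 D ?R = src2 D ?L" "trg2 D ?R = trg2 D ?L"
    unfolding assms(2-) using assms(1) by (simp_all add: strict)
qed

lemma rr_coherence:
  assumes "X \<in> Obj C"
  defines "X2 \<equiv> so (so X)" and "X3 \<equiv> so (so (so X))" and "Su \<equiv> S1 (so (so X)) (so X) (mm X)" and "Sj \<equiv> S1 (so X) (so (so X)) (e (so X))"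
  shows "(mh X \<rhd> (S2 (so X) (so X) (rho X) \<cdot> chi (so X) X2 (so X) (mm X) (e (so X)))) \<cdot> (mu X3 X2 (so X) (mm X) Su \<lhd> Sj) =
    (mh X \<rhd> (iota (so X) \<cdot> rr (so X))) \<cdot> (mu X3 X2 (so X) (mm X) (mm (so X)) \<lhd> Sj) \<cdot>
    (st2 X3 (so X) (omega (so X) X (ti (so X))) \<lhd> Sj)" (is "?L = ?R")
proof (rule st2_faithful[of X2 "so X"])
  let ?P = "inv2 D (mu X2 X2 (so X) (mm X) (S1 (so X) (so X) (ti (so X))))"
  let ?Q = "(mu X3 X2 (so X) (mm X) Su \<lhd> st X2 X3 Sj) \<cdot> mu X2 X3 (so X) (mh X \<odot> Su) Sj"
  have "st2 X2 (so X) ?L = ?P \<cdot> ((mh X \<rhd> hat2 (so X) (so X) (rho X)) \<cdot> (mh X \<rhd> chih (so X) (so (so X)) (so X) (mm X) (e (so X)))) \<cdot> ?Q"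
    unfolding assms(2-) using assms(1) by (simp add: strict flat)
  also have "\<dots> = st2 X2 (so X) ?R" unfolding unit_coherence[OF assms(1)] unfolding assms(2-) using assms(1) by (simp add: strict flat)
  finally show "st2 X2 (so X) ?L = st2 X2 (so X) ?R" .
  show "kl2 X2 (so X) ?L" "?R \<in> Cel D" "src2 D ?R = src2 D ?L" "trg2 D ?R = trg2 D ?L"
    unfolding assms(2-) using assms(1) by (simp_all add: strict)
qed

definition "Ku = \<lparr>tob = (\<lambda>X. (X, e X, so X)), tmor = (\<lambda>(X, f, Y). (X, Teta R X Y (eh Y \<odot> f), so Y))\<rparr>"
definition "Km = \<lparr>tob = (\<lambda>X. (so (so X), mm X, so X)), tmor = (\<lambda>(X, f, Y). (so (so X), omega X Y (eh Y \<odot> f), so Y))\<rparr>"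
definition "KM = \<lparr>mfun = KS, mmult = Km, munit = Ku, masc = (\<lambda>X. (so (so (so X)), omega (so X) X (ti (so X)), so X)),
  mlu = (\<lambda>X. (so X, rho X, so X)), mru = (\<lambda>X. (so X, rr X, so X))\<rparr>"

lemma KM_sel[simp]:
  "tob Ku X = (X, e X, so X)" "tmor Ku (X, f, Y) = (X, Teta R X Y (eh Y \<odot> f), so Y)"
  "tob Km X = (so (so X), mm X, so X)" "tmor Km (X, f, Y) = (so (so X), omega X Y (eh Y \<odot> f), so Y)"
  "mfun KM = KS" "mmult KM = Km" "munit KM = Ku" "masc KM X = (so (so (so X)), omega (so X) X (ti (so X)), so X)"
  "mlu KM X = (so X, rho X, so X)" "mru KM X = (so X, rr X, so X)"
  by (simp_all add: Ku_def Km_def KM_def)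

lemma pseudonatural_Ku: "pseudonatural K K (pf_id K) KS Ku"
proof (intro pseudonatural.intro pseudonatural_axioms.intro, goal_cases)
  case 1
  show ?case by (rule pseudofunctor_id[OF bicategory_Kl])
next
  case 2
  show ?case by (rule pseudofunctor_KS)
next
  case (3 X)
  then show ?case by (simp add: hom_Kl strict)
next
  case (4 f X Y)
  then obtain f0 where *: "f = (X, f0, Y)" "kl X Y f0" by (auto simp: hom_Kl)
  then show ?case using klD[OF *(2)] by (simp add: icells_Kl strict)
next
  case (5 f X Y \<alpha> f')
  then obtain a where *: "\<alpha> = (X, a, Y)" "kl2 X Y a" "f = (X, src2 D a, Y)" "f' = (X, trg2 D a, Y)" by (auto simp: cells_Kl hom_Kl)
  then show ?case using unit_natural[OF *(2)] kl2D[OF *(2)] by (simp add: strict)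
next
  case (6 f X Y g Z)
  then obtain f0 g0 where *: "f = (X, f0, Y)" "g = (Y, g0, Z)" "kl X Y f0" "kl Y Z g0" by (auto simp: hom_Kl)
  then show ?case using unit_cmp[OF *(3,4)] klD[OF *(3)] klD[OF *(4)] by (simp add: inv2_Kl strict)
next
  case (7 X)
  then have "X \<in> Obj C" by simp
  then show ?case using unit_one[of X] by (simp add: strict)
qed

lemma pseudonatural_Km: "pseudonatural K K (pf_comp K KS KS) KS Km"
proof (intro pseudonatural.intro pseudonatural_axioms.intro, goal_cases)
  case 1
  show ?case by (rule pseudofunctor_comp[OF pseudofunctor_KS pseudofunctor_KS])
next
  case 2
  show ?case by (rule pseudofunctor_KS)
next
  case (3 X)
  then show ?case by (simp add: hom_Kl strict)
next
  case (4 f X Y)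
  then obtain f0 where *: "f = (X, f0, Y)" "kl X Y f0" by (auto simp: hom_Kl)
  then show ?case using klD[OF *(2)] by (simp add: icells_Kl strict)
next
  case (5 f X Y \<alpha> f')
  then obtain a where *: "\<alpha> = (X, a, Y)" "kl2 X Y a" "f = (X, src2 D a, Y)" "f' = (X, trg2 D a, Y)" by (auto simp: cells_Kl hom_Kl)
  then show ?case using omega_natural[OF *(2)] kl2D[OF *(2)] by (simp add: strict)
next
  case (6 f X Y g Z)
  then obtain f0 g0 where *: "f = (X, f0, Y)" "g = (Y, g0, Z)" "kl X Y f0" "kl Y Z g0" by (auto simp: hom_Kl)
  then show ?case using omega_chi[OF *(3,4)] klD[OF *(3)] klD[OF *(4)] by (simp add: inv2_Kl strict)
next
  case (7 X)
  then have "X \<in> Obj C" by simp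
  then show ?case using omega_iota[of X] by (simp add: strict)
qed

theorem pseudomonad_KM: "pseudomonad K KM"
proof (intro pseudomonad.intro pseudomonad_axioms.intro, goal_cases)
  case 1
  show ?case by (rule bicategory_Kl)
next
  case 2
  show ?case using pseudofunctor_KS by simp
next
  case 3
  show ?case using pseudonatural_Ku by simp
next
  case 4
  show ?case using pseudonatural_Km by simp
next
  case 5
  show ?case unfolding invertible_modification_def
  proof (intro conjI ballI allI, goal_cases)
    case (1 X)
    then show ?case by (simp add: pn_comp_def pn_wleft_def pn_wright_def icells_Kl strict)
  next
    case (2 X Y f)
    then obtain f0 where *: "f = (X, f0, Y)" "kl X Y f0" by (auto simp: hom_Kl)
    then show ?case using omega_modification[OF *(2)] klD[OF *(2)]
      by (simp add: pn_comp_def pn_wleft_def pn_wright_def inv2_Kl strict)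
  qed
next
  case 6
  show ?case unfolding invertible_modification_def
  proof (intro conjI ballI allI, goal_cases)
    case (1 X)
    then show ?case by (simp add: pn_comp_def pn_id_def pn_wright_def icells_Kl strict)
  next
    case (2 X Y f)
    then obtain f0 where *: "f = (X, f0, Y)" "kl X Y f0" by (auto simp: hom_Kl)
    then show ?case using rho_modification[OF *(2)] klD[OF *(2)]
      by (simp add: pn_comp_def pn_id_def pn_wright_def inv2_Kl strict)
  qed
next
  case 7
  show ?case unfolding invertible_modification_def
  proof (intro conjI ballI allI, goal_cases)
    case (1 X)
    then show ?case by (simp add: pn_comp_def pn_wleft_def pn_id_def icells_Kl strict)
  next
    case (2 X Y f)
    then obtain f0 where *: "f = (X, f0, Y)" "kl X Y f0" by (auto simp: hom_Kl)
    then show ?case using rr_modification[OF *(2)] klD[OF *(2)]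
      by (simp add: pn_comp_def pn_wleft_def pn_id_def inv2_Kl strict)
  qed
next
  case (8 X u v w a)
  then have "X \<in> Obj C" by simp
  then show ?case unfolding 8(2-) using omega_coherence[of X] by (simp add: inv2_Kl strict)
next
  case (9 X u v j)
  then have "X \<in> Obj C" by simp
  then show ?case unfolding 9(2-) using rr_coherence[of X] by (simp add: inv2_Kl strict)
qed

end

section \<open>2-monads\<close>

sublocale two_monad \<subseteq> S: two_functor B B "sfun M"
  by (rule sfun_two_functor)

context two_monad
begin

text \<open>The comparison 2-cell is an identity, so its source and target agree.\<close>

lemma S_cmp[strict]:
  assumes "g \<in> Mor B" "into1 B f (src B g)"
  shows "pmor S (g \<odot> f) = pmor S g \<odot> pmor S f"
proof -
  have "pcmp S g f = idc B (pmor S g \<odot> pmor S f)"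
    using S.pcmp_idc[of f "src B f" "src B g" g "trg B g"] assms by (simp add: hom_iff tydef)
  then have "trg2 B (pcmp S g f) = pmor S g \<odot> pmor S f" using assms by (simp add: strict tydef)
  then show ?thesis using assms by (simp add: strict)
qed

lemma S_one[strict]: "X \<in> Obj B \<Longrightarrow> pmor S (one B X) = one B (pob S X)"
  using S.pone_idc[of X] S.pone_typ(3)[of X] by (simp add: strict)

lemma S_hcmp[strict]:
  assumes "\<alpha> \<in> Cel B" "\<beta> \<in> Cel B" "src B (src2 B \<beta>) = trg B (src2 B \<alpha>)"
  shows "pcel S (\<beta> \<star> \<alpha>) = pcel S \<beta> \<star> pcel S \<alpha>"
proof -
  \<comment> \<open>Here f and g are functions of \<alpha>, so that one fact covers both the source
    and the target morphisms.\<close>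
  have c: "pcmp S (g \<alpha>) (f \<alpha>) = idc B (pmor S (g \<alpha>) \<odot> pmor S (f \<alpha>))" if "f \<alpha> \<in> Mor B" "g \<alpha> \<in> Mor B" "src B (g \<alpha>) = trg B (f \<alpha>)" for f g
    using S.pcmp_idc[of "f \<alpha>" "src B (f \<alpha>)" "src B (g \<alpha>)" "g \<alpha>" "trg B (g \<alpha>)"] that by (simp add: hom_iff)
  show ?thesis
    using S.pcmp_nat[of \<beta> \<alpha>] assms c[of "src2 B" "\<lambda>_. src2 B \<beta>"] c[of "trg2 B" "\<lambda>_. trg2 B \<beta>"]
    by (simp add: strict tydef)
qed

lemma m_typ:
  assumes "X \<in> Obj B"
  shows m_Mor[strict]: "m X \<in> Mor B" and src_m[strict]: "src B (m X) = pob S (pob S X)" and trg_m[strict]: "trg B (m X) = pob S X"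
  using smult_hom[OF assms] by (auto simp: hom_def)

lemma e_typ:
  assumes "X \<in> Obj B"
  shows e_Mor[strict]: "e X \<in> Mor B" and src_e[strict]: "src B (e X) = X" and trg_e[strict]: "trg B (e X) = pob S X"
  using sunit_hom[OF assms] by (auto simp: hom_def)

lemmas [strict] = into1I[OF m_Mor trg_m] into1I[OF e_Mor trg_e] smult_assoc smult_unit_left smult_unit_right

lemma past:
  assumes "u \<odot> v = w" "u \<in> Mor B" "v \<in> Mor B" "src B u = trg B v" "into1 B Q (src B v)"
  shows "u \<odot> (v \<odot> Q) = w \<odot> Q"
  using assms(2-) by (simp add: strict tydef flip: assms(1))

text \<open>The orientation of this rule and of \<open>e_nat\<close> moves m and e to the left, past
  any image under S.\<close>

lemma m_nat[strict]:
  assumes "f \<in> Mor B" "src B f = X"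
  shows "pmor S f \<odot> m X = m (trg B f) \<odot> pmor S (pmor S f)"
  using smult_natural[of f X "trg B f"] assms by (simp add: hom_iff)

lemma e_nat[strict]:
  assumes "f \<in> Mor B" "src B f = X"
  shows "pmor S f \<odot> e X = e (trg B f) \<odot> f"
  using sunit_natural[of f X "trg B f"] assms by (simp add: hom_iff)

lemma Sm_nat[strict]:
  assumes "f \<in> Mor B" "src B f = X"
  shows "pmor S (pmor S f) \<odot> pmor S (m X) = pmor S (m (trg B f)) \<odot> pmor S (pmor S (pmor S f))"
  using arg_cong[OF m_nat[OF assms], of "pmor S"] assms by (auto simp add: strict tydef simp del: m_nat)

lemma Se_nat[strict]:
  assumes "f \<in> Mor B" "src B f = X"
  shows "pmor S (pmor S f) \<odot> pmor S (e X) = pmor S (e (trg B f)) \<odot> pmor S f"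
  using arg_cong[OF e_nat[OF assms], of "pmor S"] assms by (auto simp add: strict tydef simp del: e_nat)

lemma nat_past[strict]:
  assumes "f \<in> Mor B" "src B f = X"
  shows "into1 B Q (pob S (pob S X)) \<Longrightarrow> pmor S f \<odot> (m X \<odot> Q) = m (trg B f) \<odot> (pmor S (pmor S f) \<odot> Q)"
    "into1 B Q X \<Longrightarrow> pmor S f \<odot> (e X \<odot> Q) = e (trg B f) \<odot> (f \<odot> Q)"
    "into1 B Q (pob S (pob S (pob S X))) \<Longrightarrow> pmor S (pmor S f) \<odot> (pmor S (m X) \<odot> Q) = pmor S (m (trg B f)) \<odot> (pmor S (pmor S (pmor S f)) \<odot> Q)"
    "into1 B Q (pob S X) \<Longrightarrow> pmor S (pmor S f) \<odot> (pmor S (e X) \<odot> Q) = pmor S (e (trg B f)) \<odot> (pmor S f \<odot> Q)"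
proof -
  have t: "X \<in> Obj B" "trg B f \<in> Obj B" "into1 B f (trg B f)" using assms src_Obj trg_Obj by (auto simp: tydef)
  show "into1 B Q (pob S (pob S X)) \<Longrightarrow> pmor S f \<odot> (m X \<odot> Q) = m (trg B f) \<odot> (pmor S (pmor S f) \<odot> Q)"
    by (subst past[OF m_nat[OF assms]]) (use assms t in \<open>simp_all add: strict\<close>)
  show "into1 B Q X \<Longrightarrow> pmor S f \<odot> (e X \<odot> Q) = e (trg B f) \<odot> (f \<odot> Q)"
    by (subst past[OF e_nat[OF assms]]) (use assms t in \<open>simp_all add: strict\<close>)
  show "into1 B Q (pob S (pob S (pob S X))) \<Longrightarrow>
      pmor S (pmor S f) \<odot> (pmor S (m X) \<odot> Q) = pmor S (m (trg B f)) \<odot> (pmor S (pmor S (pmor S f)) \<odot> Q)"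
    by (subst past[OF Sm_nat[OF assms]]) (use assms t in \<open>simp_all add: strict\<close>)
  show "into1 B Q (pob S X) \<Longrightarrow> pmor S (pmor S f) \<odot> (pmor S (e X) \<odot> Q) = pmor S (e (trg B f)) \<odot> (pmor S f \<odot> Q)"
    by (subst past[OF Se_nat[OF assms]]) (use assms t in \<open>simp_all add: strict\<close>)
qed

lemma unit_past[strict]:
  assumes "X \<in> Obj B"
  shows "into1 B Q (pob S X) \<Longrightarrow> m X \<odot> (e (pob S X) \<odot> Q) = Q"
    "into1 B Q (pob S X) \<Longrightarrow> m X \<odot> (pmor S (e X) \<odot> Q) = Q"
    "into1 B Q (pob S (pob S (pob S X))) \<Longrightarrow> m X \<odot> (pmor S (m X) \<odot> Q) = m X \<odot> (m (pob S X) \<odot> Q)"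
  using assms past[OF smult_unit_left[OF assms], of Q] past[OF smult_unit_right[OF assms], of Q] past[OF smult_assoc[OF assms], of Q]
  by (simp_all add: strict)

text \<open>Under \<open>m_nat\<close> the composite of \<open>pmor S (m X)\<close> with m turns
  into m after \<open>pmor S (pmor S (m X))\<close> before \<open>smult_assoc\<close> can act. This
  equation joins the two normal forms.\<close>

lemma m_mSS:
  assumes "X \<in> Obj B"
  shows "m X \<odot> m (pob S X) \<odot> pmor S (pmor S (m X)) = m X \<odot> m (pob S X) \<odot> m (pob S (pob S X))"
proof -
  have "m X \<odot> m (pob S X) \<odot> pmor S (pmor S (m X)) = m X \<odot> pmor S (m X) \<odot> m (pob S (pob S X))"
    using assms m_nat[of "m X"] by (simp add: strict)
  also have "\<dots> = m X \<odot> m (pob S X) \<odot> m (pob S (pob S X))"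
    using assms by (simp add: strict del: m_nat)
  finally show ?thesis .
qed

lemma m_nat2[strict]:
  assumes "\<alpha> \<in> Cel B" "src B (src2 B \<alpha>) = X"
  shows "pcel S \<alpha> \<lhd> m X = m (trg B (src2 B \<alpha>)) \<rhd> pcel S (pcel S \<alpha>)"
  using smult_natural2[of "src2 B \<alpha>" X "trg B (src2 B \<alpha>)" \<alpha> "trg2 B \<alpha>"] assms by (simp add: hom_iff cells_iff' strict)

lemma e_nat2[strict]:
  assumes "\<alpha> \<in> Cel B" "src B (src2 B \<alpha>) = X"
  shows "pcel S \<alpha> \<lhd> e X = e (trg B (src2 B \<alpha>)) \<rhd> \<alpha>"
  using sunit_natural2[of "src2 B \<alpha>" X "trg B (src2 B \<alpha>)" \<alpha> "trg2 B \<alpha>"] assms by (simp add: hom_iff cells_iff' strict)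

lemma nat2_past[strict]:
  assumes "\<alpha> \<in> Cel B" "src B (src2 B \<alpha>) = X"
  shows "into1 B Q (pob S (pob S X)) \<Longrightarrow>
      pcel S \<alpha> \<lhd> m X \<odot> Q = m (trg B (src2 B \<alpha>)) \<rhd> (pcel S (pcel S \<alpha>) \<lhd> Q)"
    "into1 B Q X \<Longrightarrow> pcel S \<alpha> \<lhd> e X \<odot> Q = e (trg B (src2 B \<alpha>)) \<rhd> (\<alpha> \<lhd> Q)"
proof -
  have X: "X \<in> Obj B" using assms src_Obj src2_Mor by blast
  show "pcel S \<alpha> \<lhd> m X \<odot> Q = m (trg B (src2 B \<alpha>)) \<rhd> (pcel S (pcel S \<alpha>) \<lhd> Q)" if "into1 B Q (pob S (pob S X))"
    using arg_cong[OF m_nat2[OF assms], of "\<lambda>z. z \<lhd> Q"] assms that X by (simp add: strict tydef del: m_nat2)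
  show "pcel S \<alpha> \<lhd> e X \<odot> Q = e (trg B (src2 B \<alpha>)) \<rhd> (\<alpha> \<lhd> Q)" if "into1 B Q X"
    using arg_cong[OF e_nat2[OF assms], of "\<lambda>z. z \<lhd> Q"] assms that X by (simp add: strict tydef del: e_nat2)
qed

section \<open>Pseudoalgebras and pseudomorphisms\<close>

abbreviation "psalg \<equiv> pseudoalgebra B M"
abbreviation "psmor \<equiv> pseudomorphism B M"
abbreviation "algcell \<equiv> algebra_cell B M"

lemma psalgD:
  assumes "psalg P"
  shows "car P \<in> Obj B" "act P \<in> Mor B" "src B (act P) = pob S (car P)" "trg B (act P) = car P"
    "amul P \<in> Cel B" "src2 B (amul P) = act P \<odot> pmor S (act P)" "trg2 B (amul P) = act P \<odot> m (car P)" "invertible B (amul P)"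
    "aone P \<in> Cel B" "src2 B (aone P) = one B (car P)" "trg2 B (aone P) = act P \<odot> e (car P)" "invertible B (aone P)"
    "into1 B (act P) (car P)" "into2 B (amul P) (act P \<odot> m (car P))" "into2 B (aone P) (act P \<odot> e (car P))"
  using assms by (simp_all add: pseudoalgebra_def Let_def hom_iff icells_iff tydef)

lemma psalg_assoc:
  assumes "psalg P"
  shows "(amul P \<lhd> m (pob S (car P))) \<cdot> (amul P \<lhd> pmor S (pmor S (act P))) =
     (amul P \<lhd> pmor S (m (car P))) \<cdot> (act P \<rhd> pcel S (amul P))"
  using assms by (simp add: pseudoalgebra_def Let_def)

lemma psalg_unit_right:
  assumes "psalg P"
  shows "(amul P \<lhd> pmor S (e (car P))) \<cdot> (act P \<rhd> pcel S (aone P)) = idc B (act P)"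
  using assms by (simp add: pseudoalgebra_def Let_def)

text \<open>A counterpart of Kelly's argument for the derived unit laws of a monoidal category:
  associativity at a unit shows that the composite \<open>?x\<close> becomes trivial after S and a,
  and the invertible \<open>aone P\<close> then detects this for \<open>?x\<close> itself.\<close>

lemma psalg_unit_left:
  assumes "psalg P"
  shows "(amul P \<lhd> e (pob S (car P))) \<cdot> (aone P \<lhd> act P) = idc B (act P)"
proof -
  let ?a = "act P" and ?A = "car P"
  let ?x = "(amul P \<lhd> e (pob S ?A)) \<cdot> (aone P \<lhd> ?a)"
  note T = psalgD[OF assms]
  have Sme: "pmor S (m ?A) \<odot> pmor S (e (pob S ?A)) = one B (pob S (pob S ?A))"
    using S_cmp[of "m ?A" "e (pob S ?A)"] T by (simp add: strict del: S_cmp)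
  \<comment> \<open>Whiskered with S of the unit, the outer factor on either side of associativity
    becomes \<open>amul P\<close>, which is then cancelled.\<close>
  have "amul P \<cdot> (amul P \<lhd> pmor S (e ?A) \<odot> pmor S ?a) = amul P \<cdot> (?a \<rhd> (pcel S (amul P) \<lhd> pmor S (e (pob S ?A))))"
    using arg_cong[OF psalg_assoc[OF assms], of "\<lambda>z. z \<lhd> pmor S (e (pob S ?A))"] T
    by (simp add: strict Sme)
  then have 1: "amul P \<lhd> pmor S (e ?A) \<odot> pmor S ?a = ?a \<rhd> (pcel S (amul P) \<lhd> pmor S (e (pob S ?A)))"
    by (rule cancel_left[rotated]) (use T in \<open>simp_all add: strict Sme\<close>)
  have 2: "(amul P \<lhd> pmor S (e ?A) \<odot> pmor S ?a) \<cdot> (?a \<rhd> (pcel S (aone P) \<lhd> pmor S ?a)) = idc B (?a \<odot> pmor S ?a)"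
    using arg_cong[OF psalg_unit_right[OF assms], of "\<lambda>z. z \<lhd> pmor S ?a"] T by (simp add: strict)
  have 3: "?a \<rhd> pcel S ?x = idc B (?a \<odot> pmor S ?a)"
    using 2 T by (simp add: strict 1)
  \<comment> \<open>Restriction along the unit strips off S by naturality of e; what remains slides
    past \<open>aone P\<close>.\<close>
  have 4: "?a \<odot> e ?A \<rhd> ?x = idc B (?a \<odot> e ?A \<odot> ?a)"
    using arg_cong[OF 3, of "\<lambda>z. z \<lhd> e (pob S ?A)"] T by (simp add: strict)
  have "(aone P \<lhd> ?a) \<cdot> ?x = (?a \<odot> e ?A \<rhd> ?x) \<cdot> (aone P \<lhd> ?a)"
    using slide[of ?x "aone P"] T by (simp add: strict)
  then have "(aone P \<lhd> ?a) \<cdot> ?x = (aone P \<lhd> ?a) \<cdot> idc B ?a" unfolding 4 using T by (simp add: strict)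
  then show ?thesis by (rule cancel_left[rotated]) (use T in \<open>simp_all add: strict\<close>)
qed

lemma psmorD:
  assumes "psmor P Q f \<phi>"
  shows "f \<in> Mor B" "src B f = car P" "trg B f = car Q" "\<phi> \<in> Cel B" "src2 B \<phi> = act Q \<odot> pmor S f"
    "trg2 B \<phi> = f \<odot> act P" "invertible B \<phi>" "into1 B f (car Q)" "into2 B \<phi> (f \<odot> act P)"
  using assms by (simp_all add: pseudomorphism_def Let_def hom_iff icells_iff tydef)

lemma psmor_assoc:
  assumes "psmor P Q f \<phi>"
  shows "(\<phi> \<lhd> m (car P)) \<cdot> (amul Q \<lhd> pmor S (pmor S f)) =
    (f \<rhd> amul P) \<cdot> (\<phi> \<lhd> pmor S (act P)) \<cdot> (act Q \<rhd> pcel S \<phi>)"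
  using assms by (simp add: pseudomorphism_def Let_def)

lemma psmor_unit:
  assumes "psmor P Q f \<phi>"
  shows "(\<phi> \<lhd> e (car P)) \<cdot> (aone Q \<lhd> f) = f \<rhd> aone P"
  using assms by (simp add: pseudomorphism_def Let_def)

lemma psmor_comp:
  assumes "psalg P" "psalg Q" "psalg R" "psmor P Q f \<phi>" "psmor Q R g \<psi>"
  shows "psmor P R (g \<odot> f) (psm_comp B M g \<psi> f \<phi>)"
proof -
  let ?a = "act P" and ?b = "act Q" and ?c = "act R"
  note T = psalgD[OF assms(1)] psalgD[OF assms(2)] psalgD[OF assms(3)] psmorD[OF assms(4)] psmorD[OF assms(5)]
  let ?k = "(g \<rhd> \<phi>) \<cdot> (\<psi> \<lhd> pmor S f)"
  have 1: "(\<psi> \<lhd> m (car Q) \<odot> pmor S (pmor S f)) \<cdot> (amul R \<lhd> pmor S (pmor S g) \<odot> pmor S (pmor S f)) =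
    (g \<rhd> (amul Q \<lhd> pmor S (pmor S f))) \<cdot> (\<psi> \<lhd> pmor S ?b \<odot> pmor S (pmor S f)) \<cdot> (?c \<rhd> (pcel S \<psi> \<lhd> pmor S (pmor S f)))"
    using arg_cong[OF psmor_assoc[OF assms(5)], of "\<lambda>z. z \<lhd> pmor S (pmor S f)"] T by (simp add: strict)
  have 2: "(g \<rhd> (\<phi> \<lhd> m (car P))) \<cdot> (g \<rhd> (amul Q \<lhd> pmor S (pmor S f))) =
    (g \<odot> f \<rhd> amul P) \<cdot> (g \<rhd> (\<phi> \<lhd> pmor S ?a)) \<cdot> (g \<odot> ?b \<rhd> pcel S \<phi>)"
    using arg_cong[OF psmor_assoc[OF assms(4)], of "\<lambda>z. g \<rhd> z"] T by (simp add: strict)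
  have 3: "(g \<odot> ?b \<rhd> pcel S \<phi>) \<cdot> (\<psi> \<lhd> pmor S ?b \<odot> pmor S (pmor S f)) =
    (\<psi> \<lhd> pmor S f \<odot> pmor S ?a) \<cdot> (?c \<odot> pmor S g \<rhd> pcel S \<phi>)"
    using slide[of "pcel S \<phi>" \<psi>] T by (simp add: strict)
  have assoc: "(?k \<lhd> m (car P)) \<cdot> (amul R \<lhd> pmor S (pmor S (g \<odot> f))) =
    (g \<odot> f \<rhd> amul P) \<cdot> (?k \<lhd> pmor S ?a) \<cdot> (?c \<rhd> pcel S ?k)"
    using T by (simp add: strict 1 2[THEN vcmp_extend] 3[THEN vcmp_extend])
  have 4: "(\<psi> \<lhd> e (car Q) \<odot> f) \<cdot> (aone R \<lhd> g \<odot> f) = g \<rhd> (aone Q \<lhd> f)"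
    using arg_cong[OF psmor_unit[OF assms(5)], of "\<lambda>z. z \<lhd> f"] T by (simp add: strict)
  have 5: "(g \<rhd> (\<phi> \<lhd> e (car P))) \<cdot> (g \<rhd> (aone Q \<lhd> f)) = g \<odot> f \<rhd> aone P"
    using arg_cong[OF psmor_unit[OF assms(4)], of "\<lambda>z. g \<rhd> z"] T by (simp add: strict)
  have unit: "(?k \<lhd> e (car P)) \<cdot> (aone R \<lhd> g \<odot> f) = g \<odot> f \<rhd> aone P"
    using T by (simp add: strict 4 5)
  show ?thesis unfolding pseudomorphism_def psm_comp_def Let_def using assoc unit T
    by (simp add: hom_iff icells_iff strict)
qed

lemma algcell_iff: "algcell P Q f \<phi> g \<psi> \<alpha> \<longleftrightarrow> \<alpha> \<in> Cel B \<and> src2 B \<alpha> = f \<and> trg2 B \<alpha> = g \<and>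
    (\<alpha> \<lhd> act P) \<cdot> \<phi> = \<psi> \<cdot> (act Q \<rhd> pcel S \<alpha>)"
  by (auto simp: algebra_cell_def cells_iff')

lemma algcell_vcmp:
  assumes "psalg P" "psalg Q" "psmor P Q f \<phi>" "psmor P Q g \<psi>" "psmor P Q h \<chi>" "algcell P Q f \<phi> g \<psi> \<alpha>" "algcell P Q g \<psi> h \<chi> \<beta>"
  shows "algcell P Q f \<phi> h \<chi> (\<beta> \<cdot> \<alpha>)"
proof -
  note T = psalgD[OF assms(1)] psalgD[OF assms(2)] psmorD[OF assms(3)] psmorD[OF assms(4)] psmorD[OF assms(5)]
  have t: "\<alpha> \<in> Cel B" "src2 B \<alpha> = f" "trg2 B \<alpha> = g" "\<beta> \<in> Cel B" "src2 B \<beta> = g" "trg2 B \<beta> = h" "into2 B \<alpha> g" "into2 B \<beta> h"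
    and a: "(\<alpha> \<lhd> act P) \<cdot> \<phi> = \<psi> \<cdot> (act Q \<rhd> pcel S \<alpha>)"
    and b: "(\<beta> \<lhd> act P) \<cdot> \<psi> = \<chi> \<cdot> (act Q \<rhd> pcel S \<beta>)"
    using assms(6,7) by (simp_all add: algcell_iff tydef)
  show ?thesis unfolding algcell_iff using T t by (simp add: strict a b[THEN vcmp_extend])
qed

end

section \<open>The relative pseudomonad of a lifting\<close>

locale lifted_pseudomonad = relative_pseudomonad C D J T + restricts_along C D J SC SD +
    lifting_to_pseudoalgebras C D J T SC SD L
  for C :: "('oc, 'mc, 'cc) bicat" and D :: "('od, 'md, 'cd) bicat" (structure)
    and J :: "('oc, 'mc, 'cc, 'od, 'md, 'cd) pfun" and T :: "('oc, 'od, 'md, 'cd) rpmonad"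
    and SC :: "('oc, 'mc, 'cc) monad2" and SD :: "('od, 'md, 'cd) monad2"
    and L :: "('oc, 'mc, 'cc, 'od, 'md, 'cd) lifting_data"
begin

abbreviation "so X \<equiv> pob (sfun SC) X"

lemma J_restrict:
  shows J_so[strict]: "X \<in> Obj C \<Longrightarrow> pob J (so X) = pob SD.S (pob J X)"
    and J_S1[strict]: "f \<in> Mor C \<Longrightarrow> pmor J (pmor SC.S f) = pmor SD.S (pmor J f)"
    and J_S2[strict]: "\<alpha> \<in> Cel C \<Longrightarrow> pcel J (pcel SC.S \<alpha>) = pcel SD.S (pcel J \<alpha>)"
  using restrict_fun by (simp_all add: pf_eq_def)

lemmas [strict] = restrict_mult restrict_unit

section \<open>Free algebras and the lifted action\<close>

definition "FA X = \<lparr>car = so X, act = SC.m X, amul = idc C (SC.m X \<odot>\<^bsub>C\<^esub> pmor SC.S (SC.m X)), aone = idc C (one C (so X))\<rparr>"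

text \<open>All 2-cells involved are identities, so the coherence axioms amount to equations between
  morphisms; the one with three multiplications is \<open>m_mSS\<close>.\<close>

lemma salg_FA: "X \<in> Obj C \<Longrightarrow> salg (FA X)"
  using SC.m_mSS[of X] by (simp add: strict_algebra_def pseudoalgebra_def FA_def Let_def C.hom_iff C.icells_iff strict)

lemma jalg_sel[simp]:
  "X \<in> Obj C \<Longrightarrow> car (jalg (FA X)) = pob SD.S (pob J X)" "X \<in> Obj C \<Longrightarrow> act (jalg (FA X)) = SD.m (pob J X)"
  "X \<in> Obj C \<Longrightarrow> amul (jalg (FA X)) = idc D (SD.m (pob J X) \<odot> SD.m (pob SD.S (pob J X)))"
  "X \<in> Obj C \<Longrightarrow> aone (jalg (FA X)) = idc D (one D (pob SD.S (pob J X)))"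
  by (simp_all add: lift_alg_def FA_def strict)

lemma jalg_psalg: "X \<in> Obj C \<Longrightarrow> SD.psalg (jalg (FA X))"
  using restrict_alg[OF salg_FA] by (simp add: strict_algebra_def)

abbreviation "E X \<equiv> talg (FA X)"
abbreviation "t X \<equiv> act (E X)"
abbreviation "am X \<equiv> amul (E X)"
abbreviation "ao X \<equiv> aone (E X)"

lemma car_FA[simp]: "car (FA X) = so X"
  by (simp add: FA_def)

lemma car_E[simp]: "X \<in> Obj C \<Longrightarrow> car (E X) = Tob T (so X)"
  using lalg_car[OF salg_FA] by simp

lemma psalg_E: "X \<in> Obj C \<Longrightarrow> SD.psalg (E X)"
  by (rule lalg_pseudoalgebra[OF salg_FA])

lemma E_typ[strict]:
  assumes "X \<in> Obj C"
  shows "t X \<in> Mor D" "src D (t X) = pob SD.S (Tob T (so X))" "trg D (t X) = Tob T (so X)"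
    "into1 D (t X) Z \<longleftrightarrow> Tob T (so X) = Z"
    "am X \<in> Cel D" "src2 D (am X) = t X \<odot> pmor SD.S (t X)" "trg2 D (am X) = t X \<odot> SD.m (Tob T (so X))" "invertible D (am X)"
    "ao X \<in> Cel D" "src2 D (ao X) = one D (Tob T (so X))" "trg2 D (ao X) = t X \<odot> SD.e (Tob T (so X))" "invertible D (ao X)"
  using SD.psalgD[OF psalg_E[OF assms]] assms by (simp_all add: tydef)

lemmas [strict] = D.into2I[OF E_typ(5,7)] D.into2I[OF E_typ(9,11)]

lemma E_laws:
  assumes "X \<in> Obj C"
  shows E_assoc: "(am X \<lhd> SD.m (pob SD.S (Tob T (so X)))) \<cdot> (am X \<lhd> pmor SD.S (pmor SD.S (t X))) =
     (am X \<lhd> pmor SD.S (SD.m (Tob T (so X)))) \<cdot> (t X \<rhd> pcel SD.S (am X))"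
    and E_unit_right: "(am X \<lhd> pmor SD.S (SD.e (Tob T (so X)))) \<cdot> (t X \<rhd> pcel SD.S (ao X)) = idc D (t X)"
    and E_unit_left: "(am X \<lhd> SD.e (pob SD.S (Tob T (so X)))) \<cdot> (ao X \<lhd> t X) = idc D (t X)"
  using SD.psalg_assoc[OF psalg_E[OF assms]] SD.psalg_unit_right[OF psalg_E[OF assms]] SD.psalg_unit_left[OF psalg_E[OF assms]] assms
  by simp_all

section \<open>The structure of R = T S\<close>

definition "ext X Y x = t Y \<odot> pmor SD.S x"
definition "ext2 X Y \<alpha> = t Y \<rhd> pcel SD.S \<alpha>"

abbreviation "est X Y x \<equiv> st (so X) (so Y) (ext X Y x)"
abbreviation "est2 X Y \<alpha> \<equiv> st2 (so X) (so Y) (ext2 X Y \<alpha>)"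

lemma kl_ext[strict]: "kl X (so Y) x \<Longrightarrow> Y \<in> Obj C \<Longrightarrow> kl (so X) (so Y) (ext X Y x)"
  by (simp add: ext_def strict tydef)

lemma ext_typ:
  assumes "kl X (so Y) x" "Y \<in> Obj C"
  shows [strict]: "ext X Y x \<in> Mor D" "src D (ext X Y x) = pob SD.S (pob J X)" "trg D (ext X Y x) = Tob T (so Y)"
  using klD[OF kl_ext[OF assms]] klD[OF assms(1)] by (simp_all add: strict)

lemmas [strict] = D.into1I[OF ext_typ(1,3)]

lemma ext_e[strict]:
  assumes "kl X (so Y) x" "Y \<in> Obj C"
  shows "ext X Y x \<odot> SD.e (pob J X) = t Y \<odot> SD.e (Tob T (so Y)) \<odot> x"
  using klD[OF assms(1)] assms by (simp add: ext_def strict)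

lemma ext2_typ:
  assumes "kl2 X (so Y) \<alpha>" "Y \<in> Obj C"
  shows [strict]: "ext2 X Y \<alpha> \<in> Cel D" "src2 D (ext2 X Y \<alpha>) = ext X Y (src2 D \<alpha>)" "trg2 D (ext2 X Y \<alpha>) = ext X Y (trg2 D \<alpha>)"
  using kl2D[OF assms(1)] assms by (simp_all add: strict ext2_def ext_def)

lemmas [strict] = D.into2I[OF ext2_typ(1,3)]

lemma ext_m[strict]:
  assumes "kl X (so Y) x" "Y \<in> Obj C"
  shows "ext X Y x \<odot> SD.m (pob J X) = t Y \<odot> SD.m (Tob T (so Y)) \<odot> pmor SD.S (pmor SD.S x)"
  using klD[OF assms(1)] assms by (simp add: ext_def strict)

lemma ext_Se[strict]:
  assumes "kl X (so Y) x" "Y \<in> Obj C"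
  shows "pmor SD.S (ext X Y x) \<odot> pmor SD.S (SD.e (pob J X)) = pmor SD.S (t Y) \<odot> pmor SD.S (SD.e (Tob T (so Y))) \<odot> pmor SD.S x"
  using klD[OF assms(1)] assms by (simp add: ext_def strict)

text \<open>By naturality of m the morphism S x is a strict map out of the free algebra, so only the
  multiplication 2-cell of the target \<open>E Y\<close> contributes to the structure of
  \<open>ext X Y x\<close>.\<close>

definition "dst Y x = am Y \<lhd> pmor SD.S (pmor SD.S x)"

text \<open>The two conditions are the associativity axiom of \<open>E Y\<close> and its left unit
  law, whiskered by iterates of S on x. The second is where the derived law
  \<open>psalg_unit_left\<close> enters.\<close>

lemma psm_ext:
  assumes "kl X (so Y) x" "Y \<in> Obj C"
  shows "psm (jalg (FA X)) (E Y) (ext X Y x) (dst Y x)"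
proof -
  note K = assms klD[OF assms(1)]
  have assoc: "(dst Y x \<lhd> SD.m (pob SD.S (pob J X))) \<cdot> (am Y \<lhd> pmor SD.S (pmor SD.S (ext X Y x))) =
    (ext X Y x \<rhd> amul (jalg (FA X))) \<cdot> (dst Y x \<lhd> pmor SD.S (SD.m (pob J X))) \<cdot> (t Y \<rhd> pcel SD.S (dst Y x))"
    using arg_cong[OF E_assoc[OF assms(2)], of "\<lambda>z. z \<lhd> pmor SD.S (pmor SD.S (pmor SD.S x))"] K
    by (simp add: strict ext_def dst_def)
  have unit: "(dst Y x \<lhd> SD.e (pob SD.S (pob J X))) \<cdot> (ao Y \<lhd> ext X Y x) = ext X Y x \<rhd> aone (jalg (FA X))"
    using arg_cong[OF E_unit_left[OF assms(2)], of "\<lambda>z. z \<lhd> pmor SD.S x"] K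
    by (simp add: strict ext_def dst_def)
  show ?thesis unfolding pseudomorphism_def Let_def using assoc unit K
    by (simp add: D.hom_iff D.icells_iff strict ext_def dst_def)
qed

text \<open>The pseudomorphism structure \<open>t\<^sub>Y S(f\<^sup>*) \<rightarrow> f\<^sup>* t\<^sub>X\<close>, where \<open>f = t\<^sub>Y S x\<close>.\<close>

definition "lb X Y x = lstar L (FA X) (FA Y) (ext X Y x) (dst Y x)"

lemma psm_lb:
  assumes "kl X (so Y) x" "Y \<in> Obj C"
  shows "psm (E X) (E Y) (est X Y x) (lb X Y x)"
  using lstar_psm[OF salg_FA salg_FA psm_ext[OF assms]] klD[OF assms(1)] assms by (simp add: lb_def)

lemma lb_typ:
  assumes "kl X (so Y) x" "Y \<in> Obj C"
  shows [strict]: "lb X Y x \<in> Cel D" "src2 D (lb X Y x) = t Y \<odot> pmor SD.S (est X Y x)" "trg2 D (lb X Y x) = est X Y x \<odot> t X"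
    "invertible D (lb X Y x)"
  using SD.psmorD[OF psm_lb[OF assms]] by simp_all

lemmas [strict] = D.into2I[OF lb_typ(1,3)]

lemma lb_assoc:
  assumes "kl X (so Y) x" "Y \<in> Obj C"
  shows "(lb X Y x \<lhd> SD.m (Tob T (so X))) \<cdot> (am Y \<lhd> pmor SD.S (pmor SD.S (est X Y x))) =
    (est X Y x \<rhd> am X) \<cdot> (lb X Y x \<lhd> pmor SD.S (t X)) \<cdot> (t Y \<rhd> pcel SD.S (lb X Y x))"
  using SD.psmor_assoc[OF psm_lb[OF assms]] klD[OF assms(1)] by simp

text \<open>Interchange with the multiplication of \<open>E Y\<close> makes
  \<open>ext2 X Y \<alpha>\<close> an algebra 2-cell, and by \<open>lstar_cell\<close> so is its
  star.\<close>

lemma lb_natural: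
  assumes "kl2 X (so Y) \<alpha>" "Y \<in> Obj C"
  shows "(est2 X Y \<alpha> \<lhd> t X) \<cdot> lb X Y (src2 D \<alpha>) = lb X Y (trg2 D \<alpha>) \<cdot> (t Y \<rhd> pcel SD.S (est2 X Y \<alpha>))"
proof -
  note K = assms kl2D[OF assms(1)]
  have "acell (jalg (FA X)) (E Y) (ext X Y (src2 D \<alpha>)) (dst Y (src2 D \<alpha>)) (ext X Y (trg2 D \<alpha>)) (dst Y (trg2 D \<alpha>)) (ext2 X Y \<alpha>)"
    using D.slide[of "pcel SD.S (pcel SD.S \<alpha>)" "am Y"] K
    by (simp add: SD.algcell_iff strict ext2_def dst_def ext_def)
  from lstar_cell[OF salg_FA salg_FA psm_ext psm_ext this]
  show ?thesis using K by (simp add: SD.algcell_iff lb_def)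
qed

text \<open>Since S preserves composition strictly, the dagger of \<open>est Y Z g \<odot> f\<close>
  is t S(\<open>est Y Z g\<close>) S f; the pseudomorphism structure of the star moves t inwards to
  produce \<open>ext X Y f\<close>.\<close>

definition "emu X Y Z g f = lb Y Z g \<lhd> pmor SD.S f"

lemma emu_typ:
  assumes "kl X (so Y) f" "kl Y (so Z) g" "Z \<in> Obj C"
  shows [strict]: "emu X Y Z g f \<in> Cel D" "src2 D (emu X Y Z g f) = ext X Z (est Y Z g \<odot> f)" "trg2 D (emu X Y Z g f) = est Y Z g \<odot> ext X Y f"
    "invertible D (emu X Y Z g f)"
  using klD[OF assms(1)] klD[OF assms(2)] assms by (simp_all add: strict emu_def ext_def[of X Z "est Y Z g \<odot> f"] ext_def[of X Y f])

lemmas [strict] = D.into2I[OF emu_typ(1,3)]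

definition "eps X = ti (so X) \<odot> SD.e (pob J X)"

lemma eps_typ:
  assumes "X \<in> Obj C"
  shows [strict]: "eps X \<in> Mor D" "src D (eps X) = pob J X" "trg D (eps X) = Tob T (so X)" "kl X (so X) (eps X)"
  using assms by (simp_all add: strict eps_def tydef)

lemmas [strict] = D.into1I[OF eps_typ(1,3)]

abbreviation "lI X \<equiv> li L (FA X)"

lemma psm_lI: "X \<in> Obj C \<Longrightarrow> psm (jalg (FA X)) (E X) (ti (so X)) (lI X)"
  using li_psm[OF salg_FA] by simp

lemma lI_typ:
  assumes "X \<in> Obj C"
  shows [strict]: "lI X \<in> Cel D" "src2 D (lI X) = t X \<odot> pmor SD.S (ti (so X))" "trg2 D (lI X) = ti (so X) \<odot> SD.m (pob J X)"
    "invertible D (lI X)"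
  using SD.psmorD[OF psm_lI[OF assms]] assms by simp_all

lemmas [strict] = D.into2I[OF lI_typ(1,3)]

text \<open>The structure of i moves t past it and leaves m after S e, an identity.\<close>

definition "eth X = lI X \<lhd> pmor SD.S (SD.e (pob J X))"

lemma eth_typ:
  assumes "X \<in> Obj C"
  shows [strict]: "eth X \<in> Cel D" "src2 D (eth X) = ext X X (eps X)" "trg2 D (eth X) = ti (so X)" "invertible D (eth X)"
  using assms by (simp_all add: strict eth_def ext_def eps_def)

lemmas [strict] = D.into2I[OF eth_typ(1,3)]

text \<open>\<open>ao Y\<close> inserts t e in front of f, naturality of e turns this into
  \<open>ext X Y f\<close> after e, and \<open>eta\<close> of T opens the extension.\<close>

definition "eeta X Y f = (eta (so X) (so Y) (ext X Y f) \<lhd> SD.e (pob J X)) \<cdot> (ao Y \<lhd> f)"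

lemma eeta_typ:
  assumes "kl X (so Y) f" "Y \<in> Obj C"
  shows [strict]: "eeta X Y f \<in> Cel D" "src2 D (eeta X Y f) = f" "trg2 D (eeta X Y f) = est X Y f \<odot> eps X" "invertible D (eeta X Y f)"
  using klD[OF assms(1)] assms by (simp_all add: strict eeta_def eps_def)

lemmas [strict] = D.into2I[OF eeta_typ(1,3)]

definition "emR X Y Z g f = mu (so X) (so Y) (so Z) (ext Y Z g) (ext X Y f) \<cdot> st2 (so X) (so Z) (emu X Y Z g f)"

lemma emR_typ:
  assumes "kl X (so Y) f" "kl Y (so Z) g" "Z \<in> Obj C"
  shows [strict]: "emR X Y Z g f \<in> Cel D" "src2 D (emR X Y Z g f) = est X Z (est Y Z g \<odot> f)" "trg2 D (emR X Y Z g f) = est Y Z g \<odot> est X Y f"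
    "invertible D (emR X Y Z g f)"
  using klD[OF assms(1)] klD[OF assms(2)] assms by (simp_all add: strict emR_def)

lemmas [strict] = D.into2I[OF emR_typ(1,3)]

text \<open>The required equation is \<open>lb_assoc\<close> whiskered by S S f.\<close>

lemma emu_acell:
  assumes "kl X (so Y) f" "kl Y (so Z) g" "Z \<in> Obj C"
  shows "acell (jalg (FA X)) (E Z) (ext X Z (est Y Z g \<odot> f)) (dst Z (est Y Z g \<odot> f))
    (est Y Z g \<odot> ext X Y f) (psm_comp D SD (est Y Z g) (lb Y Z g) (ext X Y f) (dst Y f)) (emu X Y Z g f)"
proof -
  note K = assms klD[OF assms(1)] klD[OF assms(2)]
  have "(lb Y Z g \<lhd> SD.m (Tob T (so Y)) \<odot> pmor SD.S (pmor SD.S f)) \<cdot> (am Z \<lhd> pmor SD.S (pmor SD.S (est Y Z g)) \<odot> pmor SD.S (pmor SD.S f)) =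
    (est Y Z g \<rhd> am Y \<lhd> pmor SD.S (pmor SD.S f)) \<cdot> (lb Y Z g \<lhd> pmor SD.S (t Y) \<odot> pmor SD.S (pmor SD.S f)) \<cdot>
    (t Z \<rhd> pcel SD.S (lb Y Z g) \<lhd> pmor SD.S (pmor SD.S f))"
    using arg_cong[OF lb_assoc[OF assms(2,3)], of "\<lambda>z. z \<lhd> pmor SD.S (pmor SD.S f)"] K by (simp add: strict)
  moreover have "pmor SD.S (ext X Y f) = pmor SD.S (t Y) \<odot> pmor SD.S (pmor SD.S f)"
    using K by (simp add: ext_def strict)
  moreover have "emu X Y Z g f \<lhd> SD.m (pob J X) = lb Y Z g \<lhd> SD.m (Tob T (so Y)) \<odot> pmor SD.S (pmor SD.S f)"
    using K by (simp add: emu_def strict)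
  moreover have "pcel SD.S (emu X Y Z g f) = pcel SD.S (lb Y Z g) \<lhd> pmor SD.S (pmor SD.S f)"
    using K by (simp add: emu_def strict)
  ultimately show ?thesis using K
    by (simp add: SD.algcell_iff psm_comp_def dst_def strict)
qed

text \<open>Associativity of R involves \<open>lb\<close> at a composite
  \<open>est Y Z g \<odot> f\<close>, because \<open>emu\<close> is a whiskering of
  \<open>lb\<close>. This lemma computes it: \<open>emu\<close> is an algebra 2-cell, hence so is
  its star by \<open>lstar_cell\<close>, and so is \<open>mu\<close> by
  \<open>Tmu_acell\<close>.\<close>

lemma emR_acell:
  assumes "kl X (so Y) f" "kl Y (so Z) g" "Z \<in> Obj C"
  shows "acell (E X) (E Z) (est X Z (est Y Z g \<odot> f)) (lb X Z (est Y Z g \<odot> f))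
    (est Y Z g \<odot> est X Y f) (psm_comp D SD (est Y Z g) (lb Y Z g) (est X Y f) (lb X Y f)) (emR X Y Z g f)"
proof -
  have O: "X \<in> Obj C" "Y \<in> Obj C" using klD[OF assms(1)] klD[OF assms(2)] by simp_all
  note A = salg_FA[OF O(1)] and B = salg_FA[OF O(2)] and E = salg_FA[OF assms(3)]
  have k: "kl X (so Z) (est Y Z g \<odot> f)" using assms O by (simp add: strict)
  note p = psm_ext[OF assms(1) O(2)] and q = psm_ext[OF assms(2,3)]
  note pq = SD.psmor_comp[OF jalg_psalg[OF O(1)] psalg_E[OF O(2)] psalg_E[OF assms(3)] p psm_lb[OF assms(2,3)]]
  have a1: "acell (E X) (E Z) (est X Z (est Y Z g \<odot> f)) (lb X Z (est Y Z g \<odot> f)) (st (so X) (so Z) (est Y Z g \<odot> ext X Y f))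
      (lstar L (FA X) (FA Z) (est Y Z g \<odot> ext X Y f) (psm_comp D SD (est Y Z g) (lb Y Z g) (ext X Y f) (dst Y f))) (st2 (so X) (so Z) (emu X Y Z g f))"
    using lstar_cell[OF A E psm_ext[OF k assms(3)] pq emu_acell[OF assms]] by (simp add: lb_def)
  have a2: "acell (E X) (E Z) (st (so X) (so Z) (est Y Z g \<odot> ext X Y f))
      (lstar L (FA X) (FA Z) (est Y Z g \<odot> ext X Y f) (psm_comp D SD (est Y Z g) (lb Y Z g) (ext X Y f) (dst Y f)))
      (est Y Z g \<odot> est X Y f) (psm_comp D SD (est Y Z g) (lb Y Z g) (est X Y f) (lb X Y f)) (mu (so X) (so Y) (so Z) (ext Y Z g) (ext X Y f))"
    using Tmu_acell[OF A B E p q] by (simp add: lb_def)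
  have p1: "psm (E X) (E Z) (st (so X) (so Z) (est Y Z g \<odot> ext X Y f))
      (lstar L (FA X) (FA Z) (est Y Z g \<odot> ext X Y f) (psm_comp D SD (est Y Z g) (lb Y Z g) (ext X Y f) (dst Y f)))"
    using lstar_psm[OF A E pq] by simp
  show ?thesis unfolding emR_def
    by (rule SD.algcell_vcmp[OF psalg_E[OF O(1)] psalg_E[OF assms(3)] psm_lb[OF k assms(3)] p1 _ a1 a2])
      (rule SD.psmor_comp[OF psalg_E[OF O(1)] psalg_E[OF O(2)] psalg_E[OF assms(3)] psm_lb[OF assms(1) O(2)] psm_lb[OF assms(2,3)]])
qed

lemma emR_lb:
  assumes "kl X (so Y) f" "kl Y (so Z) g" "Z \<in> Obj C"
  shows "(emR X Y Z g f \<lhd> t X) \<cdot> lb X Z (est Y Z g \<odot> f) =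
    (est Y Z g \<rhd> lb X Y f) \<cdot> (lb Y Z g \<lhd> pmor SD.S (est X Y f)) \<cdot> (t Z \<rhd> pcel SD.S (emR X Y Z g f))"
  using emR_acell[OF assms] klD[OF assms(1)] klD[OF assms(2)] assms by (simp add: SD.algcell_iff psm_comp_def strict)

lemma eta_lb:
  assumes "kl X (so Y) f" "Y \<in> Obj C"
  shows "(eta (so X) (so Y) (ext X Y f) \<lhd> SD.m (pob J X)) \<cdot> dst Y f =
    (est X Y f \<rhd> lI X) \<cdot> (lb X Y f \<lhd> pmor SD.S (ti (so X))) \<cdot> (t Y \<rhd> pcel SD.S (eta (so X) (so Y) (ext X Y f)))"
proof -
  have O: "X \<in> Obj C" using klD[OF assms(1)] by simp
  show ?thesis using Teta_acell[OF salg_FA[OF O] salg_FA[OF assms(2)] psm_ext[OF assms]] O klD[OF assms(1)] assms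
    by (simp add: SD.algcell_iff psm_comp_def lb_def[symmetric] strict)
qed

section \<open>The axioms of R\<close>

lemma ext2_idc[strict]: "kl X (so Y) x \<Longrightarrow> Y \<in> Obj C \<Longrightarrow> ext2 X Y (idc D x) = idc D (ext X Y x)"
  using klD[of X "so Y" x] by (simp add: ext2_def ext_def strict)

lemma ext2_vcmp[strict]:
  assumes "kl2 X (so Y) \<beta>" "Y \<in> Obj C" "into2 D \<alpha> (src2 D \<beta>)"
  shows "ext2 X Y (\<beta> \<cdot> \<alpha>) = ext2 X Y \<beta> \<cdot> ext2 X Y \<alpha>"
proof -
  have a: "\<alpha> \<in> Cel D" "trg2 D \<alpha> = src2 D \<beta>" using assms by (simp_all add: tydef)
  have "src D (src2 D \<beta>) = src D (src2 D \<alpha>)" "trg D (src2 D \<beta>) = trg D (src2 D \<alpha>)"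
    using a D.src_trg2[of \<alpha>] D.trg_trg2[of \<alpha>] by simp_all
  then show ?thesis using assms a kl2D[OF assms(1)] by (simp add: ext2_def strict)
qed

lemma emu_natural:
  assumes "kl2 X (so Y) \<alpha>" "kl2 Y (so Z) \<beta>" "Z \<in> Obj C"
  shows "emu X Y Z (trg2 D \<beta>) (trg2 D \<alpha>) \<cdot> ext2 X Z (est2 Y Z \<beta> \<star> \<alpha>) =
    (est2 Y Z \<beta> \<star> ext2 X Y \<alpha>) \<cdot> emu X Y Z (src2 D \<beta>) (src2 D \<alpha>)"
proof -
  note K = assms kl2D[OF assms(1)] kl2D[OF assms(2)]
  let ?Sf' = "idc D (pmor SD.S (trg2 D \<alpha>))" and ?b = "est2 Y Z \<beta>" and ?g = "est Y Z (src2 D \<beta>)"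
  have 1: "pcel SD.S ?b \<star> pcel SD.S \<alpha> = (pcel SD.S ?b \<star> ?Sf') \<cdot> (pmor SD.S ?g \<rhd> pcel SD.S \<alpha>)"
    using D.hcmp_left_first[of "pcel SD.S \<alpha>" "pcel SD.S ?b"] K by (simp add: strict)
  have 2: "?b \<star> t Y \<rhd> pcel SD.S \<alpha> = (?b \<lhd> t Y \<odot> pmor SD.S (trg2 D \<alpha>)) \<cdot> (?g \<odot> t Y \<rhd> pcel SD.S \<alpha>)"
    using D.hcmp_left_first[of "t Y \<rhd> pcel SD.S \<alpha>" ?b] K by (simp add: strict)
  have 3: "(lb Y Z (trg2 D \<beta>) \<star> ?Sf') \<cdot> (t Z \<rhd> pcel SD.S ?b \<star> ?Sf') =
     (?b \<lhd> t Y \<odot> pmor SD.S (trg2 D \<alpha>)) \<cdot> (lb Y Z (src2 D \<beta>) \<star> ?Sf')"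
    using arg_cong[OF lb_natural[OF assms(2,3)], of "\<lambda>z. z \<star> ?Sf'"] K by (simp add: strict)
  have 4: "(lb Y Z (src2 D \<beta>) \<star> ?Sf') \<cdot> (t Z \<odot> pmor SD.S ?g \<rhd> pcel SD.S \<alpha>) =
     (?g \<odot> t Y \<rhd> pcel SD.S \<alpha>) \<cdot> (lb Y Z (src2 D \<beta>) \<lhd> pmor SD.S (src2 D \<alpha>))"
    using D.slide[of "pcel SD.S \<alpha>" "lb Y Z (src2 D \<beta>)"] K by (simp add: strict)
  show ?thesis unfolding emu_def ext2_def[of X Z] ext2_def[of X Y \<alpha>]
    using K by (simp add: strict 1 2 3[THEN D.vcmp_extend] 4)
qed

lemma emR_natural:
  assumes "kl2 X (so Y) \<alpha>" "kl2 Y (so Z) \<beta>" "Z \<in> Obj C"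
  shows "emR X Y Z (trg2 D \<beta>) (trg2 D \<alpha>) \<cdot> est2 X Z (est2 Y Z \<beta> \<star> \<alpha>) =
    (est2 Y Z \<beta> \<star> est2 X Y \<alpha>) \<cdot> emR X Y Z (src2 D \<beta>) (src2 D \<alpha>)"
proof -
  note K = assms kl2D[OF assms(1)] kl2D[OF assms(2)]
  have 1: "st2 (so X) (so Z) (emu X Y Z (trg2 D \<beta>) (trg2 D \<alpha>)) \<cdot> est2 X Z (est2 Y Z \<beta> \<star> \<alpha>) =
    st2 (so X) (so Z) (est2 Y Z \<beta> \<star> ext2 X Y \<alpha>) \<cdot> st2 (so X) (so Z) (emu X Y Z (src2 D \<beta>) (src2 D \<alpha>))"
    using arg_cong[OF emu_natural[OF assms], of "st2 (so X) (so Z)"] K by (simp add: strict)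
  have 2: "mu (so X) (so Y) (so Z) (ext Y Z (trg2 D \<beta>)) (ext X Y (trg2 D \<alpha>)) \<cdot> st2 (so X) (so Z) (est2 Y Z \<beta> \<star> ext2 X Y \<alpha>) =
     (est2 Y Z \<beta> \<star> est2 X Y \<alpha>) \<cdot> mu (so X) (so Y) (so Z) (ext Y Z (src2 D \<beta>)) (ext X Y (src2 D \<alpha>))"
    using mu_natural[of "so X" "so Y" "ext2 X Y \<alpha>" "so Z" "ext2 Y Z \<beta>"] K by (simp add: strict)
  show ?thesis unfolding emR_def using K by (simp add: strict 1 2[THEN D.vcmp_extend])
qed

lemma eeta_natural:
  assumes "kl2 X (so Y) \<alpha>" "Y \<in> Obj C"
  shows "eeta X Y (trg2 D \<alpha>) \<cdot> \<alpha> = (est2 X Y \<alpha> \<lhd> eps X) \<cdot> eeta X Y (src2 D \<alpha>)"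
proof -
  note K = assms kl2D[OF assms(1)]
  let ?e = "idc D (SD.e (pob J X))"
  have 1: "(ao Y \<lhd> trg2 D \<alpha>) \<cdot> \<alpha> = (ext2 X Y \<alpha> \<star> ?e) \<cdot> (ao Y \<lhd> src2 D \<alpha>)"
    using D.slide[of \<alpha> "ao Y"] K by (simp add: strict ext2_def)
  have 2: "(eta (so X) (so Y) (ext X Y (trg2 D \<alpha>)) \<star> ?e) \<cdot> (ext2 X Y \<alpha> \<star> ?e) =
     (est2 X Y \<alpha> \<lhd> eps X) \<cdot> (eta (so X) (so Y) (ext X Y (src2 D \<alpha>)) \<star> ?e)"
    using arg_cong[OF eta_natural[of "so X" "so Y" "ext2 X Y \<alpha>"], of "\<lambda>z. z \<star> ?e"] K by (simp add: strict eps_def)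
  show ?thesis unfolding eeta_def using K 2 by (simp add: strict 1 eps_def 2[THEN D.vcmp_extend, unfolded eps_def])
qed

text \<open>Associativity of R splits into a part for \<open>emu\<close>, which lives below (-)^*,
  and the associativity axiom of T at the three extensions. Naturality of \<open>mu\<close> in both
  arguments separates the parts.\<close>

lemma emR_coherence:
  assumes "kl X (so Y) f" "kl Y (so Z) g" "kl Z (so V) h" "V \<in> Obj C"
  shows "(est Z V h \<rhd> emR X Y Z g f) \<cdot> emR X Z V h (est Y Z g \<odot> f) \<cdot> est2 X V (emR Y Z V h g \<lhd> f) =
    (emR Y Z V h g \<lhd> est X Y f) \<cdot> emR X Y V (est Z V h \<odot> g) f"
proof -
  note K = assms klD[OF assms(1)] klD[OF assms(2)] klD[OF assms(3)]
  let ?f = "ext X Y f" and ?g = "ext Y Z g" and ?h = "ext Z V h" and ?hg = "est Z V h \<odot> g"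
  have emu: "emu X Y V ?hg f = lb Y V ?hg \<lhd> pmor SD.S f" by (simp add: emu_def)
  \<comment> \<open>\<open>emR_lb\<close> whiskered by S f: this is where \<open>mu\<close> being an
    algebra 2-cell is used.\<close>
  have 1: "(est Z V h \<rhd> emu X Y Z g f) \<cdot> emu X Z V h (est Y Z g \<odot> f) \<cdot> ext2 X V (emR Y Z V h g \<lhd> f) =
     (emR Y Z V h g \<lhd> ?f) \<cdot> emu X Y V ?hg f"
    using arg_cong[OF emR_lb[OF assms(2-4)], of "\<lambda>z. z \<lhd> pmor SD.S f"] K
    by (simp add: strict emu_def ext2_def ext_def[of X Y f])
  have 2: "(est Z V h \<rhd> st2 (so X) (so Z) (emu X Y Z g f)) \<cdot> mu (so X) (so Z) (so V) ?h (ext X Z (est Y Z g \<odot> f)) =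
     mu (so X) (so Z) (so V) ?h (est Y Z g \<odot> ?f) \<cdot> st2 (so X) (so V) (est Z V h \<rhd> emu X Y Z g f)"
    using mu_natural_right[of "so Z" "so V" ?h "so X" "emu X Y Z g f"] K by (simp add: strict)
  have 3: "mu (so X) (so Y) (so V) (est Z V h \<odot> ?g) ?f \<cdot> st2 (so X) (so V) (st2 (so Y) (so V) (emu Y Z V h g) \<lhd> ?f) =
     (st2 (so Y) (so V) (emu Y Z V h g) \<lhd> est X Y f) \<cdot> mu (so X) (so Y) (so V) (ext Y V ?hg) ?f"
    using mu_natural_left[of "so Y" "so V" "emu Y Z V h g" "so X" ?f] K by (simp add: strict)
  have 4: "st2 (so X) (so V) (emR Y Z V h g \<lhd> ?f) = st2 (so X) (so V) (mu (so Y) (so Z) (so V) ?h ?g \<lhd> ?f) \<cdot>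
     st2 (so X) (so V) (st2 (so Y) (so V) (emu Y Z V h g) \<lhd> ?f)"
    using K by (simp add: strict emR_def)
  have 5: "(est Z V h \<rhd> mu (so X) (so Y) (so Z) ?g ?f) \<cdot> mu (so X) (so Z) (so V) ?h (est Y Z g \<odot> ?f) \<cdot>
      st2 (so X) (so V) (mu (so Y) (so Z) (so V) ?h ?g \<lhd> ?f) =
     (mu (so Y) (so Z) (so V) ?h ?g \<lhd> est X Y f) \<cdot> mu (so X) (so Y) (so V) (est Z V h \<odot> ?g) ?f"
    using mu_coherence[of "so X" "so Y" ?f "so Z" ?g "so V" ?h] K by (simp add: strict)
  let ?A = "est Z V h \<rhd> mu (so X) (so Y) (so Z) ?g ?f" and ?B = "mu (so X) (so Z) (so V) ?h (est Y Z g \<odot> ?f)"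
  have "(est Z V h \<rhd> emR X Y Z g f) \<cdot> emR X Z V h (est Y Z g \<odot> f) \<cdot> est2 X V (emR Y Z V h g \<lhd> f) =
    ?A \<cdot> ((est Z V h \<rhd> st2 (so X) (so Z) (emu X Y Z g f)) \<cdot> mu (so X) (so Z) (so V) ?h (ext X Z (est Y Z g \<odot> f))) \<cdot>
      st2 (so X) (so V) (emu X Z V h (est Y Z g \<odot> f)) \<cdot> est2 X V (emR Y Z V h g \<lhd> f)"
    using K by (simp add: strict emR_def[of X Y Z g f] emR_def[of X Z V h])
  also have "\<dots> = ?A \<cdot> ?B \<cdot> st2 (so X) (so V) ((est Z V h \<rhd> emu X Y Z g f) \<cdot> emu X Z V h (est Y Z g \<odot> f) \<cdot> ext2 X V (emR Y Z V h g \<lhd> f))"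
    unfolding 2 using K by (simp add: strict)
  also have "\<dots> = (?A \<cdot> ?B \<cdot> st2 (so X) (so V) (mu (so Y) (so Z) (so V) ?h ?g \<lhd> ?f)) \<cdot>
      st2 (so X) (so V) (st2 (so Y) (so V) (emu Y Z V h g) \<lhd> ?f) \<cdot> st2 (so X) (so V) (emu X Y V ?hg f)"
    unfolding 1 using K 4 by (simp add: strict)
  also have "\<dots> = (mu (so Y) (so Z) (so V) ?h ?g \<lhd> est X Y f) \<cdot>
      (mu (so X) (so Y) (so V) (est Z V h \<odot> ?g) ?f \<cdot> st2 (so X) (so V) (st2 (so Y) (so V) (emu Y Z V h g) \<lhd> ?f)) \<cdot> st2 (so X) (so V) (emu X Y V ?hg f)"
    unfolding 5 using K by (simp add: strict)
  also have "\<dots> = (emR Y Z V h g \<lhd> est X Y f) \<cdot> emR X Y V (est Z V h \<odot> g) f"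
    unfolding 3 using K by (simp add: strict emR_def)
  finally show ?thesis .
qed

text \<open>The same separation as for associativity: fact B lives below (-)^* and reduces the law
  to the unit axiom of T at \<open>ext X Y f\<close>.\<close>

lemma eeta_coherence:
  assumes "kl X (so Y) f" "Y \<in> Obj C"
  shows "(est X Y f \<rhd> (th (so X) \<cdot> st2 (so X) (so X) (eth X))) \<cdot> emR X X Y f (eps X) \<cdot> est2 X Y (eeta X Y f) = idc D (est X Y f)"
proof -
  note K = assms klD[OF assms(1)]
  let ?f = "ext X Y f" and ?Se = "idc D (pmor SD.S (SD.e (pob J X)))"
  have 1: "(est X Y f \<rhd> st2 (so X) (so X) (eth X)) \<cdot> mu (so X) (so X) (so Y) ?f (ext X X (eps X)) =
     mu (so X) (so X) (so Y) ?f (ti (so X)) \<cdot> st2 (so X) (so Y) (est X Y f \<rhd> eth X)"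
    using mu_natural_right[of "so X" "so Y" ?f "so X" "eth X"] K by (simp add: strict)
  have 2: "dst Y f \<star> ?Se = (am Y \<lhd> pmor SD.S (SD.e (Tob T (so Y)))) \<lhd> pmor SD.S f"
    using K by (simp add: strict dst_def)
  have 3: "(dst Y f \<star> ?Se) \<cdot> (t Y \<rhd> pcel SD.S (ao Y) \<lhd> pmor SD.S f) = idc D ?f"
    using arg_cong[OF E_unit_right[OF assms(2)], of "\<lambda>z. z \<lhd> pmor SD.S f"] K
    unfolding 2 by (simp add: strict ext_def)
  have 4: "(est X Y f \<rhd> eth X) \<cdot> emu X X Y f (eps X) \<cdot> (t Y \<rhd> pcel SD.S (eta (so X) (so Y) ?f) \<star> ?Se) =
     eta (so X) (so Y) ?f \<cdot> (dst Y f \<star> ?Se)"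
    using arg_cong[OF eta_lb[OF assms], of "\<lambda>z. z \<star> ?Se", symmetric] K
    by (simp add: strict emu_def eth_def eps_def dst_def)
  have 5: "ext2 X Y (eeta X Y f) = (t Y \<rhd> pcel SD.S (eta (so X) (so Y) ?f) \<star> ?Se) \<cdot> (t Y \<rhd> pcel SD.S (ao Y) \<lhd> pmor SD.S f)"
    using K by (simp add: strict ext2_def eeta_def)
  \<comment> \<open>Fact 4, \<open>eta\<close> being an algebra 2-cell, brings \<open>eta\<close> to
    the front; fact 3, the right unit law of \<open>E Y\<close>, removes the rest.\<close>
  have B: "(est X Y f \<rhd> eth X) \<cdot> emu X X Y f (eps X) \<cdot> ext2 X Y (eeta X Y f) = eta (so X) (so Y) ?f"
  proof -
    have "(est X Y f \<rhd> eth X) \<cdot> emu X X Y f (eps X) \<cdot> ext2 X Y (eeta X Y f) =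
      ((est X Y f \<rhd> eth X) \<cdot> emu X X Y f (eps X) \<cdot> (t Y \<rhd> pcel SD.S (eta (so X) (so Y) ?f) \<star> ?Se)) \<cdot>
      (t Y \<rhd> pcel SD.S (ao Y) \<lhd> pmor SD.S f)"
      unfolding 5 using K by (simp add: strict ext_def[of X X "eps X"]  eth_def emu_def eps_def)
    also have "\<dots> = eta (so X) (so Y) ?f \<cdot> ((dst Y f \<star> ?Se) \<cdot> (t Y \<rhd> pcel SD.S (ao Y) \<lhd> pmor SD.S f))"
      unfolding 4 using K by (simp add: strict dst_def ext_def[of X Y f, symmetric])
    finally show ?thesis unfolding 3 using K by (simp add: strict)
  qed
  have "(est X Y f \<rhd> (th (so X) \<cdot> st2 (so X) (so X) (eth X))) \<cdot> emR X X Y f (eps X) \<cdot> est2 X Y (eeta X Y f) =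
     (est X Y f \<rhd> th (so X)) \<cdot> ((est X Y f \<rhd> st2 (so X) (so X) (eth X)) \<cdot> mu (so X) (so X) (so Y) ?f (ext X X (eps X))) \<cdot>
       st2 (so X) (so Y) (emu X X Y f (eps X)) \<cdot> est2 X Y (eeta X Y f)"
    using K by (simp add: strict emR_def)
  also have "\<dots> = (est X Y f \<rhd> th (so X)) \<cdot> mu (so X) (so X) (so Y) ?f (ti (so X)) \<cdot>
      st2 (so X) (so Y) ((est X Y f \<rhd> eth X) \<cdot> emu X X Y f (eps X) \<cdot> ext2 X Y (eeta X Y f))"
    unfolding 1 using K by (simp add: strict)
  also have "\<dots> = idc D (est X Y f)"
    unfolding B using eta_coherence[of "so X" "so Y" ?f] K by (simp add: strict)
  finally show ?thesis .
qed

definition "R = \<lparr>Tob = (\<lambda>X. Tob T (so X)), star = est, star2 = est2, Ti = eps, Tmu = emR, Teta = eeta,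
  Ttheta = (\<lambda>X. th (so X) \<cdot> st2 (so X) (so X) (eth X))\<rparr>"

lemma R_sel[simp]:
  "Tob R X = Tob T (so X)" "star R X Y x = est X Y x" "star2 R X Y \<alpha> = est2 X Y \<alpha>" "Ti R X = eps X" "Tmu R X Y Z g f = emR X Y Z g f"
  "Teta R X Y f = eeta X Y f" "Ttheta R X = th (so X) \<cdot> st2 (so X) (so X) (eth X)"
  by (simp_all add: R_def)

lemma khom_R: "X \<in> Obj C \<Longrightarrow> Y \<in> Obj C \<Longrightarrow> f \<in> khom D J R X Y \<longleftrightarrow> kl X (so Y) f"
  by (auto simp: khom_def D.hom_iff kl_def strict)

lemma relative_pseudomonad_R: "relative_pseudomonad C D J R"
proof (intro relative_pseudomonad.intro relative_pseudomonad_axioms.intro, goal_cases)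
  case (6 X Y f \<alpha> f')
  then have *: "kl2 X (so Y) \<alpha>" "src2 D \<alpha> = f" "trg2 D \<alpha> = f'" by (auto simp: khom_R cells_iff)
  then show ?case using kl2D[OF *(1)] 6(1,2) by (simp add: cells_iff strict)
next
  case (8 X Y f \<alpha> f' \<beta> f'')
  then have *: "kl2 X (so Y) \<alpha>" "src2 D \<alpha> = f" "trg2 D \<alpha> = f'" "\<beta> \<in> Cel D" "src2 D \<beta> = f'" "trg2 D \<beta> = f''"
    by (auto simp: khom_R cells_iff)
  then show ?case using kl2D[OF *(1)] 8(1,2) by (simp add: strict tydef)
next
  case (13 X Y Z f g \<alpha> f' \<beta> g')
  then have *: "kl2 X (so Y) \<alpha>" "kl2 Y (so Z) \<beta>" "src2 D \<alpha> = f" "trg2 D \<alpha> = f'" "src2 D \<beta> = g" "trg2 D \<beta> = g'"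
    by (auto simp: khom_R cells_iff)
  then show ?case using emR_natural[OF *(1,2)] 13(3) by simp
next
  case (14 X Y f \<alpha> f')
  then have *: "kl2 X (so Y) \<alpha>" "src2 D \<alpha> = f" "trg2 D \<alpha> = f'" by (auto simp: khom_R cells_iff)
  then show ?case using eeta_natural[OF *(1)] 14(2) by simp
next
  case (15 X Y Z V f g h)
  then show ?case using emR_coherence[of X Y f Z g V h] by (simp add: khom_R)
next
  case (16 X Y f)
  then show ?case using eeta_coherence[of X Y f] by (simp add: khom_R)
qed (use C.two_category_axioms D.two_category_axioms J.pseudofunctor_axioms klD in
    \<open>auto simp: khom_R D.hom_iff D.icells_iff strict\<close>)

text \<open>The factorisations hold by the definitions of R, so apart from R being a relative
  pseudomonad only typing is left.\<close>

lemma kleisli_extension_R: "kleisli_extension C D J T R (pob (sfun SC)) ext ext2 emu eth"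
  using relative_pseudomonad_R relative_pseudomonad_axioms
  by (auto intro!: kleisli_extension.intro kleisli_extension_axioms.intro simp: strict emR_def dest: klD)

declare R_sel[simp del]

end

sublocale lifted_pseudomonad \<subseteq> KE: kleisli_extension C D J T R "pob (sfun SC)" ext ext2 emu eth
  by (rule kleisli_extension_R)

section \<open>The extension\<close>

context relative_pseudomonad
begin

abbreviation "F \<equiv> FT C D J T"
abbreviation "FJ g \<equiv> ti (trg C g) \<odot> pmor J g"
abbreviation "Fc h g \<equiv> (ti (trg C h) \<rhd> pcmp J h g) \<cdot> (inv2 D (eta (src C h) (trg C h) (FJ h)) \<lhd> pmor J g)"

lemma F_sel[simp]:
  "pob F X = X" "pmor F g = (src C g, FJ g, trg C g)"
  "pcel F \<alpha> = (src C (src2 C \<alpha>), ti (trg C (src2 C \<alpha>)) \<rhd> pcel J \<alpha>, trg C (src2 C \<alpha>))"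
  "pcmp F h g = (src C g, Fc h g, trg C h)" "pone F X = (X, ti X \<rhd> pone J X, X)"
  by (simp_all add: FT_def)

lemma kl_FJ[strict]: "g \<in> Mor C \<Longrightarrow> src C g = X \<Longrightarrow> trg C g = Y \<Longrightarrow> kl X Y (ti Y \<odot> pmor J g)"
  using C.src_Obj[of g] C.trg_Obj[of g] by (auto simp: strict kl_def)

lemma J_pcmp_assoc:
  assumes "f \<in> Mor C" "g \<in> Mor C" "h \<in> Mor C" "src C g = trg C f" "src C h = trg C g"
  shows "pcmp J (h \<odot>\<^bsub>C\<^esub> g) f \<cdot> (pcmp J h g \<lhd> pmor J f) = pcmp J h (g \<odot>\<^bsub>C\<^esub> f) \<cdot> (pmor J h \<rhd> pcmp J g f)"
  using J.pcmp_assoc[of f "src C f" "trg C f" g "trg C g" h "trg C h"] assms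
  by (simp add: C.hom_iff D.hom_iff C.assoc_idc[of f "src C f" "trg C f" g "trg C g" h "trg C h"]
      D.assoc_idc[of "pmor J f" "pob J (src C f)" "pob J (trg C f)" "pmor J g" "pob J (trg C g)" "pmor J h" "pob J (trg C h)"] strict tydef)

lemma J_pone_left:
  assumes "f \<in> Mor C" "trg C f = Y"
  shows "pcmp J (one C Y) f \<cdot> (pone J Y \<lhd> pmor J f) = idc D (pmor J f)"
  using J.pone_left[of f "src C f" "trg C f"] assms C.trg_Obj[of f]
  by (auto simp add: C.hom_iff C.lunit_idc D.lunit_idc strict tydef)

lemma J_pone_right:
  assumes "f \<in> Mor C" "src C f = X"
  shows "pcmp J f (one C X) \<cdot> (pmor J f \<rhd> pone J X) = idc D (pmor J f)"
  using J.pone_right[of f "src C f" "trg C f"] assms C.src_Obj[of f]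
  by (auto simp add: C.hom_iff C.runit_idc D.runit_idc strict tydef)

lemma eta_ti:
  assumes "X \<in> Obj C"
  shows "eta X X (ti X) = inv2 D (th X) \<lhd> ti X"
proof (rule D.cancel_left)
  show "(th X \<lhd> ti X) \<cdot> eta X X (ti X) = (th X \<lhd> ti X) \<cdot> (inv2 D (th X) \<lhd> ti X)"
    unfolding th_eta[OF assms] using assms by (simp add: strict)
qed (use assms in \<open>simp_all add: strict\<close>)

lemma inv_eta_natural:
  assumes "kl2 X Y \<alpha>"
  shows "inv2 D (eta X Y (trg2 D \<alpha>)) \<cdot> (st2 X Y \<alpha> \<lhd> ti X) = \<alpha> \<cdot> inv2 D (eta X Y (src2 D \<alpha>))"
proof (rule D.cancel_right[of "eta X Y (src2 D \<alpha>)"])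
  note K = assms kl2D[OF assms]
  show "(inv2 D (eta X Y (trg2 D \<alpha>)) \<cdot> (st2 X Y \<alpha> \<lhd> ti X)) \<cdot> eta X Y (src2 D \<alpha>) = (\<alpha> \<cdot> inv2 D (eta X Y (src2 D \<alpha>))) \<cdot> eta X Y (src2 D \<alpha>)"
    using K by (simp add: strict flip: eta_natural)
qed (use assms kl2D[OF assms] in \<open>simp_all add: strict\<close>)

lemma inv_eta_mu:
  assumes "kl X Y f" "kl Y Z g"
  shows "(st Y Z g \<rhd> inv2 D (eta X Y f)) \<cdot> (mu X Y Z g f \<lhd> ti X) = inv2 D (eta X Z (st Y Z g \<odot> f))"
proof (rule D.cancel_right[of "eta X Z (st Y Z g \<odot> f)"])
  note K = assms klD[OF assms(1)] klD[OF assms(2)]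
  show "((st Y Z g \<rhd> inv2 D (eta X Y f)) \<cdot> (mu X Y Z g f \<lhd> ti X)) \<cdot> eta X Z (st Y Z g \<odot> f) =
    inv2 D (eta X Z (st Y Z g \<odot> f)) \<cdot> eta X Z (st Y Z g \<odot> f)"
    using K mu_eta[OF assms] by (simp add: strict)
qed (use assms klD[OF assms(1)] klD[OF assms(2)] in \<open>simp_all add: strict\<close>)

text \<open>The comparison contains an inverse \<open>eta\<close>, so the composition axiom rests on
  the derived law \<open>mu_eta\<close> and the left unit axiom on \<open>th_eta\<close>; on the
  right, \<open>eta\<close> meets its own inverse. The remaining factors form the corresponding
  axiom of J.\<close>

lemma pseudofunctor_FT: "pseudofunctor C K F"
proof (intro pseudofunctor.intro pseudofunctor_axioms.intro, goal_cases)
  case 1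
  show ?case by (rule C.bicategory_axioms)
next
  case 2
  show ?case by (rule bicategory_Kl)
next
  case (7 \<alpha> f g \<beta> h)
  then have T: "\<alpha> \<in> Cel C" "src2 C \<alpha> = f" "trg2 C \<alpha> = g" "\<beta> \<in> Cel C" "src2 C \<beta> = g" "trg2 C \<beta> = h"
    "f \<in> Mor C" "g \<in> Mor C" "trg C g = trg C f" "src C g = src C f" "src C f \<in> Obj C" "trg C f \<in> Obj C"
    using C.src_trg2[of \<alpha>] C.trg_trg2[of \<alpha>] C.src2_Mor[of \<alpha>] C.trg2_Mor[of \<alpha>] C.src_Obj C.trg_Obj by (auto simp: C.cells_iff')
  show ?case using T by (simp add: strict tydef)
next
  case (8 f X Y g Z)
  then have t: "f \<in> Mor C" "src C f = X" "trg C f = Y" "g \<in> Mor C" "src C g = Y" "trg C g = Z" by (auto simp: C.hom_iff)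
  have t': "X \<in> Obj C" "Y \<in> Obj C" "Z \<in> Obj C" using t C.src_Obj C.trg_Obj by metis+
  show ?case using t t' by (simp add: icells_Kl Mor_Kl strict tydef)
next
  case (10 f X Y g Z \<alpha> f' \<beta> g')
  then have t: "f \<in> Mor C" "src C f = X" "trg C f = Y" "g \<in> Mor C" "src C g = Y" "trg C g = Z"
    "\<alpha> \<in> Cel C" "src2 C \<alpha> = f" "trg2 C \<alpha> = f'" "\<beta> \<in> Cel C" "src2 C \<beta> = g" "trg2 C \<beta> = g'" by (auto simp: C.hom_iff C.cells_iff')
  have t': "f' \<in> Mor C" "src C f' = X" "trg C f' = Y" "g' \<in> Mor C" "src C g' = Y" "trg C g' = Z"
    "X \<in> Obj C" "Y \<in> Obj C" "Z \<in> Obj C"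
    using t C.src_trg2 C.trg_trg2 C.trg2_Mor C.src_Obj C.trg_Obj by metis+
  note T = t t'
  let ?b = "ti Z \<rhd> pcel J \<beta>"
  have 1: "st2 Y Z ?b \<star> ti Y \<rhd> pcel J \<alpha> = (st2 Y Z ?b \<lhd> ti Y \<odot> pmor J f') \<cdot> (st Y Z (ti Z \<odot> pmor J g) \<odot> ti Y \<rhd> pcel J \<alpha>)"
    using D.hcmp_left_first[of "ti Y \<rhd> pcel J \<alpha>" "st2 Y Z ?b"] T by (simp add: strict)
  have 2: "(inv2 D (eta Y Z (ti Z \<odot> pmor J g')) \<lhd> pmor J f') \<cdot> (st2 Y Z ?b \<lhd> ti Y \<odot> pmor J f') =
     (?b \<lhd> pmor J f') \<cdot> (inv2 D (eta Y Z (ti Z \<odot> pmor J g)) \<lhd> pmor J f')"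
    using arg_cong[OF inv_eta_natural[of Y Z ?b], of "\<lambda>z. z \<lhd> pmor J f'"] T by (simp add: strict)
  have 3: "(inv2 D (eta Y Z (ti Z \<odot> pmor J g)) \<lhd> pmor J f') \<cdot> (st Y Z (ti Z \<odot> pmor J g) \<odot> ti Y \<rhd> pcel J \<alpha>) =
     (ti Z \<odot> pmor J g \<rhd> pcel J \<alpha>) \<cdot> (inv2 D (eta Y Z (ti Z \<odot> pmor J g)) \<lhd> pmor J f)"
    using D.slide[of "pcel J \<alpha>" "inv2 D (eta Y Z (ti Z \<odot> pmor J g))"] T by (simp add: strict)
  have 4: "pcel J \<beta> \<star> pcel J \<alpha> = (pcel J \<beta> \<lhd> pmor J f') \<cdot> (pmor J g \<rhd> pcel J \<alpha>)"
    using D.hcmp_left_first[of "pcel J \<alpha>" "pcel J \<beta>"] T by (simp add: strict)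
  have 5: "(ti Z \<rhd> pcmp J g' f') \<cdot> (ti Z \<rhd> pcel J \<beta> \<lhd> pmor J f') \<cdot> (ti Z \<odot> pmor J g \<rhd> pcel J \<alpha>) =
     (ti Z \<rhd> pcel J (\<beta> \<star>\<^bsub>C\<^esub> \<alpha>)) \<cdot> (ti Z \<rhd> pcmp J g f)"
    using arg_cong[OF J.pcmp_nat[of \<beta> \<alpha>], of "\<lambda>z. ti Z \<rhd> z"] T unfolding 4 by (simp add: strict tydef)
  have "((ti Z \<rhd> pcmp J g' f') \<cdot> (inv2 D (eta Y Z (ti Z \<odot> pmor J g')) \<lhd> pmor J f')) \<cdot> (st2 Y Z ?b \<star> ti Y \<rhd> pcel J \<alpha>) =
     ((ti Z \<rhd> pcmp J g' f') \<cdot> (ti Z \<rhd> pcel J \<beta> \<lhd> pmor J f') \<cdot> (ti Z \<odot> pmor J g \<rhd> pcel J \<alpha>)) \<cdot>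
       (inv2 D (eta Y Z (ti Z \<odot> pmor J g)) \<lhd> pmor J f)"
    unfolding 1 using T by (simp add: strict tydef 2[THEN D.vcmp_extend] 3)
  then show ?case unfolding 5 using T by (simp add: strict tydef)
next
  case (11 f X Y g Z h W)
  then have t: "f \<in> Mor C" "src C f = X" "trg C f = Y" "g \<in> Mor C" "src C g = Y" "trg C g = Z"
    "h \<in> Mor C" "src C h = Z" "trg C h = W" by (auto simp: C.hom_iff)
  have t': "X \<in> Obj C" "Y \<in> Obj C" "Z \<in> Obj C" "W \<in> Obj C" using t C.src_Obj C.trg_Obj by metis+
  note T = t t'
  let ?h = "ti W \<odot> pmor J h" and ?g = "ti Z \<odot> pmor J g" and ?Jf = "idc D (pmor J f)"
  let ?x = "(ti W \<rhd> pcmp J h g) \<cdot> (inv2 D (eta Z W ?h) \<lhd> pmor J g)"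
  have 1: "(inv2 D (eta Y W (ti W \<odot> pmor J (h \<odot>\<^bsub>C\<^esub> g))) \<star> ?Jf) \<cdot> (st2 Y W ?x \<lhd> ti Y \<odot> pmor J f) =
     (?x \<star> ?Jf) \<cdot> (inv2 D (eta Y W (st Z W ?h \<odot> ?g)) \<star> ?Jf)"
    using arg_cong[OF inv_eta_natural[of Y W ?x], of "\<lambda>z. z \<star> ?Jf"] T by (simp add: strict tydef del: st2_vcmp)
  have 2: "(st Z W ?h \<rhd> inv2 D (eta Y Z ?g) \<star> ?Jf) \<cdot> (mu Y Z W ?h ?g \<lhd> ti Y \<odot> pmor J f) =
     inv2 D (eta Y W (st Z W ?h \<odot> ?g)) \<star> ?Jf"
    using arg_cong[OF inv_eta_mu[of Y Z ?g W ?h], of "\<lambda>z. z \<star> ?Jf"] T by (simp add: strict)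
  have 3: "(inv2 D (eta Z W ?h) \<lhd> pmor J (g \<odot>\<^bsub>C\<^esub> f)) \<cdot> (st Z W ?h \<odot> ti Z \<rhd> pcmp J g f) =
     (ti W \<odot> pmor J h \<rhd> pcmp J g f) \<cdot> (inv2 D (eta Z W ?h) \<lhd> pmor J g \<odot> pmor J f)"
    using D.slide[of "pcmp J g f" "inv2 D (eta Z W ?h)"] T by (simp add: strict tydef)
  have 4: "(ti W \<rhd> pcmp J (h \<odot>\<^bsub>C\<^esub> g) f) \<cdot> (ti W \<rhd> pcmp J h g \<star> ?Jf) =
     (ti W \<rhd> pcmp J h (g \<odot>\<^bsub>C\<^esub> f)) \<cdot> (ti W \<odot> pmor J h \<rhd> pcmp J g f)"
    using arg_cong[OF J_pcmp_assoc[of f g h], of "\<lambda>z. ti W \<rhd> z"] T by (simp add: strict tydef)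
  have "((ti W \<rhd> pcmp J (h \<odot>\<^bsub>C\<^esub> g) f) \<cdot> (inv2 D (eta Y W (ti W \<odot> pmor J (h \<odot>\<^bsub>C\<^esub> g))) \<star> ?Jf)) \<cdot> (st2 Y W ?x \<lhd> ti Y \<odot> pmor J f)
     = (ti W \<rhd> pcmp J (h \<odot>\<^bsub>C\<^esub> g) f) \<cdot> ((inv2 D (eta Y W (ti W \<odot> pmor J (h \<odot>\<^bsub>C\<^esub> g))) \<star> ?Jf) \<cdot> (st2 Y W ?x \<lhd> ti Y \<odot> pmor J f))"
    using T by (simp add: strict tydef del: st2_vcmp)
  also have "\<dots> = ((ti W \<rhd> pcmp J (h \<odot>\<^bsub>C\<^esub> g) f) \<cdot> (ti W \<rhd> pcmp J h g \<star> ?Jf)) \<cdot>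
     (inv2 D (eta Z W ?h) \<lhd> pmor J g \<odot> pmor J f) \<cdot> (inv2 D (eta Y W (st Z W ?h \<odot> ?g)) \<star> ?Jf)"
    unfolding 1 using T by (simp add: strict tydef)
  also have "\<dots> = (ti W \<rhd> pcmp J h (g \<odot>\<^bsub>C\<^esub> f)) \<cdot> ((ti W \<odot> pmor J h \<rhd> pcmp J g f) \<cdot>
     (inv2 D (eta Z W ?h) \<lhd> pmor J g \<odot> pmor J f)) \<cdot> (inv2 D (eta Y W (st Z W ?h \<odot> ?g)) \<star> ?Jf)"
    unfolding 4 using T by (simp add: strict tydef)
  also have "\<dots> = ((ti W \<rhd> pcmp J h (g \<odot>\<^bsub>C\<^esub> f)) \<cdot> (inv2 D (eta Z W ?h) \<lhd> pmor J (g \<odot>\<^bsub>C\<^esub> f))) \<cdot>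
     (st Z W ?h \<rhd> ((ti Z \<rhd> pcmp J g f) \<cdot> (inv2 D (eta Y Z ?g) \<star> ?Jf))) \<cdot> (mu Y Z W ?h ?g \<lhd> ti Y \<odot> pmor J f)"
    unfolding 2[symmetric] 3[symmetric] using T by (simp add: strict tydef)
  finally show ?case using T C.assoc_idc[OF 11] by (simp add: strict tydef del: st2_vcmp)
next
  case (12 f X Y)
  then have t: "f \<in> Mor C" "src C f = X" "trg C f = Y" by (auto simp: C.hom_iff)
  have t': "X \<in> Obj C" "Y \<in> Obj C" using t C.src_Obj C.trg_Obj by metis+
  note T = t t'
  let ?Jf = "idc D (pmor J f)" and ?x = "ti Y \<rhd> pone J Y"
  have 1: "(inv2 D (eta Y Y (ti Y \<odot> pmor J (one C Y))) \<star> ?Jf) \<cdot> (st2 Y Y ?x \<lhd> ti Y \<odot> pmor J f) =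
     (?x \<star> ?Jf) \<cdot> (inv2 D (eta Y Y (ti Y)) \<star> ?Jf)"
    using arg_cong[OF inv_eta_natural[of Y Y ?x], of "\<lambda>z. z \<star> ?Jf"] T by (simp add: strict)
  have 2: "(ti Y \<rhd> pcmp J (one C Y) f) \<cdot> (ti Y \<rhd> pone J Y \<star> ?Jf) = idc D (ti Y \<odot> pmor J f)"
    using arg_cong[OF J_pone_left[OF T(1,3)], of "\<lambda>z. ti Y \<rhd> z"] T by (simp add: strict tydef)
  have "((ti Y \<rhd> pcmp J (one C Y) f) \<cdot> (inv2 D (eta Y Y (ti Y \<odot> pmor J (one C Y))) \<star> ?Jf)) \<cdot> (st2 Y Y ?x \<lhd> ti Y \<odot> pmor J f) =
     ((ti Y \<rhd> pcmp J (one C Y) f) \<cdot> (ti Y \<rhd> pone J Y \<star> ?Jf)) \<cdot> (inv2 D (eta Y Y (ti Y)) \<star> ?Jf)"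
    using T by (simp add: strict tydef 1)
  also have "\<dots> = th Y \<lhd> ti Y \<odot> pmor J f"
    unfolding 2 using T by (simp add: strict tydef eta_ti)
  finally show ?case using T by (simp add: C.lunit_idc strict tydef)
next
  case (13 f X Y)
  then have t: "f \<in> Mor C" "src C f = X" "trg C f = Y" by (auto simp: C.hom_iff)
  have t': "X \<in> Obj C" "Y \<in> Obj C" using t C.src_Obj C.trg_Obj by metis+
  note T = t t'
  let ?f = "ti Y \<odot> pmor J f"
  have 1: "(inv2 D (eta X Y ?f) \<lhd> pmor J (one C X)) \<cdot> (st X Y ?f \<odot> ti X \<rhd> pone J X) =
     (ti Y \<odot> pmor J f \<rhd> pone J X) \<cdot> inv2 D (eta X Y ?f)"
    using D.slide[of "pone J X" "inv2 D (eta X Y ?f)"] T by (simp add: strict)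
  have 2: "(ti Y \<rhd> pcmp J f (one C X)) \<cdot> (ti Y \<odot> pmor J f \<rhd> pone J X) = idc D (ti Y \<odot> pmor J f)"
    using arg_cong[OF J_pone_right[OF T(1,2)], of "\<lambda>z. ti Y \<rhd> z"] T by (simp add: strict tydef)
  have "((ti Y \<rhd> pcmp J f (one C X)) \<cdot> (inv2 D (eta X Y ?f) \<lhd> pmor J (one C X))) \<cdot> (st X Y ?f \<odot> ti X \<rhd> pone J X) =
     ((ti Y \<rhd> pcmp J f (one C X)) \<cdot> (ti Y \<odot> pmor J f \<rhd> pone J X)) \<cdot> inv2 D (eta X Y ?f)"
    using T by (simp add: strict tydef 1)
  also have "\<dots> = inv2 D (eta X Y ?f)"
    unfolding 2 using T by (simp add: strict tydef)
  finally have 3: "((ti Y \<rhd> pcmp J f (one C X)) \<cdot> (inv2 D (eta X Y ?f) \<lhd> pmor J (one C X))) \<cdot> (st X Y ?f \<odot> ti X \<rhd> pone J X) =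
     inv2 D (eta X Y ?f)" .
  show ?case using arg_cong[OF 3, of "\<lambda>z. z \<cdot> eta X Y ?f"] T by (simp add: C.runit_idc strict tydef)
qed (use C.src_Obj C.trg_Obj in \<open>auto simp: C.hom_iff C.cells_iff' C.icells_iff hom_Kl cells_Kl icells_Kl Mor_Kl strict\<close>)

end

section \<open>Comparison of S_1 with S along F^T\<close>

context lifted_pseudomonad
begin

text \<open>The pseudofunctors J S and S J agree including their comparison 2-cells, and the
  contributions of S to these are identities on both sides.\<close>

lemma S_J_cmp:
  assumes "f \<in> Mor C" "g \<in> Mor C" "trg C f = src C g"
  shows "pcel SD.S (pcmp J g f) = pcmp J (pmor SC.S g) (pmor SC.S f)"
proof -
  have "pcmp (pf_comp D J SC.S) g f = pcmp (pf_comp D SD.S J) g f"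
    using restrict_fun assms by (simp add: pf_eq_def)
  moreover have "pcmp SC.S g f = idc C (pmor SC.S g \<odot>\<^bsub>C\<^esub> pmor SC.S f)"
    using SC.S.pcmp_idc[of f "src C f" "src C g" g "trg C g"] assms by (simp add: C.hom_iff)
  moreover have "pcmp SD.S (pmor J g) (pmor J f) = idc D (pmor SD.S (pmor J g) \<odot> pmor SD.S (pmor J f))"
    using SD.S.pcmp_idc[of "pmor J f" "pob J (src C f)" "pob J (src C g)" "pmor J g" "pob J (trg C g)"] assms by (simp add: D.hom_iff strict)
  ultimately show ?thesis using assms by (simp add: strict tydef)
qed

lemma S_J_one:
  assumes "X \<in> Obj C"
  shows "pcel SD.S (pone J X) = pone J (so X)"
proof -
  have "pone (pf_comp D J SC.S) X = pone (pf_comp D SD.S J) X"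
    using restrict_fun assms by (simp add: pf_eq_def)
  then show ?thesis using SC.S.pone_idc[of X] SD.S.pone_idc[of "pob J X"] assms by (simp add: strict tydef)
qed

abbreviation "SJ f \<equiv> pmor SD.S (pmor J f)"

text \<open>Precomposition with J(h) passes strictly through e_Y^* and through t S. Hence S_1 of i
  J(h) is S_1(i) followed, on the inside, by S J(h), and \<open>iota\<close> alone compares it with
  i S J(h).\<close>

lemma S1_J[strict]:
  assumes "h \<in> Mor C" "src C h = W" "trg C h = X" "kl X Y f"
  shows "KE.S1 W Y (f \<odot> pmor J h) = KE.S1 X Y f \<odot> SJ h"
  using assms klD[OF assms(4)] C.src_Obj[of h] by (simp add: KE.S1_def ext_def strict del: KE.S1_fold)

lemma kl_S1_J[strict]:
  assumes "h \<in> Mor C" "src C h = W" "trg C h = X" "kl X Y f"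
  shows "kl (so W) (so Y) (KE.S1 X Y f \<odot> SJ h)"
  using KE.kl_S1[of W Y "f \<odot> pmor J h"] assms klD[OF assms(4)] C.src_Obj[of h] by (auto simp: strict kl_def)

lemma S2_J[strict]:
  assumes "h \<in> Mor C" "src C h = W" "trg C h = X" "kl2 X Y \<alpha>"
  shows "KE.S2 W Y (\<alpha> \<lhd> pmor J h) = KE.S2 X Y \<alpha> \<lhd> SJ h"
  using assms kl2D[OF assms(4)] C.src_Obj[of h] by (simp add: KE.S2_def ext2_def strict)

lemma S2_right[strict]:
  assumes "\<alpha> \<in> Cel D" "src D (src2 D \<alpha>) = pob J W" "trg D (src2 D \<alpha>) = pob J X" "kl X Y f" "W \<in> Obj C"
  shows "KE.S2 W Y (f \<rhd> \<alpha>) = KE.S1 X Y f \<rhd> pcel SD.S \<alpha>"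
  using assms klD[OF assms(4)] by (simp add: KE.S2_def KE.S1_def ext2_def ext_def strict del: KE.S1_fold)

lemma S2_inv2[strict]:
  assumes "kl X Y (src2 D \<alpha>)" "invertible D \<alpha>"
  shows "KE.S2 X Y (inv2 D \<alpha>) = inv2 D (KE.S2 X Y \<alpha>)" "invertible D (KE.S2 X Y \<alpha>)"
  using assms klD[OF assms(1)] D.invertible_Cel[OF assms(2)] by (simp_all add: KE.S2_def ext2_def strict)

text \<open>\<open>emu\<close> is a whiskering by S of its last argument, and \<open>ext2\<close>
  applies the 2-functor S, so S J(h) splits off. This reduces \<open>chi\<close> at F^T of a
  morphism to \<open>chi\<close> at a unit of Kl(T).\<close>

lemma chi_J:
  assumes "h \<in> Mor C" "src C h = W" "trg C h = X" "kl X Y f" "kl Y Z g"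
  shows "KE.chi W Y Z g (f \<odot> pmor J h) = KE.chi X Y Z g f \<lhd> SJ h"
  using assms klD[OF assms(4)] klD[OF assms(5)] C.src_Obj[of h]
  by (simp add: KE.chi_def emu_def ext2_def strict)

text \<open>
  For \<open>a = i\<^sub>Y J(f)\<close>, \<open>kap f\<close> is the comparison \<open>S\<^sub>1 a = (S\<^sub>1 i\<^sub>Y) J S f \<rightarrow> i\<^sub>S\<^sub>Y J S f\<close>; the identity components of the
  transformation \<open>S\<^sub>1 F\<^sup>T \<cong> F\<^sup>T S\<close> are units of \<open>Kl T\<close> and contribute \<open>\<theta>\<close> and \<open>\<eta>\<close>.
\<close>

abbreviation "FS f \<equiv> ti (so (trg C f)) \<odot> SJ f"
abbreviation "kap f \<equiv> inv2 D (KE.iota (trg C f)) \<lhd> SJ f"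
abbreviation "tau f \<equiv> eta (so (src C f)) (so (trg C f)) (FS f) \<cdot> kap f \<cdot>
  (th (so (trg C f)) \<lhd> KE.S1 (trg C f) (trg C f) (ti (trg C f)) \<odot> SJ f)"

lemma kl_FS[strict]: "f \<in> Mor C \<Longrightarrow> src C f = X \<Longrightarrow> trg C f = Y \<Longrightarrow> kl (so X) (so Y) (ti (so Y) \<odot> SJ f)"
  using kl_FJ[of "pmor SC.S f" "so X" "so Y"] by (simp add: strict)

lemma Fc_S:
  assumes "f \<in> Mor C" "src C f = X" "trg C f = Y" "g \<in> Mor C" "src C g = Y" "trg C g = Z"
  shows "Fc (pmor SC.S g) (pmor SC.S f) = (ti (so Z) \<rhd> pcel SD.S (pcmp J g f)) \<cdot>
    (inv2 D (eta (so Y) (so Z) (FS g)) \<lhd> SJ f)"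
  using assms by (simp add: strict S_J_cmp)

text \<open>The composition axiom of the transformation with the constraints of its identity
  components stripped off. By \<open>chi_J\<close> it comes down to \<open>chi\<close> at
  \<open>ti Y\<close>, which the right unit axiom of S_1 determines.\<close>

lemma kap_cmp:
  assumes "f \<in> Mor C" "src C f = X" "trg C f = Y" "g \<in> Mor C" "src C g = Y" "trg C g = Z"
  shows "kap (g \<odot>\<^bsub>C\<^esub> f) \<cdot> KE.S2 X Z (Fc g f) \<cdot> KE.chi X Y Z (FJ g) (FJ f) =
    Fc (pmor SC.S g) (pmor SC.S f) \<cdot> (st (so Y) (so Z) (FS g) \<rhd> kap f) \<cdot>
    (st2 (so Y) (so Z) (kap g) \<lhd> KE.S1 Y Y (ti Y) \<odot> SJ f)"
proof -
  have O: "X \<in> Obj C" "Y \<in> Obj C" "Z \<in> Obj C" using assms C.src_Obj C.trg_Obj by metis+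
  note T = assms O
  let ?b = "ti Z \<odot> pmor J g" and ?B = "KE.S1 Z Z (ti Z) \<odot> SJ g" and ?Sf = "idc D (SJ f)"
  let ?p = "pcel SD.S (pcmp J g f)"
  \<comment> \<open>\<open>iota_chi\<close> at \<open>?b\<close>, solved for
    \<open>chi\<close>.\<close>
  have 1: "KE.S2 Y Z (inv2 D (eta Y Z ?b)) \<cdot> KE.chi Y Y Z ?b (ti Y) =
     inv2 D (eta (so Y) (so Z) ?B) \<cdot> (st (so Y) (so Z) ?B \<rhd> inv2 D (KE.iota Y))"
    (is "?L \<cdot> ?C = ?R")
  proof (rule D.cancel_right[of "(st (so Y) (so Z) ?B \<rhd> KE.iota Y) \<cdot> eta (so Y) (so Z) ?B"])
    show "(?L \<cdot> ?C) \<cdot> (st (so Y) (so Z) ?B \<rhd> KE.iota Y) \<cdot> eta (so Y) (so Z) ?B =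
        ?R \<cdot> (st (so Y) (so Z) ?B \<rhd> KE.iota Y) \<cdot> eta (so Y) (so Z) ?B"
      using KE.iota_chi[of Y Z ?b] T by (simp add: strict)
  qed (use T in \<open>simp_all add: strict\<close>)
  have 2: "KE.S2 X Z (Fc g f) = (KE.S1 Z Z (ti Z) \<rhd> ?p) \<cdot> (KE.S2 Y Z (inv2 D (eta Y Z ?b)) \<star> ?Sf)"
    using T S2_right[of "pcmp J g f" X Z Z "ti Z"] by (simp add: strict tydef)
  have 3: "(inv2 D (KE.iota Z) \<lhd> SJ (g \<odot>\<^bsub>C\<^esub> f)) \<cdot> (KE.S1 Z Z (ti Z) \<rhd> ?p) =
     (ti (so Z) \<rhd> ?p) \<cdot> (inv2 D (KE.iota Z) \<lhd> SJ g \<odot> SJ f)"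
    using D.slide[of ?p "inv2 D (KE.iota Z)"] T by (simp add: strict tydef)
  have 4: "(st (so Y) (so Z) (FS g) \<rhd> inv2 D (KE.iota Y)) \<cdot> (st2 (so Y) (so Z) (kap g) \<lhd> KE.S1 Y Y (ti Y)) =
     (st2 (so Y) (so Z) (kap g) \<lhd> ti (so Y)) \<cdot> (st (so Y) (so Z) ?B \<rhd> inv2 D (KE.iota Y))"
    using D.slide[of "inv2 D (KE.iota Y)" "st2 (so Y) (so Z) (kap g)"] T by (simp add: strict)
  have 5: "inv2 D (eta (so Y) (so Z) (FS g)) \<cdot> (st2 (so Y) (so Z) (kap g) \<lhd> ti (so Y)) = kap g \<cdot> inv2 D (eta (so Y) (so Z) ?B)"
    using inv_eta_natural[of "so Y" "so Z" "kap g"] T by (simp add: strict)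
  have 6: "(st (so Y) (so Z) (FS g) \<rhd> kap f) \<cdot> (st2 (so Y) (so Z) (kap g) \<lhd> KE.S1 Y Y (ti Y) \<odot> SJ f) =
     (st2 (so Y) (so Z) (kap g) \<lhd> ti (so Y) \<odot> SJ f) \<cdot> (st (so Y) (so Z) ?B \<rhd> inv2 D (KE.iota Y) \<star> ?Sf)"
    using arg_cong[OF 4, of "\<lambda>z. z \<star> ?Sf"] T by (simp add: strict)
  have 7: "(inv2 D (eta (so Y) (so Z) (FS g)) \<star> ?Sf) \<cdot> (st2 (so Y) (so Z) (kap g) \<lhd> ti (so Y) \<odot> SJ f) =
     (inv2 D (KE.iota Z) \<lhd> SJ g \<odot> SJ f) \<cdot> (inv2 D (eta (so Y) (so Z) ?B) \<star> ?Sf)"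
    using arg_cong[OF 5, of "\<lambda>z. z \<star> ?Sf"] T by (simp add: strict)
  have 8: "KE.chi X Y Z ?b (FJ f) = KE.chi Y Y Z ?b (ti Y) \<star> ?Sf"
    using T by (simp add: chi_J strict)
  have "kap (g \<odot>\<^bsub>C\<^esub> f) \<cdot> KE.S2 X Z (Fc g f) \<cdot> KE.chi X Y Z ?b (FJ f) =
     ((inv2 D (KE.iota Z) \<lhd> SJ (g \<odot>\<^bsub>C\<^esub> f)) \<cdot> (KE.S1 Z Z (ti Z) \<rhd> ?p)) \<cdot>
     ((KE.S2 Y Z (inv2 D (eta Y Z ?b)) \<cdot> KE.chi Y Y Z ?b (ti Y)) \<star> ?Sf)"
    unfolding 2 8 using T by (simp add: strict tydef)
  also have "\<dots> = (ti (so Z) \<rhd> ?p) \<cdot> ((inv2 D (KE.iota Z) \<lhd> SJ g \<odot> SJ f) \<cdot> (inv2 D (eta (so Y) (so Z) ?B) \<star> ?Sf)) \<cdot>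
     (st (so Y) (so Z) ?B \<rhd> inv2 D (KE.iota Y) \<star> ?Sf)"
    unfolding 1 3 using T by (simp add: strict tydef)
  also have "\<dots> = ((ti (so Z) \<rhd> ?p) \<cdot> (inv2 D (eta (so Y) (so Z) (FS g)) \<star> ?Sf)) \<cdot>
    ((st2 (so Y) (so Z) (kap g) \<lhd> ti (so Y) \<odot> SJ f) \<cdot> (st (so Y) (so Z) ?B \<rhd> inv2 D (KE.iota Y) \<star> ?Sf))"
    unfolding 7[symmetric] using T by (simp add: strict tydef del: st2_vcmp)
  finally show ?thesis
    unfolding Fc_S[OF assms] 6[symmetric] using T by (simp add: strict tydef)
qed

lemma tau_natural:
  assumes "\<alpha> \<in> Cel C" "src2 C \<alpha> = f" "trg2 C \<alpha> = f'" "src C f = X" "trg C f = Y"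
  shows "tau f' \<cdot> (st (so Y) (so Y) (ti (so Y)) \<rhd> KE.S2 X Y (ti Y \<rhd> pcel J \<alpha>)) =
    (st2 (so X) (so Y) (ti (so Y) \<rhd> pcel SD.S (pcel J \<alpha>)) \<lhd> ti (so X)) \<cdot> tau f"
proof -
  have t: "f \<in> Mor C" "f' \<in> Mor C" "src C f' = X" "trg C f' = Y" "X \<in> Obj C" "Y \<in> Obj C"
    using assms C.src_trg2[of \<alpha>] C.trg_trg2[of \<alpha>] C.src2_Mor[of \<alpha>] C.trg2_Mor[of \<alpha>] C.src_Obj C.trg_Obj by metis+
  note T = assms t
  let ?a = "pcel SD.S (pcel J \<alpha>)" and ?S = "KE.S1 Y Y (ti Y)"
  have 1: "(th (so Y) \<lhd> ?S \<odot> SJ f') \<cdot> (st (so Y) (so Y) (ti (so Y)) \<odot> ?S \<rhd> ?a) = (?S \<rhd> ?a) \<cdot> (th (so Y) \<lhd> ?S \<odot> SJ f)"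
    using D.slide[of "?S \<rhd> ?a" "th (so Y)"] T by (simp add: strict)
  have 2: "(inv2 D (KE.iota Y) \<lhd> SJ f') \<cdot> (?S \<rhd> ?a) = (ti (so Y) \<rhd> ?a) \<cdot> (inv2 D (KE.iota Y) \<lhd> SJ f)"
    using D.slide[of ?a "inv2 D (KE.iota Y)"] T by (simp add: strict)
  have 3: "eta (so X) (so Y) (ti (so Y) \<odot> SJ f') \<cdot> (ti (so Y) \<rhd> ?a) = (st2 (so X) (so Y) (ti (so Y) \<rhd> ?a) \<lhd> ti (so X)) \<cdot> eta (so X) (so Y) (ti (so Y) \<odot> SJ f)"
    using eta_natural[of "so X" "so Y" "ti (so Y) \<rhd> ?a"] T by (simp add: strict)
  show ?thesis
    using T by (simp add: strict 1 2[THEN D.vcmp_extend] 3[THEN D.vcmp_extend])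
qed

lemma tau_one:
  assumes "X \<in> Obj C"
  shows "tau (one C X) \<cdot> (st (so X) (so X) (ti (so X)) \<rhd> (KE.S2 X X (ti X \<rhd> pone J X) \<cdot> KE.iota X)) =
    st2 (so X) (so X) (ti (so X) \<rhd> pone J (so X)) \<lhd> ti (so X)"
proof -
  note T = assms
  let ?p = "pcel SD.S (pone J X)" and ?S = "KE.S1 X X (ti X)" and ?f = "one C X" and ?t = "ti (so X)"
  let ?x = "?t \<rhd> ?p"
  have 1: "(th (so X) \<lhd> ?S \<odot> SJ ?f) \<cdot> (st (so X) (so X) ?t \<odot> ?S \<rhd> ?p) = (?S \<rhd> ?p) \<cdot> (th (so X) \<lhd> ?S)"
    using D.slide[of "?S \<rhd> ?p" "th (so X)"] T by (simp add: strict)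
  have 2: "(inv2 D (KE.iota X) \<lhd> SJ ?f) \<cdot> (?S \<rhd> ?p) = ?x \<cdot> inv2 D (KE.iota X)"
    using D.slide[of ?p "inv2 D (KE.iota X)"] T by (simp add: strict)
  have 3: "(th (so X) \<lhd> ?S) \<cdot> (st (so X) (so X) ?t \<rhd> KE.iota X) = KE.iota X \<cdot> (th (so X) \<lhd> ?t)"
    using D.slide[of "KE.iota X" "th (so X)"] T by (simp add: strict)
  have 4: "eta (so X) (so X) (?t \<odot> SJ ?f) \<cdot> ?x = (st2 (so X) (so X) ?x \<lhd> ?t) \<cdot> (inv2 D (th (so X)) \<lhd> ?t)"
    using eta_natural[of "so X" "so X" ?x] T by (simp add: strict eta_ti)
  have "tau ?f \<cdot> (st (so X) (so X) ?t \<rhd> (KE.S2 X X (ti X \<rhd> pone J X) \<cdot> KE.iota X)) = st2 (so X) (so X) ?x \<lhd> ?t"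
    using T by (simp add: strict 1[THEN D.vcmp_extend] 2[THEN D.vcmp_extend] 3 4[THEN D.vcmp_extend])
  then show ?thesis using T by (simp add: S_J_one)
qed

text \<open>Reduction to \<open>kap_cmp\<close>: \<open>st_th\<close> disposes of \<open>th\<close>
  on one side, \<open>st2_eta\<close> and \<open>mu_eta\<close> of the constraints on the other, and
  naturality of \<open>eta\<close> carries the comparison of F^T past the last one.\<close>

lemma tau_cmp:
  assumes "f \<in> Mor C" "src C f = X" "trg C f = Y" "g \<in> Mor C" "src C g = Y" "trg C g = Z"
  shows "tau (g \<odot>\<^bsub>C\<^esub> f) \<cdot> (st (so Z) (so Z) (ti (so Z)) \<rhd> (KE.S2 X Z (Fc g f) \<cdot> KE.chi X Y Z (FJ g) (FJ f))) \<cdot>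
      (mu (so Y) (so Z) (so Z) (ti (so Z)) (KE.S1 Y Z (FJ g)) \<lhd> KE.S1 X Y (FJ f)) =
    (st2 (so X) (so Z) (Fc (pmor SC.S g) (pmor SC.S f)) \<lhd> ti (so X)) \<cdot>
      inv2 D (mu (so X) (so Y) (so Z) (FS g) (FS f) \<lhd> ti (so X)) \<cdot> (st (so Y) (so Z) (FS g) \<rhd> tau f) \<cdot>
      (mu (so Y) (so Y) (so Z) (FS g) (ti (so Y)) \<lhd> KE.S1 X Y (FJ f)) \<cdot>
      (st2 (so Y) (so Z) (tau g) \<lhd> KE.S1 X Y (FJ f))"
proof -
  have O: "X \<in> Obj C" "Y \<in> Obj C" "Z \<in> Obj C" using assms C.src_Obj C.trg_Obj by metis+
  note T = assms O
  let ?tZ = "ti (so Z)" and ?B = "KE.S1 Z Z (ti Z) \<odot> SJ g" and ?A = "KE.S1 Y Y (ti Y) \<odot> SJ f"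
  let ?S = "KE.S1 Z Z (ti Z) \<odot> SJ (g \<odot>\<^bsub>C\<^esub> f)" and ?FS = "ti (so Z) \<odot> SJ (g \<odot>\<^bsub>C\<^esub> f)"
  let ?g = "ti (so Z) \<odot> SJ g" and ?f = "ti (so Y) \<odot> SJ f"
  let ?kg = "inv2 D (KE.iota Z) \<lhd> SJ g" and ?kf = "inv2 D (KE.iota Y) \<lhd> SJ f"
  let ?k = "inv2 D (KE.iota Z) \<lhd> SJ (g \<odot>\<^bsub>C\<^esub> f)"
  \<comment> \<open>From here on only the types of c and P and equation 0 matter; keeping both
    opaque stops the rules from taking them apart.\<close>
  define c where "c = KE.S2 X Z (Fc g f) \<cdot> KE.chi X Y Z (FJ g) (FJ f)"
  define P where "P = Fc (pmor SC.S g) (pmor SC.S f)"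
  have P: "P \<in> Cel D" "src2 D P = st (so Y) (so Z) ?g \<odot> ?f" "trg2 D P = ?FS"
    unfolding P_def Fc_S[OF assms] using T by (simp_all add: strict tydef)
  have c: "c \<in> Cel D" "src2 D c = st (so Y) (so Z) ?B \<odot> ?A" "trg2 D c = ?S"
    unfolding c_def using T by (simp_all add: strict tydef chi_J)
  note [strict] = D.into2I[OF P(1,3)] D.into2I[OF c(1,3)]
  have gf: "g \<odot>\<^bsub>C\<^esub> f \<in> Mor C" "src C (g \<odot>\<^bsub>C\<^esub> f) = X" "trg C (g \<odot>\<^bsub>C\<^esub> f) = Z"
    using T by (simp_all add: strict tydef)
  note T = T P c gf
  have 0: "?k \<cdot> c = P \<cdot> (st (so Y) (so Z) ?g \<rhd> ?kf) \<cdot> (st2 (so Y) (so Z) ?kg \<lhd> ?A)"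
    using kap_cmp[OF assms] T(1-9) gf by (simp add: c_def P_def strict tydef)
  have 1: "(th (so Z) \<lhd> ?S) \<cdot> (st (so Z) (so Z) ?tZ \<rhd> c) = c \<cdot> (th (so Z) \<lhd> st (so Y) (so Z) ?B \<odot> ?A)"
    using D.slide[of c "th (so Z)"] T by (simp add: strict tydef)
  have 2: "(th (so Z) \<lhd> st (so Y) (so Z) ?B \<odot> ?A) \<cdot> (mu (so Y) (so Z) (so Z) ?tZ ?B \<lhd> ?A) = st2 (so Y) (so Z) (th (so Z) \<lhd> ?B) \<lhd> ?A"
    using arg_cong[OF st_th[of "so Y" "so Z" ?B], of "\<lambda>z. z \<lhd> ?A"] T by (simp add: strict)
  have 3: "(mu (so Y) (so Y) (so Z) ?g (ti (so Y)) \<lhd> ?A) \<cdot> (st2 (so Y) (so Z) (eta (so Y) (so Z) ?g) \<lhd> ?A) =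
      st (so Y) (so Z) ?g \<rhd> inv2 D (th (so Y)) \<lhd> ?A"
    using arg_cong[OF st2_eta[of "so Y" "so Z" ?g], of "\<lambda>z. (mu (so Y) (so Y) (so Z) ?g (ti (so Y)) \<lhd> ?A) \<cdot> (z \<lhd> ?A)"] T by (simp add: strict)
  have 4: "(inv2 D (mu (so X) (so Y) (so Z) ?g ?f) \<lhd> ti (so X)) \<cdot> (st (so Y) (so Z) ?g \<rhd> eta (so X) (so Y) ?f) =
      eta (so X) (so Z) (st (so Y) (so Z) ?g \<odot> ?f)"
    using T by (simp add: strict flip: mu_eta)
  have 5: "(st2 (so X) (so Z) P \<lhd> ti (so X)) \<cdot> eta (so X) (so Z) (st (so Y) (so Z) ?g \<odot> ?f) = eta (so X) (so Z) ?FS \<cdot> P"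
    using eta_natural[of "so X" "so Z" P] T by (simp add: strict)
  have "eta (so X) (so Z) ?FS \<cdot> ?k \<cdot> (th (so Z) \<lhd> ?S) \<cdot> (st (so Z) (so Z) ?tZ \<rhd> c) \<cdot> (mu (so Y) (so Z) (so Z) ?tZ ?B \<lhd> ?A) =
     eta (so X) (so Z) ?FS \<cdot> P \<cdot> (st (so Y) (so Z) ?g \<rhd> ?kf) \<cdot> (st2 (so Y) (so Z) ?kg \<lhd> ?A) \<cdot> (st2 (so Y) (so Z) (th (so Z) \<lhd> ?B) \<lhd> ?A)"
    using T by (simp add: strict 1[THEN D.vcmp_extend] 0[THEN D.vcmp_extend] 2)
  note lhs = this
  let ?s = "idc D (st (so Y) (so Z) ?g)"
  let ?Q = "(st2 (so Y) (so Z) ?kg \<lhd> ?A) \<cdot> (st2 (so Y) (so Z) (th (so Z) \<lhd> ?B) \<lhd> ?A)"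
  have "(st2 (so X) (so Z) P \<lhd> ti (so X)) \<cdot> (inv2 D (mu (so X) (so Y) (so Z) ?g ?f) \<lhd> ti (so X)) \<cdot>
      (?s \<star> eta (so X) (so Y) ?f) \<cdot> (?s \<star> ?kf) \<cdot> (?s \<star> th (so Y) \<lhd> ?A) \<cdot>
      (mu (so Y) (so Y) (so Z) ?g (ti (so Y)) \<lhd> ?A) \<cdot> (st2 (so Y) (so Z) (eta (so Y) (so Z) ?g) \<lhd> ?A) \<cdot> ?Q =
    ((st2 (so X) (so Z) P \<lhd> ti (so X)) \<cdot> ((inv2 D (mu (so X) (so Y) (so Z) ?g ?f) \<lhd> ti (so X)) \<cdot>
      (?s \<star> eta (so X) (so Y) ?f))) \<cdot> (?s \<star> ?kf) \<cdot> (?s \<star> th (so Y) \<lhd> ?A) \<cdot>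
      ((mu (so Y) (so Y) (so Z) ?g (ti (so Y)) \<lhd> ?A) \<cdot> (st2 (so Y) (so Z) (eta (so Y) (so Z) ?g) \<lhd> ?A)) \<cdot> ?Q"
    using T by (simp add: strict)
  also have "\<dots> = eta (so X) (so Z) ?FS \<cdot> P \<cdot> (?s \<star> ?kf) \<cdot> ?Q"
    unfolding 4 5 3 using T by (simp add: strict)
  finally show ?thesis
    using lhs T unfolding c_def[symmetric] P_def[symmetric] by (simp add: strict)
qed

definition "kappa = \<lparr>tob = (\<lambda>X. (so X, ti (so X), so X)), tmor = (\<lambda>f. (so (src C f), tau f, so (trg C f)))\<rparr>"

lemma pseudonatural_kappa: "pseudonatural C K (pf_comp K KE.KS F) (pf_comp K F SC.S) kappa"
proof (intro pseudonatural.intro pseudonatural_axioms.intro, goal_cases)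
  case 1
  show ?case by (rule pseudofunctor_comp[OF pseudofunctor_FT KE.pseudofunctor_KS])
next
  case 2
  show ?case by (rule pseudofunctor_comp[OF SC.S.pseudofunctor_axioms pseudofunctor_FT])
next
  case (3 X)
  then show ?case by (simp add: hom_Kl kappa_def strict)
next
  case (4 f X Y)
  then have t: "f \<in> Mor C" "src C f = X" "trg C f = Y" by (auto simp: C.hom_iff)
  have t': "X \<in> Obj C" "Y \<in> Obj C" using t C.src_Obj C.trg_Obj by metis+
  show ?case using t t' by (simp add: icells_Kl kappa_def strict)
next
  case (5 f X Y \<alpha> f')
  then have t: "\<alpha> \<in> Cel C" "src2 C \<alpha> = f" "trg2 C \<alpha> = f'" "src C f = X" "trg C f = Y" "f \<in> Mor C" by (auto simp: C.hom_iff C.cells_iff')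
  have t': "f' \<in> Mor C" "src C f' = X" "trg C f' = Y" "X \<in> Obj C" "Y \<in> Obj C"
    using t C.src_trg2[of \<alpha>] C.trg_trg2[of \<alpha>] C.trg2_Mor[of \<alpha>] C.src_Obj C.trg_Obj by metis+
  show ?case using tau_natural[OF t(1-5)] t t' by (simp add: kappa_def strict)
next
  case (6 f X Y g Z)
  then have t: "f \<in> Mor C" "src C f = X" "trg C f = Y" "g \<in> Mor C" "src C g = Y" "trg C g = Z" by (auto simp: C.hom_iff)
  have t': "X \<in> Obj C" "Y \<in> Obj C" "Z \<in> Obj C" using t C.src_Obj C.trg_Obj by metis+
  have gf: "g \<odot>\<^bsub>C\<^esub> f \<in> Mor C" "src C (g \<odot>\<^bsub>C\<^esub> f) = X" "trg C (g \<odot>\<^bsub>C\<^esub> f) = Z"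
    using t by (simp_all add: strict tydef)
  have p: "pcmp SC.S g f = idc C (pmor SC.S g \<odot>\<^bsub>C\<^esub> pmor SC.S f)"
    using SC.S.pcmp_idc[OF 6] .
  show ?case using tau_cmp[OF t] t t' gf by (simp add: kappa_def inv2_Kl p strict)
next
  case (7 X)
  show ?case using tau_one[OF 7] SC.S.pone_idc[OF 7] 7 by (simp add: kappa_def strict eta_ti)
qed

lemma extension_KM: "extension_of C D J T SC KE.KM"
proof -
  have "icells K (tob KE.Ku X) (pmor F (SC.e X)) \<noteq> {}" if "X \<in> Obj C" for X
  proof -
    \<comment> \<open>The unit of R was defined as i after e, so the unit component equals F^T(e)
      exactly.\<close>
    have "(X, idc D (eps X), so X) \<in> icells K (tob KE.Ku X) (pmor F (SC.e X))"
      using that by (simp add: icells_Kl strict R_sel flip: eps_def)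
    then show ?thesis by blast
  qed
  moreover have "icells K (tob KE.Km X) (pmor F (SC.m X)) \<noteq> {}" if "X \<in> Obj C" for X
  proof -
    \<comment> \<open>The multiplication component unfolds to t S(i), which the pseudomorphism
      structure of i compares with i m = F^T(m).\<close>
    have "(so (so X), lI X, so X) \<in> icells K (tob KE.Km X) (pmor F (SC.m X))"
      using that KE.kl_mm[OF that] by (simp add: icells_Kl strict KE.mm_def ext_def del: KE.mm_fold)
    then show ?thesis by blast
  qed
  moreover have "tob kappa X = one K (so X)" if "X \<in> Obj C" for X
    using that by (simp add: kappa_def)
  ultimately show ?thesis
    using pseudonatural_kappa unfolding extension_of_def Let_def by auto
qed

end

theorem theorem6p3:
  fixes C :: "('oc, 'mc, 'cc) bicat" and D :: "('od, 'md, 'cd) bicat"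
    and J :: "('oc, 'mc, 'cc, 'od, 'md, 'cd) pfun"
    and T :: "('oc, 'od, 'md, 'cd) rpmonad"
    and SC :: "('oc, 'mc, 'cc) monad2" and SD :: "('od, 'md, 'cd) monad2"
  assumes "two_category C" and "two_category D" and "pseudofunctor C D J"
    and "relative_pseudomonad C D J T"
    and "two_monad D SD" and "restricts_along C D J SC SD"
    and "(\<exists>L. lifting_to_strict_algebras C D J T SC SD L) \<or>
         (\<exists>L. lifting_to_pseudoalgebras C D J T SC SD L)"
  shows "\<exists>M. pseudomonad (Kl C D J T) M \<and> extension_of C D J T SC M"
proof -
  \<comment> \<open>A lifting to strict algebras is in particular one to pseudoalgebras, so both
    alternatives meet here.\<close>
  obtain L where "lifting_to_pseudoalgebras C D J T SC SD L"
    using assms(7) by (auto dest: lifting_to_strict_algebras.axioms)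
  then interpret lifted_pseudomonad C D J T SC SD L
    using assms by (intro lifted_pseudomonad.intro)
  show ?thesis using KE.pseudomonad_KM extension_KM by blast
qed

end
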